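(* Consider one of the three expansions $u(y)=\sum_{\nu\in\mathcal F}u_\nu\phi_\nu(y)$ of the solution map: the Taylor series ($u_\nu=t_\nu$, $\phi_\nu(y)=y^\nu$), the Jacobi series ($u_\nu=v_\nu$, $\phi_\nu=J_\nu$), or the Hermite series ($u_\nu=w_\nu$, $\phi_\nu=H_\nu$). Correspondingly let $\mathcal V=L^\infty(U,V)$ in the Taylor case, $\mathcal V=L^2(U,V,\sigma)$ in the Jacobi case, and $\mathcal V=L^2(U,V,\gamma)$ in the Hermite case. Let $X\subset V$ be a smoothness class with norm $\|\cdot\|_X$, and let $(V_n)_{n>0}$ be linear subspaces of $V$ with $\dim V_n=n$ such that, for some constants $C_X>0$ and $t>0$, $$\min_{v_n\in V_n}\|v-v_n\|_V\le C_Xn^{-t}\|v\|_X,\qquad n>0,\ v\in X .$$ Assume that $(\|u_\nu\|_V)_{\nu\in\mathcal F}\in\ell^{p_V}(\mathcal F)$ and $(\|u_\nu\|_X)_{\nu\in\mathcal F}\in\ell^{p_X}(\mathcal F)$ for some $0<p_V\le p_X<2$, where in the Taylor case additionally $p_V<1$. For each $n$ let $\Lambda_n\subset\mathcal F$ be a set of indices corresponding to $n$ largest values of $\|u_\nu\|_V$. Then there is a constant $C$, depending on $\|(\|u_\nu\|_V)_{\nu\in\mathcal F}\|_{\ell^{p_V}}$, $\|(\|u_\nu\|_X)_{\nu\in\mathcal F}\|_{\ell^{p_X}}$ and $C_X$ (and on $p_V,p_X,t$) but not on $n$, such that for each $n$ there exists a vector $\mathbf n=(n_\nu)_{\nu\in\Lambda_n}$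 of positive integers with $$\min_{u_{\mathbf n}\in V_{\mathbf n}}\|u-u_{\mathbf n}\|_{\mathcal V}\le CN^{-\min\{r,t\}},\qquad N=\sum_{\nu\in\Lambda_n}n_\nu=\dim(V_{\mathbf n}),$$ where $V_{\mathbf n}=\bigoplus_{\nu\in\Lambda_n}(V_{n_\nu}\otimes\mathbb R\phi_\nu)$, and where the rate $r$ is given in the Taylor case by $$r=\frac{st}{s+t+1-p_X^{-1}},\qquad s=\frac1{p_V}-1,$$ and in the Jacobi and Hermite cases by $$r=\frac{st}{s+t+\frac12-p_X^{-1}},\qquad s=\frac1{p_V}-\frac12 .$$
   Context: $D\subset\mathbb R^m$ is a bounded Lipschitz domain, $V=H^1_0(D)$ with norm $\|v\|_V=\|\nabla v\|_{L^2(D)}$, $V'=H^{-1}(D)$, $f\in V'$. For a parameter-dependent scalar coefficient $a(y)$, $u(y)\in V$ is the weak solution of $-\mathrm{div}(a(y)\nabla u(y))=f$ with zero Dirichlet data: $\int_Da(y)\nabla u(y)\cdot\nabla v=\langle f,v\rangle_{V',V}$ for all $v\in V$. $\mathcal F$ is the set of finitely supported sequences $\nu=(\nu_j)_{j\ge1}$ of non-negative integers, $\nu!=\prod_j\nu_j!$, $y^\nu=\prod_jy_j^{\nu_j}$. Affine case (Taylor and Jacobi series): $U=[-1,1]^{\mathbb N}$, $a(y)=\bar a+\sum_{j\ge1}y_j\psi_j$ with $\bar a,\psi_j\in L^\infty(D)$ satisfying the uniform ellipticity assumption $\sum_{j\ge1}|\psi_j|\le\bar a-r_0$ a.e. on $D$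 for some $r_0>0$. Taylor coefficients: $t_\nu=\frac1{\nu!}\partial^\nu u(0)$. Jacobi coefficients: for fixed $\alpha_0,\beta_0>-1$ let $d(t)=c(1-t)^{\alpha_0}(1+t)^{\beta_0}$ be normalized to a probability density on $[-1,1]$, $(J_n)_{n\ge0}$ the polynomials ($\deg J_n=n$) orthonormal in $L^2([-1,1],d(t)dt)$, $J_\nu(y)=\prod_jJ_{\nu_j}(y_j)$, $d\sigma(y)=\bigotimes_jd(y_j)dy_j$, and $v_\nu=\int_Uu(y)J_\nu(y)\,d\sigma(y)$. Lognormal case (Hermite series): $U=\mathbb R^{\mathbb N}$, $d\gamma(y)=\bigotimes_{j\ge1}g(y_j)dy_j$ with $g(t)=\frac1{\sqrt{2\pi}}e^{-t^2/2}$, $a(y)=\exp(\sum_{j\ge1}y_j\psi_j)$, with $u(y)$ defined for $\gamma$-a.e. $y$ and $u\in L^2(U,V,\gamma)$; $(H_n)_{n\ge0}$ are the Hermite polynomials normalized in $L^2(\mathbb R,g(t)dt)$, $H_\nu(y)=\prod_jH_{\nu_j}(y_j)$, $w_\nu=\int_Uu(y)H_\nu(y)\,d\gamma(y)$. *)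

theory Defs
  imports "HOL-Probability.Probability" "HOL-Computational_Algebra.Polynomial" "HOL-Library.Function_Algebras"
begin

section \<open>The Hilbert space of square integrable functions\<close>

definition square_integrable :: "('a::euclidean_space \<Rightarrow> 'b::euclidean_space) \<Rightarrow> bool" where
  "square_integrable f \<longleftrightarrow>
     f \<in> borel_measurable lebesgue \<and> integrable lebesgue (\<lambda>x. (norm (f x))\<^sup>2)"

lemma square_integrable_measurable [measurable_dest]:
  "square_integrable f \<Longrightarrow> f \<in> borel_measurable lebesgue"
  by (simp add: square_integrable_def)

lemma square_integrable_zero: "square_integrable (\<lambda>x. 0)"
  by (simp add: square_integrable_def)

lemma square_integrable_bound:
  assumes "f \<in> borel_measurable lebesgue" "integrable lebesgue h"
    and "AE x in lebesgue. (norm (f x))\<^sup>2 \<le> h x"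
  shows "square_integrable f"
  unfolding square_integrable_def
proof
  show "integrable lebesgue (\<lambda>x. (norm (f x))\<^sup>2)"
    using assms(3) by (intro Bochner_Integration.integrable_bound[OF assms(2)])
      (use assms(1) in \<open>auto elim!: eventually_mono\<close>)
qed (rule assms(1))

lemma square_integrable_scaleR: "square_integrable f \<Longrightarrow> square_integrable (\<lambda>x. c *\<^sub>R f x)"
  by (auto simp: square_integrable_def power_mult_distrib)

lemma norm_add_square_le: "(norm (a + b))\<^sup>2 \<le> 2 * (norm a)\<^sup>2 + 2 * (norm (b::'b::real_inner))\<^sup>2"
proof -
  have "(norm (a + b))\<^sup>2 + (norm (a - b))\<^sup>2 = 2 * (norm a)\<^sup>2 + 2 * (norm b)\<^sup>2"
    by (simp add: power2_norm_eq_inner inner_simps inner_commute)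
  then show ?thesis
    using zero_le_power2[of "norm (a - b)"] by linarith
qed

lemma square_integrable_add:
  assumes f: "square_integrable f" and g: "square_integrable g"
  shows "square_integrable (\<lambda>x. f x + g x)"
proof (rule square_integrable_bound)
  show "integrable lebesgue (\<lambda>x. 2 * (norm (f x))\<^sup>2 + 2 * (norm (g x))\<^sup>2)"
    using f g by (auto simp: square_integrable_def)
qed (use f g in \<open>auto simp: square_integrable_def intro: norm_add_square_le\<close>)

lemma square_integrable_diff:
  "square_integrable f \<Longrightarrow> square_integrable g \<Longrightarrow> square_integrable (\<lambda>x. f x - g x)"
  using square_integrable_add[of f "\<lambda>x. (-1) *\<^sub>R g x"] square_integrable_scaleR[of g "-1"] by simp

lemma integrable_inner_square_integrable:
  assumes f: "square_integrable f" and g: "square_integrable g"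
  shows "integrable lebesgue (\<lambda>x. f x \<bullet> g x)"
proof (rule Bochner_Integration.integrable_bound)
  show "integrable lebesgue (\<lambda>x. (norm (f x))\<^sup>2 + (norm (g x))\<^sup>2)"
    using f g by (auto simp: square_integrable_def)
  show "(\<lambda>x. f x \<bullet> g x) \<in> borel_measurable lebesgue"
    using f g by measurable
  have "norm (a \<bullet> b) \<le> norm ((norm a)\<^sup>2 + (norm b)\<^sup>2)" for a b :: 'b
  proof -
    have "\<bar>a \<bullet> b\<bar> \<le> norm a * norm b" by (rule Cauchy_Schwarz_ineq2)
    moreover have "2 * (norm a * norm b) \<le> (norm a)\<^sup>2 + (norm b)\<^sup>2"
      using sum_squares_bound[of "norm a" "norm b"] by simp
    moreover have "0 \<le> norm a * norm b" by simp
    ultimately have "\<bar>a \<bullet> b\<bar> \<le> (norm a)\<^sup>2 + (norm b)\<^sup>2" by linarith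
    then show ?thesis by simp
  qed
  then show "AE x in lebesgue. norm (f x \<bullet> g x) \<le> norm ((norm (f x))\<^sup>2 + (norm (g x))\<^sup>2)"
    by (auto intro!: AE_I2)
qed

text \<open>
  Square integrable functions on the whole space, modulo equality almost everywhere.  The class
  \<open>abs_L2 f\<close> is unspecified unless \<open>f\<close> is square integrable.
\<close>

quotient_type (overloaded) ('a, 'b) L2 = "'a::euclidean_space \<Rightarrow> 'b::euclidean_space" /
  partial: "\<lambda>f g. square_integrable f \<and> square_integrable g \<and> (AE x in lebesgue. f x = g x)"
proof (rule part_equivpI)
  show "\<exists>f. square_integrable f \<and> square_integrable f \<and> (AE x in lebesgue. f x = f x)"
    using square_integrable_zero by blast
  show "symp (\<lambda>f g. square_integrable f \<and> square_integrable g \<and> (AE x in lebesgue. f x = g x))"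
    by (auto intro!: sympI elim!: eventually_mono)
  show "transp (\<lambda>f g. square_integrable f \<and> square_integrable g \<and> (AE x in lebesgue. f x = g x))"
    by (auto intro!: transpI)
qed

instantiation L2 :: (euclidean_space, euclidean_space) real_inner
begin

lift_definition zero_L2 :: "('a, 'b) L2" is "\<lambda>x. 0"
  by (simp add: square_integrable_zero)

lift_definition plus_L2 :: "('a, 'b) L2 \<Rightarrow> ('a, 'b) L2 \<Rightarrow> ('a, 'b) L2" is "\<lambda>f g x. f x + g x"
  by (auto simp: square_integrable_add)

lift_definition minus_L2 :: "('a, 'b) L2 \<Rightarrow> ('a, 'b) L2 \<Rightarrow> ('a, 'b) L2" is "\<lambda>f g x. f x - g x"
  by (auto simp: square_integrable_diff)

lift_definition scaleR_L2 :: "real \<Rightarrow> ('a, 'b) L2 \<Rightarrow> ('a, 'b) L2" is "\<lambda>c f x. c *\<^sub>R f x"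
  by (auto simp: square_integrable_scaleR)

definition uminus_L2 :: "('a, 'b) L2 \<Rightarrow> ('a, 'b) L2" where "uminus_L2 f = 0 - f"

lift_definition inner_L2 :: "('a, 'b) L2 \<Rightarrow> ('a, 'b) L2 \<Rightarrow> real" is
  "\<lambda>f g. LINT x|lebesgue. f x \<bullet> g x"
proof (elim conjE)
  fix f f' g g' :: "'a \<Rightarrow> 'b"
  assume *: "square_integrable f" "square_integrable f'" "square_integrable g" "square_integrable g'"
    and "AE x in lebesgue. f x = f' x" "AE x in lebesgue. g x = g' x"
  then have "AE x in lebesgue. f x \<bullet> g x = f' x \<bullet> g' x" by auto
  then show "(LINT x|lebesgue. f x \<bullet> g x) = (LINT x|lebesgue. f' x \<bullet> g' x)"
    using * by (intro integral_cong_AE borel_measurable_inner square_integrable_measurable)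
qed

definition norm_L2 :: "('a, 'b) L2 \<Rightarrow> real" where "norm_L2 f = sqrt (f \<bullet> f)"
definition sgn_L2 :: "('a, 'b) L2 \<Rightarrow> ('a, 'b) L2" where "sgn_L2 f = inverse (norm f) *\<^sub>R f"
definition dist_L2 :: "('a, 'b) L2 \<Rightarrow> ('a, 'b) L2 \<Rightarrow> real" where "dist_L2 f g = norm (f - g)"
definition uniformity_L2 :: "(('a, 'b) L2 \<times> ('a, 'b) L2) filter" where
  "uniformity_L2 = (INF e\<in>{0 <..}. principal {(f, g). dist f g < e})"
definition open_L2 :: "('a, 'b) L2 set \<Rightarrow> bool" where
  "open_L2 S = (\<forall>f\<in>S. \<forall>\<^sub>F (f', g) in uniformity. f' = f \<longrightarrow> g \<in> S)"

instance
proof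
  fix f g h :: "('a, 'b) L2" and c d :: real
  show "f + g + h = f + (g + h)"
    by transfer (simp add: square_integrable_add add.assoc)
  show "f + g = g + f"
    by transfer (simp add: square_integrable_add add.commute)
  show "0 + f = f"
    by transfer simp
  show "- f + f = 0"
    unfolding uminus_L2_def
    by transfer (auto simp: square_integrable_diff square_integrable_add square_integrable_zero
        intro!: square_integrable_scaleR[where c = "-1", simplified])
  show "f - g = f + - g"
    unfolding uminus_L2_def
    by transfer (auto simp: square_integrable_diff square_integrable_add square_integrable_zero
        intro!: square_integrable_scaleR[where c = "-1", simplified])
  show "c *\<^sub>R (f + g) = c *\<^sub>R f + c *\<^sub>R g"
    by transfer (simp add: scaleR_add_right square_integrable_add square_integrable_scaleR)
  show "(c + d) *\<^sub>R f = c *\<^sub>R f + d *\<^sub>R f"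
    by transfer (simp add: scaleR_add_left square_integrable_add square_integrable_scaleR)
  show "c *\<^sub>R d *\<^sub>R f = (c * d) *\<^sub>R f"
    by transfer (simp add: square_integrable_scaleR)
  show "1 *\<^sub>R f = f"
    by transfer simp
  show "f \<bullet> g = g \<bullet> f"
    by transfer (simp add: inner_commute)
  show "(f + g) \<bullet> h = f \<bullet> h + g \<bullet> h"
    by transfer (simp add: inner_add_left integrable_inner_square_integrable)
  show "(c *\<^sub>R f) \<bullet> g = c * (f \<bullet> g)"
    by transfer simp
  show "0 \<le> f \<bullet> f"
    by transfer simp
  show "f \<bullet> f = 0 \<longleftrightarrow> f = 0"
  proof transfer
    fix f :: "'a \<Rightarrow> 'b"
    assume "square_integrable f \<and> square_integrable f \<and> (AE x in lebesgue. f x = f x)"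
    then have f: "square_integrable f" by blast
    have "(LINT x|lebesgue. f x \<bullet> f x) = 0 \<longleftrightarrow> (AE x in lebesgue. f x \<bullet> f x = 0)"
      by (rule integral_nonneg_eq_0_iff_AE) (use f in \<open>auto intro: integrable_inner_square_integrable\<close>)
    then show "(LINT x|lebesgue. f x \<bullet> f x) = 0 \<longleftrightarrow>
        square_integrable f \<and> square_integrable (\<lambda>x. 0 :: 'b) \<and> (AE x in lebesgue. f x = 0)"
      using f by (simp add: square_integrable_zero)
  qed
qed (rule norm_L2_def sgn_L2_def dist_L2_def uniformity_L2_def open_L2_def)+

end


lemma square_integrable_rep_L2: "square_integrable (rep_L2 f)"
  using Quotient3_rep_reflp[OF Quotient3_L2] by blast

lemma abs_rep_L2: "abs_L2 (rep_L2 f) = f"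
  by (rule Quotient3_abs_rep[OF Quotient3_L2])

lemma rep_abs_L2: "square_integrable f \<Longrightarrow> AE x in lebesgue. rep_L2 (abs_L2 f) x = f x"
  using Quotient3_rep_abs[OF Quotient3_L2, of f] by simp

lemma inner_abs_L2:
  "square_integrable f \<Longrightarrow> square_integrable g \<Longrightarrow>
     abs_L2 f \<bullet> abs_L2 g = (LINT x|lebesgue. f x \<bullet> g x)"
  by (rule inner_L2.abs_eq) auto

lemma norm_abs_L2_power2:
  assumes "square_integrable f"
  shows "(norm (abs_L2 f))\<^sup>2 = (LINT x|lebesgue. (norm (f x))\<^sup>2)"
  using assms by (simp add: power2_norm_eq_inner inner_abs_L2)

lemma diff_abs_L2:
  "square_integrable f \<Longrightarrow> square_integrable g \<Longrightarrow> abs_L2 f - abs_L2 g = abs_L2 (\<lambda>x. f x - g x)"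
  by (rule minus_L2.abs_eq) auto

lemma add_abs_L2:
  "square_integrable f \<Longrightarrow> square_integrable g \<Longrightarrow> abs_L2 f + abs_L2 g = abs_L2 (\<lambda>x. f x + g x)"
  by (rule plus_L2.abs_eq) auto

lemma scaleR_abs_L2: "square_integrable f \<Longrightarrow> c *\<^sub>R abs_L2 f = abs_L2 (\<lambda>x. c *\<^sub>R f x)"
  by (rule scaleR_L2.abs_eq) auto

lemma nn_integral_dist_L2:
  assumes "square_integrable f" "square_integrable g"
  shows "(\<integral>\<^sup>+x. ennreal ((norm (f x - g x))\<^sup>2) \<partial>lebesgue) = ennreal ((dist (abs_L2 f) (abs_L2 g))\<^sup>2)"
  using assms square_integrable_diff[OF assms]
  by (simp add: dist_norm diff_abs_L2 norm_abs_L2_power2 nn_integral_eq_integral square_integrable_def)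

lemma L2_dominated_convergence:
  fixes f :: "'a::euclidean_space \<Rightarrow> 'b::euclidean_space"
  assumes f: "square_integrable f" and s: "\<And>i. s i \<in> borel_measurable lebesgue"
    and lim: "AE x in lebesgue. (\<lambda>i. s i x) \<longlonglongrightarrow> f x"
    and bnd: "\<And>i. AE x in lebesgue. norm (s i x) \<le> 2 * norm (f x)"
  shows "\<And>i. square_integrable (s i)" "(\<lambda>i. abs_L2 (s i)) \<longlonglongrightarrow> abs_L2 f"
proof -
  have int: "integrable lebesgue (\<lambda>x. c * (norm (f x))\<^sup>2)" for c
    using f by (auto simp: square_integrable_def)
  show si: "square_integrable (s i)" for i
  proof (rule square_integrable_bound[OF s int[of 4]])
    show "AE x in lebesgue. (norm (s i x))\<^sup>2 \<le> 4 * (norm (f x))\<^sup>2"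
      using bnd[of i]
    proof eventually_elim
      case (elim x)
      then have "(norm (s i x))\<^sup>2 \<le> (2 * norm (f x))\<^sup>2" by (intro power_mono) auto
      then show ?case by (simp add: power_mult_distrib)
    qed
  qed
  have meas: "(\<lambda>x. (norm (s i x - f x))\<^sup>2) \<in> borel_measurable lebesgue" for i
    using square_integrable_diff[OF si f] by (auto simp: square_integrable_def)
  have "(\<lambda>i. LINT x|lebesgue. (norm (s i x - f x))\<^sup>2) \<longlonglongrightarrow> (LINT x::'a|lebesgue. 0 :: real)"
  proof (rule integral_dominated_convergence[where w = "\<lambda>x. 9 * (norm (f x))\<^sup>2"])
    show "AE x in lebesgue. (\<lambda>i. (norm (s i x - f x))\<^sup>2) \<longlonglongrightarrow> 0"
      using lim
    proof eventually_elim
      case (elim x)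
      then have "(\<lambda>i. (norm (s i x - f x))\<^sup>2) \<longlonglongrightarrow> (norm (f x - f x))\<^sup>2"
        by (intro tendsto_intros)
      then show ?case by simp
    qed
    show "AE x in lebesgue. norm ((norm (s i x - f x))\<^sup>2) \<le> 9 * (norm (f x))\<^sup>2" for i
      using bnd[of i]
    proof eventually_elim
      case (elim x)
      have "norm (s i x - f x) \<le> 3 * norm (f x)"
        using norm_triangle_ineq4[of "s i x" "f x"] elim by linarith
      then have "(norm (s i x - f x))\<^sup>2 \<le> (3 * norm (f x))\<^sup>2"
        by (intro power_mono) auto
      then show ?case by (simp add: power_mult_distrib)
    qed
  qed (use meas int[of 9] in simp_all)
  then have "(\<lambda>i. (dist (abs_L2 (s i)) (abs_L2 f))\<^sup>2) \<longlonglongrightarrow> 0"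
    by (simp add: dist_norm diff_abs_L2 si f norm_abs_L2_power2 square_integrable_diff)
  then have "(\<lambda>i. sqrt ((dist (abs_L2 (s i)) (abs_L2 f))\<^sup>2)) \<longlonglongrightarrow> sqrt 0"
    by (rule tendsto_real_sqrt)
  then show "(\<lambda>i. abs_L2 (s i)) \<longlonglongrightarrow> abs_L2 f"
    using tendsto_dist_iff by fastforce
qed

instance L2 :: (euclidean_space, euclidean_space) complete_space
proof
  fix X :: "nat \<Rightarrow> ('a, 'b) L2"
  assume X: "Cauchy X"
  have "\<exists>r. \<forall>n. (\<forall>i\<ge>r n. \<forall>j\<ge>r n. dist (X i) (X j) < (1/4) ^ n) \<and> r n < r (Suc n)"
  proof (rule dependent_nat_choice)
    show "\<exists>m. \<forall>i\<ge>m. \<forall>j\<ge>m. dist (X i) (X j) < (1/4) ^ 0"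
      using metric_CauchyD[OF X, of 1] by simp
    fix m n :: nat
    obtain M where "\<forall>i\<ge>M. \<forall>j\<ge>M. dist (X i) (X j) < (1/4) ^ Suc n"
      using metric_CauchyD[OF X, of "(1/4) ^ Suc n"] by auto
    then show "\<exists>m'. (\<forall>i\<ge>m'. \<forall>j\<ge>m'. dist (X i) (X j) < (1/4) ^ Suc n) \<and> m < m'"
      by (intro exI[of _ "max M (Suc m)"]) auto
  qed
  then obtain r where r: "\<And>n i j. i \<ge> r n \<Longrightarrow> j \<ge> r n \<Longrightarrow> dist (X i) (X j) < (1/4) ^ n"
    and rSuc: "\<And>n. r n < r (Suc n)" by metis
  have mono: "strict_mono r" using rSuc by (rule strict_monoI_Suc)
  define g where "g k = rep_L2 (X (r k))" for k
  have g: "square_integrable (g k)" and gX: "abs_L2 (g k) = X (r k)" for k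
    by (simp_all add: g_def square_integrable_rep_L2 abs_rep_L2)
  have [measurable]: "g k \<in> borel_measurable lebesgue" for k
    using g by (simp add: square_integrable_def)
  define d where "d k x = g (Suc k) x - g k x" for k x
  have [measurable]: "d k \<in> borel_measurable lebesgue" for k
    unfolding d_def by measurable
  have int_d: "(\<integral>\<^sup>+x. ennreal (2 ^ k * (norm (d k x))\<^sup>2) \<partial>lebesgue) \<le> ennreal ((1/8) ^ k)" for k
  proof -
    have "(\<integral>\<^sup>+x. ennreal (2 ^ k * (norm (d k x))\<^sup>2) \<partial>lebesgue)
        = ennreal (2 ^ k) * (\<integral>\<^sup>+x. ennreal ((norm (d k x))\<^sup>2) \<partial>lebesgue)"
      by (subst nn_integral_cmult[symmetric]) (auto simp: ennreal_mult)
    also have "\<dots> = ennreal (2 ^ k * (dist (X (r (Suc k))) (X (r k)))\<^sup>2)"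
      by (simp add: d_def nn_integral_dist_L2[OF g g] gX ennreal_mult)
    also have "\<dots> \<le> ennreal (2 ^ k * ((1/4) ^ k)\<^sup>2)"
      using r[of k "r (Suc k)" "r k"] rSuc[of k]
      by (intro ennreal_leI mult_left_mono power_mono) (auto intro: less_imp_le)
    also have "2 ^ k * ((1/4) ^ k)\<^sup>2 = (1/8 :: real) ^ k"
    proof -
      have "2 ^ k * ((1/4) ^ k)\<^sup>2 = (2 * (1/4)\<^sup>2 :: real) ^ k"
        by (simp only: power_mult_distrib power_mult[symmetric] mult.commute)
      then show ?thesis by (simp add: power2_eq_square)
    qed
    finally show ?thesis .
  qed
  have "(\<integral>\<^sup>+x. (\<Sum>k. ennreal (2 ^ k * (norm (d k x))\<^sup>2)) \<partial>lebesgue)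
      = (\<Sum>k. \<integral>\<^sup>+x. ennreal (2 ^ k * (norm (d k x))\<^sup>2) \<partial>lebesgue)"
    by (rule nn_integral_suminf) measurable
  also have "\<dots> \<le> (\<Sum>k. ennreal ((1/8) ^ k))"
    by (intro suminf_le int_d) auto
  also have "\<dots> = ennreal (\<Sum>k. (1/8) ^ k)"
    by (rule suminf_ennreal2) (auto intro: summable_geometric)
  finally have fin: "(\<integral>\<^sup>+x. (\<Sum>k. ennreal (2 ^ k * (norm (d k x))\<^sup>2)) \<partial>lebesgue) \<noteq> \<infinity>"
    by (auto simp: top_unique)
  have "AE x in lebesgue. (\<Sum>k. ennreal (2 ^ k * (norm (d k x))\<^sup>2)) \<noteq> \<infinity>"
    by (rule nn_integral_noteq_infinite[OF _ fin]) measurable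
  then have conv: "AE x in lebesgue. convergent (\<lambda>k. g k x)"
  proof eventually_elim
    case (elim x)
    define M where "M = enn2real (\<Sum>k. ennreal (2 ^ k * (norm (d k x))\<^sup>2))"
    have M: "0 \<le> M" "(\<Sum>k. ennreal (2 ^ k * (norm (d k x))\<^sup>2)) = ennreal M"
      unfolding M_def using elim by (simp, subst ennreal_enn2real) (auto simp: less_top)
    have bound: "norm (d k x) \<le> sqrt M * (1 / sqrt 2) ^ k" for k
    proof -
      have "ennreal (2 ^ k * (norm (d k x))\<^sup>2) \<le> ennreal M"
        using sum_le_suminf[of "\<lambda>k. ennreal (2 ^ k * (norm (d k x))\<^sup>2)" "{k}"] M by simp
      then have "2 ^ k * (norm (d k x))\<^sup>2 \<le> M" using M by simp
      then have "sqrt (2 ^ k * (norm (d k x))\<^sup>2) \<le> sqrt M" by simp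
      then show ?thesis
        by (simp add: real_sqrt_mult real_sqrt_power power_divide field_simps)
    qed
    have "summable (\<lambda>k. sqrt M * (1 / sqrt 2) ^ k)"
      by (intro summable_mult summable_geometric) simp
    then have "summable (\<lambda>k. d k x)"
      by (rule summable_comparison_test') (use bound in auto)
    then have "convergent (\<lambda>n. g 0 x + (\<Sum>k<n. d k x))"
      by (auto simp: summable_iff_convergent intro: convergent_add convergent_const)
    moreover have "g 0 x + (\<Sum>k<n. d k x) = g n x" for n
      by (induction n) (simp_all add: d_def algebra_simps)
    ultimately show ?case by simp
  qed
  define G where "G x = lim (\<lambda>k. g k x)" for x
  have [measurable]: "G \<in> borel_measurable lebesgue"
    unfolding G_def by measurable
  have lim: "AE x in lebesgue. (\<lambda>k. g k x) \<longlonglongrightarrow> G x"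
    using conv by eventually_elim (simp add: G_def convergent_LIMSEQ_iff)
  have fatou: "(\<integral>\<^sup>+x. ennreal ((norm (g m x - G x))\<^sup>2) \<partial>lebesgue) \<le> ennreal (((1/4) ^ n)\<^sup>2)"
    if "m \<ge> n" for m n
  proof -
    have "(\<integral>\<^sup>+x. ennreal ((norm (g m x - G x))\<^sup>2) \<partial>lebesgue)
        = (\<integral>\<^sup>+x. liminf (\<lambda>k. ennreal ((norm (g m x - g k x))\<^sup>2)) \<partial>lebesgue)"
    proof (rule nn_integral_cong_AE)
      show "AE x in lebesgue. ennreal ((norm (g m x - G x))\<^sup>2)
          = liminf (\<lambda>k. ennreal ((norm (g m x - g k x))\<^sup>2))"
        using lim
      proof eventually_elim
        case (elim x)
        then have "(\<lambda>k. ennreal ((norm (g m x - g k x))\<^sup>2)) \<longlonglongrightarrow> ennreal ((norm (g m x - G x))\<^sup>2)"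
          by (intro tendsto_intros)
        then show ?case
          by (metis lim_imp_Liminf trivial_limit_sequentially)
      qed
    qed
    also have "\<dots> \<le> liminf (\<lambda>k. \<integral>\<^sup>+x. ennreal ((norm (g m x - g k x))\<^sup>2) \<partial>lebesgue)"
      by (rule nn_integral_liminf) measurable
    also have "\<dots> \<le> ennreal (((1/4) ^ n)\<^sup>2)"
    proof (rule Liminf_le)
      show "\<forall>\<^sub>F k in sequentially.
          (\<integral>\<^sup>+x. ennreal ((norm (g m x - g k x))\<^sup>2) \<partial>lebesgue) \<le> ennreal (((1/4) ^ n)\<^sup>2)"
        using eventually_ge_at_top[of n]
      proof eventually_elim
        case (elim k)
        then show ?case
          using r[of n "r m" "r k"] that mono
          by (auto simp: nn_integral_dist_L2[OF g g] gX strict_mono_less_eq intro!: ennreal_leI power_mono)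
      qed
    qed simp
    finally show ?thesis .
  qed
  have diff: "square_integrable (\<lambda>x. g m x - G x)" for m
    unfolding square_integrable_def
    using fatou[of m m] by (auto intro!: integrableI_bounded simp: le_less_trans)
  have G: "square_integrable G"
    using square_integrable_diff[OF g[of 0] diff[of 0]] by simp
  have le: "dist (X (r m)) (abs_L2 G) \<le> (1/4) ^ n" if "m \<ge> n" for m n
  proof -
    have "ennreal ((dist (X (r m)) (abs_L2 G))\<^sup>2) \<le> ennreal (((1/4) ^ n)\<^sup>2)"
      using fatou[OF that] by (simp add: nn_integral_dist_L2[OF g G] gX)
    then show ?thesis
      by (auto dest: power2_le_imp_le)
  qed
  have "(X \<circ> r) \<longlonglongrightarrow> abs_L2 G"
  proof (rule metric_LIMSEQ_I)
    fix e :: real assume "e > 0"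
    then obtain n where "(1/4) ^ n < e"
      using real_arch_pow_inv[of e "1/4"] by auto
    then show "\<exists>n. \<forall>m\<ge>n. dist ((X \<circ> r) m) (abs_L2 G) < e"
      using le by (auto intro!: exI[of _ n] intro: le_less_trans)
  qed
  then show "convergent X"
    using Cauchy_converges_subseq[OF X mono] by (auto simp: convergent_def)
qed

instance L2 :: (euclidean_space, euclidean_space) banach ..


lemma L2_lmeasurable_approx:
  fixes A :: "'a::euclidean_space set" and v :: "'b::euclidean_space"
  assumes K: "closed K"
    and U: "\<And>U. open U \<Longrightarrow> U \<in> lmeasurable \<Longrightarrow> abs_L2 (\<lambda>x. indicator U x *\<^sub>R v) \<in> K"
    and A: "A \<in> lmeasurable"
  shows "abs_L2 (\<lambda>x. indicator A x *\<^sub>R v) \<in> K"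
proof -
  have sq: "square_integrable (\<lambda>x. indicator B x *\<^sub>R v)" if "B \<in> lmeasurable" for B :: "'a set"
  proof (rule square_integrable_bound[where h = "\<lambda>x. (norm v)\<^sup>2 * indicator B x"])
    show "integrable lebesgue (\<lambda>x. (norm v)\<^sup>2 * indicator B x)"
      using that by (intro integrable_mult_right) (auto simp: fmeasurable_def less_top)
    show "(\<lambda>x. indicator B x *\<^sub>R v) \<in> borel_measurable lebesgue"
      using that by (intro borel_measurable_scaleR borel_measurable_indicator) auto
  qed (auto simp: indicator_def)
  have "\<exists>T. open T \<and> A \<subseteq> T \<and> T - A \<in> lmeasurable \<and> emeasure lebesgue (T - A) < ennreal (1 / Suc n)"
    for n
    using sets_lebesgue_outer_open[of A "1 / Suc n"] A by (metis fmeasurableD of_nat_0_less_iff zero_less_Suc zero_less_divide_1_iff)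
  then obtain T where T: "\<And>n. open (T n)" "\<And>n. A \<subseteq> T n" "\<And>n. T n - A \<in> lmeasurable"
      "\<And>n. emeasure lebesgue (T n - A) < ennreal (1 / Suc n)"
    by metis
  have TL: "T n \<in> lmeasurable" for n
  proof -
    have "A \<union> (T n - A) \<in> lmeasurable" using A T(3) by (rule fmeasurable.Un)
    moreover have "A \<union> (T n - A) = T n" using T(2) by auto
    ultimately show ?thesis by simp
  qed
  have le: "dist (abs_L2 (\<lambda>x. indicator (T n) x *\<^sub>R v)) (abs_L2 (\<lambda>x. indicator A x *\<^sub>R v))
      \<le> norm v * sqrt (1 / Suc n)" for n
  proof -
    have "ennreal ((dist (abs_L2 (\<lambda>x. indicator (T n) x *\<^sub>R v)) (abs_L2 (\<lambda>x. indicator A x *\<^sub>R v)))\<^sup>2)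
        = (\<integral>\<^sup>+x. ennreal ((norm v)\<^sup>2) * indicator (T n - A) x \<partial>lebesgue)"
      unfolding nn_integral_dist_L2[OF sq[OF TL] sq[OF A], symmetric]
      using T(2)[of n] by (intro nn_integral_cong) (auto simp: indicator_def)
    also have "\<dots> = ennreal ((norm v)\<^sup>2) * emeasure lebesgue (T n - A)"
      using T(3)[of n] by (intro nn_integral_cmult_indicator) auto
    also have "\<dots> \<le> ennreal ((norm v)\<^sup>2) * ennreal (1 / Suc n)"
      using T(4)[of n] by (intro mult_left_mono) auto
    also have "\<dots> = ennreal ((norm v * sqrt (1 / Suc n))\<^sup>2)"
      by (simp add: power_mult_distrib flip: ennreal_mult)
    finally show ?thesis
      by (auto dest!: power2_le_imp_le)
  qed
  have "(\<lambda>n. norm v * sqrt (1 / Suc n)) \<longlonglongrightarrow> norm v * sqrt 0"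
    by (intro tendsto_intros LIMSEQ_inverse_real_of_nat[unfolded inverse_eq_divide])
  have "(\<lambda>n. dist (abs_L2 (\<lambda>x. indicator (T n) x *\<^sub>R v)) (abs_L2 (\<lambda>x. indicator A x *\<^sub>R v)))
      \<longlonglongrightarrow> 0"
  proof (rule Lim_null_comparison[rotated, where g = "\<lambda>n. norm v * sqrt (1 / Suc n)"])
    show "(\<lambda>n. norm v * sqrt (1 / Suc n)) \<longlonglongrightarrow> 0"
      using \<open>(\<lambda>n. norm v * sqrt (1 / Suc n)) \<longlonglongrightarrow> norm v * sqrt 0\<close> by (simp only: real_sqrt_zero mult_zero_right)
    show "\<forall>\<^sub>F n in sequentially.
        norm (dist (abs_L2 (\<lambda>x. indicator (T n) x *\<^sub>R v)) (abs_L2 (\<lambda>x. indicator A x *\<^sub>R v)))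
        \<le> norm v * sqrt (1 / Suc n)"
      using le by (intro always_eventually allI) (simp only: real_norm_def abs_of_nonneg[OF zero_le_dist])
  qed
  then have "(\<lambda>n. abs_L2 (\<lambda>x. indicator (T n) x *\<^sub>R v)) \<longlonglongrightarrow> abs_L2 (\<lambda>x. indicator A x *\<^sub>R v)"
    using tendsto_dist_iff by blast
  then show ?thesis
    using closed_sequentially[OF K, of "\<lambda>n. abs_L2 (\<lambda>x. indicator (T n) x *\<^sub>R v)"] U T(1) TL by blast
qed

lemma L2_countable_dense:
  "\<exists>Q :: ('a::euclidean_space, 'b::euclidean_space) L2 set. countable Q \<and> closure Q = UNIV"
proof -
  obtain \<B> :: "'a set set" where cB: "countable \<B>" and tB: "topological_basis \<B>"
    using ex_countable_basis by blast
  define \<G> where "\<G> = (\<lambda>(P, n). \<Union>P \<inter> ball 0 (real n)) ` ({P. finite P \<and> P \<subseteq> \<B>} \<times> UNIV)"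
  define S :: "('a, 'b) L2 set" where
    "S = (\<lambda>(F, i). abs_L2 (\<lambda>x. indicator F x *\<^sub>R i)) ` (\<G> \<times> Basis)"
  define comb :: "(rat \<times> ('a, 'b) L2) list \<Rightarrow> ('a, 'b) L2" where
    "comb l = (\<Sum>(q, s)\<leftarrow>l. real_of_rat q *\<^sub>R s)" for l
  define Q where "Q = comb ` lists (UNIV \<times> S)"
  define K where "K = closure Q"
  have "countable \<G>"
    unfolding \<G>_def using cB by (intro countable_image countable_SIGMA countable_Collect_finite_subset) auto
  then have "countable S"
    unfolding S_def by (intro countable_image countable_SIGMA) (auto intro: countable_finite)
  then have cQ: "countable Q"
    unfolding Q_def by (intro countable_image countable_lists countable_SIGMA) auto
  have closed: "closed K" by (simp add: K_def)
  have lim: "x \<in> K" if "\<And>n. f n \<in> K" "f \<longlonglongrightarrow> x" for f x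
    using closed_sequentially[OF closed] that by blast
  have seq: "\<exists>f. (\<forall>n. f n \<in> Q) \<and> f \<longlonglongrightarrow> x" if "x \<in> K" for x
    using that unfolding K_def closure_sequential by blast
  have comb: "comb [] = 0" "comb [(1, s)] = s" "comb (l @ l') = comb l + comb l'" for s l l'
    by (simp_all add: comb_def)
  have comb_scale: "comb (map (\<lambda>(q, s). (p * q, s)) l) = real_of_rat p *\<^sub>R comb l" for p l
    by (induction l) (auto simp: comb_def scaleR_add_right of_rat_mult)
  have Qadd: "x + y \<in> Q" if x: "x \<in> Q" and y: "y \<in> Q" for x y
  proof -
    from x obtain l where l: "x = comb l" "l \<in> lists (UNIV \<times> S)" unfolding Q_def by (rule imageE)
    from y obtain l' where l': "y = comb l'" "l' \<in> lists (UNIV \<times> S)" unfolding Q_def by (rule imageE)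
    show ?thesis
      unfolding Q_def by (rule image_eqI[of _ _ "l @ l'"]) (use l l' in \<open>simp_all add: comb\<close>)
  qed
  have Qscale: "real_of_rat p *\<^sub>R x \<in> Q" if x: "x \<in> Q" for p x
  proof -
    from x obtain l where l: "x = comb l" "l \<in> lists (UNIV \<times> S)" unfolding Q_def by (rule imageE)
    show ?thesis
      unfolding Q_def by (rule image_eqI[of _ _ "map (\<lambda>(q, s). (p * q, s)) l"])
        (use l in \<open>auto simp: comb_scale\<close>)
  qed
  have QK: "Q \<subseteq> K" by (simp add: K_def closure_subset)
  have SK: "s \<in> K" if "s \<in> S" for s
  proof -
    have "s \<in> Q"
      unfolding Q_def by (rule image_eqI[of _ _ "[(1, s)]"]) (use that in \<open>simp_all add: comb\<close>)
    then show ?thesis using QK by blast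
  qed
  have Kadd: "x + y \<in> K" if xy: "x \<in> K" "y \<in> K" for x y
  proof -
    obtain f g where fg: "\<And>n. f n \<in> Q" "f \<longlonglongrightarrow> x" "\<And>n. g n \<in> Q" "g \<longlonglongrightarrow> y"
      using seq[OF xy(1)] seq[OF xy(2)] by metis
    have "f n + g n \<in> K" for n
      using Qadd[OF fg(1) fg(3)] QK by blast
    then show ?thesis by (rule lim) (rule tendsto_add[OF fg(2,4)])
  qed
  have KscaleQ: "c *\<^sub>R x \<in> K" if "x \<in> Q" for c x
  proof -
    have "c \<in> closure \<rat>"
      unfolding closure_approachable
    proof (intro allI impI)
      fix e :: real assume "e > 0"
      then obtain q where "q \<in> \<rat>" "c < q" "q < c + e"
        using Rats_dense_in_real[of c "c + e"] by auto
      then show "\<exists>q\<in>\<rat>. dist q c < e"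
        by (intro bexI[of _ q]) (auto simp: dist_real_def)
    qed
    then obtain f where f: "\<And>n. f n \<in> \<rat>" "f \<longlonglongrightarrow> c"
      unfolding closure_sequential by blast
    have "f n *\<^sub>R x \<in> K" for n
      using f(1)[of n] Qscale[OF that] QK by (auto elim!: Rats_cases)
    then show ?thesis by (rule lim) (rule tendsto_scaleR[OF f(2) tendsto_const])
  qed
  have Kscale: "c *\<^sub>R x \<in> K" if "x \<in> K" for c x
  proof -
    obtain f where f: "\<And>n. f n \<in> Q" "f \<longlonglongrightarrow> x"
      using seq[OF \<open>x \<in> K\<close>] by metis
    show ?thesis
      by (rule lim[of "\<lambda>n. c *\<^sub>R f n"]) (rule KscaleQ f tendsto_scaleR tendsto_const)+
  qed
  have "0 \<in> Q"
    unfolding Q_def by (rule image_eqI[of _ _ "[]"]) (simp_all add: comb)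
  then have K0: "0 \<in> K" using QK by auto
  have Ksum: "(\<Sum>i\<in>I. f i) \<in> K" if "\<And>i. i \<in> I \<Longrightarrow> f i \<in> K" for I :: "'b set" and f
    using that by (induction I rule: infinite_finite_induct) (auto simp: K0 intro: Kadd)
  have sqi: "square_integrable (\<lambda>x. indicator B x *\<^sub>R v)" if "B \<in> lmeasurable"
    for B :: "'a set" and v :: 'b
  proof (rule square_integrable_bound[where h = "\<lambda>x. (norm v)\<^sup>2 * indicator B x"])
    show "integrable lebesgue (\<lambda>x. (norm v)\<^sup>2 * indicator B x)"
      using that by (intro integrable_mult_right) (auto simp: fmeasurable_def less_top)
    show "(\<lambda>x. indicator B x *\<^sub>R v) \<in> borel_measurable lebesgue"
      using that by (intro borel_measurable_scaleR borel_measurable_indicator) auto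
  qed (auto simp: indicator_def)
  have Kopen: "abs_L2 (\<lambda>x. indicator U x *\<^sub>R i) \<in> K"
    if U: "open U" "U \<in> lmeasurable" and i: "i \<in> Basis" for U i
  proof -
    obtain \<C> where \<C>: "\<C> \<subseteq> \<B>" "\<Union>\<C> = U"
      using tB U(1) unfolding topological_basis_def by blast
    have "countable (insert {} \<C>)" using cB \<C>(1) by (auto intro: countable_subset)
    then have B: "range (from_nat_into (insert {} \<C>)) = insert {} \<C>"
      by (intro range_from_nat_into) auto
    define B where "B = from_nat_into (insert {} \<C>)"
    note B = B[folded B_def]
    define F where "F n = \<Union>(B ` {..<n} - {{}}) \<inter> ball 0 (real n)" for n
    have "B ` {..<n} - {{}} \<subseteq> \<B>" for n
      using B \<C>(1) by blast
    then have FG: "F n \<in> \<G>" for n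
      unfolding \<G>_def F_def by (intro image_eqI[of _ _ "(B ` {..<n} - {{}}, n)"]) auto
    have opn: "open W" if "W \<in> \<B>" for W
      using tB that unfolding topological_basis_def by auto
    have FL: "F n \<in> sets lebesgue" for n
    proof -
      have "open (F n)"
        unfolding F_def using \<open>B ` {..<n} - {{}} \<subseteq> \<B>\<close> opn by (intro open_Int open_Union) auto
      then show ?thesis by auto
    qed
    have FU: "F n \<subseteq> U" for n
      unfolding F_def using B \<C>(2) by blast
    show ?thesis
    proof (rule lim)
      show "abs_L2 (\<lambda>x. indicator (F n) x *\<^sub>R i) \<in> K" for n
        by (rule SK) (use FG i in \<open>auto simp: S_def intro!: image_eqI[of _ _ "(F n, i)"]\<close>)
      show "(\<lambda>n. abs_L2 (\<lambda>x. indicator (F n) x *\<^sub>R i)) \<longlonglongrightarrow> abs_L2 (\<lambda>x. indicator U x *\<^sub>R i)"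
      proof (rule L2_dominated_convergence(2)[OF sqi[OF U(2)]])
        show "(\<lambda>x. indicator (F n) x *\<^sub>R i) \<in> borel_measurable lebesgue" for n
          using FL by (intro borel_measurable_scaleR borel_measurable_indicator) auto
        show "AE x in lebesgue. norm (indicator (F n) x *\<^sub>R i) \<le> 2 * norm (indicator U x *\<^sub>R i)" for n
          using FU[of n] by (intro AE_I2) (auto simp: indicator_def)
        have "(\<lambda>n. indicator (F n) x *\<^sub>R i) \<longlonglongrightarrow> indicator U x *\<^sub>R i" for x
        proof (cases "x \<in> U")
          case True
          then obtain k where k: "x \<in> B k"
            using \<C>(2) B by (metis UnionE insertI2 rangeE)
          obtain m :: nat where m: "norm x < real m" using reals_Archimedean2 by blast
          have "x \<in> F n" if "n \<ge> max (Suc k) m" for n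
            unfolding F_def using k m that by (auto intro!: bexI[of _ k])
          then have "\<forall>\<^sub>F n in sequentially. indicator (F n) x *\<^sub>R i = indicator U x *\<^sub>R i"
            using True by (intro eventually_sequentiallyI[of "max (Suc k) m"]) auto
          then show ?thesis by (rule tendsto_eventually)
        next
          case False
          then have "x \<notin> F n" for n using FU by blast
          then show ?thesis using False by simp
        qed
        then show "AE x in lebesgue. (\<lambda>n. indicator (F n) x *\<^sub>R i) \<longlonglongrightarrow> indicator U x *\<^sub>R i"
          by (intro AE_I2)
      qed
    qed
  qed
  have Kset: "abs_L2 (\<lambda>x. indicator A x *\<^sub>R i) \<in> K" if "A \<in> lmeasurable" "i \<in> Basis" for A i
    by (rule L2_lmeasurable_approx[OF closed Kopen]) (use that in auto)
  have Kvec: "abs_L2 (\<lambda>x. indicator A x *\<^sub>R v) \<in> K" if A: "A \<in> lmeasurable" for A and v :: 'b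
  proof -
    have fin: "square_integrable (\<lambda>x. \<Sum>i\<in>I. (v \<bullet> i) *\<^sub>R (indicator A x *\<^sub>R i)) \<and>
        abs_L2 (\<lambda>x. \<Sum>i\<in>I. (v \<bullet> i) *\<^sub>R (indicator A x *\<^sub>R i))
          = (\<Sum>i\<in>I. (v \<bullet> i) *\<^sub>R abs_L2 (\<lambda>x. indicator A x *\<^sub>R i))" if "finite I" for I
      using that
    proof (induction I rule: finite_induct)
      case empty
      then show ?case by (simp add: square_integrable_zero zero_L2.abs_eq)
    next
      case (insert i I)
      have 1: "square_integrable (\<lambda>x. (v \<bullet> i) *\<^sub>R (indicator A x *\<^sub>R i))"
        by (intro square_integrable_scaleR sqi A)
      have 2: "square_integrable (\<lambda>x. \<Sum>i\<in>I. (v \<bullet> i) *\<^sub>R (indicator A x *\<^sub>R i))"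
        and 3: "abs_L2 (\<lambda>x. \<Sum>i\<in>I. (v \<bullet> i) *\<^sub>R (indicator A x *\<^sub>R i))
          = (\<Sum>i\<in>I. (v \<bullet> i) *\<^sub>R abs_L2 (\<lambda>x. indicator A x *\<^sub>R i))"
        using insert.IH by blast+
      show ?case
        using insert.hyps square_integrable_add[OF 1 2] add_abs_L2[OF 1 2] 3
          scaleR_abs_L2[OF sqi[OF A], of "v \<bullet> i" i]
        by simp
    qed
    have "(\<Sum>i\<in>Basis. (v \<bullet> i) *\<^sub>R (indicator A x *\<^sub>R i)) = indicator A x *\<^sub>R v" for x
    proof -
      have "(\<Sum>i\<in>Basis. (v \<bullet> i) *\<^sub>R (indicator A x *\<^sub>R i)) = indicator A x *\<^sub>R (\<Sum>i\<in>Basis. (v \<bullet> i) *\<^sub>R i)"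
        by (simp add: scaleR_sum_right mult.commute)
      then show ?thesis by (simp add: euclidean_representation)
    qed
    then have "abs_L2 (\<lambda>x. indicator A x *\<^sub>R v)
        = (\<Sum>i\<in>Basis. (v \<bullet> i) *\<^sub>R abs_L2 (\<lambda>x. indicator A x *\<^sub>R i))"
      using fin[of Basis] by simp
    also have "\<dots> \<in> K"
      using A by (intro Ksum Kscale Kset) auto
    finally show ?thesis .
  qed
  have Ksimple: "abs_L2 s \<in> K" if s: "simple_function lebesgue s" "square_integrable s" for s
  proof -
    have lm: "s -` {v} \<in> lmeasurable" if "v \<noteq> 0" for v
    proof (rule fmeasurableI)
      show meas: "s -` {v} \<in> sets lebesgue"
        using simple_functionD(2)[OF s(1), of "{v}"] by simp
      have "ennreal ((norm v)\<^sup>2) * emeasure lebesgue (s -` {v})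
          = (\<integral>\<^sup>+x. ennreal ((norm v)\<^sup>2) * indicator (s -` {v}) x \<partial>lebesgue)"
        using meas by (simp add: nn_integral_cmult_indicator)
      also have "\<dots> \<le> (\<integral>\<^sup>+x. ennreal ((norm (s x))\<^sup>2) \<partial>lebesgue)"
        by (intro nn_integral_mono) (auto simp: indicator_def)
      also have "\<dots> < \<infinity>"
        using s(2) by (auto simp: square_integrable_def integrable_iff_bounded)
      finally show "emeasure lebesgue (s -` {v}) < \<infinity>"
        using that by (auto simp: ennreal_mult_less_top)
    qed
    have fin: "square_integrable (\<lambda>x. \<Sum>v\<in>I. indicator (s -` {v}) x *\<^sub>R v) \<and>
        abs_L2 (\<lambda>x. \<Sum>v\<in>I. indicator (s -` {v}) x *\<^sub>R v) \<in> K" if "finite I" "0 \<notin> I" for I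
      using that
    proof (induction I rule: finite_induct)
      case empty
      then show ?case using K0 by (simp add: square_integrable_zero zero_L2.abs_eq)
    next
      case (insert v I)
      have 0: "s -` {v} \<in> lmeasurable" using insert.prems by (intro lm) auto
      have 2: "square_integrable (\<lambda>x. \<Sum>v\<in>I. indicator (s -` {v}) x *\<^sub>R v)"
        and 3: "abs_L2 (\<lambda>x. \<Sum>v\<in>I. indicator (s -` {v}) x *\<^sub>R v) \<in> K"
        using insert by auto
      have 4: "(\<lambda>x. \<Sum>v\<in>insert v I. indicator (s -` {v}) x *\<^sub>R v)
          = (\<lambda>x. indicator (s -` {v}) x *\<^sub>R v + (\<Sum>v\<in>I. indicator (s -` {v}) x *\<^sub>R v))"
        by (rule ext, rule sum.insert[OF insert.hyps])
      show ?case
        unfolding 4 add_abs_L2[OF sqi[OF 0] 2, symmetric]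
        by (rule conjI[OF square_integrable_add[OF sqi[OF 0] 2] Kadd[OF Kvec[OF 0] 3]])
    qed
    have frange: "finite (range s)" using simple_functionD(1)[OF s(1)] by simp
    have "s x = (\<Sum>v\<in>range s - {0}. indicator (s -` {v}) x *\<^sub>R v)" for x
    proof -
      have "(\<Sum>v\<in>range s - {0}. indicator (s -` {v}) x *\<^sub>R v)
          = (\<Sum>v\<in>range s - {0}. if v = s x then v else 0)"
        by (intro sum.cong) (auto simp: indicator_def)
      also have "\<dots> = s x" using frange by simp
      finally show ?thesis by simp
    qed
    then have "s = (\<lambda>x. \<Sum>v\<in>range s - {0}. indicator (s -` {v}) x *\<^sub>R v)" by blast
    then show ?thesis using fin[of "range s - {0}"] frange by (metis Diff_iff finite_Diff insertI1)
  qed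
  have "X \<in> K" for X
  proof -
    define f where "f = rep_L2 X"
    have f: "square_integrable f" and X: "abs_L2 f = X"
      by (simp_all add: f_def square_integrable_rep_L2 abs_rep_L2)
    obtain s where s: "\<And>i. simple_function lebesgue (s i)" "\<And>x. (\<lambda>i. s i x) \<longlonglongrightarrow> f x"
        "\<And>i x. dist (s i x) 0 \<le> 2 * dist (f x) 0"
      using borel_measurable_implies_sequence_metric[of f lebesgue 0] f
      by (auto simp: square_integrable_def)
    have sm: "s i \<in> borel_measurable lebesgue" for i
      using s(1) by (rule borel_measurable_simple_function)
    have AE: "AE x in lebesgue. (\<lambda>i. s i x) \<longlonglongrightarrow> f x"
        "AE x in lebesgue. norm (s i x) \<le> 2 * norm (f x)" for i
      using s(2,3) by (auto simp: dist_norm)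
    note * = L2_dominated_convergence[OF f sm AE]
    show ?thesis
      using *(2) unfolding X by (rule lim[rotated]) (rule Ksimple[OF s(1) *(1)])
  qed
  then show ?thesis using cQ K_def by blast
qed

instance L2 :: (euclidean_space, euclidean_space) second_countable_topology
proof
  obtain Q :: "('a, 'b) L2 set" where Q: "countable Q" "closure Q = UNIV"
    using L2_countable_dense by blast
  define B where "B = (\<lambda>(q, n). ball q (1 / Suc n)) ` (Q \<times> UNIV)"
  have "topological_basis B"
  proof (rule topological_basisI)
    show "open b" if "b \<in> B" for b using that by (auto simp: B_def)
    fix S :: "('a, 'b) L2 set" and x assume "open S" "x \<in> S"
    then obtain e where e: "e > 0" "ball x e \<subseteq> S" by (meson open_contains_ball)
    obtain n where n: "1 / Suc n < e / 2" using e(1) nat_approx_posE[of "e / 2"] by auto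
    have "x \<in> closure Q" using Q by simp
    then obtain q where q: "q \<in> Q" "dist q x < 1 / Suc n"
      by (meson closure_approachable of_nat_0_less_iff zero_less_Suc zero_less_divide_1_iff)
    have "ball q (1 / Suc n) \<subseteq> ball x e"
    proof
      fix z assume "z \<in> ball q (1 / Suc n)"
      then have "dist q z < 1 / Suc n" by simp
      then have "dist x z < e"
        using dist_triangle[of x z q] q(2) n by (simp add: dist_commute)
      then show "z \<in> ball x e" by simp
    qed
    then show "\<exists>b\<in>B. x \<in> b \<and> b \<subseteq> S"
      using q e(2) by (auto simp: B_def intro!: bexI[of _ "(q, n)"])
  qed
  moreover have "countable B" unfolding B_def using Q(1) by auto
  ultimately show "\<exists>B :: ('a, 'b) L2 set set. countable B \<and> open = generate_topology B"
    using topological_basis_imp_subbasis by blast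
qed


section \<open>The space H^1_0(D) and weak solutions\<close>

text \<open>
  Near a boundary point \<open>x\<close>, the domain is the part of a ball that lies, in the direction \<open>e\<close>, above
  the graph of a Lipschitz function \<open>g\<close> on the hyperplane orthogonal to \<open>e\<close>.
\<close>

definition bounded_lipschitz_domain :: "'a::euclidean_space set \<Rightarrow> bool" where
  "bounded_lipschitz_domain D \<longleftrightarrow>
     D \<noteq> {} \<and> open D \<and> connected D \<and> bounded D \<and>
     (\<forall>x\<in>frontier D. \<exists>e r L g. norm e = 1 \<and> 0 < r \<and>
        L-lipschitz_on {z. z \<bullet> e = 0} g \<and>
        (\<forall>z\<in>ball x r. z \<in> D \<longleftrightarrow> g (z - (z \<bullet> e) *\<^sub>R e) < z \<bullet> e))"

primrec Ck :: "nat \<Rightarrow> ('a::euclidean_space \<Rightarrow> real) \<Rightarrow> bool" where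
  "Ck 0 \<phi> \<longleftrightarrow> continuous_on UNIV \<phi>"
| "Ck (Suc k) \<phi> \<longleftrightarrow> (\<forall>x. \<phi> differentiable (at x)) \<and>
     (\<forall>i\<in>Basis. Ck k (\<lambda>x. frechet_derivative \<phi> (at x) i))"

definition test_functions :: "'a::euclidean_space set \<Rightarrow> ('a \<Rightarrow> real) set" where
  "test_functions D =
     {\<phi>. (\<forall>k. Ck k \<phi>) \<and> (\<exists>K. compact K \<and> K \<subseteq> D \<and> (\<forall>x. x \<notin> K \<longrightarrow> \<phi> x = 0))}"

definition gradient :: "('a::euclidean_space \<Rightarrow> real) \<Rightarrow> 'a \<Rightarrow> 'a" where
  "gradient \<phi> x = (\<Sum>i\<in>Basis. frechet_derivative \<phi> (at x) i *\<^sub>R i)"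

lemma Ck_imp_continuous: "(\<forall>k. Ck k \<phi>) \<Longrightarrow> continuous_on UNIV \<phi>"
  using Ck.simps(1) by blast

lemma continuous_on_gradient:
  assumes "\<forall>k. Ck k \<phi>"
  shows "continuous_on UNIV (gradient \<phi>)"
proof -
  have "Ck (Suc 0) \<phi>" using assms by blast
  then have "\<forall>i\<in>Basis. continuous_on UNIV (\<lambda>x. frechet_derivative \<phi> (at x) i)" by simp
  then show ?thesis unfolding gradient_def[abs_def] by (intro continuous_intros) auto
qed

lemma square_integrable_compact_support:
  fixes h :: "'a::euclidean_space \<Rightarrow> 'b::euclidean_space"
  assumes h: "continuous_on UNIV h" and K: "compact K" "\<And>x. x \<notin> K \<Longrightarrow> h x = 0"
  shows "square_integrable h"
proof -
  have "bounded (h ` K)"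
    using h K(1) by (intro compact_imp_bounded compact_continuous_image) (auto intro: continuous_on_subset)
  then obtain B where B: "\<And>x. x \<in> K \<Longrightarrow> norm (h x) \<le> B"
    unfolding bounded_iff by blast
  show ?thesis
  proof (rule square_integrable_bound[where h = "\<lambda>x. B\<^sup>2 * indicator K x"])
    show "h \<in> borel_measurable lebesgue"
      using h by (intro measurable_completion) (simp add: borel_measurable_continuous_onI)
    show "integrable lebesgue (\<lambda>x. B\<^sup>2 * indicator K x)"
      using K(1) lmeasurable_compact[OF K(1)] by (intro integrable_mult_right) (auto simp: fmeasurable_def less_top)
    show "AE x in lebesgue. (norm (h x))\<^sup>2 \<le> B\<^sup>2 * indicator K x"
      using B K(2) by (intro AE_I2) (auto simp: indicator_def intro!: power_mono)
  qed
qed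

lemma test_function_square_integrable:
  assumes "\<phi> \<in> test_functions D"
  shows "square_integrable \<phi>" "square_integrable (gradient \<phi>)"
proof -
  from assms obtain K where C: "\<forall>k. Ck k \<phi>" and K: "compact K" "\<And>x. x \<notin> K \<Longrightarrow> \<phi> x = 0"
    unfolding test_functions_def by blast
  show "square_integrable \<phi>" by (rule square_integrable_compact_support[OF Ck_imp_continuous[OF C] K])
  have "gradient \<phi> x = 0" if "x \<notin> K" for x
  proof -
    have "(\<phi> has_derivative (\<lambda>_. 0)) (at x)"
    proof (rule has_derivative_transform_within_open[where f = "\<lambda>_. 0" and s = "- K"])
      show "open (- K)" using K(1) compact_imp_closed by blast
    qed (use that K in auto)
    then have "frechet_derivative \<phi> (at x) = (\<lambda>_. 0)"
      by (metis frechet_derivative_at)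
    then show ?thesis by (simp add: gradient_def)
  qed
  then show "square_integrable (gradient \<phi>)" by (intro square_integrable_compact_support[OF continuous_on_gradient[OF C] K(1)])
qed

text \<open>
  An element of H^1_0(D) is represented by the pair of its extension by zero and the weak gradient
  of that extension, both as classes of functions on the whole space.  The norm of the product type
  is then the full H^1 norm, so the closure below is the closure of the test functions in H^1, and
  derivatives and Bochner integrals of maps into H^1_0(D) are those of the library.  For bounded
  D the norm \<open>normV\<close> is equivalent to the norm of the type on H^1_0(D), by the Poincare inequality.
\<close>

type_synonym 'a H1 = "('a, real) L2 \<times> ('a, 'a) L2"

definition H10 :: "'a::euclidean_space set \<Rightarrow> 'a H1 set" where
  "H10 D = closure ((\<lambda>\<phi>. (abs_L2 \<phi>, abs_L2 (gradient \<phi>))) ` test_functions D)"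

definition weak_grad :: "'a::euclidean_space H1 \<Rightarrow> 'a \<Rightarrow> 'a" where
  "weak_grad v = rep_L2 (snd v)"

definition normV :: "'a::euclidean_space H1 \<Rightarrow> real" where
  "normV v = norm (snd v)"

definition H10_dual :: "'a::euclidean_space set \<Rightarrow> ('a H1 \<Rightarrow> real) set" where
  "H10_dual D = {f.
     (\<forall>v\<in>H10 D. \<forall>w\<in>H10 D. f (v + w) = f v + f w) \<and>
     (\<forall>c. \<forall>v\<in>H10 D. f (c *\<^sub>R v) = c * f v) \<and>
     (\<exists>B. \<forall>v\<in>H10 D. \<bar>f v\<bar> \<le> B * normV v)}"

definition weak_solution ::
    "'a::euclidean_space set \<Rightarrow> ('a \<Rightarrow> real) \<Rightarrow> ('a H1 \<Rightarrow> real) \<Rightarrow> 'a H1 \<Rightarrow> bool" where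
  "weak_solution D a f u \<longleftrightarrow> u \<in> H10 D \<and>
     (\<forall>v\<in>H10 D. set_integrable lebesgue D (\<lambda>x. a x * (weak_grad u x \<bullet> weak_grad v x)) \<and>
        (LINT x:D|lebesgue. a x * (weak_grad u x \<bullet> weak_grad v x)) = f v)"

definition essentially_bounded_on :: "'a::euclidean_space set \<Rightarrow> ('a \<Rightarrow> real) \<Rightarrow> bool" where
  "essentially_bounded_on D h \<longleftrightarrow>
     h \<in> borel_measurable (lebesgue_on D) \<and> (\<exists>B. AE x in lebesgue_on D. \<bar>h x\<bar> \<le> B)"


section \<open>Multi-indices and expansions\<close>

text \<open>Coordinates of sequences are numbered from 0 instead of 1.\<close>

definition multi_indices :: "(nat \<Rightarrow> nat) set" where
  "multi_indices = {\<nu>. finite {j. \<nu> j \<noteq> 0}}"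

definition mfact :: "(nat \<Rightarrow> nat) \<Rightarrow> real" where
  "mfact \<nu> = (\<Prod>j | \<nu> j \<noteq> 0. fact (\<nu> j))"

definition partial_deriv ::
    "nat \<Rightarrow> ((nat \<Rightarrow> real) \<Rightarrow> 'v::real_normed_vector) \<Rightarrow> (nat \<Rightarrow> real) \<Rightarrow> 'v" where
  "partial_deriv j u y = vector_derivative (\<lambda>s. u (y(j := s))) (at (y j))"

definition mixed_deriv ::
    "(nat \<Rightarrow> nat) \<Rightarrow> ((nat \<Rightarrow> real) \<Rightarrow> 'v::real_normed_vector) \<Rightarrow> (nat \<Rightarrow> real) \<Rightarrow> 'v" where
  "mixed_deriv \<nu> u = fold (\<lambda>j. partial_deriv j ^^ \<nu> j) (sorted_list_of_set {j. \<nu> j \<noteq> 0}) u"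

definition jacobi_weight :: "real \<Rightarrow> real \<Rightarrow> real \<Rightarrow> real" where
  "jacobi_weight \<alpha> \<beta> s = indicator {-1..1} s * (1 - s) powr \<alpha> * (1 + s) powr \<beta>"

definition jacobi_measure :: "real \<Rightarrow> real \<Rightarrow> real measure" where
  "jacobi_measure \<alpha> \<beta> =
     density lborel (\<lambda>s. jacobi_weight \<alpha> \<beta> s / (LINT s|lborel. jacobi_weight \<alpha> \<beta> s))"

text \<open>
  Orthonormality fixes the polynomials up to sign; \<open>J 0 = 1\<close> is needed for the infinite products
  of the \<open>J (\<nu> j)\<close> to make sense.
\<close>

definition jacobi_polynomials :: "real \<Rightarrow> real \<Rightarrow> (nat \<Rightarrow> real poly) \<Rightarrow> bool" where
  "jacobi_polynomials \<alpha> \<beta> J \<longleftrightarrow>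
     J 0 = 1 \<and> (\<forall>n. degree (J n) = n) \<and>
     (\<forall>m n. (LINT s|jacobi_measure \<alpha> \<beta>. poly (J m) s * poly (J n) s) = (if m = n then 1 else 0))"

text \<open>
  By the Rodrigues formula; \<open>1 / sqrt (fact n)\<close> normalizes in \<open>L\<^sup>2\<close> of the standard Gaussian measure.
\<close>

definition hermite :: "nat \<Rightarrow> real \<Rightarrow> real" where
  "hermite n s = (-1) ^ n / sqrt (fact n) *
     (deriv ^^ n) std_normal_density s / std_normal_density s"

datatype expansion = Taylor | Jacobi real real "nat \<Rightarrow> real poly" | Hermite

primrec valid_expansion :: "expansion \<Rightarrow> bool" where
  "valid_expansion Taylor \<longleftrightarrow> True"
| "valid_expansion (Jacobi \<alpha> \<beta> J) \<longleftrightarrow> -1 < \<alpha> \<and> -1 < \<beta> \<and> jacobi_polynomials \<alpha> \<beta> J"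
| "valid_expansion Hermite \<longleftrightarrow> True"

definition unit_cube :: "(nat \<Rightarrow> real) set" where
  "unit_cube = {y. \<forall>j. y j \<in> {-1..1}}"

primrec param_set :: "expansion \<Rightarrow> (nat \<Rightarrow> real) set" where
  "param_set Taylor = unit_cube"
| "param_set (Jacobi \<alpha> \<beta> J) = unit_cube"
| "param_set Hermite = UNIV"

text \<open>
  In the Taylor case only the sigma-algebra of this measure is used.
\<close>

primrec param_measure :: "expansion \<Rightarrow> (nat \<Rightarrow> real) measure" where
  "param_measure Taylor = (\<Pi>\<^sub>M j\<in>UNIV. borel)"
| "param_measure (Jacobi \<alpha> \<beta> J) = (\<Pi>\<^sub>M j\<in>UNIV. jacobi_measure \<alpha> \<beta>)"
| "param_measure Hermite = (\<Pi>\<^sub>M j\<in>UNIV. density lborel std_normal_density)"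

text \<open>All factors with \<open>\<nu> j = 0\<close> are 1 and are left out of the product.\<close>

definition basis_fun :: "expansion \<Rightarrow> (nat \<Rightarrow> nat) \<Rightarrow> (nat \<Rightarrow> real) \<Rightarrow> real" where
  "basis_fun ex \<nu> y = (\<Prod>j | \<nu> j \<noteq> 0. case ex of
       Taylor \<Rightarrow> y j ^ \<nu> j
     | Jacobi \<alpha> \<beta> J \<Rightarrow> poly (J (\<nu> j)) (y j)
     | Hermite \<Rightarrow> hermite (\<nu> j) (y j))"

definition expansion_coeff ::
    "expansion \<Rightarrow> ((nat \<Rightarrow> real) \<Rightarrow> 'a::euclidean_space H1) \<Rightarrow> (nat \<Rightarrow> nat) \<Rightarrow> 'a H1" where
  "expansion_coeff ex u \<nu> =
     (if ex = Taylor then (1 / mfact \<nu>) *\<^sub>R mixed_deriv \<nu> u (\<lambda>_. 0)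
      else LINT y:param_set ex|param_measure ex. basis_fun ex \<nu> y *\<^sub>R u y)"

text \<open>
  Membership in, and the norm of, the space in which the error is measured: functions on
  \<open>param_set ex\<close> with the supremum norm in the Taylor case, and with the \<open>L\<^sup>2\<close> norm otherwise.
\<close>

definition in_param_space :: "expansion \<Rightarrow> ((nat \<Rightarrow> real) \<Rightarrow> 'a::euclidean_space H1) \<Rightarrow> bool" where
  "in_param_space ex w \<longleftrightarrow>
     w \<in> borel_measurable (restrict_space (param_measure ex) (param_set ex)) \<and>
     (if ex = Taylor then bdd_above ((\<lambda>y. normV (w y)) ` param_set ex)
      else set_integrable (param_measure ex) (param_set ex) (\<lambda>y. (normV (w y))\<^sup>2))"

definition param_norm :: "expansion \<Rightarrow> ((nat \<Rightarrow> real) \<Rightarrow> 'a::euclidean_space H1) \<Rightarrow> real" where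
  "param_norm ex w =
     (if ex = Taylor then SUP y\<in>param_set ex. normV (w y)
      else sqrt (LINT y:param_set ex|param_measure ex. (normV (w y))\<^sup>2))"


section \<open>The parametric problems\<close>

definition affine_solution ::
    "'a::euclidean_space set \<Rightarrow> ('a \<Rightarrow> real) \<Rightarrow> (nat \<Rightarrow> 'a \<Rightarrow> real) \<Rightarrow> ('a H1 \<Rightarrow> real) \<Rightarrow>
     ((nat \<Rightarrow> real) \<Rightarrow> 'a H1) \<Rightarrow> bool" where
  "affine_solution D abar \<psi> f u \<longleftrightarrow>
     essentially_bounded_on D abar \<and> (\<forall>j. essentially_bounded_on D (\<psi> j)) \<and>
     (\<exists>r0>0. AE x in lebesgue_on D.
        summable (\<lambda>j. \<bar>\<psi> j x\<bar>) \<and> (\<Sum>j. \<bar>\<psi> j x\<bar>) \<le> abar x - r0) \<and>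
     (\<forall>y\<in>unit_cube. weak_solution D (\<lambda>x. abar x + (\<Sum>j. y j * \<psi> j x)) f (u y))"

text \<open>
  The diffusion coefficient of a lognormal problem need not be bounded or bounded away from 0 here;
  what is used of \<open>u y\<close>, for almost every \<open>y\<close>, is that it solves the weak formulation.
\<close>

definition lognormal_solution ::
    "'a::euclidean_space set \<Rightarrow> (nat \<Rightarrow> 'a \<Rightarrow> real) \<Rightarrow> ('a H1 \<Rightarrow> real) \<Rightarrow>
     ((nat \<Rightarrow> real) \<Rightarrow> 'a H1) \<Rightarrow> bool" where
  "lognormal_solution D \<psi> f u \<longleftrightarrow>
     (\<forall>j. \<psi> j \<in> borel_measurable (lebesgue_on D)) \<and>
     (AE y in param_measure Hermite.
        (AE x in lebesgue_on D. summable (\<lambda>j. y j * \<psi> j x)) \<and>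
        weak_solution D (\<lambda>x. exp (\<Sum>j. y j * \<psi> j x)) f (u y)) \<and>
     in_param_space Hermite u"

definition solution_map ::
    "expansion \<Rightarrow> 'a::euclidean_space set \<Rightarrow> ('a \<Rightarrow> real) \<Rightarrow> (nat \<Rightarrow> 'a \<Rightarrow> real) \<Rightarrow>
     ('a H1 \<Rightarrow> real) \<Rightarrow> ((nat \<Rightarrow> real) \<Rightarrow> 'a H1) \<Rightarrow> bool" where
  "solution_map ex D abar \<psi> f u \<longleftrightarrow>
     (if ex = Hermite then lognormal_solution D \<psi> f u else affine_solution D abar \<psi> f u)"


section \<open>Discretization\<close>

definition norm_on :: "'v::real_vector set \<Rightarrow> ('v \<Rightarrow> real) \<Rightarrow> bool" where
  "norm_on X N \<longleftrightarrow>
     (\<forall>v\<in>X. 0 \<le> N v \<and> (N v = 0 \<longleftrightarrow> v = 0)) \<and>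
     (\<forall>c. \<forall>v\<in>X. N (c *\<^sub>R v) = \<bar>c\<bar> * N v) \<and>
     (\<forall>v\<in>X. \<forall>w\<in>X. N (v + w) \<le> N v + N w)"

definition in_ell :: "real \<Rightarrow> ((nat \<Rightarrow> nat) \<Rightarrow> real) \<Rightarrow> bool" where
  "in_ell p c \<longleftrightarrow> (\<lambda>\<nu>. \<bar>c \<nu>\<bar> powr p) summable_on multi_indices"

definition ell_norm :: "real \<Rightarrow> ((nat \<Rightarrow> nat) \<Rightarrow> real) \<Rightarrow> real" where
  "ell_norm p c = (\<Sum>\<^sub>\<infinity>\<nu>\<in>multi_indices. \<bar>c \<nu>\<bar> powr p) powr (1 / p)"

definition n_largest :: "nat \<Rightarrow> ((nat \<Rightarrow> nat) \<Rightarrow> real) \<Rightarrow> (nat \<Rightarrow> nat) set \<Rightarrow> bool" where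
  "n_largest n c \<Lambda> \<longleftrightarrow>
     \<Lambda> \<subseteq> multi_indices \<and> finite \<Lambda> \<and> card \<Lambda> = n \<and>
     (\<forall>\<nu>\<in>\<Lambda>. \<forall>\<mu>\<in>multi_indices - \<Lambda>. c \<mu> \<le> c \<nu>)"

text \<open>Functions on \<open>param_set ex\<close> are extended by 0 to all sequences.\<close>

definition tensor_space ::
    "expansion \<Rightarrow> (nat \<Rightarrow> 'a::euclidean_space H1 set) \<Rightarrow> (nat \<Rightarrow> nat) set \<Rightarrow>
     ((nat \<Rightarrow> nat) \<Rightarrow> nat) \<Rightarrow> ((nat \<Rightarrow> real) \<Rightarrow> 'a H1) set" where
  "tensor_space ex W \<Lambda> n =
     {(\<lambda>y. if y \<in> param_set ex then \<Sum>\<nu>\<in>\<Lambda>. basis_fun ex \<nu> y *\<^sub>R v \<nu> else 0) | v.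
        \<forall>\<nu>\<in>\<Lambda>. v \<nu> \<in> W (n \<nu>)}"

text \<open>
  Function types are not an instance of \<^class>\<open>real_vector\<close>, hence the explicit scalar multiplication.
\<close>

definition fun_dim :: "('b \<Rightarrow> 'v::real_vector) set \<Rightarrow> nat" where
  "fun_dim = vector_space.dim (\<lambda>(c::real) w y. c *\<^sub>R w y)"

text \<open>
  The rate \<open>s\<close> of the tail of the sorted coefficients is measured in \<open>\<ell>\<^sup>1\<close> in the Taylor case and in
  \<open>\<ell>\<^sup>2\<close> for the orthonormal bases.
\<close>

definition base_exponent :: "expansion \<Rightarrow> real" where
  "base_exponent ex = (if ex = Taylor then 1 else 1/2)"

definition rate_s :: "expansion \<Rightarrow> real \<Rightarrow> real" where
  "rate_s ex pV = 1 / pV - base_exponent ex"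

definition rate_r :: "expansion \<Rightarrow> real \<Rightarrow> real \<Rightarrow> real \<Rightarrow> real" where
  "rate_r ex pV pX t =
     rate_s ex pV * t / (rate_s ex pV + t + base_exponent ex - 1 / pX)"

end

theory Submission
  imports Defs
begin

text \<open>
  In all three cases the error is bounded by the \<open>\<ell>\<^sup>q\<close> sum of the errors of the retained coefficients
  and of the norms of the discarded ones, with \<open>q = 1\<close> for the Taylor series and \<open>q = 2\<close>, by Parseval,
  for the orthonormal series.  The discarded coefficients are controlled by Stechkin's estimate, and
  degrees proportional to a power of the X-norms of the coefficients balance the two contributions.

  Completeness of the orthonormal polynomials in infinitely many variables rests on finite exponential
  moments in each variable.  The Taylor coefficients satisfy a recursion obtained by differentiating
  the weak formulation; by uniqueness, a summable Taylor series therefore sums to the solution.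
\<close>

section \<open>Balancing the degrees\<close>

text \<open>The parameter \<open>b = 1 / q\<close> carries both error measures through one
  computation, with \<open>b = 1\<close> for the supremum norm and \<open>b = 1/2\<close> for mean
  squares. In the affine case only the pointwise sum of the \<open>\<bar>\<psi> j x\<bar>\<close> is
  controlled and the norms of the \<open>\<psi> j\<close> need not be summable, so
  \<open>A y = A0 + (sum of y j * P j)\<close> converges only when applied to a fixed element.
  Rearrangements of double sums therefore take place in the weak form, where a choice of signs
  within the cube yields absolute convergence. For the orthonormal series the density of polynomials
  is reached without Fourier transforms: for \<open>\<bar>a\<bar> \<le> 1/2\<close> the power series
  of \<open>sin (a * y j)\<close> is dominated by \<open>exp (\<bar>y j\<bar> / 2)\<close>, whose
  square the moment hypothesis absorbs, and this works directly for functions with values in a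
  Hilbert space. Density enters only through the inequality that bounds the norm of \<open>u\<close>
  by its coefficients; everything else about the error is finite Hilbert space algebra.\<close>

text \<open>Each of the \<open>n\<close> retained values dominates a discarded \<open>v j\<close>,
  so \<open>n * v j powr p \<le> A\<close>. Hence the surplus power \<open>v j powr (q - p)\<close>
  is at most \<open>(A / n) powr ((q - p) / p)\<close>, and only \<open>p\<close>-th powers remain
  to be summed.\<close>

lemma stechkin_tail:
  fixes v :: "'i \<Rightarrow> real"
  assumes p: "0 < p" "p \<le> q" and v: "\<And>i. i \<in> I \<Longrightarrow> 0 \<le> v i"
    and sm: "(\<lambda>i. v i powr p) summable_on I"
    and L: "finite \<Lambda>" "\<Lambda> \<subseteq> I" "card \<Lambda> = n" "0 < n"
    and ord: "\<And>i j. i \<in> \<Lambda> \<Longrightarrow> j \<in> I - \<Lambda> \<Longrightarrow> v j \<le> v i"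
    and A: "(\<Sum>\<^sub>\<infinity>i\<in>I. v i powr p) = A"
  shows "(\<lambda>i. v i powr q) summable_on I - \<Lambda>"
    and "(\<Sum>\<^sub>\<infinity>i\<in>I - \<Lambda>. v i powr q) \<le> A powr (q / p) * real n powr (1 - q / p)"
proof -
  define B where "B = (A / n) powr ((q - p) / p)"
  have A0: "0 \<le> A" unfolding A[symmetric] by (rule infsum_nonneg) simp
  have smJ: "(\<lambda>i. v i powr p) summable_on I - \<Lambda>"
    using sm by (rule summable_on_subset_banach) simp
  have le: "v j powr q \<le> v j powr p * B" if j: "j \<in> I - \<Lambda>" for j
  proof (cases "v j = 0")
    case False
    then have pos: "0 < v j" using v[of j] j by auto
    have "n * v j powr p = (\<Sum>i\<in>\<Lambda>. v j powr p)" using L by simp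
    also have "\<dots> \<le> (\<Sum>i\<in>\<Lambda>. v i powr p)"
      using ord[OF _ j] pos p by (intro sum_mono powr_mono2) auto
    also have "\<dots> \<le> A" unfolding A[symmetric]
      by (rule finite_sum_le_infsum[OF sm L(1,2)]) simp
    finally have "v j powr p \<le> A / n" using L(4) by (simp add: field_simps)
    then have "(v j powr p) powr ((q - p) / p) \<le> B"
      unfolding B_def using p by (intro powr_mono2) auto
    then have "v j powr (q - p) \<le> B" using p by (simp add: powr_powr)
    then have "v j powr p * v j powr (q - p) \<le> v j powr p * B" by (intro mult_left_mono) auto
    then show ?thesis by (simp add: powr_add[symmetric])
  qed simp
  have smB: "(\<lambda>i. v i powr p * B) summable_on I - \<Lambda>"
    by (rule summable_on_cmult_left[OF smJ])
  show smq: "(\<lambda>i. v i powr q) summable_on I - \<Lambda>"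
    by (rule summable_on_comparison_test[OF smB]) (use le in auto)
  have "(\<Sum>\<^sub>\<infinity>i\<in>I - \<Lambda>. v i powr q) \<le> (\<Sum>\<^sub>\<infinity>i\<in>I - \<Lambda>. v i powr p * B)"
    by (rule infsum_mono[OF smq smB]) (use le in auto)
  also have "\<dots> = (\<Sum>\<^sub>\<infinity>i\<in>I - \<Lambda>. v i powr p) * B" by (rule infsum_cmult_left') 
  also have "\<dots> \<le> A * B" unfolding A[symmetric]
    by (intro mult_right_mono infsum_mono_neutral smJ sm) (auto simp: B_def)
  also have "A * B = A powr (q / p) * real n powr (1 - q / p)"
  proof (cases "A = 0")
    case False
    then have "0 < A" using A0 by simp
    then have "A * B = A powr 1 * (A powr (q / p - 1) / real n powr (q / p - 1))"
      using p L unfolding B_def by (simp add: powr_divide diff_divide_distrib)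
    also have "\<dots> = (A powr 1 * A powr (q / p - 1)) * real n powr (- (q / p - 1))"
      using powr_minus_divide[of "real n" "q / p - 1"] by simp
    also have "A powr 1 * A powr (q / p - 1) = A powr (q / p)"
      unfolding powr_add[symmetric] by simp
    finally show ?thesis by simp
  qed simp
  finally show "(\<Sum>\<^sub>\<infinity>i\<in>I - \<Lambda>. v i powr q) \<le> A powr (q / p) * real n powr (1 - q / p)" .
qed

text \<open>For \<open>\<eta> < p\<close> this is Hoelder's inequality up to the constant, obtained
  by comparing each \<open>x i\<close> with a threshold. For \<open>\<eta> \<ge> p\<close> the
  surplus power is bounded in terms of \<open>A\<close> and the number of terms does not enter. The
  prefactor adds up what either case requires.\<close>

lemma sum_powr_le_card:
  fixes x :: "'i \<Rightarrow> real"
  assumes p: "0 < p" "0 < \<eta>" and x: "\<And>i. i \<in> I \<Longrightarrow> 0 \<le> x i"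
    and sm: "(\<lambda>i. x i powr p) summable_on I"
    and L: "finite \<Lambda>" "\<Lambda> \<subseteq> I" "card \<Lambda> = n" "0 < n"
    and A: "(\<Sum>\<^sub>\<infinity>i\<in>I. x i powr p) = A"
  shows "(\<Sum>i\<in>\<Lambda>. x i powr \<eta>) \<le> (1 + A + A * A powr (\<eta> / p - 1)) * real n powr (max 0 (1 - \<eta> / p))"
proof -
  have A0: "0 \<le> A" unfolding A[symmetric] by (rule infsum_nonneg) simp
  have sA: "(\<Sum>i\<in>\<Lambda>. x i powr p) \<le> A" unfolding A[symmetric]
    by (rule finite_sum_le_infsum[OF sm L(1,2)]) simp
  show ?thesis
  proof (cases "\<eta> < p")
    case True
    \<comment> \<open>At this threshold the \<open>n\<close> small terms and the large terms are
      bounded by the same power of \<open>n\<close>.\<close>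
    define \<tau> where "\<tau> = real n powr (- 1 / p)"
    have \<tau>: "0 < \<tau>" using L by (simp add: \<tau>_def)
    have le: "x i powr \<eta> \<le> \<tau> powr \<eta> + x i powr p * \<tau> powr (\<eta> - p)" if "i \<in> \<Lambda>" for i
    proof (cases "x i \<le> \<tau>")
      case True
      then have "x i powr \<eta> \<le> \<tau> powr \<eta>" using that x[of i] L p by (intro powr_mono2) auto
      then show ?thesis by (simp add: add_increasing2)
    next
      case False
      then have "x i powr (\<eta> - p) \<le> \<tau> powr (\<eta> - p)" using \<tau> True by (intro powr_mono2') auto
      then have "x i powr p * x i powr (\<eta> - p) \<le> x i powr p * \<tau> powr (\<eta> - p)"
        by (intro mult_left_mono) auto
      then show ?thesis by (simp add: powr_add[symmetric] add_increasing)
    qed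
    have "(\<Sum>i\<in>\<Lambda>. x i powr \<eta>) \<le> (\<Sum>i\<in>\<Lambda>. \<tau> powr \<eta> + x i powr p * \<tau> powr (\<eta> - p))"
      by (rule sum_mono[OF le])
    also have "\<dots> = n * \<tau> powr \<eta> + (\<Sum>i\<in>\<Lambda>. x i powr p) * \<tau> powr (\<eta> - p)"
      using L by (simp add: sum.distrib sum_distrib_right)
    also have "\<dots> \<le> n * \<tau> powr \<eta> + A * \<tau> powr (\<eta> - p)"
      using sA by (intro add_left_mono mult_right_mono) auto
    also have "n * \<tau> powr \<eta> = real n powr 1 * real n powr (- (\<eta> / p))"
      using L by (simp add: \<tau>_def powr_powr)
    also have "\<dots> = real n powr (1 - \<eta> / p)"
      unfolding powr_add[symmetric] by simp
    also have "\<tau> powr (\<eta> - p) = real n powr (1 - \<eta> / p)"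
      using L p by (simp add: \<tau>_def powr_powr diff_divide_distrib)
    also have "real n powr (1 - \<eta> / p) + A * real n powr (1 - \<eta> / p) = (1 + A) * real n powr (1 - \<eta> / p)"
      by (simp add: algebra_simps)
    also have "\<dots> \<le> (1 + A + A * A powr (\<eta> / p - 1)) * real n powr (1 - \<eta> / p)"
      using A0 by (intro mult_right_mono) auto
    also have "1 - \<eta> / p = max 0 (1 - \<eta> / p)" using True p by (simp add: max_def field_simps)
    finally show ?thesis .
  next
    case False
    have le: "x i powr \<eta> \<le> x i powr p * A powr (\<eta> / p - 1)" if i: "i \<in> \<Lambda>" for i
    proof -
      have "x i powr p \<le> A"
        using member_le_sum[OF i, of "\<lambda>i. x i powr p"] sA L by force
      then have "(x i powr p) powr (\<eta> / p - 1) \<le> A powr (\<eta> / p - 1)"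
        using False p by (intro powr_mono2) (auto simp: field_simps)
      then have "x i powr (\<eta> - p) \<le> A powr (\<eta> / p - 1)"
        using p by (simp add: powr_powr algebra_simps)
      then have "x i powr p * x i powr (\<eta> - p) \<le> x i powr p * A powr (\<eta> / p - 1)"
        by (intro mult_left_mono) auto
      then show ?thesis by (simp add: powr_add[symmetric])
    qed
    have "(\<Sum>i\<in>\<Lambda>. x i powr \<eta>) \<le> (\<Sum>i\<in>\<Lambda>. x i powr p) * A powr (\<eta> / p - 1)"
      unfolding sum_distrib_right by (rule sum_mono[OF le])
    also have "\<dots> \<le> A * A powr (\<eta> / p - 1)" using sA by (intro mult_right_mono) auto
    also have "\<dots> \<le> 1 + A + A * A powr (\<eta> / p - 1)" using A0 by simp
    also have "max 0 (1 - \<eta> / p) = 0" using False p by (simp add: max_def field_simps)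
    then have "1 + A + A * A powr (\<eta> / p - 1)
        = (1 + A + A * A powr (\<eta> / p - 1)) * real n powr (max 0 (1 - \<eta> / p))"
      using L by simp
    finally show ?thesis .
  qed
qed

text \<open>
  The degrees are \<open>n\<^sub>\<nu> = \<lfloor>n\<^sup>h x\<^sub>\<nu>\<^sup>\<eta>\<rfloor> + 1\<close>: minimizing \<open>\<Sum> (n\<^sub>\<nu> powr - t * x\<^sub>\<nu>) powr (1/b)\<close> for a given sum of the
  \<open>n\<^sub>\<nu>\<close> leads to the power \<open>\<eta> = 1 / (b + t)\<close>, and \<open>h\<close> balances this error with the tail of the \<open>v\<^sub>\<nu>\<close>.
\<close>

lemma balanced_degrees:
  fixes b pV pX t AV AX CX :: real
  assumes b: "0 < b" and pV: "0 < pV" "pV \<le> pX" "pV < 1 / b" and t: "0 < t" and CX: "0 < CX"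
    and s: "s = 1 / pV - b"
  shows "\<exists>C>0. \<forall>(I :: 'i set) \<Lambda> v x n.
    (0::nat) < n \<and> finite \<Lambda> \<and> \<Lambda> \<subseteq> I \<and> card \<Lambda> = n \<and> (\<forall>i\<in>I. 0 \<le> v i) \<and> (\<forall>i\<in>I. 0 \<le> x i) \<and>
    (\<lambda>i. v i powr pV) summable_on I \<and> (\<Sum>\<^sub>\<infinity>i\<in>I. v i powr pV) = AV \<and>
    (\<lambda>i. x i powr pX) summable_on I \<and> (\<Sum>\<^sub>\<infinity>i\<in>I. x i powr pX) = AX \<and>
    (\<forall>i\<in>\<Lambda>. \<forall>j\<in>I - \<Lambda>. v j \<le> v i) \<longrightarrow>
    (\<exists>nn. (\<forall>i\<in>\<Lambda>. (0::nat) < nn i) \<and>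
       (\<forall>e. (\<forall>i\<in>\<Lambda>. 0 \<le> e i \<and> e i \<le> CX * real (nn i) powr (- t) * x i) \<longrightarrow>
          ((\<Sum>i\<in>\<Lambda>. e i powr (1 / b)) + (\<Sum>\<^sub>\<infinity>i\<in>I - \<Lambda>. v i powr (1 / b))) powr b
            \<le> C * real (\<Sum>i\<in>\<Lambda>. nn i) powr (- min (s * t / (s + t + b - 1 / pX)) t)))"
proof -
  define q \<eta> where "q = 1 / b" and "\<eta> = 1 / (b + t)"
  define g where "g = max 0 (1 - \<eta> / pX)"
  define K where "K = 1 + AX + AX * AX powr (\<eta> / pX - 1)"
  define \<rho> where "\<rho> = min (s * t / (s + t + b - 1 / pX)) t"
  have pX: "0 < pX" using pV by simp
  have s0: "0 < s" using pV b by (simp add: s field_simps)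
  have sb: "1 / pX \<le> s + b" using pV pX by (simp add: s frac_le)
  have \<eta>0: "0 < \<eta>" and q0: "0 < q" using b t by (auto simp: \<eta>_def q_def)
  have \<eta>bt: "\<eta> * (b + t) = 1" using b t by (simp add: \<eta>_def)
  have qb: "q * b = 1" using b by (simp add: q_def)
  \<comment> \<open>\<open>h\<close> is the exponent of the scale of the degrees, the dimension will
    be at most a multiple of \<open>n powr \<kappa>\<close>, and both errors decay like
    \<open>n powr (- \<sigma>)\<close>. The relation \<open>\<sigma> = \<kappa> * \<rho>\<close>
    turns decay in \<open>n\<close> into decay in the dimension.\<close>
  obtain h \<kappa> \<sigma> where h: "1 \<le> \<kappa>" "h + g \<le> \<kappa>" "b * g - h * t \<le> - \<sigma>" "\<sigma> \<le> s" "\<sigma> = \<kappa> * \<rho>" "0 \<le> \<sigma>"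
  proof (cases "\<eta> < pX")
    case False
    \<comment> \<open>The sum of the \<open>x i powr \<eta>\<close> stays bounded here. Then
      \<open>b + t \<le> 1 / pX\<close> forces \<open>t \<le> s\<close>, and the discretization rate
      \<open>t\<close> is the smaller one.\<close>
    then have g: "g = 0" using pX by (simp add: g_def max_def field_simps)
    have "b + t \<le> 1 / pX" using False b t pX by (simp add: \<eta>_def field_simps)
    then have 1: "t \<le> s" and 2: "s + t + b - 1 / pX \<le> s" using sb by auto
    have 3: "0 < s + t + b - 1 / pX" using sb t by simp
    have "t \<le> s * t / (s + t + b - 1 / pX)"
      using 2 3 t by (simp add: pos_le_divide_eq mult.commute)
    then have "\<rho> = t" by (simp add: \<rho>_def)
    then show ?thesis using 1 t g by (intro that[of 1 1 t]) auto
  next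
    case True
    then have g: "g = 1 - \<eta> / pX" using pX by (simp add: g_def max_def field_simps)
    \<comment> \<open>The first summand is \<open>h\<close>, the value at which the discretization
      error decays exactly like the discarded tail: \<open>b * g - h * t = - s\<close>.\<close>
    define \<kappa> where "\<kappa> = (s + b * g) / t + g"
    have "1 / pX < b + t" using True b t pX by (simp add: \<eta>_def field_simps)
    then have D: "0 < s + t + b - 1 / pX" "s \<le> s + t + b - 1 / pX" using s0 by auto
    have "\<kappa> * t = s + (b + t) * g" using t by (simp add: \<kappa>_def field_simps)
    also have "(b + t) * g = b + t - 1 / pX" using \<eta>bt unfolding g by (simp add: algebra_simps)
    finally have \<kappa>t: "\<kappa> * t = s + t + b - 1 / pX" by simp
    have "1 * t \<le> \<kappa> * t" using \<kappa>t sb by simp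
    then have k1: "1 \<le> \<kappa>" using t by (simp only: mult_le_cancel_right_pos)
    have "s * t / (s + t + b - 1 / pX) = s / \<kappa>" using t unfolding \<kappa>t[symmetric] by simp
    moreover have "s / \<kappa> \<le> t"
      using k1 D(2) \<kappa>t by (simp add: pos_divide_le_eq mult.commute)
    ultimately have "\<rho> = s / \<kappa>" by (simp add: \<rho>_def)
    then show ?thesis using k1 s0 t by (intro that[of \<kappa> "(s + b * g) / t" s]) (auto simp: \<kappa>_def)
  qed
  define C where "C = (CX powr q * K + AV powr (q / pV)) powr b * (1 + K) powr \<rho> + 1"
  show ?thesis
  proof (intro exI[of _ C] conjI allI impI)
    show "0 < C" by (simp add: C_def add_nonneg_pos)
    fix I \<Lambda> :: "'i set" and v x :: "'i \<Rightarrow> real" and n :: nat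
    assume "0 < n \<and> finite \<Lambda> \<and> \<Lambda> \<subseteq> I \<and> card \<Lambda> = n \<and> (\<forall>i\<in>I. 0 \<le> v i) \<and> (\<forall>i\<in>I. 0 \<le> x i) \<and>
      (\<lambda>i. v i powr pV) summable_on I \<and> (\<Sum>\<^sub>\<infinity>i\<in>I. v i powr pV) = AV \<and>
      (\<lambda>i. x i powr pX) summable_on I \<and> (\<Sum>\<^sub>\<infinity>i\<in>I. x i powr pX) = AX \<and>
      (\<forall>i\<in>\<Lambda>. \<forall>j\<in>I - \<Lambda>. v j \<le> v i)"
    then have n: "0 < n" and L: "finite \<Lambda>" "\<Lambda> \<subseteq> I" "card \<Lambda> = n"
      and v0: "\<And>i. i \<in> I \<Longrightarrow> 0 \<le> v i" and x0: "\<And>i. i \<in> I \<Longrightarrow> 0 \<le> x i"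
      and V: "(\<lambda>i. v i powr pV) summable_on I" "(\<Sum>\<^sub>\<infinity>i\<in>I. v i powr pV) = AV"
      and X: "(\<lambda>i. x i powr pX) summable_on I" "(\<Sum>\<^sub>\<infinity>i\<in>I. x i powr pX) = AX"
      and ord: "\<And>i j. i \<in> \<Lambda> \<Longrightarrow> j \<in> I - \<Lambda> \<Longrightarrow> v j \<le> v i" by blast+
    define c where "c = real n powr h"
    define S where "S = (\<Sum>i\<in>\<Lambda>. x i powr \<eta>)"
    define nn where "nn i = nat \<lfloor>c * x i powr \<eta>\<rfloor> + 1" for i
    have n1: "1 \<le> real n" using n by simp
    have c0: "0 < c" using n by (simp add: c_def)
    have AX0: "0 \<le> AX" unfolding X(2)[symmetric] by (rule infsum_nonneg) simp
    have K1: "1 \<le> K" using AX0 by (simp add: K_def)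
    have S: "S \<le> K * real n powr g"
      unfolding S_def K_def g_def by (rule sum_powr_le_card[OF pX \<eta>0 x0 X(1) L n X(2)])
    have S0: "0 \<le> S" by (simp add: S_def sum_nonneg)
    have nn_le: "real (nn i) \<le> c * x i powr \<eta> + 1" and nn_ge: "c * x i powr \<eta> \<le> real (nn i)" for i
    proof -
      have "0 \<le> c * x i powr \<eta>" using c0 by simp
      then show "real (nn i) \<le> c * x i powr \<eta> + 1" "c * x i powr \<eta> \<le> real (nn i)"
        unfolding nn_def by linarith+
    qed
    have "real (\<Sum>i\<in>\<Lambda>. nn i) \<le> (\<Sum>i\<in>\<Lambda>. c * x i powr \<eta> + 1)"
      unfolding of_nat_sum by (rule sum_mono) (rule nn_le)
    also have "\<dots> = n + c * S" using L by (simp add: S_def sum.distrib sum_distrib_left)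
    also have "\<dots> \<le> real n powr \<kappa> + K * real n powr \<kappa>"
    proof (rule add_mono)
      show "real n \<le> real n powr \<kappa>" using powr_mono[OF h(1) n1] n by simp
      have "c * S \<le> c * (K * real n powr g)" using S c0 by simp
      also have "\<dots> = K * real n powr (h + g)" by (simp add: c_def powr_add)
      also have "\<dots> \<le> K * real n powr \<kappa>" using K1 n1 h(2) by (intro mult_left_mono powr_mono) auto
      finally show "c * S \<le> K * real n powr \<kappa>" .
    qed
    finally have N: "real (\<Sum>i\<in>\<Lambda>. nn i) \<le> (1 + K) * real n powr \<kappa>" by (simp add: algebra_simps)
    have N0: "0 < real (\<Sum>i\<in>\<Lambda>. nn i)"
    proof -
      have "\<Lambda> \<noteq> {}" using L n by auto
      then have "0 < (\<Sum>i\<in>\<Lambda>. nn i)" using L by (intro sum_pos) (auto simp: nn_def)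
      then show ?thesis by (simp only: of_nat_0_less_iff)
    qed
    have \<rho>0: "0 \<le> \<rho>" using h by (simp add: zero_le_mult_iff)
    show "\<exists>nn. (\<forall>i\<in>\<Lambda>. 0 < nn i) \<and>
       (\<forall>e. (\<forall>i\<in>\<Lambda>. 0 \<le> e i \<and> e i \<le> CX * real (nn i) powr (- t) * x i) \<longrightarrow>
          ((\<Sum>i\<in>\<Lambda>. e i powr (1 / b)) + (\<Sum>\<^sub>\<infinity>i\<in>I - \<Lambda>. v i powr (1 / b))) powr b
            \<le> C * real (\<Sum>i\<in>\<Lambda>. nn i) powr (- min (s * t / (s + t + b - 1 / pX)) t))"
      unfolding \<rho>_def[symmetric] q_def[symmetric]
    proof (intro exI[of _ nn] conjI ballI allI impI)
      show "0 < nn i" for i by (simp add: nn_def)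
      fix e assume e: "\<forall>i\<in>\<Lambda>. 0 \<le> e i \<and> e i \<le> CX * real (nn i) powr (- t) * x i"
      \<comment> \<open>The choice of \<open>\<eta>\<close> makes the power left over in the error,
        \<open>(1 - \<eta> * t) * q\<close>, equal to \<open>\<eta>\<close> again, so the same sum
        \<open>S\<close> controls the dimension and the error.\<close>
      have ei: "e i powr q \<le> CX powr q * c powr (- t * q) * x i powr \<eta>" if i: "i \<in> \<Lambda>" for i
      proof (cases "x i = 0")
        case True
        then have "e i = 0" using e i by force
        then show ?thesis by simp
      next
        case False
        then have xi: "0 < x i" using x0[of i] i L by auto
        have "e i \<le> CX * real (nn i) powr (- t) * x i" using e i by blast
        also have "\<dots> \<le> CX * (c * x i powr \<eta>) powr (- t) * x i"
          using nn_ge[of i] c0 xi t CX by (intro mult_right_mono mult_left_mono powr_mono2') auto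
        also have "\<dots> = CX * c powr (- t) * x i powr (1 - \<eta> * t)"
          using c0 xi by (simp add: powr_mult powr_powr powr_diff powr_minus field_simps)
        finally have "e i powr q \<le> (CX * c powr (- t) * x i powr (1 - \<eta> * t)) powr q"
          using e i q0 by (intro powr_mono2) auto
        also have "\<dots> = CX powr q * c powr (- t * q) * x i powr ((1 - \<eta> * t) * q)"
          using CX c0 xi by (simp add: powr_mult powr_powr)
        also have "(1 - \<eta> * t) * q = \<eta>"
        proof -
          have "1 - \<eta> * t = \<eta> * b" using \<eta>bt by (simp add: algebra_simps)
          then show ?thesis using qb by (simp add: mult.assoc mult.commute)
        qed
        finally show ?thesis .
      qed
      have qs: "1 - q / pV = - s * q" using qb pV by (simp add: s field_simps)
      have "(\<Sum>i\<in>\<Lambda>. e i powr q) \<le> CX powr q * c powr (- t * q) * S"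
        unfolding S_def sum_distrib_left by (rule sum_mono[OF ei])
      also have "\<dots> \<le> CX powr q * c powr (- t * q) * (K * real n powr g)"
        using S by (intro mult_left_mono) auto
      also have "\<dots> = CX powr q * K * real n powr (g - h * t * q)"
        unfolding c_def by (simp add: powr_powr powr_diff powr_minus field_simps)
      also have "\<dots> \<le> CX powr q * K * real n powr (- \<sigma> * q)"
      proof -
        have "(b * g - h * t) * q \<le> - \<sigma> * q" using h(3) q0 by (intro mult_right_mono) auto
        moreover have "(b * g - h * t) * q = q * b * g - h * t * q" by (simp add: algebra_simps)
        ultimately have "g - h * t * q \<le> - \<sigma> * q" using qb by simp
        then show ?thesis using n1 K1 by (intro mult_left_mono powr_mono) auto
      qed
      finally have 1: "(\<Sum>i\<in>\<Lambda>. e i powr q) \<le> CX powr q * K * real n powr (- \<sigma> * q)" .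
      have "pV \<le> q" using pV by (simp add: q_def)
      from stechkin_tail(2)[OF pV(1) this v0 V(1) L n ord V(2)]
      have "(\<Sum>\<^sub>\<infinity>i\<in>I - \<Lambda>. v i powr q) \<le> AV powr (q / pV) * real n powr (- s * q)"
        unfolding qs by simp
      also have "\<dots> \<le> AV powr (q / pV) * real n powr (- \<sigma> * q)"
        using n1 h(4) q0 by (intro mult_left_mono powr_mono) auto
      finally have 2: "(\<Sum>\<^sub>\<infinity>i\<in>I - \<Lambda>. v i powr q) \<le> AV powr (q / pV) * real n powr (- \<sigma> * q)" .
      have "((\<Sum>i\<in>\<Lambda>. e i powr q) + (\<Sum>\<^sub>\<infinity>i\<in>I - \<Lambda>. v i powr q)) powr b
          \<le> ((CX powr q * K + AV powr (q / pV)) * real n powr (- \<sigma> * q)) powr b"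
        using 1 2 b by (intro powr_mono2 add_nonneg_nonneg sum_nonneg infsum_nonneg)
          (auto simp: algebra_simps)
      also have "\<dots> = (CX powr q * K + AV powr (q / pV)) powr b * real n powr (- \<sigma>)"
        using K1 qb by (simp add: powr_mult powr_powr mult.assoc)
      also have "real n powr (- \<sigma>) \<le> (1 + K) powr \<rho> * real (\<Sum>i\<in>\<Lambda>. nn i) powr (- \<rho>)"
      proof -
        have "((1 + K) * real n powr \<kappa>) powr (- \<rho>) \<le> real (\<Sum>i\<in>\<Lambda>. nn i) powr (- \<rho>)"
          using N N0 \<rho>0 by (intro powr_mono2') auto
        then have "(1 + K) powr (- \<rho>) * real n powr (- \<sigma>) \<le> real (\<Sum>i\<in>\<Lambda>. nn i) powr (- \<rho>)"
          using K1 by (simp add: powr_mult powr_powr h(5))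
        then have "(1 + K) powr \<rho> * ((1 + K) powr (- \<rho>) * real n powr (- \<sigma>))
            \<le> (1 + K) powr \<rho> * real (\<Sum>i\<in>\<Lambda>. nn i) powr (- \<rho>)"
          by (rule mult_left_mono) simp
        moreover have "(1 + K) powr \<rho> * (1 + K) powr (- \<rho>) = 1"
          unfolding powr_add[symmetric] using K1 by simp
        ultimately show ?thesis by (simp only: mult.assoc[symmetric] mult_1)
      qed
      finally have "((\<Sum>i\<in>\<Lambda>. e i powr q) + (\<Sum>\<^sub>\<infinity>i\<in>I - \<Lambda>. v i powr q)) powr b
          \<le> (CX powr q * K + AV powr (q / pV)) powr b * ((1 + K) powr \<rho> * real (\<Sum>i\<in>\<Lambda>. nn i) powr (- \<rho>))"
        by (simp add: mult_left_mono)
      also have "\<dots> \<le> C * real (\<Sum>i\<in>\<Lambda>. nn i) powr (- \<rho>)"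
        unfolding C_def by (simp add: algebra_simps)
      finally show "((\<Sum>i\<in>\<Lambda>. e i powr q) + (\<Sum>\<^sub>\<infinity>i\<in>I - \<Lambda>. v i powr q)) powr b
          \<le> C * real (\<Sum>i\<in>\<Lambda>. nn i) powr (- \<rho>)" .
    qed
  qed
qed

section \<open>Orthonormal polynomials in infinitely many variables\<close>

text \<open>A predicate on functions, for an arbitrary measure and values in a separable Hilbert
  space. The values will be gradients, that is, elements of the type \<open>L2\<close> over the
  physical domain.\<close>

definition L2_function :: "'a measure \<Rightarrow> ('a \<Rightarrow> 'g::{real_inner,banach,second_countable_topology}) \<Rightarrow> bool" where
  "L2_function M f \<longleftrightarrow> f \<in> borel_measurable M \<and> integrable M (\<lambda>y. (norm (f y))\<^sup>2)"

lemma L2_function_measurable[measurable_dest]: "L2_function M f \<Longrightarrow> f \<in> borel_measurable M"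
  by (simp add: L2_function_def)

lemma L2_function_bound:
  assumes "f \<in> borel_measurable M" "integrable M h" "AE y in M. (norm (f y))\<^sup>2 \<le> h y"
  shows "L2_function M f"
  unfolding L2_function_def
proof
  show "integrable M (\<lambda>y. (norm (f y))\<^sup>2)"
    using assms(3) by (intro Bochner_Integration.integrable_bound[OF assms(2)])
      (use assms(1) in \<open>auto elim!: eventually_mono\<close>)
qed (rule assms(1))

lemma L2_function_add:
  assumes "L2_function M f" "L2_function M g"
  shows "L2_function M (\<lambda>y. f y + g y)"
proof (rule L2_function_bound)
  show "integrable M (\<lambda>y. 2 * (norm (f y))\<^sup>2 + 2 * (norm (g y))\<^sup>2)"
    using assms by (auto simp: L2_function_def)
qed (use assms in \<open>auto simp: L2_function_def intro: norm_add_square_le\<close>)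

lemma L2_function_bounded_mult:
  assumes f: "L2_function M f" and h: "h \<in> borel_measurable M" "\<And>y. \<bar>h y\<bar> \<le> B"
  shows "L2_function M (\<lambda>y. h y *\<^sub>R f y)"
proof (rule L2_function_bound)
  show "integrable M (\<lambda>y. B\<^sup>2 * (norm (f y))\<^sup>2)"
    using f by (auto simp: L2_function_def)
  have "(h y)\<^sup>2 \<le> B\<^sup>2" for y using power_mono[OF h(2), of y 2] by simp
  then show "AE y in M. (norm (h y *\<^sub>R f y))\<^sup>2 \<le> B\<^sup>2 * (norm (f y))\<^sup>2"
    by (auto simp: power_mult_distrib intro!: mult_right_mono)
qed (use f h in \<open>auto simp: L2_function_def\<close>)

lemma L2_function_scaleR: "L2_function M f \<Longrightarrow> L2_function M (\<lambda>y. c *\<^sub>R f y)"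
  using L2_function_bounded_mult[of M f "\<lambda>_. c" "\<bar>c\<bar>"] by simp

lemma L2_function_diff:
  "L2_function M f \<Longrightarrow> L2_function M g \<Longrightarrow> L2_function M (\<lambda>y. f y - g y)"
  using L2_function_add[of M f "\<lambda>y. (-1) *\<^sub>R g y"] L2_function_scaleR[of M g "-1"] by simp

lemma integrable_inner_L2_function:
  assumes "L2_function M f" "L2_function M g"
  shows "integrable M (\<lambda>y. f y \<bullet> g y)"
proof (rule Bochner_Integration.integrable_bound)
  show "integrable M (\<lambda>y. (norm (f y))\<^sup>2 + (norm (g y))\<^sup>2)"
    using assms by (auto simp: L2_function_def)
  show "(\<lambda>y. f y \<bullet> g y) \<in> borel_measurable M" using assms by (auto simp: L2_function_def)
  have "norm (f y \<bullet> g y) \<le> norm ((norm (f y))\<^sup>2 + (norm (g y))\<^sup>2)" for y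
  proof -
    have "\<bar>f y \<bullet> g y\<bar> \<le> norm (f y) * norm (g y)" by (rule Cauchy_Schwarz_ineq2)
    moreover have "2 * (norm (f y) * norm (g y)) \<le> (norm (f y))\<^sup>2 + (norm (g y))\<^sup>2"
      using sum_squares_bound[of "norm (f y)" "norm (g y)"] by simp
    moreover have "0 \<le> norm (f y) * norm (g y)" by simp
    ultimately have "\<bar>f y \<bullet> g y\<bar> \<le> (norm (f y))\<^sup>2 + (norm (g y))\<^sup>2" by linarith
    then show ?thesis by simp
  qed
  then show "AE y in M. norm (f y \<bullet> g y) \<le> norm ((norm (f y))\<^sup>2 + (norm (g y))\<^sup>2)" by simp
qed

lemma integrable_scaleR_L2_function:
  fixes f :: "'a \<Rightarrow> 'g::{real_inner,banach,second_countable_topology}" and h :: "'a \<Rightarrow> real"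
  assumes "L2_function M h" and f: "f \<in> borel_measurable M" "integrable M (\<lambda>y. (norm (f y))\<^sup>2)"
  shows "integrable M (\<lambda>y. h y *\<^sub>R f y)"
proof (rule Bochner_Integration.integrable_bound)
  show "integrable M (\<lambda>y. (h y)\<^sup>2 + (norm (f y))\<^sup>2)"
    using assms by (auto simp: L2_function_def)
  show "(\<lambda>y. h y *\<^sub>R f y) \<in> borel_measurable M" using assms by (auto simp: L2_function_def)
  have "norm (h y *\<^sub>R f y) \<le> norm ((h y)\<^sup>2 + (norm (f y))\<^sup>2)" for y
  proof -
    have "2 * (\<bar>h y\<bar> * norm (f y)) \<le> (h y)\<^sup>2 + (norm (f y))\<^sup>2"
      using sum_squares_bound[of "\<bar>h y\<bar>" "norm (f y)"] by simp
    moreover have "0 \<le> \<bar>h y\<bar> * norm (f y)" by simp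
    ultimately have "\<bar>h y\<bar> * norm (f y) \<le> (h y)\<^sup>2 + (norm (f y))\<^sup>2" by linarith
    then show ?thesis by simp
  qed
  then show "AE y in M. norm (h y *\<^sub>R f y) \<le> norm ((h y)\<^sup>2 + (norm (f y))\<^sup>2)" by simp
qed

text \<open>What Jacobi and Hermite polynomials have in common. \<open>q_0\<close> lets all but
  finitely many factors of a product be dropped, \<open>q_exp\<close> is the source of completeness,
  and \<open>q_rec\<close> says that multiplication by the variable stays in the span; the
  recurrence may involve all lower degrees.\<close>

locale orthonormal_system = prob_space \<mu> for \<mu> :: "real measure" +
  fixes q :: "nat \<Rightarrow> real \<Rightarrow> real" and c :: "nat \<Rightarrow> nat \<Rightarrow> real"
  assumes sets_mu: "sets \<mu> = sets borel"
    and q_measurable: "\<And>n. q n \<in> borel_measurable borel"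
    and q_0: "q 0 = (\<lambda>_. 1)"
    and q_exp: "\<And>n. integrable \<mu> (\<lambda>s. (q n s)\<^sup>2 * exp \<bar>s\<bar>)"
    and q_orth: "\<And>m n. (LINT s|\<mu>. q m s * q n s) = (if m = n then 1 else 0)"
    and q_rec: "\<And>n s. s * q n s = (\<Sum>k\<le>Suc n. c n k * q k s)"
begin

sublocale P: product_prob_space "\<lambda>_::nat. \<mu>" UNIV
  by (rule product_prob_spaceI) (rule prob_space_axioms)

abbreviation M :: "(nat \<Rightarrow> real) measure" where "M \<equiv> \<Pi>\<^sub>M j\<in>UNIV. \<mu>"

definition \<phi> :: "(nat \<Rightarrow> nat) \<Rightarrow> (nat \<Rightarrow> real) \<Rightarrow> real" where
  "\<phi> \<nu> y = (\<Prod>j | \<nu> j \<noteq> 0. q (\<nu> j) (y j))"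

lemma space_M: "space M = UNIV"
proof -
  have "space \<mu> = UNIV" using sets_eq_imp_space_eq[OF sets_mu] by simp
  then show ?thesis by (simp add: space_PiM)
qed

lemma borel_mu: "f \<in> borel_measurable borel \<Longrightarrow> f \<in> borel_measurable \<mu>"
  using measurable_cong_sets[OF sets_mu refl] by blast

lemma coord_measurable[measurable]: "(\<lambda>y. y j) \<in> borel_measurable M"
proof -
  have "(\<lambda>y. y j) \<in> measurable M \<mu>" by simp
  then show ?thesis using measurable_cong_sets[OF refl sets_mu] by blast
qed

lemma q_measurable_coord[measurable]: "(\<lambda>y. q n (y j)) \<in> borel_measurable M"
  using measurable_compose[OF coord_measurable q_measurable] .

lemma \<phi>_measurable[measurable]: "\<phi> \<nu> \<in> borel_measurable M"
  unfolding \<phi>_def[abs_def] by measurable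

text \<open>A function of the coordinates in \<open>J\<close> is integrated against the image of
  \<open>M\<close> under restriction to \<open>J\<close>, which is the finite product measure, and
  there the integral factorizes.\<close>

lemma product_integral:
  fixes f :: "nat \<Rightarrow> real \<Rightarrow> real"
  assumes J: "finite J" and f: "\<And>j. j \<in> J \<Longrightarrow> integrable \<mu> (f j)"
  shows "integrable M (\<lambda>y. \<Prod>j\<in>J. f j (y j))"
    and "(LINT y|M. (\<Prod>j\<in>J. f j (y j))) = (\<Prod>j\<in>J. (LINT s|\<mu>. f j s))"
proof -
  have d: "distr M (\<Pi>\<^sub>M j\<in>J. \<mu>) (\<lambda>x. restrict x J) = (\<Pi>\<^sub>M j\<in>J. \<mu>)"
    by (rule P.distr_PiM_restrict_finite[OF J]) simp
  have m: "(\<lambda>x. restrict x J) \<in> measurable M (\<Pi>\<^sub>M j\<in>J. \<mu>)" by (rule measurable_restrict_subset) simp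
  have i: "integrable (\<Pi>\<^sub>M j\<in>J. \<mu>) (\<lambda>x. (\<Prod>j\<in>J. f j (x j)))"
    by (rule P.product_integrable_prod[OF J f])
  then have i': "integrable (distr M (\<Pi>\<^sub>M j\<in>J. \<mu>) (\<lambda>x. restrict x J)) (\<lambda>x. \<Prod>j\<in>J. f j (x j))"
    unfolding d .
  show "integrable M (\<lambda>y. \<Prod>j\<in>J. f j (y j))"
    using integrable_distr[OF m i'] by simp
  have "(\<Prod>j\<in>J. (LINT s|\<mu>. f j s)) = (LINT x|(\<Pi>\<^sub>M j\<in>J. \<mu>). (\<Prod>j\<in>J. f j (x j)))"
    by (rule P.product_integral_prod[OF J f, symmetric])
  also have "\<dots> = (LINT x|distr M (\<Pi>\<^sub>M j\<in>J. \<mu>) (\<lambda>x. restrict x J). (\<Prod>j\<in>J. f j (x j)))"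
    unfolding d ..
  also have "\<dots> = (LINT y|M. (\<Prod>j\<in>J. f j (y j)))"
    using borel_measurable_integrable[OF i] by (subst integral_distr[OF m]) auto
  finally show "(LINT y|M. (\<Prod>j\<in>J. f j (y j))) = (\<Prod>j\<in>J. (LINT s|\<mu>. f j s))" ..
qed

text \<open>Since \<open>q 0 = 1\<close>, two basis functions can be written as products over a
  common finite index set.\<close>

lemma \<phi>_superset:
  assumes "finite J" "{j. \<nu> j \<noteq> 0} \<subseteq> J"
  shows "\<phi> \<nu> y = (\<Prod>j\<in>J. q (\<nu> j) (y j))"
  unfolding \<phi>_def by (rule prod.mono_neutral_left) (use assms in \<open>auto simp: q_0\<close>)

lemma q_square: "integrable \<mu> (\<lambda>s. (q n s)\<^sup>2)"
proof (rule Bochner_Integration.integrable_bound[OF q_exp[of n]])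
  show "(\<lambda>s. (q n s)\<^sup>2) \<in> borel_measurable \<mu>" using q_measurable by (intro borel_mu) simp
  have "(q n s)\<^sup>2 \<le> (q n s)\<^sup>2 * exp \<bar>s\<bar>" for s
    using mult_left_mono[of 1 "exp \<bar>s\<bar>" "(q n s)\<^sup>2"] by simp
  then show "AE s in \<mu>. norm ((q n s)\<^sup>2) \<le> norm ((q n s)\<^sup>2 * exp \<bar>s\<bar>)" by simp
qed

lemma \<phi>_exp:
  assumes "\<nu> \<in> multi_indices"
  shows "integrable M (\<lambda>y. (\<phi> \<nu> y)\<^sup>2 * exp \<bar>y k\<bar>)"
proof -
  \<comment> \<open>The coordinate \<open>k\<close> is adjoined to the support so that the
    exponential can be attached to its factor, even if that factor is 1.\<close>
  define J where "J = insert k {j. \<nu> j \<noteq> 0}"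
  have J: "finite J" "{j. \<nu> j \<noteq> 0} \<subseteq> J" "k \<in> J" using assms by (auto simp: J_def multi_indices_def)
  have "integrable M (\<lambda>y. \<Prod>j\<in>J. (q (\<nu> j) (y j))\<^sup>2 * (if j = k then exp \<bar>y j\<bar> else 1))"
  proof (rule product_integral(1)[OF J(1), where f = "\<lambda>j s. (q (\<nu> j) s)\<^sup>2 * (if j = k then exp \<bar>s\<bar> else 1)"])
    show "integrable \<mu> (\<lambda>s. (q (\<nu> j) s)\<^sup>2 * (if j = k then exp \<bar>s\<bar> else 1))" for j
      using q_exp[of "\<nu> j"] q_square[of "\<nu> j"] by (cases "j = k") auto
  qed
  also have "(\<lambda>y. \<Prod>j\<in>J. (q (\<nu> j) (y j))\<^sup>2 * (if j = k then exp \<bar>y j\<bar> else 1)) = (\<lambda>y. (\<phi> \<nu> y)\<^sup>2 * exp \<bar>y k\<bar>)"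
    using J by (simp add: \<phi>_superset[OF J(1,2)] prod.distrib prod_power_distrib fun_eq_iff)
  finally show ?thesis .
qed

lemma \<phi>_L2: "\<nu> \<in> multi_indices \<Longrightarrow> L2_function M (\<phi> \<nu>)"
proof (rule L2_function_bound[OF \<phi>_measurable \<phi>_exp[of \<nu> 0]])
  have "(\<phi> \<nu> y)\<^sup>2 \<le> (\<phi> \<nu> y)\<^sup>2 * exp \<bar>y 0\<bar>" for y
    using mult_left_mono[of 1 "exp \<bar>y 0\<bar>" "(\<phi> \<nu> y)\<^sup>2"] by simp
  then show "AE y in M. (norm (\<phi> \<nu> y))\<^sup>2 \<le> (\<phi> \<nu> y)\<^sup>2 * exp \<bar>y 0\<bar>" by simp
qed

lemma \<phi>_orth:
  assumes "\<nu> \<in> multi_indices" "\<kappa> \<in> multi_indices"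
  shows "(LINT y|M. \<phi> \<nu> y * \<phi> \<kappa> y) = (if \<nu> = \<kappa> then 1 else 0)"
proof -
  define J where "J = {j. \<nu> j \<noteq> 0} \<union> {j. \<kappa> j \<noteq> 0}"
  have J: "finite J" "{j. \<nu> j \<noteq> 0} \<subseteq> J" "{j. \<kappa> j \<noteq> 0} \<subseteq> J"
    using assms by (auto simp: J_def multi_indices_def)
  have int: "integrable \<mu> (\<lambda>s. q m s * q n s)" for m n
  proof (rule Bochner_Integration.integrable_bound)
    show "integrable \<mu> (\<lambda>s. (q m s)\<^sup>2 + (q n s)\<^sup>2)" using q_square by simp
    show "(\<lambda>s. q m s * q n s) \<in> borel_measurable \<mu>" using q_measurable by (intro borel_mu) simp
    have "\<bar>a * b\<bar> \<le> a\<^sup>2 + b\<^sup>2" for a b :: real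
    proof -
      have "2 * (\<bar>a\<bar> * \<bar>b\<bar>) \<le> a\<^sup>2 + b\<^sup>2" using sum_squares_bound[of "\<bar>a\<bar>" "\<bar>b\<bar>"] by simp
      moreover have "0 \<le> \<bar>a\<bar> * \<bar>b\<bar>" by simp
      ultimately show ?thesis unfolding abs_mult by linarith
    qed
    then show "AE s in \<mu>. norm (q m s * q n s) \<le> norm ((q m s)\<^sup>2 + (q n s)\<^sup>2)" by auto
  qed
  have "(LINT y|M. \<phi> \<nu> y * \<phi> \<kappa> y) = (LINT y|M. (\<Prod>j\<in>J. q (\<nu> j) (y j) * q (\<kappa> j) (y j)))"
    by (simp add: \<phi>_superset[OF J(1,2)] \<phi>_superset[OF J(1,3)] prod.distrib)
  also have "\<dots> = (\<Prod>j\<in>J. if \<nu> j = \<kappa> j then 1 else 0)"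
    unfolding q_orth[symmetric] by (rule product_integral(2)[OF J(1) int])
  also have "\<dots> = (if \<nu> = \<kappa> then 1 else 0)"
  proof (cases "\<nu> = \<kappa>")
    case False
    then obtain j where j: "\<nu> j \<noteq> \<kappa> j" by blast
    then have "j \<in> J" by (auto simp: J_def)
    then show ?thesis using j J(1) False by (auto intro!: prod_zero)
  qed simp
  finally show ?thesis .
qed

section \<open>Finite expansions and their closure in the mean-square sense\<close>

text \<open>The span of the basis functions with vector coefficients. No rule for scalar multiples
  is required, because a scalar is absorbed by \<open>d\<close>.\<close>

inductive_set S :: "((nat \<Rightarrow> real) \<Rightarrow> 'g::{real_inner,banach,second_countable_topology}) set" where
  basis: "\<nu> \<in> multi_indices \<Longrightarrow> (\<lambda>y. \<phi> \<nu> y *\<^sub>R d) \<in> S"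
| add: "f \<in> S \<Longrightarrow> g \<in> S \<Longrightarrow> (\<lambda>y. f y + g y) \<in> S"

lemma \<phi>_scaleR_L2: "\<nu> \<in> multi_indices \<Longrightarrow> L2_function M (\<lambda>y. \<phi> \<nu> y *\<^sub>R d)"
  using \<phi>_L2[of \<nu>] by (auto simp: L2_function_def power_mult_distrib)

lemma S_L2: "f \<in> S \<Longrightarrow> L2_function M f"
  by (induction rule: S.induct) (auto intro: \<phi>_scaleR_L2 L2_function_add)

lemma zero_multi: "(\<lambda>_. 0) \<in> multi_indices" by (simp add: multi_indices_def)

lemma \<phi>_zero: "\<phi> (\<lambda>_. 0) y = 1" by (simp add: \<phi>_def)

lemma S_const: "(\<lambda>y. d) \<in> S"
  using S.basis[OF zero_multi, of d] by (simp add: \<phi>_zero)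

lemma S_sum: "finite I \<Longrightarrow> (\<And>i. i \<in> I \<Longrightarrow> f i \<in> S) \<Longrightarrow> (\<lambda>y. \<Sum>i\<in>I. f i y) \<in> S"
  by (induction rule: finite_induct) (auto intro: S_const S.add)

lemma S_scale: "f \<in> S \<Longrightarrow> (\<lambda>y. a *\<^sub>R f y) \<in> S"
proof (induction rule: S.induct)
  case (basis \<nu> d)
  then show ?case using S.basis[of \<nu> "a *\<^sub>R d"] by (simp add: mult.commute)
qed (auto simp: scaleR_add_right intro: S.add)

text \<open>The recurrence is applied in the coordinate \<open>i\<close> alone, which replaces
  \<open>\<nu> i\<close> by each \<open>k \<le> Suc (\<nu> i)\<close> and leaves the other factors
  untouched.\<close>

lemma S_coord: "f \<in> S \<Longrightarrow> (\<lambda>y. y i *\<^sub>R f y) \<in> S"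
proof (induction rule: S.induct)
  case (basis \<nu> d)
  define J where "J = insert i {j. \<nu> j \<noteq> 0}"
  have J: "finite J" "{j. \<nu> j \<noteq> 0} \<subseteq> J" "{j. (\<nu>(i := k)) j \<noteq> 0} \<subseteq> J" "i \<in> J" for k
    using basis by (auto simp: J_def multi_indices_def)
  have m: "\<nu>(i := k) \<in> multi_indices" for k
    unfolding multi_indices_def using finite_subset[OF J(3) J(1)] by blast
  have eq: "y i * \<phi> \<nu> y = (\<Sum>k\<le>Suc (\<nu> i). c (\<nu> i) k * \<phi> (\<nu>(i := k)) y)" for y
  proof -
    have "y i * \<phi> \<nu> y = (y i * q (\<nu> i) (y i)) * (\<Prod>j\<in>J-{i}. q (\<nu> j) (y j))"
      using J by (simp add: \<phi>_superset[OF J(1,2)] prod.remove)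
    also have "\<dots> = (\<Sum>k\<le>Suc (\<nu> i). c (\<nu> i) k * q k (y i) * (\<Prod>j\<in>J-{i}. q (\<nu> j) (y j)))"
      unfolding q_rec sum_distrib_right ..
    also have "\<dots> = (\<Sum>k\<le>Suc (\<nu> i). c (\<nu> i) k * \<phi> (\<nu>(i := k)) y)"
    proof (rule sum.cong[OF refl])
      fix k
      have "\<phi> (\<nu>(i := k)) y = q k (y i) * (\<Prod>j\<in>J-{i}. q ((\<nu>(i := k)) j) (y j))"
        using J by (simp add: \<phi>_superset[OF J(1,3)] prod.remove)
      also have "(\<Prod>j\<in>J-{i}. q ((\<nu>(i := k)) j) (y j)) = (\<Prod>j\<in>J-{i}. q (\<nu> j) (y j))"
        by (rule prod.cong) auto
      finally show "c (\<nu> i) k * q k (y i) * (\<Prod>j\<in>J-{i}. q (\<nu> j) (y j)) = c (\<nu> i) k * \<phi> (\<nu>(i := k)) y"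
        by (simp only: mult.assoc)
    qed
    finally show ?thesis .
  qed
  have "(\<lambda>y. \<Sum>k\<le>Suc (\<nu> i). c (\<nu> i) k *\<^sub>R (\<phi> (\<nu>(i := k)) y *\<^sub>R d)) \<in> S"
    by (intro S_sum S_scale S.basis m) simp
  also have "(\<lambda>y. \<Sum>k\<le>Suc (\<nu> i). c (\<nu> i) k *\<^sub>R (\<phi> (\<nu>(i := k)) y *\<^sub>R d)) = (\<lambda>y. y i *\<^sub>R (\<phi> \<nu> y *\<^sub>R d))"
    unfolding scaleR_scaleR eq scaleR_sum_left ..
  finally show ?case .
qed (auto simp: scaleR_add_right intro: S.add)

lemma S_coord_power: "f \<in> S \<Longrightarrow> (\<lambda>y. (a * y i) ^ n *\<^sub>R f y) \<in> S"
proof (induction n)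
  case (Suc n)
  from S_scale[OF S_coord[OF Suc.IH[OF Suc.prems], of i], of a]
  show ?case by (simp add: mult.assoc mult.left_commute)
qed simp

text \<open>The closure of \<open>S\<close> in mean square, phrased with the squared distance. The
  aim of the following lemmas is that \<open>K\<close> contains every square integrable
  function.\<close>

definition K :: "((nat \<Rightarrow> real) \<Rightarrow> 'g::{real_inner,banach,second_countable_topology}) set" where
  "K = {f. L2_function M f \<and> (\<forall>\<epsilon>>0. \<exists>g\<in>S. (LINT y|M. (norm (f y - g y))\<^sup>2) < \<epsilon>)}"

lemma S_subset_K: "S \<subseteq> K"
  by (auto simp: K_def S_L2 intro!: bexI)

lemma K_L2: "f \<in> K \<Longrightarrow> L2_function M f" by (simp add: K_def)

lemma L2_error_add:
  assumes "L2_function M f" "L2_function M g"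
  shows "(LINT y|M. (norm (f y + g y))\<^sup>2) \<le> 2 * (LINT y|M. (norm (f y))\<^sup>2) + 2 * (LINT y|M. (norm (g y))\<^sup>2)"
proof -
  have "(LINT y|M. (norm (f y + g y))\<^sup>2) \<le> (LINT y|M. 2 * (norm (f y))\<^sup>2 + 2 * (norm (g y))\<^sup>2)"
    using assms L2_function_add[OF assms]
    by (intro integral_mono norm_add_square_le) (auto simp: L2_function_def)
  also have "\<dots> = 2 * (LINT y|M. (norm (f y))\<^sup>2) + 2 * (LINT y|M. (norm (g y))\<^sup>2)"
    using assms by (simp add: L2_function_def)
  finally show ?thesis .
qed

lemma K_closed:
  assumes f: "L2_function M f"
    and ap: "\<And>\<epsilon>. 0 < \<epsilon> \<Longrightarrow> \<exists>g\<in>K. (LINT y|M. (norm (f y - g y))\<^sup>2) < \<epsilon>"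
  shows "f \<in> K"
  unfolding K_def
proof (intro CollectI conjI allI impI f)
  fix \<epsilon> :: real assume "0 < \<epsilon>"
  \<comment> \<open>A quarter of \<open>\<epsilon>\<close> for each of two errors, because the
    squared norm of a sum costs a factor 2 in \<open>L2_error_add\<close>.\<close>
  then obtain g where g: "g \<in> K" "(LINT y|M. (norm (f y - g y))\<^sup>2) < \<epsilon> / 4" using ap[of "\<epsilon> / 4"] by auto
  obtain h where h: "h \<in> S" "(LINT y|M. (norm (g y - h y))\<^sup>2) < \<epsilon> / 4"
    using g(1) \<open>0 < \<epsilon>\<close> unfolding K_def by (auto dest!: spec[of _ "\<epsilon> / 4"])
  have "(LINT y|M. (norm ((f y - g y) + (g y - h y)))\<^sup>2) < \<epsilon>"
    using L2_error_add[OF L2_function_diff[OF f K_L2[OF g(1)]] L2_function_diff[OF K_L2[OF g(1)] S_L2[OF h(1)]]]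
      g(2) h(2) by simp
  then show "\<exists>h\<in>S. (LINT y|M. (norm (f y - h y))\<^sup>2) < \<epsilon>" using h(1) by auto
qed

lemma K_limit:
  assumes f: "L2_function M f" and w: "integrable M w"
    and g: "\<And>n. g n \<in> K" and lim: "\<And>y. (\<lambda>n. g n y) \<longlonglongrightarrow> f y"
    and bnd: "\<And>n y. (norm (f y - g n y))\<^sup>2 \<le> w y"
  shows "f \<in> K"
proof (rule K_closed[OF f])
  fix \<epsilon> :: real assume "0 < \<epsilon>"
  have [measurable]: "f \<in> borel_measurable M" "g n \<in> borel_measurable M" for n
    using f K_L2[OF g] by (auto simp: L2_function_def)
  have "(\<lambda>n. LINT y|M. (norm (f y - g n y))\<^sup>2) \<longlonglongrightarrow> (LINT y|M. (norm (f y - f y))\<^sup>2)"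
  proof (rule integral_dominated_convergence[where w = w])
    show "AE y in M. (\<lambda>n. (norm (f y - g n y))\<^sup>2) \<longlonglongrightarrow> (norm (f y - f y))\<^sup>2"
      using lim by (intro AE_I2 tendsto_intros)
  qed (use w bnd in auto)
  then have "(\<lambda>n. LINT y|M. (norm (f y - g n y))\<^sup>2) \<longlonglongrightarrow> 0" by simp
  then have "\<forall>\<^sub>F n in sequentially. (LINT y|M. (norm (f y - g n y))\<^sup>2) < \<epsilon>"
    using \<open>0 < \<epsilon>\<close> by (rule order_tendstoD(2))
  then show "\<exists>g\<in>K. (LINT y|M. (norm (f y - g y))\<^sup>2) < \<epsilon>"
    using g by (auto simp: eventually_sequentially)
qed

lemma K_add:
  assumes "f \<in> K" "g \<in> K"
  shows "(\<lambda>y. f y + g y) \<in> K"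
proof (rule K_closed)
  show "L2_function M (\<lambda>y. f y + g y)" using assms by (intro L2_function_add K_L2)
  fix \<epsilon> :: real assume "0 < \<epsilon>"
  then obtain f' g' where f': "f' \<in> S" "(LINT y|M. (norm (f y - f' y))\<^sup>2) < \<epsilon> / 4"
    and g': "g' \<in> S" "(LINT y|M. (norm (g y - g' y))\<^sup>2) < \<epsilon> / 4"
    using assms unfolding K_def by (auto dest!: spec[of _ "\<epsilon> / 4"])
  have "(LINT y|M. (norm ((f y - f' y) + (g y - g' y)))\<^sup>2) < \<epsilon>"
    using L2_error_add[OF L2_function_diff[OF K_L2[OF assms(1)] S_L2[OF f'(1)]]
        L2_function_diff[OF K_L2[OF assms(2)] S_L2[OF g'(1)]]] f' g' by simp
  then have "(LINT y|M. (norm ((f y + g y) - (f' y + g' y)))\<^sup>2) < \<epsilon>"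
    by (simp add: algebra_simps)
  then show "\<exists>h\<in>K. (LINT y|M. (norm ((f y + g y) - h y))\<^sup>2) < \<epsilon>"
    using S.add[OF f'(1) g'(1)] S_subset_K by (intro bexI[of _ "\<lambda>y. f' y + g' y"]) auto
qed

text \<open>Multiplication by a bounded function is continuous in mean square, so it maps
  \<open>K\<close> to itself as soon as it maps the dense part \<open>S\<close> into the closed set
  \<open>K\<close>.\<close>

lemma K_bounded_mult:
  assumes h: "h \<in> borel_measurable M" "\<And>y. \<bar>h y\<bar> \<le> B"
    and S: "\<And>p :: _ \<Rightarrow> 'g::{real_inner,banach,second_countable_topology}. p \<in> S \<Longrightarrow> (\<lambda>y. h y *\<^sub>R p y) \<in> K"
    and f: "(f :: _ \<Rightarrow> 'g) \<in> K"
  shows "(\<lambda>y. h y *\<^sub>R f y) \<in> K"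
proof (rule K_closed)
  show "L2_function M (\<lambda>y. h y *\<^sub>R f y)" by (rule L2_function_bounded_mult[OF K_L2[OF f] h])
  fix \<epsilon> :: real assume \<epsilon>: "0 < \<epsilon>"
  \<comment> \<open>The summand 1 keeps the divisor positive when \<open>B = 0\<close>.\<close>
  have B: "0 < B\<^sup>2 + 1" by (simp add: add_nonneg_pos)
  then have "0 < \<epsilon> / (B\<^sup>2 + 1)" using \<epsilon> by simp
  then obtain g where g: "g \<in> S" "(LINT y|M. (norm (f y - g y))\<^sup>2) < \<epsilon> / (B\<^sup>2 + 1)"
    using f unfolding K_def by blast
  have d: "L2_function M (\<lambda>y. f y - g y)" by (intro L2_function_diff K_L2[OF f] S_L2[OF g(1)])
  have "(LINT y|M. (norm (h y *\<^sub>R (f y - g y)))\<^sup>2) \<le> (LINT y|M. (B\<^sup>2 + 1) * (norm (f y - g y))\<^sup>2)"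
  proof (rule integral_mono)
    show "integrable M (\<lambda>y. (norm (h y *\<^sub>R (f y - g y)))\<^sup>2)"
      using L2_function_bounded_mult[OF d h] by (simp add: L2_function_def)
    show "integrable M (\<lambda>y. (B\<^sup>2 + 1) * (norm (f y - g y))\<^sup>2)" using d by (simp add: L2_function_def)
    have "(h y)\<^sup>2 \<le> B\<^sup>2 + 1" for y using power_mono[OF h(2), of y 2] by simp
    then show "(norm (h y *\<^sub>R (f y - g y)))\<^sup>2 \<le> (B\<^sup>2 + 1) * (norm (f y - g y))\<^sup>2" for y
      by (auto simp: power_mult_distrib intro!: mult_right_mono)
  qed
  also have "\<dots> = (B\<^sup>2 + 1) * (LINT y|M. (norm (f y - g y))\<^sup>2)" by simp
  also have "\<dots> < \<epsilon>" using g(2) B by (simp add: pos_less_divide_eq mult.commute)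
  finally show "\<exists>g\<in>K. (LINT y|M. (norm (h y *\<^sub>R f y - g y))\<^sup>2) < \<epsilon>"
    using S[OF g(1)] by (auto simp: scaleR_diff_right intro!: bexI)
qed

lemma K_scale: "f \<in> K \<Longrightarrow> (\<lambda>y. a *\<^sub>R f y) \<in> K"
  by (rule K_bounded_mult[where B = "\<bar>a\<bar>"]) (use S_scale S_subset_K in auto)

text \<open>
  The bounded multipliers of the closure \<open>K\<close> form an algebra closed under bounded pointwise limits.
  Since \<open>sin (a * y j)\<close> belongs to it, by the power series, so do all indicator functions.
\<close>

definition Mult :: "'g::{real_inner,banach,second_countable_topology} itself \<Rightarrow> ((nat \<Rightarrow> real) \<Rightarrow> real) set" where
  "Mult T = {h. h \<in> borel_measurable M \<and> (\<exists>B. \<forall>y. \<bar>h y\<bar> \<le> B) \<and>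
     (\<forall>f :: _ \<Rightarrow> 'g. f \<in> K \<longrightarrow> (\<lambda>y. h y *\<^sub>R f y) \<in> K)}"

lemma Mult_const: "(\<lambda>_. a) \<in> Mult T"
  by (auto simp: Mult_def intro: K_scale)

lemma Mult_add: "g \<in> Mult T \<Longrightarrow> h \<in> Mult T \<Longrightarrow> (\<lambda>y. g y + h y) \<in> Mult T"
proof -
  assume g: "g \<in> Mult T" and h: "h \<in> Mult T"
  obtain A B where "\<And>y. \<bar>g y\<bar> \<le> A" "\<And>y. \<bar>h y\<bar> \<le> B" using g h by (auto simp: Mult_def)
  then have "\<bar>g y + h y\<bar> \<le> A + B" for y
    using abs_triangle_ineq[of "g y" "h y"] by (meson add_mono order_trans)
  then have "\<exists>B. \<forall>y. \<bar>g y + h y\<bar> \<le> B" by blast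
  then show ?thesis using g h by (auto simp: Mult_def scaleR_add_left intro: K_add)
qed

lemma Mult_mult: "g \<in> Mult T \<Longrightarrow> h \<in> Mult T \<Longrightarrow> (\<lambda>y. g y * h y) \<in> Mult T"
proof -
  assume g: "g \<in> Mult T" and h: "h \<in> Mult T"
  obtain A B where "\<And>y. \<bar>g y\<bar> \<le> A" "\<And>y. \<bar>h y\<bar> \<le> B" using g h by (auto simp: Mult_def)
  then have "\<bar>g y * h y\<bar> \<le> A * B" for y
    unfolding abs_mult by (intro mult_mono) (auto intro: order_trans[OF abs_ge_zero])
  then have "\<exists>B. \<forall>y. \<bar>g y * h y\<bar> \<le> B" by blast
  moreover have "(\<lambda>y. (g y * h y) *\<^sub>R f y) \<in> K" if "f \<in> K" for f :: "(nat \<Rightarrow> real) \<Rightarrow> 'a"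
    using that g h unfolding scaleR_scaleR[symmetric] Mult_def by blast
  ultimately show ?thesis using g h by (auto simp: Mult_def)
qed

lemma Mult_limit:
  assumes g: "\<And>n. g n \<in> Mult T" and B: "\<And>n y. \<bar>g n y\<bar> \<le> B" and lim: "\<And>y. (\<lambda>n. g n y) \<longlonglongrightarrow> h y"
  shows "h \<in> Mult T"
proof -
  have hB: "\<bar>h y\<bar> \<le> B" for y
    by (rule LIMSEQ_le_const2[OF tendsto_rabs[OF lim[of y]]]) (use B in auto)
  have [measurable]: "g n \<in> borel_measurable M" for n using g by (auto simp: Mult_def)
  have hm[measurable]: "h \<in> borel_measurable M"
    by (rule borel_measurable_LIMSEQ_real[where u = g]) (use lim in auto)
  have "(\<lambda>y. h y *\<^sub>R f y) \<in> K" if f: "f \<in> K" for f :: "(nat \<Rightarrow> real) \<Rightarrow> 'a"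
  proof (rule K_limit[where g = "\<lambda>n y. g n y *\<^sub>R f y" and w = "\<lambda>y. (2 * B)\<^sup>2 * (norm (f y))\<^sup>2"])
    show "L2_function M (\<lambda>y. h y *\<^sub>R f y)" by (rule L2_function_bounded_mult[OF K_L2[OF f] hm hB])
    show "integrable M (\<lambda>y. (2 * B)\<^sup>2 * (norm (f y))\<^sup>2)" using K_L2[OF f] by (simp add: L2_function_def)
    show "(\<lambda>y. g n y *\<^sub>R f y) \<in> K" for n using g f by (auto simp: Mult_def)
    show "(\<lambda>n. g n y *\<^sub>R f y) \<longlonglongrightarrow> h y *\<^sub>R f y" for y by (intro tendsto_intros lim)
    show "(norm (h y *\<^sub>R f y - g n y *\<^sub>R f y))\<^sup>2 \<le> (2 * B)\<^sup>2 * (norm (f y))\<^sup>2" for n y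
    proof -
      have "\<bar>h y - g n y\<bar> \<le> 2 * B" using hB[of y] B[of n y] by linarith
      then have "(h y - g n y)\<^sup>2 \<le> (2 * B)\<^sup>2" using power_mono[of "\<bar>h y - g n y\<bar>" "2 * B" 2] by simp
      then show ?thesis
        unfolding scaleR_diff_left[symmetric] norm_scaleR power_mult_distrib[of "\<bar>_\<bar>"] power2_abs
        by (intro mult_right_mono) auto
    qed
  qed
  then show ?thesis using hB by (auto simp: Mult_def)
qed

text \<open>Partial sums of the sine series times an element of \<open>S\<close> are again in
  \<open>S\<close>. With \<open>x = a * y i\<close> they are bounded by
  \<open>exp \<bar>x\<bar> \<le> exp (\<bar>y i\<bar> / 2)\<close>, which is where
  \<open>1/2\<close> comes from: the square is \<open>exp \<bar>y i\<bar>\<close>, integrable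
  against \<open>(\<phi> \<nu> y)\<^sup>2\<close>. Dominated convergence then places the limit in
  \<open>K\<close>.\<close>

lemma Mult_sin:
  assumes a: "\<bar>a\<bar> \<le> 1/2"
  shows "(\<lambda>y. sin (a * y i)) \<in> Mult (T :: 'g::{real_inner,banach,second_countable_topology} itself)"
proof -
  have m[measurable]: "(\<lambda>y. sin (a * y i)) \<in> borel_measurable M" by measurable
  have S: "(\<lambda>y. sin (a * y i) *\<^sub>R p y) \<in> K" if "p \<in> S" for p :: "_ \<Rightarrow> 'g"
    using that
  proof (induction rule: S.induct)
    case (basis \<nu> d)
    define t where "t N x = (\<Sum>k<N. sin_coeff k * x ^ k)" for N :: nat and x :: real
    have tlim: "(\<lambda>N. t N x) \<longlonglongrightarrow> sin x" for x
      using sin_converges[of x] by (simp add: t_def sums_def)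
    have tb: "\<bar>t N x\<bar> \<le> exp \<bar>x\<bar>" for N x
    proof -
      have "\<bar>t N x\<bar> \<le> (\<Sum>k<N. \<bar>sin_coeff k * x ^ k\<bar>)" unfolding t_def by (rule sum_abs)
      also have "\<dots> \<le> (\<Sum>k<N. inverse (fact k) * \<bar>x\<bar> ^ k)"
        by (intro sum_mono) (auto simp: sin_coeff_def abs_mult power_abs divide_inverse)
      also have "\<dots> \<le> (\<Sum>k. inverse (fact k) * \<bar>x\<bar> ^ k)"
        using summable_exp[of "\<bar>x\<bar>"] by (intro sum_le_suminf) auto
      also have "\<dots> = exp \<bar>x\<bar>" by (simp add: exp_def)
      finally show ?thesis .
    qed
    show ?case
    proof (rule K_limit[where g = "\<lambda>N y. t N (a * y i) *\<^sub>R (\<phi> \<nu> y *\<^sub>R d)"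
          and w = "\<lambda>y. 4 * (norm d)\<^sup>2 * ((\<phi> \<nu> y)\<^sup>2 * exp \<bar>y i\<bar>)"])
      show "L2_function M (\<lambda>y. sin (a * y i) *\<^sub>R (\<phi> \<nu> y *\<^sub>R d))"
        by (rule L2_function_bounded_mult[OF \<phi>_scaleR_L2[OF basis] m, of 1]) simp
      show "integrable M (\<lambda>y. 4 * (norm d)\<^sup>2 * ((\<phi> \<nu> y)\<^sup>2 * exp \<bar>y i\<bar>))"
        by (intro integrable_mult_right \<phi>_exp basis)
      show "(\<lambda>N. t N (a * y i) *\<^sub>R \<phi> \<nu> y *\<^sub>R d) \<longlonglongrightarrow> sin (a * y i) *\<^sub>R \<phi> \<nu> y *\<^sub>R d" for y
        by (intro tendsto_intros tlim)
      have "(\<lambda>y. \<Sum>k<N. sin_coeff k *\<^sub>R ((a * y i) ^ k *\<^sub>R (\<phi> \<nu> y *\<^sub>R d))) \<in> S" for N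
        by (intro S_sum S_scale S_coord_power S.basis basis) simp
      then have "(\<lambda>y. t N (a * y i) *\<^sub>R (\<phi> \<nu> y *\<^sub>R d)) \<in> S" for N
        by (simp add: t_def scaleR_sum_left sum_distrib_right mult.assoc)
      then show "(\<lambda>y. t N (a * y i) *\<^sub>R (\<phi> \<nu> y *\<^sub>R d)) \<in> K" for N using S_subset_K by blast
      show "(norm (sin (a * y i) *\<^sub>R \<phi> \<nu> y *\<^sub>R d - t N (a * y i) *\<^sub>R \<phi> \<nu> y *\<^sub>R d))\<^sup>2
          \<le> 4 * (norm d)\<^sup>2 * ((\<phi> \<nu> y)\<^sup>2 * exp \<bar>y i\<bar>)" for N y
      proof -
        define x where "x = a * y i"
        have "\<bar>a\<bar> * \<bar>y i\<bar> \<le> 1/2 * \<bar>y i\<bar>" using a by (rule mult_right_mono) simp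
        then have x: "\<bar>x\<bar> \<le> \<bar>y i\<bar> / 2" by (simp add: x_def abs_mult)
        have "\<bar>sin x - t N x\<bar> \<le> 1 + exp \<bar>x\<bar>"
          using tb[of N x] abs_sin_le_one[of x] by linarith
        also have "\<dots> \<le> 2 * exp \<bar>x\<bar>" by simp
        also have "\<dots> \<le> 2 * exp (\<bar>y i\<bar> / 2)" using x by simp
        finally have "\<bar>sin x - t N x\<bar>\<^sup>2 \<le> (2 * exp (\<bar>y i\<bar> / 2))\<^sup>2"
          by (rule power_mono) simp
        also have "\<dots> = 4 * exp \<bar>y i\<bar>"
          by (simp add: power_mult_distrib power2_eq_square exp_add[symmetric])
        finally have "(sin x - t N x)\<^sup>2 \<le> 4 * exp \<bar>y i\<bar>" by simp
        then have "(sin x - t N x)\<^sup>2 * ((\<phi> \<nu> y)\<^sup>2 * (norm d)\<^sup>2) \<le> 4 * exp \<bar>y i\<bar> * ((\<phi> \<nu> y)\<^sup>2 * (norm d)\<^sup>2)"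
          by (rule mult_right_mono) simp
        then show ?thesis
          unfolding scaleR_diff_left[symmetric] norm_scaleR power_mult_distrib power2_abs x_def
          by (simp add: mult_ac)
      qed
    qed
  next
    case (add f g)
    then show ?case using K_add by (simp add: scaleR_add_right)
  qed
  have "(\<lambda>y. sin (a * y i) *\<^sub>R f y) \<in> K" if "f \<in> K" for f :: "_ \<Rightarrow> 'g"
    by (rule K_bounded_mult[OF m _ S that, of 1]) simp_all
  then show ?thesis using m by (auto simp: Mult_def intro!: exI[of _ 1])
qed

text \<open>Polynomials of a multiplier are multipliers, and by Weierstrass they approximate
  \<open>k\<close> uniformly on the bounded interval that contains the values of
  \<open>h\<close>.\<close>

lemma Mult_continuous:
  assumes h: "h \<in> Mult T" and k: "continuous_on UNIV k"
  shows "(\<lambda>y. k (h y) :: real) \<in> Mult T"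
proof -
  have poly: "(\<lambda>y. g (h y)) \<in> Mult T" if "real_polynomial_function g" for g :: "real \<Rightarrow> real"
    using that
  proof (induction rule: real_polynomial_function.induct)
    case (linear f)
    then have "f = (\<lambda>x. f 1 * x)" by (metis linear_simps(5) mult.commute mult.right_neutral real_scaleR_def)
    then show ?case using Mult_mult[OF Mult_const[of "f 1"] h] by metis
  qed (auto intro: Mult_const Mult_add Mult_mult)
  obtain B where B: "\<And>y. \<bar>h y\<bar> \<le> B" using h by (auto simp: Mult_def)
  have ck: "compact {-B..B}" "continuous_on {-B..B} k" using k by (auto intro: continuous_on_subset)
  have "\<exists>g. real_polynomial_function g \<and> (\<forall>x\<in>{-B..B}. \<bar>k x - g x\<bar> < 1 / Suc n)" for n
  proof -
    have "0 < 1 / real (Suc n)" by simp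
    from Stone_Weierstrass_real_polynomial_function[OF ck this] show ?thesis by metis
  qed
  then obtain g where g: "\<And>n. real_polynomial_function (g n)"
    "\<And>n x. x \<in> {-B..B} \<Longrightarrow> \<bar>k x - g n x\<bar> < 1 / Suc n" by metis
  have hy: "h y \<in> {-B..B}" for y using B[of y] by auto
  have "bounded (k ` {-B..B})" using ck by (intro compact_imp_bounded compact_continuous_image)
  then obtain A where A: "\<And>x. x \<in> {-B..B} \<Longrightarrow> \<bar>k x\<bar> \<le> A"
    unfolding bounded_iff by (metis imageI real_norm_def)
  show ?thesis
  proof (rule Mult_limit[where g = "\<lambda>n y. g n (h y)" and B = "A + 1"])
    show "(\<lambda>y. g n (h y)) \<in> Mult T" for n using poly g(1) by blast
    show "\<bar>g n (h y)\<bar> \<le> A + 1" for n y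
    proof -
      have "1 / Suc n \<le> (1::real)" by simp
      then show ?thesis using A[OF hy, of y] g(2)[OF hy, of y n] by linarith
    qed
    show "(\<lambda>n. g n (h y)) \<longlonglongrightarrow> k (h y)" for y
    proof (rule metric_LIMSEQ_I)
      fix r :: real assume "0 < r"
      then obtain N where N: "1 / Suc N < r" using nat_approx_posE by blast
      have "dist (g n (h y)) (k (h y)) < r" if "n \<ge> N" for n
      proof -
        have "1 / Suc n \<le> 1 / Suc N" using that by (simp add: frac_le)
        then show ?thesis using g(2)[OF hy, of y n] N by (simp add: dist_real_def abs_minus_commute)
      qed
      then show "\<exists>N. \<forall>n\<ge>N. dist (g n (h y)) (k (h y)) < r" by blast
    qed
  qed
qed

text \<open>The derivative of the sine at 0, in the form \<open>m * sin (x / m)\<close> with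
  \<open>m = n + 2\<close>; the shift keeps \<open>1 / m\<close> within the bound \<open>1/2\<close>
  of \<open>Mult_sin\<close>.\<close>

lemma tendsto_sin_scaled: "(\<lambda>n. real (Suc (Suc n)) * sin (inverse (real (Suc (Suc n))) * x)) \<longlonglongrightarrow> x"
proof (cases "x = 0")
  case False
  have "(\<lambda>n. inverse (real (Suc n)) * x) \<longlonglongrightarrow> 0 * x"
    by (intro tendsto_mult LIMSEQ_inverse_real_of_nat tendsto_const)
  then have l0: "(\<lambda>n. inverse (real (Suc (Suc n))) * x) \<longlonglongrightarrow> 0"
    using LIMSEQ_Suc by fastforce
  have "((\<lambda>h. (sin (0 + h) - sin 0) / h) \<longlongrightarrow> cos 0) (at (0::real))"
    using DERIV_sin[of "0::real"] unfolding DERIV_def .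
  then have l1: "((\<lambda>h. sin h / h) \<longlongrightarrow> 1) (at (0::real))" by simp
  have "filterlim (\<lambda>n. inverse (real (Suc (Suc n))) * x) (at 0) sequentially"
    unfolding filterlim_at using l0 False by auto
  from filterlim_compose[OF l1 this]
  have "(\<lambda>n. sin (inverse (real (Suc (Suc n))) * x) / (inverse (real (Suc (Suc n))) * x)) \<longlonglongrightarrow> 1" .
  from tendsto_mult[OF this tendsto_const[of x]]
  have "(\<lambda>n. sin (inverse (real (Suc (Suc n))) * x) / (inverse (real (Suc (Suc n))) * x) * x) \<longlonglongrightarrow> x"
    by (simp only: mult_1)
  moreover have "w / (inverse r * x) * x = r * w" if "r \<noteq> 0" for r w :: real
    using that False by (simp add: field_simps)
  ultimately show ?thesis by (simp only: of_nat_eq_0_iff nat.simps not_False_eq_True)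
qed simp

text \<open>A coordinate need not be bounded and so cannot itself be used as a multiplier. It is
  replaced by the bounded approximations \<open>m * sin (y j / m)\<close> inside \<open>k\<close>,
  and the bound on \<open>k\<close> makes the limit admissible.\<close>

lemma Mult_coord:
  assumes k: "continuous_on UNIV k" "\<And>x. \<bar>k x\<bar> \<le> B"
  shows "(\<lambda>y. k (y j) :: real) \<in> Mult T"
proof (rule Mult_limit[where g = "\<lambda>n y. k (real (Suc (Suc n)) * sin (inverse (real (Suc (Suc n))) * y j))" and B = B])
  show "(\<lambda>y. k (real (Suc (Suc n)) * sin (inverse (real (Suc (Suc n))) * y j))) \<in> Mult T" for n
    by (intro Mult_continuous[OF _ k(1)] Mult_mult Mult_const Mult_sin) (simp add: field_simps)
  show "(\<lambda>n. k (real (Suc (Suc n)) * sin (inverse (real (Suc (Suc n))) * y j))) \<longlonglongrightarrow> k (y j)" for y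
    by (rule continuous_on_tendsto_compose[OF k(1) tendsto_sin_scaled]) auto
qed (rule k(2))

text \<open>Ramps of slope \<open>n\<close>, clipped to the unit interval, increase to the
  indicator; at \<open>y j = a\<close> they all vanish, in accordance with the strict
  inequality.\<close>

lemma Mult_greaterThan: "(\<lambda>y. indicator {y. a < y j} y) \<in> Mult T"
proof (rule Mult_limit[where g = "\<lambda>n y. min 1 (max 0 (real n * (y j - a)))" and B = 1])
  show "(\<lambda>y. min 1 (max 0 (real n * (y j - a)))) \<in> Mult T" for n
    by (rule Mult_coord[where k = "\<lambda>x. min 1 (max 0 (real n * (x - a)))" and B = 1])
      (auto intro!: continuous_intros)
  show "(\<lambda>n. min 1 (max 0 (real n * (y j - a)))) \<longlonglongrightarrow> indicator {y. a < y j} y" for y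
  proof (cases "a < y j")
    case True
    obtain N :: nat where N: "1 / (y j - a) < N" using reals_Archimedean2 by blast
    have "min 1 (max 0 (real n * (y j - a))) = indicator {y. a < y j} y" if "n \<ge> N" for n
    proof -
      have "1 < real N * (y j - a)" using N True by (simp add: field_simps)
      also have "\<dots> \<le> real n * (y j - a)" using that True by (intro mult_right_mono) auto
      finally show ?thesis using True by simp
    qed
    then show ?thesis by (intro tendsto_eventually eventually_sequentiallyI[of N]) auto
  next
    case False
    then have "real n * (y j - a) \<le> 0" for n by (simp add: mult_le_0_iff)
    then have "min 1 (max 0 (real n * (y j - a))) = 0" for n by (simp add: max_absorb1)
    then show ?thesis using False by simp
  qed
qed simp

lemma Mult_Compl:
  assumes "(\<lambda>y. indicator A y) \<in> Mult T"
  shows "(\<lambda>y. indicator (- A) y) \<in> Mult T"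
proof -
  have "(\<lambda>y. 1 + (-1) * indicator A y) \<in> Mult T"
    using assms by (intro Mult_add Mult_mult Mult_const)
  also have "(\<lambda>y. 1 + (-1) * indicator A y) = (\<lambda>y. indicator (- A) y :: real)"
    by (auto simp: fun_eq_iff indicator_def)
  finally show ?thesis .
qed

text \<open>Finite intersections are products of indicators, so finite unions follow by complements
  and the countable union is a bounded pointwise limit.\<close>

lemma Mult_UN:
  assumes "\<And>n::nat. (\<lambda>y. indicator (A n) y) \<in> Mult T"
  shows "(\<lambda>y. indicator (\<Union>n. A n) y) \<in> Mult T"
proof -
  have "(\<lambda>y. \<Prod>i<n. indicator (- A i) y) \<in> Mult T" for n
  proof (induction n)
    case (Suc n)
    then show ?case using Mult_mult[OF Suc.IH Mult_Compl[OF assms[of n]]] by simp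
  qed (simp add: Mult_const)
  then have "(\<lambda>y. 1 + (-1) * (\<Prod>i<n. indicator (- A i) y)) \<in> Mult T" for n
    by (intro Mult_add Mult_mult[OF Mult_const] Mult_const)
  moreover have "1 + (-1) * (\<Prod>i<n. indicator (- A i) y) = (indicator (\<Union>i<n. A i) y :: real)" for n y
  proof (cases "y \<in> (\<Union>i<n. A i)")
    case True
    then obtain i where "i < n" "y \<in> A i" by auto
    then have "(\<Prod>i<n. indicator (- A i) y) = (0 :: real)" by (intro prod_zero bexI[of _ i]) auto
    then show ?thesis using True by simp
  qed simp
  ultimately have fin: "(\<lambda>y. indicator (\<Union>i<n. A i) y) \<in> Mult T" for n by simp
  show ?thesis
  proof (rule Mult_limit[where g = "\<lambda>n y. indicator (\<Union>i<n. A i) y" and B = 1, OF fin])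
    show "(\<lambda>n. indicator (\<Union>i<n. A i) y :: real) \<longlonglongrightarrow> indicator (\<Union>n. A n) y" for y
      by (rule LIMSEQ_indicator_UN)
  qed (auto simp: indicator_def)
qed

text \<open>Two inductions over generated sigma-algebras: from half-lines to Borel sets of one
  coordinate, and from these cylinders to the product sigma-algebra.\<close>

lemma Mult_indicator:
  assumes "A \<in> sets M"
  shows "(\<lambda>y. indicator A y) \<in> Mult T"
proof -
  have borel: "(\<lambda>y. indicator {y. y j \<in> X} y) \<in> Mult T" if "X \<in> sets borel" for j and X :: "real set"
  proof -
    have "X \<in> sigma_sets UNIV (range greaterThan)"
      using that unfolding borel_Ioi by simp
    then show ?thesis
  proof (induction rule: sigma_sets.induct)
    case (Basic X)
    then show ?case using Mult_greaterThan by auto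
  next
    case Empty
    then show ?case using Mult_const[of 0] by simp
  next
    case (Compl X)
    have "- {y. y j \<in> X} = {y. y j \<in> UNIV - X}" by auto
    then show ?case using Mult_Compl[OF Compl.IH] by simp
  next
    case (Union X)
    have "{y. y j \<in> (\<Union>i. X i)} = (\<Union>i. {y. y j \<in> X i})" by auto
    then show ?case using Mult_UN[OF Union.IH] by simp
  qed
  qed
  have sp: "space \<mu> = UNIV" using sets_eq_imp_space_eq[OF sets_mu] by simp
  show ?thesis
    using assms unfolding sets_PiM_single
  proof (induction rule: sigma_sets.induct)
    case (Basic A)
    then show ?case using borel by (auto simp: sets_mu sp)
  next
    case Empty
    then show ?case using Mult_const[of 0] by simp
  next
    case (Compl A)
    then show ?case using Mult_Compl by (simp add: sp Compl_eq_Diff_UNIV[symmetric])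
  next
    case (Union A)
    then show ?case using Mult_UN by blast
  qed
qed

text \<open>Constants belong to \<open>S\<close> and indicators are multipliers, hence simple
  functions lie in \<open>K\<close>. Approximating simple functions with
  \<open>norm (s i y) \<le> 2 * norm (f y)\<close> have error at most \<open>3 * norm (f y)\<close>,
  the square of which is an integrable majorant.\<close>

lemma L2_function_in_K:
  assumes f: "L2_function M f"
  shows "f \<in> K"
proof -
  obtain s where s: "\<And>i. simple_function M (s i)" "\<And>y. (\<lambda>i. s i y) \<longlonglongrightarrow> f y"
      "\<And>i y. dist (s i y) 0 \<le> 2 * dist (f y) 0"
    using borel_measurable_implies_sequence_metric[of f M 0] f by (auto simp: L2_function_def space_M)
  have sK: "s i \<in> K" for i
  proof -
    have fin: "finite (range (s i))" using simple_functionD(1)[OF s(1)[of i]] by (simp add: space_M)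
    have ind: "(\<lambda>y. indicator (s i -` {d}) y *\<^sub>R d) \<in> K" for d
    proof -
      have "s i -` {d} \<in> sets M" using simple_functionD(2)[OF s(1)[of i], of "{d}"] by (simp add: space_M)
      then have "(\<lambda>y. indicator (s i -` {d}) y) \<in> Mult TYPE('a)" by (rule Mult_indicator)
      moreover have "(\<lambda>y. d) \<in> K" using S_const S_subset_K by blast
      ultimately show ?thesis by (auto simp: Mult_def)
    qed
    have "(\<lambda>y. \<Sum>d\<in>I. indicator (s i -` {d}) y *\<^sub>R d) \<in> K" if "finite I" for I
      using that
    proof (induction rule: finite_induct)
      case empty
      then show ?case using S_const[of 0] S_subset_K by auto
    next
      case (insert d I)
      show ?case unfolding sum.insert[OF insert.hyps] by (rule K_add[OF ind insert.IH])
    qed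
    from this[OF fin] have "(\<lambda>y. \<Sum>d\<in>range (s i). indicator (s i -` {d}) y *\<^sub>R d) \<in> K" .
    also have "(\<lambda>y. \<Sum>d\<in>range (s i). indicator (s i -` {d}) y *\<^sub>R d) = s i"
    proof
      fix y
      have "(\<Sum>d\<in>range (s i). indicator (s i -` {d}) y *\<^sub>R d) = (\<Sum>d\<in>range (s i). if d = s i y then d else 0)"
        by (intro sum.cong) (auto simp: indicator_def)
      then show "(\<Sum>d\<in>range (s i). indicator (s i -` {d}) y *\<^sub>R d) = s i y" using fin by simp
    qed
    finally show ?thesis .
  qed
  show ?thesis
  proof (rule K_limit[OF f _ sK s(2)])
    show "integrable M (\<lambda>y. 9 * (norm (f y))\<^sup>2)" using f by (simp add: L2_function_def)
    show "(norm (f y - s n y))\<^sup>2 \<le> 9 * (norm (f y))\<^sup>2" for n y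
    proof -
      have "norm (f y - s n y) \<le> 3 * norm (f y)"
        using norm_triangle_ineq4[of "f y" "s n y"] s(3)[of n y] by (simp add: dist_norm)
      then have "(norm (f y - s n y))\<^sup>2 \<le> (3 * norm (f y))\<^sup>2" by (intro power_mono) auto
      then show ?thesis by (simp add: power_mult_distrib)
    qed
  qed
qed

section \<open>Errors of finite expansions\<close>

text \<open>Pythagoras for arbitrary coefficients \<open>d \<nu>\<close>: subtracting one term from
  \<open>u\<close> changes the squared norm by the change of a single coefficient.\<close>

lemma expansion_error_eq:
  assumes u: "L2_function M u" and F: "finite F" "F \<subseteq> multi_indices"
  shows "L2_function M (\<lambda>y. u y - (\<Sum>\<nu>\<in>F. \<phi> \<nu> y *\<^sub>R d \<nu>))"
    and "(LINT y|M. (norm (u y - (\<Sum>\<nu>\<in>F. \<phi> \<nu> y *\<^sub>R d \<nu>)))\<^sup>2)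
      = (LINT y|M. (norm (u y))\<^sup>2)
        + (\<Sum>\<nu>\<in>F. (norm ((LINT y|M. \<phi> \<nu> y *\<^sub>R u y) - d \<nu>))\<^sup>2 - (norm (LINT y|M. \<phi> \<nu> y *\<^sub>R u y))\<^sup>2)"
proof -
  define U where "U \<nu> = (LINT y|M. \<phi> \<nu> y *\<^sub>R u y)" for \<nu>
  \<comment> \<open>The middle clause strengthens the induction: by orthogonality, subtracting terms
    with indices in \<open>F\<close> does not change the coefficients outside \<open>F\<close>, so
    the next coefficient is still \<open>U\<close>.\<close>
  have "L2_function M (\<lambda>y. u y - (\<Sum>\<nu>\<in>F. \<phi> \<nu> y *\<^sub>R d \<nu>)) \<and>
    (\<forall>\<kappa>\<in>multi_indices - F. (LINT y|M. \<phi> \<kappa> y *\<^sub>R (u y - (\<Sum>\<nu>\<in>F. \<phi> \<nu> y *\<^sub>R d \<nu>))) = U \<kappa>) \<and>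
    (LINT y|M. (norm (u y - (\<Sum>\<nu>\<in>F. \<phi> \<nu> y *\<^sub>R d \<nu>)))\<^sup>2)
      = (LINT y|M. (norm (u y))\<^sup>2) + (\<Sum>\<nu>\<in>F. (norm (U \<nu> - d \<nu>))\<^sup>2 - (norm (U \<nu>))\<^sup>2)"
    using F
  proof (induction rule: finite_induct)
    case empty
    then show ?case using u by (simp add: U_def)
  next
    case (insert \<mu>' F)
    define w where "w y = u y - (\<Sum>\<nu>\<in>F. \<phi> \<nu> y *\<^sub>R d \<nu>)" for y
    have eq: "u y - (\<Sum>\<nu>\<in>insert \<mu>' F. \<phi> \<nu> y *\<^sub>R d \<nu>) = w y - \<phi> \<mu>' y *\<^sub>R d \<mu>'" for y
      using insert.hyps by (simp add: w_def)
    have m: "\<mu>' \<in> multi_indices" using insert.prems by simp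
    have IH: "L2_function M w" "\<And>\<kappa>. \<kappa> \<in> multi_indices \<Longrightarrow> \<kappa> \<notin> F \<Longrightarrow> (LINT y|M. \<phi> \<kappa> y *\<^sub>R w y) = U \<kappa>"
      "(LINT y|M. (norm (w y))\<^sup>2) = (LINT y|M. (norm (u y))\<^sup>2) + (\<Sum>\<nu>\<in>F. (norm (U \<nu> - d \<nu>))\<^sup>2 - (norm (U \<nu>))\<^sup>2)"
      using insert unfolding w_def by auto
    have p: "L2_function M (\<lambda>y. \<phi> \<mu>' y *\<^sub>R d \<mu>')" by (rule \<phi>_scaleR_L2[OF m])
    have 1: "L2_function M (\<lambda>y. w y - \<phi> \<mu>' y *\<^sub>R d \<mu>')" by (rule L2_function_diff[OF IH(1) p])
    have iw: "integrable M (\<lambda>y. \<phi> \<kappa> y *\<^sub>R w y)" if "\<kappa> \<in> multi_indices" for \<kappa>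
      using IH(1) by (intro integrable_scaleR_L2_function \<phi>_L2 that) (auto simp: L2_function_def)
    have ip: "integrable M (\<lambda>y. \<phi> \<kappa> y * \<phi> \<mu>' y)" if "\<kappa> \<in> multi_indices" for \<kappa>
      using integrable_inner_L2_function[OF \<phi>_L2[OF that] \<phi>_L2[OF m]] by simp
    have 2: "(LINT y|M. \<phi> \<kappa> y *\<^sub>R (w y - \<phi> \<mu>' y *\<^sub>R d \<mu>')) = U \<kappa>" if k: "\<kappa> \<in> multi_indices" "\<kappa> \<notin> F" "\<kappa> \<noteq> \<mu>'" for \<kappa>
    proof -
      have "(LINT y|M. \<phi> \<kappa> y *\<^sub>R (w y - \<phi> \<mu>' y *\<^sub>R d \<mu>'))
          = (LINT y|M. \<phi> \<kappa> y *\<^sub>R w y) - (LINT y|M. (\<phi> \<kappa> y * \<phi> \<mu>' y) *\<^sub>R d \<mu>')"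
        using iw[OF k(1)] ip[OF k(1)] by (simp add: scaleR_diff_right)
      also have "(LINT y|M. (\<phi> \<kappa> y * \<phi> \<mu>' y) *\<^sub>R d \<mu>') = (LINT y|M. \<phi> \<kappa> y * \<phi> \<mu>' y) *\<^sub>R d \<mu>'"
        using ip[OF k(1)] by simp
      finally show ?thesis using IH(2)[OF k(1,2)] \<phi>_orth[OF k(1) m] k(3) by simp
    qed
    have sq: "(norm (w y - \<phi> \<mu>' y *\<^sub>R d \<mu>'))\<^sup>2
        = (norm (w y))\<^sup>2 - 2 * ((\<phi> \<mu>' y *\<^sub>R w y) \<bullet> d \<mu>') + (norm (d \<mu>'))\<^sup>2 * (\<phi> \<mu>' y * \<phi> \<mu>' y)" for y
      unfolding power2_norm_eq_inner by (simp add: inner_simps inner_commute algebra_simps)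
    have i1: "integrable M (\<lambda>y. (norm (w y))\<^sup>2)" using IH(1) by (simp add: L2_function_def)
    have i2: "integrable M (\<lambda>y. (\<phi> \<mu>' y *\<^sub>R w y) \<bullet> d \<mu>')" using iw[OF m] by (rule integrable_inner_left)
    have i2': "(LINT y|M. (\<phi> \<mu>' y *\<^sub>R w y) \<bullet> d \<mu>') = U \<mu>' \<bullet> d \<mu>'"
      using integral_inner_left[of "d \<mu>'" M "\<lambda>y. \<phi> \<mu>' y *\<^sub>R w y"] iw[OF m] IH(2)[OF m insert.hyps(2)] by simp
    have "(LINT y|M. (norm (w y - \<phi> \<mu>' y *\<^sub>R d \<mu>'))\<^sup>2)
        = (LINT y|M. (norm (w y))\<^sup>2) - 2 * (U \<mu>' \<bullet> d \<mu>') + (norm (d \<mu>'))\<^sup>2"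
      unfolding sq using i1 i2 ip[OF m] by (simp add: i2'[unfolded inner_scaleR_left] \<phi>_orth[OF m m])
    also have "\<dots> = (LINT y|M. (norm (w y))\<^sup>2) + ((norm (U \<mu>' - d \<mu>'))\<^sup>2 - (norm (U \<mu>'))\<^sup>2)"
      unfolding power2_norm_eq_inner by (simp add: inner_simps inner_commute)
    finally have 3: "(LINT y|M. (norm (w y - \<phi> \<mu>' y *\<^sub>R d \<mu>'))\<^sup>2)
        = (LINT y|M. (norm (u y))\<^sup>2) + (\<Sum>\<nu>\<in>insert \<mu>' F. (norm (U \<nu> - d \<nu>))\<^sup>2 - (norm (U \<nu>))\<^sup>2)"
      using IH(3) insert.hyps by simp
    show ?case unfolding eq using 1 2 3 by blast
  qed
  then show "L2_function M (\<lambda>y. u y - (\<Sum>\<nu>\<in>F. \<phi> \<nu> y *\<^sub>R d \<nu>))"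
    and "(LINT y|M. (norm (u y - (\<Sum>\<nu>\<in>F. \<phi> \<nu> y *\<^sub>R d \<nu>)))\<^sup>2)
      = (LINT y|M. (norm (u y))\<^sup>2)
        + (\<Sum>\<nu>\<in>F. (norm ((LINT y|M. \<phi> \<nu> y *\<^sub>R u y) - d \<nu>))\<^sup>2 - (norm (LINT y|M. \<phi> \<nu> y *\<^sub>R u y))\<^sup>2)"
    unfolding U_def by blast+
qed

lemma S_expand:
  assumes "f \<in> S"
  shows "\<exists>F d. finite F \<and> F \<subseteq> multi_indices \<and> f = (\<lambda>y. \<Sum>\<nu>\<in>F. \<phi> \<nu> y *\<^sub>R d \<nu>)"
  using assms
proof (induction rule: S.induct)
  case (basis \<nu> d)
  then show ?case by (intro exI[of _ "{\<nu>}"] exI[of _ "\<lambda>_. d"]) auto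
next
  case (add f g)
  from add.IH(1) obtain F d where F: "finite F" "F \<subseteq> multi_indices" "f = (\<lambda>y. \<Sum>\<nu>\<in>F. \<phi> \<nu> y *\<^sub>R d \<nu>)"
    by (elim exE conjE)
  from add.IH(2) obtain G e where G: "finite G" "G \<subseteq> multi_indices" "g = (\<lambda>y. \<Sum>\<nu>\<in>G. \<phi> \<nu> y *\<^sub>R e \<nu>)"
    by (elim exE conjE)
  define d' where "d' \<nu> = (if \<nu> \<in> F then d \<nu> else 0) + (if \<nu> \<in> G then e \<nu> else 0)" for \<nu>
  have "f y + g y = (\<Sum>\<nu>\<in>F \<union> G. \<phi> \<nu> y *\<^sub>R d' \<nu>)" for y
  proof -
    have "f y = (\<Sum>\<nu>\<in>F \<union> G. \<phi> \<nu> y *\<^sub>R (if \<nu> \<in> F then d \<nu> else 0))"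
      unfolding F(3) using F(1) G(1) by (intro sum.mono_neutral_cong_left) auto
    moreover have "g y = (\<Sum>\<nu>\<in>F \<union> G. \<phi> \<nu> y *\<^sub>R (if \<nu> \<in> G then e \<nu> else 0))"
      unfolding G(3) using F(1) G(1) by (intro sum.mono_neutral_cong_left) auto
    ultimately show ?thesis by (simp only: d'_def scaleR_add_right sum.distrib)
  qed
  then have "(\<lambda>y. f y + g y) = (\<lambda>y. \<Sum>\<nu>\<in>F \<union> G. \<phi> \<nu> y *\<^sub>R d' \<nu>)" by blast
  then show ?case using F(1,2) G(1,2) by (intro exI[of _ "F \<union> G"] exI[of _ d'] conjI) auto
qed

text \<open>By the identity for the error it remains to bound the squared norm of \<open>u\<close>
  by the sum of all squared coefficients. A finite expansion within \<open>\<epsilon>\<close> of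
  \<open>u\<close> gives this: whatever its coefficients, its error is at least the squared norm of
  \<open>u\<close> minus the \<open>U \<nu>\<close> over its index set.\<close>

theorem expansion_error_le:
  assumes u: "L2_function M u" and L: "finite \<Lambda>" "\<Lambda> \<subseteq> multi_indices"
    and sm: "(\<lambda>\<nu>. (norm (LINT y|M. \<phi> \<nu> y *\<^sub>R u y))\<^sup>2) summable_on multi_indices - \<Lambda>"
  shows "(LINT y|M. (norm (u y - (\<Sum>\<nu>\<in>\<Lambda>. \<phi> \<nu> y *\<^sub>R d \<nu>)))\<^sup>2)
    \<le> (\<Sum>\<nu>\<in>\<Lambda>. (norm ((LINT y|M. \<phi> \<nu> y *\<^sub>R u y) - d \<nu>))\<^sup>2)
      + (\<Sum>\<^sub>\<infinity>\<nu>\<in>multi_indices - \<Lambda>. (norm (LINT y|M. \<phi> \<nu> y *\<^sub>R u y))\<^sup>2)"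
proof -
  define U where "U \<nu> = (norm (LINT y|M. \<phi> \<nu> y *\<^sub>R u y))\<^sup>2" for \<nu>
  have "(LINT y|M. (norm (u y))\<^sup>2) \<le> (\<Sum>\<nu>\<in>\<Lambda>. U \<nu>) + (\<Sum>\<^sub>\<infinity>\<nu>\<in>multi_indices - \<Lambda>. U \<nu>)"
  proof (rule field_le_epsilon)
    fix \<epsilon> :: real assume "0 < \<epsilon>"
    then obtain g where g: "g \<in> S" "(LINT y|M. (norm (u y - g y))\<^sup>2) < \<epsilon>"
      using L2_function_in_K[OF u] unfolding K_def by blast
    then obtain F d where F: "finite F" "F \<subseteq> multi_indices" "g = (\<lambda>y. \<Sum>\<nu>\<in>F. \<phi> \<nu> y *\<^sub>R d \<nu>)"
      using S_expand by blast
    have "(LINT y|M. (norm (u y))\<^sup>2) + (\<Sum>\<nu>\<in>F. - U \<nu>) \<le> (LINT y|M. (norm (u y - g y))\<^sup>2)"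
      unfolding F(3) expansion_error_eq(2)[OF u F(1,2)] U_def
      by (intro add_left_mono sum_mono) simp
    then have "(LINT y|M. (norm (u y))\<^sup>2) \<le> (\<Sum>\<nu>\<in>F. U \<nu>) + \<epsilon>"
      using g(2) by (simp add: sum_negf)
    also have "(\<Sum>\<nu>\<in>F. U \<nu>) = (\<Sum>\<nu>\<in>F \<inter> \<Lambda>. U \<nu>) + (\<Sum>\<nu>\<in>F - \<Lambda>. U \<nu>)"
      using F(1) by (rule sum.Int_Diff)
    also have "(\<Sum>\<nu>\<in>F \<inter> \<Lambda>. U \<nu>) \<le> (\<Sum>\<nu>\<in>\<Lambda>. U \<nu>)"
      using L(1) by (intro sum_mono2) (auto simp: U_def)
    also have "(\<Sum>\<nu>\<in>F - \<Lambda>. U \<nu>) \<le> (\<Sum>\<^sub>\<infinity>\<nu>\<in>multi_indices - \<Lambda>. U \<nu>)"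
      using sm[folded U_def] F by (intro finite_sum_le_infsum) (auto simp: U_def)
    finally show "(LINT y|M. (norm (u y))\<^sup>2)
        \<le> (\<Sum>\<nu>\<in>\<Lambda>. U \<nu>) + (\<Sum>\<^sub>\<infinity>\<nu>\<in>multi_indices - \<Lambda>. U \<nu>) + \<epsilon>" by simp
  qed
  then show ?thesis
    unfolding expansion_error_eq(2)[OF u L] U_def by (simp add: sum_subtractf)
qed

text \<open>For \<open>u = 0\<close> the error identity says that the mean square of a combination
  is the sum of the squared norms of its coefficients.\<close>

lemma basis_independent:
  assumes F: "finite F" "F \<subseteq> multi_indices" and z: "AE y in M. (\<Sum>\<nu>\<in>F. \<phi> \<nu> y *\<^sub>R d \<nu>) = 0"
    and n: "\<nu> \<in> F"
  shows "d \<nu> = (0 :: 'g::{real_inner,banach,second_countable_topology})"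
proof -
  have [measurable]: "(\<lambda>y. \<Sum>\<nu>\<in>F. \<phi> \<nu> y *\<^sub>R d \<nu>) \<in> borel_measurable M" by measurable
  have "(LINT y|M. (norm (\<Sum>\<nu>\<in>F. \<phi> \<nu> y *\<^sub>R d \<nu>))\<^sup>2) = (LINT y|M. 0)"
    by (rule integral_cong_AE) (use z in auto)
  moreover have "(LINT y|M. (norm (0 - (\<Sum>\<nu>\<in>F. \<phi> \<nu> y *\<^sub>R d \<nu>)))\<^sup>2) = (\<Sum>\<nu>\<in>F. (norm (d \<nu>))\<^sup>2)"
    using expansion_error_eq(2)[of "\<lambda>_. 0 :: 'g" F d] F by (simp add: L2_function_def)
  ultimately have "(\<Sum>\<nu>\<in>F. (norm (d \<nu>))\<^sup>2) = 0" by simp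
  then show ?thesis using F(1) n by (simp add: sum_nonneg_eq_0_iff)
qed

end

section \<open>Hermite and Jacobi polynomials\<close>

text \<open>The leading term is removed by a multiple of \<open>p (Suc m)\<close>. At the bottom,
  \<open>p 0 \<noteq> 0\<close> has to be required because the zero polynomial also has degree
  0.\<close>

lemma poly_expand:
  fixes p :: "nat \<Rightarrow> real poly"
  assumes deg: "\<And>n. degree (p n) = n" and p0: "p 0 \<noteq> 0"
  shows "degree r \<le> m \<Longrightarrow> \<exists>c. r = (\<Sum>k\<le>m. smult (c k) (p k))"
proof (induction m arbitrary: r)
  case 0
  obtain a where a: "r = [:a:]" using 0 by (metis degree_eq_zeroE le_zero_eq)
  obtain d where d: "p 0 = [:d:]" using deg[of 0] by (metis degree_eq_zeroE)
  then have "d \<noteq> 0" using p0 by auto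
  then show ?case by (intro exI[of _ "\<lambda>_. a / d"]) (simp add: a d)
next
  case (Suc m)
  define l where "l = coeff (p (Suc m)) (Suc m)"
  have "p (Suc m) \<noteq> 0" using deg[of "Suc m"] by auto
  then have l: "l \<noteq> 0" unfolding l_def using deg[of "Suc m"] by (metis leading_coeff_0_iff)
  define r' where "r' = r - smult (coeff r (Suc m) / l) (p (Suc m))"
  have "degree r' \<le> m"
  proof (rule degree_le, intro allI impI)
    fix i assume "m < i"
    show "coeff r' i = 0"
    proof (cases "i = Suc m")
      case True
      then show ?thesis using l by (simp add: r'_def l_def)
    next
      case False
      then have "Suc m < i" using \<open>m < i\<close> by simp
      then show ?thesis using Suc.prems deg[of "Suc m"] by (simp add: r'_def coeff_eq_0)
    qed
  qed
  then obtain c where c: "r' = (\<Sum>k\<le>m. smult (c k) (p k))" using Suc.IH by blast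
  have "r = r' + smult (coeff r (Suc m) / l) (p (Suc m))" by (simp add: r'_def)
  also have "r' = (\<Sum>k\<le>m. smult ((c(Suc m := coeff r (Suc m) / l)) k) (p k))"
    unfolding c by (intro sum.cong) auto
  finally have "r = (\<Sum>k\<le>Suc m. smult ((c(Suc m := coeff r (Suc m) / l)) k) (p k))" by simp
  then show ?case by blast
qed

lemma orthonormal_system_poly:
  fixes p :: "nat \<Rightarrow> real poly"
  assumes \<mu>: "prob_space \<mu>" "sets \<mu> = sets borel"
    and p: "p 0 = 1" "\<And>n. degree (p n) = n"
    and int: "\<And>r. integrable \<mu> (\<lambda>s. poly r s * exp \<bar>s\<bar>)"
    and orth: "\<And>m n. (LINT s|\<mu>. poly (p m) s * poly (p n) s) = (if m = n then 1 else 0)"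
  shows "\<exists>c. orthonormal_system \<mu> (\<lambda>n. poly (p n)) c"
proof -
  have "\<exists>c. [:0, 1:] * p n = (\<Sum>k\<le>Suc n. smult (c k) (p k))" for n
  proof (rule poly_expand[OF p(2)])
    show "degree ([:0, 1:] * p n) \<le> Suc n"
      using degree_mult_le[of "[:0, 1:]" "p n"] p(2)[of n] by simp
  qed (simp add: p(1))
  then obtain c where c: "\<And>n. [:0, 1:] * p n = (\<Sum>k\<le>Suc n. smult (c n k) (p k))" by metis
  have "orthonormal_system \<mu> (\<lambda>n. poly (p n)) c"
    unfolding orthonormal_system_def orthonormal_system_axioms_def
  proof (intro conjI allI \<mu> orth)
    show "(\<lambda>x. poly (p n) x) \<in> borel_measurable borel" for n
      by (intro borel_measurable_continuous_onI continuous_intros)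
    show "poly (p 0) = (\<lambda>_. 1)" by (simp add: p(1) fun_eq_iff)
    show "integrable \<mu> (\<lambda>s. (poly (p n) s)\<^sup>2 * exp \<bar>s\<bar>)" for n
      using int[of "(p n)\<^sup>2"] by simp
    show "s * poly (p n) s = (\<Sum>k\<le>Suc n. c n k * poly (p k) s)" for n s
    proof -
      have "s * poly (p n) s = poly ([:0, 1:] * p n) s" by simp
      then show ?thesis unfolding c by (simp add: poly_sum)
    qed
  qed
  then show ?thesis by blast
qed

section \<open>Hermite polynomials\<close>

text \<open>The monic Hermite polynomials of probability theory; the recursion is what
  differentiating \<open>hermite_poly n\<close> times the Gaussian density yields, up to
  sign.\<close>

fun hermite_poly :: "nat \<Rightarrow> real poly" where
  "hermite_poly 0 = 1"
| "hermite_poly (Suc n) = [:0, 1:] * hermite_poly n - pderiv (hermite_poly n)"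

lemma std_normal_density_deriv:
  "(std_normal_density has_real_derivative (- s * std_normal_density s)) (at s)"
  unfolding std_normal_density_def[abs_def]
  by (auto intro!: derivative_eq_intros simp: field_simps)

lemma deriv_std_normal_density:
  "(deriv ^^ n) std_normal_density = (\<lambda>s. (- 1) ^ n * poly (hermite_poly n) s * std_normal_density s)"
proof (induction n)
  case (Suc n)
  have "((\<lambda>s. (- 1) ^ n * poly (hermite_poly n) s * std_normal_density s) has_real_derivative
      (- 1) ^ Suc n * poly (hermite_poly (Suc n)) s * std_normal_density s) (at s)" for s
    by (rule derivative_eq_intros poly_DERIV std_normal_density_deriv refl)+ (simp add: algebra_simps)
  then have "deriv (\<lambda>s. (- 1) ^ n * poly (hermite_poly n) s * std_normal_density s)
      = (\<lambda>s. (- 1) ^ Suc n * poly (hermite_poly (Suc n)) s * std_normal_density s)"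
    by (intro ext DERIV_imp_deriv)
  then show ?case using Suc.IH by simp
qed (simp add: fun_eq_iff)

lemma hermite_eq_poly: "hermite n s = poly (smult (1 / sqrt (fact n)) (hermite_poly n)) s"
proof -
  have "std_normal_density s \<noteq> 0" by (simp add: std_normal_density_def)
  moreover have "(- 1 :: real) ^ n * (- 1) ^ n = 1" by (simp flip: power_mult_distrib)
  ultimately show ?thesis
    unfolding hermite_def deriv_std_normal_density by (simp add: field_simps)
qed

text \<open>Differentiating \<open>x * h - h'\<close> gives \<open>h + (x * h' - h'')\<close>. By
  the induction hypothesis \<open>h'\<close> is a multiple of the previous polynomial, so the
  bracket is the same multiple of \<open>h\<close>.\<close>

lemma pderiv_hermite_poly: "pderiv (hermite_poly (Suc n)) = smult (real (Suc n)) (hermite_poly n)"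
proof (induction n)
  case (Suc n)
  have "pderiv (hermite_poly (Suc (Suc n)))
      = hermite_poly (Suc n) + ([:0, 1:] * pderiv (hermite_poly (Suc n)) - pderiv (pderiv (hermite_poly (Suc n))))"
  proof -
    have "pderiv ([:0, 1:] * h - pderiv h) = h + ([:0, 1:] * pderiv h - pderiv (pderiv h))" for h :: "real poly"
      by (simp add: pderiv_diff pderiv_mult pderiv_pCons algebra_simps)
    then show ?thesis unfolding hermite_poly.simps(2)[of "Suc n"] .
  qed
  also have "\<dots> = hermite_poly (Suc n) + smult (real (Suc n)) (hermite_poly (Suc n))"
  proof -
    have "[:0, 1:] * smult a h - pderiv (smult a h) = smult a ([:0, 1:] * h - pderiv h)" for a and h :: "real poly"
      by (simp add: pderiv_smult smult_diff_right)
    then show ?thesis by (simp only: Suc.IH hermite_poly.simps(2)[of n, symmetric])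
  qed
  also have "\<dots> = smult (real (Suc (Suc n))) (hermite_poly (Suc n))"
    by (simp only: smult_add_left[symmetric] smult_1_left of_nat_Suc[of "Suc n"])
      (simp only: smult_add_left smult_1_left add.commute)
  finally show ?case .
qed (simp add: pderiv_pCons one_pCons)

lemma degree_hermite_poly: "degree (hermite_poly n) = n"
proof (induction n)
  case (Suc n)
  have nz: "hermite_poly n \<noteq> 0" using Suc by (cases n) auto
  then have d: "degree ([:0, 1:] * hermite_poly n) = Suc n" using Suc by (simp add: degree_mult_eq)
  have "degree (- pderiv (hermite_poly n)) < Suc n" using Suc by (simp add: degree_pderiv)
  then have "degree ([:0, 1:] * hermite_poly n + - pderiv (hermite_poly n)) = Suc n"
    unfolding d[symmetric] by (rule degree_add_eq_left)
  then show ?case by (simp only: hermite_poly.simps diff_conv_add_uminus)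
qed simp

lemma integrable_normal_poly:
  fixes r :: "real poly"
  assumes "0 < \<sigma>"
  shows "integrable lborel (\<lambda>s. normal_density 0 \<sigma> s * poly r s)"
proof -
  have "integrable lborel (\<lambda>s. \<Sum>i\<le>degree r. coeff r i * (normal_density 0 \<sigma> s * (s - 0) ^ i))"
    by (intro Bochner_Integration.integrable_sum integrable_mult_right integrable_normal_moment assms)
  then show ?thesis by (simp add: poly_altdef sum_distrib_left mult_ac)
qed

text \<open>Gaussian integration by parts, verified on monomials, where it is the recursion
  \<open>m (n + 1) = n * m (n - 1)\<close> of the known moments, and extended by linearity.\<close>

lemma normal_poly_by_parts:
  fixes r :: "real poly"
  shows "(LINT s|lborel. std_normal_density s * poly ([:0, 1:] * r) s)
    = (LINT s|lborel. std_normal_density s * poly (pderiv r) s)"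
proof -
  let ?L = "\<lambda>r. LINT s|lborel. std_normal_density s * poly r s"
  have lin: "?L (\<Sum>i\<in>I. smult (a i) (f i)) = (\<Sum>i\<in>I. a i * ?L (f i))" for I :: "nat set" and a and f :: "nat \<Rightarrow> real poly"
  proof -
    have "?L (\<Sum>i\<in>I. smult (a i) (f i)) = (LINT s|lborel. (\<Sum>i\<in>I. a i * (std_normal_density s * poly (f i) s)))"
      by (simp add: poly_sum sum_distrib_left mult_ac)
    also have "\<dots> = (\<Sum>i\<in>I. LINT s|lborel. a i * (std_normal_density s * poly (f i) s))"
      by (intro Bochner_Integration.integral_sum integrable_mult_right integrable_normal_poly) simp
    finally show ?thesis by simp
  qed
  have even: "?L (monom 1 (2 * k)) = fact (2 * k) / (2 ^ k * fact k)" for k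
    by (simp add: poly_monom integral_std_normal_moment_even)
  have odd: "?L (monom 1 (2 * k + 1)) = 0" for k
    using integral_std_normal_moment_odd[of k] by (simp add: poly_monom)
  \<comment> \<open>For \<open>n = 0\<close> the truncated \<open>n - 1\<close> is harmless, because
    the right-hand side carries the factor 0.\<close>
  have mono: "?L (monom 1 (Suc n)) = real n * ?L (monom 1 (n - 1))" for n
  proof (cases "even n")
    case True
    then obtain k where k: "n = 2 * k" by (elim evenE)
    show ?thesis
    proof (cases k)
      case 0
      then show ?thesis using odd[of 0] k by simp
    next
      case (Suc l)
      then have "n - 1 = 2 * l + 1" "Suc n = 2 * k + 1" using k by auto
      then show ?thesis using odd[of l] odd[of k] by (simp only:)
    qed
  next
    case False
    then obtain k where k: "n = 2 * k + 1" by (elim oddE)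
    then have e: "Suc n = 2 * Suc k" "n - 1 = 2 * k" by auto
    have "fact (2 * Suc k) / (2 ^ Suc k * fact (Suc k)) = real n * (fact (2 * k) / (2 ^ k * fact k))"
    proof -
      have "fact (2 * Suc k) = 2 * real (Suc k) * (2 * real k + 1) * fact (2 * k)"
        "2 ^ Suc k * fact (Suc k) = 2 * 2 ^ k * (real (Suc k) * fact k)"
        by (simp_all add: algebra_simps)
      moreover have "real n = 2 * real k + 1" by (simp add: k)
      moreover have "2 * z * x * F / (2 * P * (z * G)) = x * (F / (P * G))" if "z \<noteq> 0" for x z F P G :: real
        using that by simp
      ultimately show ?thesis by (simp only: of_nat_eq_0_iff nat.simps not_False_eq_True)
    qed
    then show ?thesis by (simp only: e even)
  qed
  have r: "r = (\<Sum>i\<le>degree r. smult (coeff r i) (monom 1 i))"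
    using poly_as_sum_of_monoms[of r] by (simp add: smult_monom)
  have 1: "[:0, 1:] * r = (\<Sum>i\<le>degree r. smult (coeff r i) (monom 1 (Suc i)))"
  proof -
    have "[:0, 1:] * r = (\<Sum>i\<le>degree r. [:0, 1:] * smult (coeff r i) (monom 1 i))"
      by (subst (1) r) (simp only: sum_distrib_left)
    also have "\<dots> = (\<Sum>i\<le>degree r. smult (coeff r i) (monom 1 (Suc i)))"
      by (simp add: monom_Suc)
    finally show ?thesis .
  qed
  have pd: "pderiv (monom (1::real) n) = smult (real n) (monom 1 (n - 1))" for n
    by (simp add: pderiv_monom smult_monom)
  have 2: "pderiv r = (\<Sum>i\<le>degree r. smult (coeff r i * real i) (monom 1 (i - 1)))"
  proof -
    have "pderiv (\<Sum>i\<in>I. f i) = (\<Sum>i\<in>I. pderiv (f i))" for I :: "nat set" and f :: "nat \<Rightarrow> real poly"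
      by (induction I rule: infinite_finite_induct) (simp_all add: pderiv_add)
    note pderiv_sum = this
    have "pderiv r = (\<Sum>i\<le>degree r. pderiv (smult (coeff r i) (monom 1 i)))"
      by (subst (1) r) (simp only: pderiv_sum)
    then show ?thesis by (simp add: pderiv_smult pd)
  qed
  show ?thesis
    unfolding 1 2 lin mono by (simp add: mult_ac)
qed

text \<open>Raising the index of a Hermite polynomial is adjoint to differentiation under the
  Gaussian weight (\<open>shift\<close>). Differentiation lowers the other index, so
  \<open>m\<close> and \<open>n\<close> descend together and the factors build up
  \<open>fact n\<close>.\<close>

lemma hermite_poly_orth:
  "(LINT s|lborel. std_normal_density s * poly (hermite_poly m * hermite_poly n) s) = (if m = n then fact n else 0)"
proof -
  let ?L = "\<lambda>r. LINT s|lborel. std_normal_density s * poly r s"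
  have shift: "?L (hermite_poly (Suc m) * r) = ?L (hermite_poly m * pderiv r)" for m r
  proof -
    have "hermite_poly (Suc m) * r = [:0, 1:] * (hermite_poly m * r) - pderiv (hermite_poly m) * r"
      by (simp add: algebra_simps)
    then have "?L (hermite_poly (Suc m) * r)
        = (LINT s|lborel. std_normal_density s * poly ([:0, 1:] * (hermite_poly m * r)) s
            - std_normal_density s * poly (pderiv (hermite_poly m) * r) s)"
      by (simp only: poly_diff right_diff_distrib)
    also have "\<dots> = ?L ([:0, 1:] * (hermite_poly m * r)) - ?L (pderiv (hermite_poly m) * r)"
      by (intro Bochner_Integration.integral_diff integrable_normal_poly) simp_all
    also have "?L ([:0, 1:] * (hermite_poly m * r)) = ?L (pderiv (hermite_poly m * r))"
      by (rule normal_poly_by_parts)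
    also have "\<dots> - ?L (pderiv (hermite_poly m) * r)
        = (LINT s|lborel. std_normal_density s * poly (pderiv (hermite_poly m * r)) s
            - std_normal_density s * poly (pderiv (hermite_poly m) * r) s)"
      by (intro Bochner_Integration.integral_diff[symmetric] integrable_normal_poly) simp_all
    also have "\<dots> = ?L (hermite_poly m * pderiv r)"
      by (simp add: pderiv_mult algebra_simps)
    finally show ?thesis .
  qed
  have one: "?L 1 = 1"
    using integral_std_normal_moment_even[of 0] by simp
  have scale: "?L (smult a r) = a * ?L r" for a r
    by (simp add: mult.left_commute)
  show ?thesis
  proof (induction m arbitrary: n)
    case 0
    show ?case
    proof (cases n)
      case (Suc k)
      have "?L (hermite_poly 0 * hermite_poly n) = ?L (hermite_poly (Suc k) * 1)" by (simp add: Suc)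
      also have "\<dots> = 0" unfolding shift by simp
      finally show ?thesis using Suc by simp
    qed (use one in simp)
  next
    case (Suc m)
    show ?case
    proof (cases n)
      case 0
      have "?L (hermite_poly (Suc m) * hermite_poly 0) = 0" unfolding shift by simp
      then show ?thesis using 0 by simp
    next
      case (Suc k)
      have "?L (hermite_poly (Suc m) * hermite_poly n) = ?L (smult (real (Suc k)) (hermite_poly m * hermite_poly k))"
        unfolding shift Suc pderiv_hermite_poly by simp
      also have "\<dots> = real (Suc k) * (if m = k then fact k else 0)"
        unfolding scale Suc.IH ..
      finally show ?thesis using Suc by simp
    qed
  qed
qed

lemma hermite_orthonormal_system:
  "\<exists>c. orthonormal_system (density lborel std_normal_density)
     (\<lambda>n. poly (smult (1 / sqrt (fact n)) (hermite_poly n))) c"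
proof (rule orthonormal_system_poly)
  show "prob_space (density lborel std_normal_density)" by (rule prob_space_normal_density) simp
  show "degree (smult (1 / sqrt (fact n)) (hermite_poly n)) = n" for n
    by (simp add: degree_hermite_poly)
  show "integrable (density lborel std_normal_density) (\<lambda>s. poly r s * exp \<bar>s\<bar>)" for r
  proof -
    have "integrable lborel (\<lambda>s. std_normal_density s * (poly r s * exp \<bar>s\<bar>))"
    proof (rule Bochner_Integration.integrable_bound)
      \<comment> \<open>The exponential is absorbed by a Gaussian of variance 2, since
        \<open>\<bar>s\<bar> - s\<^sup>2 / 2 \<le> 1 - s\<^sup>2 / 4\<close>; \<open>sqrt 2\<close>
        is the ratio of the two normalizing factors.\<close>
      show "integrable lborel (\<lambda>s. sqrt 2 * exp 1 * (normal_density 0 (sqrt 2) s * poly r s))"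
        by (intro integrable_mult_right integrable_normal_poly) simp
      show "(\<lambda>s. std_normal_density s * (poly r s * exp \<bar>s\<bar>)) \<in> borel_measurable lborel"
        unfolding std_normal_density_def
        by (simp, intro borel_measurable_continuous_onI continuous_intros) auto
      have "std_normal_density s * exp \<bar>s\<bar> \<le> sqrt 2 * exp 1 * normal_density 0 (sqrt 2) s" for s
      proof -
        have "0 \<le> (\<bar>s\<bar> / 2 - 1)\<^sup>2" by simp
        then have "- s\<^sup>2 / 2 + \<bar>s\<bar> \<le> 1 + - s\<^sup>2 / 4"
          by (simp add: power2_eq_square algebra_simps)
        then have "exp (- s\<^sup>2 / 2) * exp \<bar>s\<bar> \<le> exp 1 * exp (- s\<^sup>2 / 4)"
          by (simp only: exp_add[symmetric] exp_le_cancel_iff)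
        then have "(1 / sqrt (2 * pi)) * (exp (- s\<^sup>2 / 2) * exp \<bar>s\<bar>) \<le> (1 / sqrt (2 * pi)) * (exp 1 * exp (- s\<^sup>2 / 4))"
          by (rule mult_left_mono) simp
        also have "\<dots> = sqrt 2 * exp 1 * normal_density 0 (sqrt 2) s"
        proof -
          have "sqrt (2 * pi * (sqrt 2)\<^sup>2) = sqrt (2 * pi) * sqrt 2"
            by (simp only: real_sqrt_mult real_sqrt_abs) simp
          then show ?thesis unfolding normal_density_def by simp
        qed
        finally show ?thesis by (simp add: std_normal_density_def)
      qed
      then have "(std_normal_density s * exp \<bar>s\<bar>) * \<bar>poly r s\<bar> \<le> (sqrt 2 * exp 1 * normal_density 0 (sqrt 2) s) * \<bar>poly r s\<bar>" for s
        by (rule mult_right_mono) simp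
      then show "AE s in lborel. norm (std_normal_density s * (poly r s * exp \<bar>s\<bar>))
          \<le> norm (sqrt 2 * exp 1 * (normal_density 0 (sqrt 2) s * poly r s))"
        by (auto simp: abs_mult mult_ac)
    qed
    then show ?thesis
      by (subst integrable_real_density) (auto intro!: borel_measurable_continuous_onI continuous_intros)
  qed
  show "(LINT s|density lborel std_normal_density. poly (smult (1 / sqrt (fact m)) (hermite_poly m)) s *
      poly (smult (1 / sqrt (fact n)) (hermite_poly n)) s) = (if m = n then 1 else 0)" for m n
  proof -
    have "(LINT s|density lborel std_normal_density. poly (smult (1 / sqrt (fact m)) (hermite_poly m)) s *
        poly (smult (1 / sqrt (fact n)) (hermite_poly n)) s)
      = (LINT s|lborel. std_normal_density s * (poly (smult (1 / sqrt (fact m)) (hermite_poly m)) s *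
        poly (smult (1 / sqrt (fact n)) (hermite_poly n)) s))"
      by (subst integral_real_density) (auto intro!: borel_measurable_continuous_onI continuous_intros)
    also have "\<dots> = (LINT s|lborel. (1 / sqrt (fact m) * (1 / sqrt (fact n))) *
        (std_normal_density s * poly (hermite_poly m * hermite_poly n) s))"
      by (intro Bochner_Integration.integral_cong) (simp_all add: mult_ac)
    also have "\<dots> = (1 / sqrt (fact m) * (1 / sqrt (fact n))) * (if m = n then fact n else 0)"
      by (simp only: integral_mult_right_zero hermite_poly_orth)
    finally show ?thesis by auto
  qed
qed simp_all

section \<open>Jacobi polynomials\<close>

lemma jacobi_orthonormal_system:
  assumes J: "jacobi_polynomials \<alpha> \<beta> J"
  shows "\<exists>c. orthonormal_system (jacobi_measure \<alpha> \<beta>) (\<lambda>n. poly (J n)) c"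
    and "AE s in jacobi_measure \<alpha> \<beta>. s \<in> {-1..1}"
proof -
  let ?\<mu> = "jacobi_measure \<alpha> \<beta>"
  have J0: "J 0 = 1" and deg: "\<And>n. degree (J n) = n"
    and orth: "\<And>m n. (LINT s|?\<mu>. poly (J m) s * poly (J n) s) = (if m = n then 1 else 0)"
    using J by (auto simp: jacobi_polynomials_def)
  have sets: "sets ?\<mu> = sets borel" by (simp add: jacobi_measure_def)
  have sp: "space ?\<mu> = UNIV" using sets_eq_imp_space_eq[OF sets] by simp
  \<comment> \<open>The total mass is read off from the orthonormality of \<open>J 0 = 1\<close>
    instead of a Beta integral. Infinite mass is excluded as well, since \<open>measure\<close>
    would then be 0.\<close>
  have "measure ?\<mu> UNIV = 1" using orth[of 0 0] by (simp add: J0 sp)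
  then have "emeasure ?\<mu> (space ?\<mu>) = 1"
    unfolding sp measure_def by (cases "emeasure ?\<mu> UNIV") auto
  then have prob: "prob_space ?\<mu>" by (rule prob_spaceI)
  then interpret prob_space ?\<mu> .
  have wm: "(\<lambda>s. jacobi_weight \<alpha> \<beta> s / (LINT s|lborel. jacobi_weight \<alpha> \<beta> s)) \<in> borel_measurable lborel"
    unfolding jacobi_weight_def by measurable
  show ae: "AE s in ?\<mu>. s \<in> {-1..1}"
    unfolding jacobi_measure_def using wm
    by (subst AE_density) (auto simp: jacobi_weight_def indicator_def)
  have int: "integrable ?\<mu> (\<lambda>s. poly r s * exp \<bar>s\<bar>)" for r
  proof -
    have "compact ((\<lambda>s. poly r s * exp \<bar>s\<bar>) ` {-1..1})"
      by (intro compact_continuous_image continuous_intros) auto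
    then have "bounded ((\<lambda>s. poly r s * exp \<bar>s\<bar>) ` {-1..1})" by (rule compact_imp_bounded)
    then obtain B where B: "\<And>s. s \<in> {-1..1} \<Longrightarrow> norm (poly r s * exp \<bar>s\<bar>) \<le> B"
      unfolding bounded_iff by (metis imageI)
    show ?thesis
    proof (rule integrable_const_bound[where B = B])
      show "AE s in ?\<mu>. norm (poly r s * exp \<bar>s\<bar>) \<le> B" using ae by eventually_elim (rule B)
      have "(\<lambda>s. poly r s * exp \<bar>s\<bar>) \<in> borel_measurable borel"
        by (intro borel_measurable_continuous_onI continuous_intros)
      then show "(\<lambda>s. poly r s * exp \<bar>s\<bar>) \<in> borel_measurable ?\<mu>"
        using measurable_cong_sets[OF sets refl] by blast
    qed
  qed
  show "\<exists>c. orthonormal_system ?\<mu> (\<lambda>n. poly (J n)) c"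
    by (rule orthonormal_system_poly[OF prob sets J0 deg int orth])
qed

section \<open>The Poincare inequality\<close>

text \<open>Difference quotients of \<open>F\<close> integrate to 0 by translation invariance of
  Lebesgue measure. The mean value theorem bounds them uniformly and their supports stay in one
  compact set, so the integral of the limit \<open>G\<close> is 0 too.\<close>

lemma integral_directional_derivative_eq_0:
  fixes F G :: "'a::euclidean_space \<Rightarrow> real"
  assumes d: "\<And>x. ((\<lambda>t. F (x + t *\<^sub>R e)) has_real_derivative G x) (at 0)"
    and cF: "continuous_on UNIV F" and cG: "continuous_on UNIV G"
    and K: "compact K" "\<And>x. x \<notin> K \<Longrightarrow> F x = 0"
  shows "(LINT x|lborel. G x) = 0"
proof -
  have GK: "G x = 0" if "x \<notin> K" for x
  proof -
    have "open (- K)" using K(1) compact_imp_closed by blast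
    moreover have "((\<lambda>t. x + t *\<^sub>R e) \<longlongrightarrow> x + 0 *\<^sub>R e) (at 0)" by (intro tendsto_intros)
    ultimately have "\<forall>\<^sub>F t in at 0. x + t *\<^sub>R e \<in> - K"
      using that by (intro topological_tendstoD) auto
    then have "\<forall>\<^sub>F t in nhds 0. F (x + t *\<^sub>R e) = (0::real)"
      unfolding eventually_at_filter
    proof eventually_elim
      case (elim t)
      then show ?case using K(2)[of "x + t *\<^sub>R e"] K(2)[OF that] by (cases "t = 0") auto
    qed
    then have "((\<lambda>t. 0::real) has_real_derivative G x) (at 0)"
      using d[of x] K(2)[OF that] by (subst (asm) DERIV_cong_ev[OF refl _ refl]) auto
    then show ?thesis using DERIV_unique[OF _ DERIV_const] by blast
  qed
  have dt: "((\<lambda>t. F (x + t *\<^sub>R e)) has_real_derivative G (x + t *\<^sub>R e)) (at t)" for x t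
  proof -
    have "((\<lambda>s. F ((x + t *\<^sub>R e) + s *\<^sub>R e)) has_real_derivative G (x + t *\<^sub>R e)) (at 0)" by (rule d)
    then have "((\<lambda>s. F (x + (s + t) *\<^sub>R e)) has_real_derivative G (x + t *\<^sub>R e)) (at 0)"
      by (simp add: algebra_simps)
    then show ?thesis
      using DERIV_shift[of "\<lambda>t. F (x + t *\<^sub>R e)" "G (x + t *\<^sub>R e)" 0 t] by (simp add: add.commute)
  qed
  have "bounded (G ` K)"
    using cG K(1) by (intro compact_imp_bounded compact_continuous_image) (auto intro: continuous_on_subset)
  then obtain C0 where C0: "\<And>x. x \<in> K \<Longrightarrow> norm (G x) \<le> C0"
    unfolding bounded_iff by blast
  define C where "C = max C0 0"
  have C: "\<bar>G x\<bar> \<le> C" for x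
    using C0[of x] GK[of x] by (cases "x \<in> K") (auto simp: C_def)
  \<comment> \<open>The points from which a step along \<open>e\<close> of length at most 1 can
    reach \<open>K\<close>; outside \<open>K'\<close> all difference quotients in use
    vanish.\<close>
  define K' where "K' = (\<lambda>z. fst z - snd z *\<^sub>R e) ` (K \<times> {0..1})"
  have K': "compact K'" unfolding K'_def
    by (intro compact_continuous_image compact_Times K(1) compact_Icc continuous_intros)
  have K'I: "x \<in> K'" if "x + t *\<^sub>R e \<in> K" "0 \<le> t" "t \<le> 1" for x t
    unfolding K'_def using that by (intro image_eqI[of _ _ "(x + t *\<^sub>R e, t)"]) auto
  define q where "q n x = real (Suc n) * (F (x + inverse (real (Suc n)) *\<^sub>R e) - F x)" for n x
  have Fb: "F \<in> borel_measurable borel" using cF by (rule borel_measurable_continuous_onI)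
  have Gb: "G \<in> borel_measurable borel" using cG by (rule borel_measurable_continuous_onI)
  have F: "integrable lborel F"
  proof -
    have "integrable lborel (\<lambda>x. indicator K x *\<^sub>R F x)"
      by (rule borel_integrable_compact[OF K(1)]) (use cF in \<open>auto intro: continuous_on_subset\<close>)
    also have "(\<lambda>x. indicator K x *\<^sub>R F x) = F" using K(2) by (auto simp: indicator_def fun_eq_iff)
    finally show ?thesis .
  qed
  have shift: "integrable lborel (\<lambda>x. F (x + c))" "(LINT x|lborel. F (x + c)) = (LINT x|lborel. F x)" for c
  proof -
    have "integrable (distr lborel borel ((+) c)) F" using F by (simp add: lborel_distr_plus)
    then show "integrable lborel (\<lambda>x. F (x + c))"
      by (subst (asm) integrable_distr_eq) (use Fb in \<open>auto simp: add.commute\<close>)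
    have "(LINT x|lborel. F x) = (LINT x|distr lborel borel ((+) c). F x)" by (simp add: lborel_distr_plus)
    also have "\<dots> = (LINT x|lborel. F (c + x))" by (rule integral_distr) (use Fb in auto)
    finally show "(LINT x|lborel. F (x + c)) = (LINT x|lborel. F x)" by (simp add: add.commute)
  qed
  have q0: "(LINT x|lborel. q n x) = 0" for n
    unfolding q_def using shift F by simp
  have "(\<lambda>n. LINT x|lborel. q n x) \<longlonglongrightarrow> (LINT x|lborel. G x)"
  proof (rule integral_dominated_convergence[where w = "\<lambda>x. C * indicator K' x"])
    show "G \<in> borel_measurable lborel" using Gb by simp
    have "(\<lambda>x. F (x + c)) \<in> borel_measurable lborel" for c
      using shift(1) by (rule borel_measurable_integrable)
    then show "q n \<in> borel_measurable lborel" for n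
      unfolding q_def[abs_def] using Fb by simp
    show "integrable lborel (\<lambda>x. C * indicator K' x)"
      using borel_integrable_compact[OF K', of "\<lambda>_. 1::real"] by (intro integrable_mult_right) auto
    show "AE x in lborel. (\<lambda>n. q n x) \<longlonglongrightarrow> G x"
    proof (rule AE_I2)
      fix x
      have l: "((\<lambda>h. (F (x + (0 + h) *\<^sub>R e) - F (x + 0 *\<^sub>R e)) / h) \<longlongrightarrow> G x) (at 0)"
        using d[of x] unfolding DERIV_def .
      have "filterlim (\<lambda>n. inverse (real (Suc n))) (at 0) sequentially"
        unfolding filterlim_at using LIMSEQ_inverse_real_of_nat by auto
      from filterlim_compose[OF l this] show "(\<lambda>n. q n x) \<longlonglongrightarrow> G x"
        by (simp add: q_def divide_inverse mult.commute)
    qed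
    show "AE x in lborel. norm (q n x) \<le> C * indicator K' x" for n
    proof (rule AE_I2)
      fix x
      define h where "h = inverse (real (Suc n))"
      have h: "0 < h" "h \<le> 1" by (auto simp: h_def inverse_le_1_iff)
      show "norm (q n x) \<le> C * indicator K' x"
      proof (cases "x \<in> K'")
        case False
        then have "x \<notin> K" "x + h *\<^sub>R e \<notin> K" using K'I[of x 0] K'I[of x h] h by auto
        then show ?thesis using False K(2) by (simp add: q_def h_def)
      next
        case True
        obtain z where z: "0 < z" "z < h" "F (x + h *\<^sub>R e) - F (x + 0 *\<^sub>R e) = (h - 0) * G (x + z *\<^sub>R e)"
          using MVT2[of 0 h "\<lambda>t. F (x + t *\<^sub>R e)" "\<lambda>t. G (x + t *\<^sub>R e)"] h(1) dt by auto
        then have "q n x = real (Suc n) * h * G (x + z *\<^sub>R e)" by (simp add: q_def h_def)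
        also have "real (Suc n) * h = 1" by (simp add: h_def)
        finally show ?thesis using C True by simp
      qed
    qed
  qed
  then show ?thesis unfolding q0 using LIMSEQ_unique[OF _ tendsto_const] by metis
qed

lemma frechet_derivative_Basis_sum:
  fixes \<phi> :: "'a::euclidean_space \<Rightarrow> real"
  assumes "\<phi> differentiable (at x)"
  shows "frechet_derivative \<phi> (at x) v = gradient \<phi> x \<bullet> v"
proof -
  interpret bounded_linear "frechet_derivative \<phi> (at x)"
    using assms frechet_derivative_works has_derivative_bounded_linear by blast
  have "frechet_derivative \<phi> (at x) v = frechet_derivative \<phi> (at x) (\<Sum>i\<in>Basis. (v \<bullet> i) *\<^sub>R i)"
    by (simp add: euclidean_representation)
  also have "\<dots> = (\<Sum>i\<in>Basis. (v \<bullet> i) * frechet_derivative \<phi> (at x) i)"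
    by (simp add: sum scaleR)
  also have "\<dots> = gradient \<phi> x \<bullet> v"
    by (simp add: gradient_def inner_sum_left inner_commute[of v] mult.commute)
  finally show ?thesis .
qed

lemma Ck_diff: "(\<forall>k. Ck k \<phi>) \<Longrightarrow> \<phi> differentiable (at x)"
  using Ck.simps(2) by blast

text \<open>Integrating the derivative along \<open>e\<close> of
  \<open>(x \<bullet> e) * (\<phi> x)\<^sup>2\<close> gives 0, which says that the squared norm of
  \<open>\<phi>\<close> is its inner product with \<open>\<psi> = - 2 * (x \<bullet> e) * (gradient
  \<phi> x \<bullet> e)\<close>. Cauchy-Schwarz and \<open>\<bar>x \<bullet> e\<bar> \<le> R\<close>
  on the support conclude.\<close>

lemma poincare_test_function:
  fixes D :: "'a::euclidean_space set"
  assumes \<phi>: "\<phi> \<in> test_functions D" and R: "\<And>x. x \<in> D \<Longrightarrow> norm x \<le> R" "0 \<le> R"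
  shows "norm (abs_L2 \<phi>) \<le> 2 * R * norm (abs_L2 (gradient \<phi>))"
proof -
  obtain K where C: "\<forall>k. Ck k \<phi>" and K: "compact K" "K \<subseteq> D" "\<And>x. x \<notin> K \<Longrightarrow> \<phi> x = 0"
    using \<phi> unfolding test_functions_def by blast
  obtain e :: 'a where e: "e \<in> Basis" by (meson ex_in_conv nonempty_Basis)
  have df: "(\<phi> has_derivative (\<lambda>v. gradient \<phi> x \<bullet> v)) (at x)" for x
    using Ck_diff[OF C, of x] frechet_derivative_Basis_sum[of \<phi> x]
    by (metis (no_types, lifting) ext frechet_derivative_works)
  have c: "continuous_on UNIV \<phi>" "continuous_on UNIV (gradient \<phi>)"
    using C by (rule Ck_imp_continuous, rule continuous_on_gradient)
  note sq = test_function_square_integrable[OF \<phi>]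
  define \<psi> where "\<psi> x = - 2 * (x \<bullet> e) * (gradient \<phi> x \<bullet> e)" for x
  \<comment> \<open>Cutting off to the support of \<open>\<phi>\<close> makes the bound by
    \<open>R\<close> valid everywhere, without changing the product with
    \<open>\<phi>\<close>.\<close>
  define \<psi>' where "\<psi>' x = indicator K x * \<psi> x" for x
  define F G where "F x = (x \<bullet> e) * (\<phi> x)\<^sup>2" and "G x = (\<phi> x)\<^sup>2 - \<phi> x * \<psi> x" for x
  have "(LINT x|lborel. G x) = 0"
  proof (rule integral_directional_derivative_eq_0[where F = F and K = K and e = e])
    fix x
    have 1: "((\<lambda>t. x + t *\<^sub>R e) has_derivative (\<lambda>t. t *\<^sub>R e)) (at 0)"
      by (auto intro!: derivative_eq_intros)
    have "((\<phi> \<circ> (\<lambda>t. x + t *\<^sub>R e)) has_derivative ((\<lambda>v. gradient \<phi> x \<bullet> v) \<circ> (\<lambda>t. t *\<^sub>R e))) (at 0)"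
      by (rule diff_chain_at[OF 1]) (simp add: df)
    moreover have "(\<lambda>t. t * (gradient \<phi> x \<bullet> e)) = (*) (gradient \<phi> x \<bullet> e)"
      by (simp add: fun_eq_iff)
    ultimately have "((\<lambda>t. \<phi> (x + t *\<^sub>R e)) has_real_derivative (gradient \<phi> x \<bullet> e)) (at 0)"
      by (simp only: has_field_derivative_def o_def inner_scaleR_right)
    then show "((\<lambda>t. F (x + t *\<^sub>R e)) has_real_derivative G x) (at 0)"
      unfolding F_def G_def \<psi>_def using e
      by (auto intro!: derivative_eq_intros simp: inner_add_left power2_eq_square algebra_simps)
  next
    show "continuous_on UNIV F" "continuous_on UNIV G"
      unfolding F_def[abs_def] G_def[abs_def] \<psi>_def[abs_def] using c
      by (auto intro!: continuous_intros)
    show "F x = 0" if "x \<notin> K" for x using K(3)[OF that] by (simp add: F_def)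
  qed (rule K(1))
  then have "(LINT x|lebesgue. G x) = 0"
    by (subst integral_completion)
      (auto intro!: borel_measurable_continuous_onI continuous_intros c simp: G_def[abs_def] \<psi>_def[abs_def])
  moreover have eq: "G x = \<phi> x \<bullet> \<phi> x - \<phi> x \<bullet> \<psi>' x" for x
    using K(3)[of x] by (cases "x \<in> K") (auto simp: G_def \<psi>'_def power2_eq_square)
  have \<psi>b: "\<bar>\<psi>' x\<bar> \<le> 2 * R * norm (gradient \<phi> x)" for x
  proof (cases "x \<in> K")
    case True
    have "\<bar>x \<bullet> e\<bar> \<le> norm x" "\<bar>gradient \<phi> x \<bullet> e\<bar> \<le> norm (gradient \<phi> x)"
      using Basis_le_norm[OF e] by auto
    moreover have "norm x \<le> R" using True K(2) R(1) by auto
    ultimately have "\<bar>x \<bullet> e\<bar> * \<bar>gradient \<phi> x \<bullet> e\<bar> \<le> R * norm (gradient \<phi> x)"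
      by (intro mult_mono) auto
    then show ?thesis using True by (simp add: \<psi>'_def \<psi>_def abs_mult)
  qed (use R in \<open>simp add: \<psi>'_def\<close>)
  have \<psi>: "square_integrable \<psi>'"
  proof (rule square_integrable_bound)
    show "integrable lebesgue (\<lambda>x. (2 * R)\<^sup>2 * (norm (gradient \<phi> x))\<^sup>2)"
      using sq(2) by (simp add: square_integrable_def)
    show "\<psi>' \<in> borel_measurable lebesgue"
      unfolding \<psi>'_def[abs_def]
    proof (intro borel_measurable_times borel_measurable_indicator)
      show "K \<in> sets lebesgue" using K(1) by (simp add: borel_compact)
      show "\<psi> \<in> borel_measurable lebesgue"
        unfolding \<psi>_def[abs_def] using c
        by (intro measurable_completion) (auto intro!: borel_measurable_continuous_onI continuous_intros)
    qed
    show "AE x in lebesgue. (norm (\<psi>' x))\<^sup>2 \<le> (2 * R)\<^sup>2 * (norm (gradient \<phi> x))\<^sup>2"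
      using \<psi>b power_mono[of "\<bar>\<psi>' _\<bar>" _ 2] by (intro AE_I2) (metis abs_ge_zero power_mult_distrib real_norm_def)
  qed
  ultimately have "(LINT x|lebesgue. \<phi> x \<bullet> \<phi> x) - (LINT x|lebesgue. \<phi> x \<bullet> \<psi>' x) = 0"
    unfolding eq Bochner_Integration.integral_diff[OF integrable_inner_square_integrable[OF sq(1) sq(1)]
      integrable_inner_square_integrable[OF sq(1) \<psi>], symmetric] by -
  then have 0: "(norm (abs_L2 \<phi>))\<^sup>2 = abs_L2 \<phi> \<bullet> abs_L2 \<psi>'"
    unfolding power2_norm_eq_inner inner_abs_L2[OF sq(1) sq(1)] inner_abs_L2[OF sq(1) \<psi>] by simp
  have "(norm (abs_L2 \<psi>'))\<^sup>2 \<le> (2 * R * norm (abs_L2 (gradient \<phi>)))\<^sup>2"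
  proof -
    have "(norm (abs_L2 \<psi>'))\<^sup>2 = (LINT x|lebesgue. (norm (\<psi>' x))\<^sup>2)" by (rule norm_abs_L2_power2[OF \<psi>])
    also have "\<dots> \<le> (LINT x|lebesgue. (2 * R)\<^sup>2 * (norm (gradient \<phi> x))\<^sup>2)"
    proof (rule integral_mono)
      show "integrable lebesgue (\<lambda>x. (norm (\<psi>' x))\<^sup>2)" using \<psi> by (simp add: square_integrable_def)
      show "integrable lebesgue (\<lambda>x. (2 * R)\<^sup>2 * (norm (gradient \<phi> x))\<^sup>2)"
        using sq(2) by (simp add: square_integrable_def)
      show "(norm (\<psi>' x))\<^sup>2 \<le> (2 * R)\<^sup>2 * (norm (gradient \<phi> x))\<^sup>2" for x
        using power_mono[OF \<psi>b[of x], of 2] by (simp add: power_mult_distrib)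
    qed
    also have "\<dots> = (2 * R * norm (abs_L2 (gradient \<phi>)))\<^sup>2"
      by (simp add: norm_abs_L2_power2[OF sq(2)] power_mult_distrib)
    finally show ?thesis .
  qed
  then have 1: "norm (abs_L2 \<psi>') \<le> 2 * R * norm (abs_L2 (gradient \<phi>))"
    by (rule power2_le_imp_le) (use R in simp)
  have "norm (abs_L2 \<phi>) * norm (abs_L2 \<phi>) \<le> norm (abs_L2 \<phi>) * norm (abs_L2 \<psi>')"
    using 0 norm_cauchy_schwarz[of "abs_L2 \<phi>" "abs_L2 \<psi>'"] by (simp add: power2_eq_square)
  then have "norm (abs_L2 \<phi>) \<le> norm (abs_L2 \<psi>')"
    by (cases "norm (abs_L2 \<phi>) = 0") (auto simp: mult_le_cancel_left)
  with 1 show ?thesis by linarith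
qed

lemma closed_H10: "closed (H10 D)" by (simp add: H10_def)

text \<open>The inequality between the two components defines a closed set containing the test
  functions, hence their closure. The additional 1 in the constant accounts for the gradient part of
  the product norm.\<close>

lemma poincare_H10:
  fixes D :: "'a::euclidean_space set"
  assumes "bounded D"
  shows "\<exists>C>0. \<forall>v\<in>H10 D. norm v \<le> C * normV v"
proof -
  obtain R where R: "0 < R" "\<And>x. x \<in> D \<Longrightarrow> norm x \<le> R"
    using assms unfolding bounded_pos by blast
  have "norm (fst v) \<le> 2 * R * norm (snd v)" if "v \<in> H10 D" for v :: "'a H1"
  proof -
    have "closed {v :: 'a H1. norm (fst v) \<le> 2 * R * norm (snd v)}"
      by (intro closed_Collect_le continuous_intros)
    moreover have "(\<lambda>\<phi>. (abs_L2 \<phi>, abs_L2 (gradient \<phi>))) ` test_functions D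
        \<subseteq> {v :: 'a H1. norm (fst v) \<le> 2 * R * norm (snd v)}"
      using poincare_test_function[OF _ R(2)] R(1) by auto
    ultimately show ?thesis using closure_minimal that unfolding H10_def by blast
  qed
  moreover have "norm v \<le> norm (fst v) + norm (snd v)" for v :: "'a H1"
    using norm_Pair_le[of "fst v" "snd v"] by simp
  ultimately have "norm v \<le> 2 * R * norm (snd v) + norm (snd v)" if "v \<in> H10 D" for v :: "'a H1"
    using that by (meson add_right_mono order_trans)
  then have "norm v \<le> (2 * R + 1) * normV v" if "v \<in> H10 D" for v :: "'a H1"
    using that by (simp add: normV_def distrib_right)
  then show ?thesis using R(1) by (intro exI[of _ "2 * R + 1"]) auto
qed

section \<open>Linear structure of the space and support of weak gradients\<close>

lemma Ck_add: "Ck k \<phi> \<Longrightarrow> Ck k \<psi> \<Longrightarrow> Ck k (\<lambda>x. \<phi> x + \<psi> x)"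
proof (induction k arbitrary: \<phi> \<psi>)
  case (Suc k)
  have "frechet_derivative (\<lambda>x. \<phi> x + \<psi> x) (at x) = (\<lambda>i. frechet_derivative \<phi> (at x) i + frechet_derivative \<psi> (at x) i)" for x
    using Suc.prems by (intro frechet_derivative_at[symmetric] has_derivative_add)
      (auto simp: frechet_derivative_works[symmetric])
  then show ?case using Suc by (auto intro!: differentiable_add)
qed (auto intro: continuous_intros)

lemma Ck_scale: "Ck k \<phi> \<Longrightarrow> Ck k (\<lambda>x. c * \<phi> x)"
proof (induction k arbitrary: \<phi>)
  case (Suc k)
  have "frechet_derivative (\<lambda>x. c * \<phi> x) (at x) = (\<lambda>i. c * frechet_derivative \<phi> (at x) i)" for x
    using Suc.prems by (intro frechet_derivative_at[symmetric] has_derivative_mult_right)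
      (auto simp: frechet_derivative_works[symmetric])
  then show ?case using Suc by (auto intro!: differentiable_mult)
qed (auto intro: continuous_intros)

lemma gradient_add:
  fixes \<phi> \<psi> :: "'a::euclidean_space \<Rightarrow> real"
  assumes "\<forall>k. Ck k \<phi>" "\<forall>k. Ck k \<psi>"
  shows "gradient (\<lambda>x. \<phi> x + \<psi> x) = (\<lambda>x. gradient \<phi> x + gradient \<psi> x)"
proof
  fix x
  have "frechet_derivative (\<lambda>x. \<phi> x + \<psi> x) (at x) = (\<lambda>i. frechet_derivative \<phi> (at x) i + frechet_derivative \<psi> (at x) i)"
    using Ck_diff[OF assms(1), of x] Ck_diff[OF assms(2), of x]
    by (intro frechet_derivative_at[symmetric] has_derivative_add) (auto simp: frechet_derivative_works[symmetric])
  then show "gradient (\<lambda>x. \<phi> x + \<psi> x) x = gradient \<phi> x + gradient \<psi> x"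
    by (simp add: gradient_def scaleR_add_left sum.distrib)
qed

lemma gradient_scale:
  fixes \<phi> :: "'a::euclidean_space \<Rightarrow> real"
  assumes "\<forall>k. Ck k \<phi>"
  shows "gradient (\<lambda>x. c * \<phi> x) = (\<lambda>x. c *\<^sub>R gradient \<phi> x)"
proof
  fix x
  have "frechet_derivative (\<lambda>x. c * \<phi> x) (at x) = (\<lambda>i. c * frechet_derivative \<phi> (at x) i)"
    using Ck_diff[OF assms, of x]
    by (intro frechet_derivative_at[symmetric] has_derivative_mult_right) (auto simp: frechet_derivative_works[symmetric])
  then show "gradient (\<lambda>x. c * \<phi> x) x = c *\<^sub>R gradient \<phi> x"
    by (simp add: gradient_def scaleR_sum_right)
qed

lemma subspace_closure_normed:
  fixes S :: "'v::real_normed_vector set"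
  assumes "subspace S"
  shows "subspace (closure S)"
proof (rule subspaceI)
  show "0 \<in> closure S" using assms closure_subset subspace_0 by blast
  show "x + y \<in> closure S" if xy: "x \<in> closure S" "y \<in> closure S" for x y
  proof -
    obtain f g where "\<And>n. f n \<in> S" "f \<longlonglongrightarrow> x" "\<And>n. g n \<in> S" "g \<longlonglongrightarrow> y"
      using xy unfolding closure_sequential by metis
    then show ?thesis
      unfolding closure_sequential using subspace_add[OF assms] tendsto_add[of f x _ g y]
      by (intro exI[of _ "\<lambda>n. f n + g n"]) auto
  qed
  show "c *\<^sub>R x \<in> closure S" if x: "x \<in> closure S" for c x
  proof -
    obtain f where "\<And>n. f n \<in> S" "f \<longlonglongrightarrow> x"
      using x unfolding closure_sequential by metis
    then show ?thesis
      unfolding closure_sequential using subspace_scale[OF assms] tendsto_scaleR[OF tendsto_const, of f x _ c]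
      by (intro exI[of _ "\<lambda>n. c *\<^sub>R f n"]) auto
  qed
qed

lemma subspace_H10: "subspace (H10 (D :: 'a::euclidean_space set))"
  unfolding H10_def
proof (rule subspace_closure_normed, rule subspaceI)
  let ?i = "\<lambda>\<phi> :: 'a \<Rightarrow> real. (abs_L2 \<phi>, abs_L2 (gradient \<phi>))"
  have T0: "(\<lambda>_. 0) \<in> test_functions D"
  proof -
    have "Ck k (\<lambda>_ :: 'a. 0 :: real)" for k by (induction k) auto
    then show ?thesis unfolding test_functions_def by (auto intro!: exI[of _ "{}"])
  qed
  show "0 \<in> ?i ` test_functions D"
    by (rule image_eqI[OF _ T0]) (simp add: gradient_def[abs_def] zero_prod_def zero_L2.abs_eq)
  show "x + y \<in> ?i ` test_functions D" if xy: "x \<in> ?i ` test_functions D" "y \<in> ?i ` test_functions D" for x y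
  proof -
    obtain \<phi> \<psi> where p: "\<phi> \<in> test_functions D" "x = ?i \<phi>" "\<psi> \<in> test_functions D" "y = ?i \<psi>" using xy by blast
    obtain K K' where K: "compact K" "K \<subseteq> D" "\<And>x. x \<notin> K \<Longrightarrow> \<phi> x = 0"
      "compact K'" "K' \<subseteq> D" "\<And>x. x \<notin> K' \<Longrightarrow> \<psi> x = 0" and C: "\<forall>k. Ck k \<phi>" "\<forall>k. Ck k \<psi>"
      using p unfolding test_functions_def by blast
    have "(\<lambda>x. \<phi> x + \<psi> x) \<in> test_functions D"
      unfolding test_functions_def
    proof (intro CollectI conjI exI[of _ "K \<union> K'"] allI impI)
      show "Ck k (\<lambda>x. \<phi> x + \<psi> x)" for k using C by (blast intro: Ck_add)
      show "\<phi> x + \<psi> x = 0" if "x \<notin> K \<union> K'" for x using that K(3)[of x] K(6)[of x] by simp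
    qed (use K in auto)
    moreover have "x + y = ?i (\<lambda>x. \<phi> x + \<psi> x)"
      using test_function_square_integrable[OF p(1)] test_function_square_integrable[OF p(3)]
      by (simp add: p gradient_add[OF C] add_abs_L2)
    ultimately show ?thesis by blast
  qed
  show "c *\<^sub>R x \<in> ?i ` test_functions D" if x: "x \<in> ?i ` test_functions D" for c x
  proof -
    obtain \<phi> where p: "\<phi> \<in> test_functions D" "x = ?i \<phi>" using x by blast
    obtain K where K: "compact K" "K \<subseteq> D" "\<And>x. x \<notin> K \<Longrightarrow> \<phi> x = 0" and C: "\<forall>k. Ck k \<phi>"
      using p unfolding test_functions_def by blast
    have "(\<lambda>x. c * \<phi> x) \<in> test_functions D"
      unfolding test_functions_def using C K by (auto intro!: Ck_scale exI[of _ K])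
    moreover have "c *\<^sub>R x = ?i (\<lambda>x. c * \<phi> x)"
      using p test_function_square_integrable[OF p(1)] by (simp add: gradient_scale[OF C] scaleR_abs_L2)
    ultimately show ?thesis by blast
  qed
qed

text \<open>Orthogonality to the cut-off \<open>h\<close> of the gradient is a closed condition, and
  it holds for test functions because their gradients vanish off a compact subset of
  \<open>D\<close>. For \<open>v\<close> itself it says that \<open>h\<close> has norm 0. Thus
  ellipticity on \<open>D\<close> alone suffices for coercivity of integrals over the whole
  space.\<close>

lemma weak_grad_outside:
  fixes D :: "'a::euclidean_space set"
  assumes D: "open D" and v: "v \<in> H10 D"
  shows "AE x in lebesgue. x \<notin> D \<longrightarrow> weak_grad v x = 0"
proof -
  have Ds: "- D \<in> sets lebesgue" using D by (simp add: borel_open)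
  define g where "g = weak_grad v"
  have g: "square_integrable g" by (simp add: g_def weak_grad_def square_integrable_rep_L2)
  define h where "h x = indicator (- D) x *\<^sub>R g x" for x
  have h: "square_integrable h"
  proof (rule square_integrable_bound)
    show "integrable lebesgue (\<lambda>x. (norm (g x))\<^sup>2)" using g by (simp add: square_integrable_def)
    show "h \<in> borel_measurable lebesgue"
      unfolding h_def[abs_def] using g Ds by (intro borel_measurable_scaleR borel_measurable_indicator) (auto simp: square_integrable_def)
    show "AE x in lebesgue. (norm (h x))\<^sup>2 \<le> (norm (g x))\<^sup>2" by (intro AE_I2) (auto simp: h_def indicator_def)
  qed
  have "closed {w :: 'a H1. snd w \<bullet> abs_L2 h = 0}" by (intro closed_Collect_eq continuous_intros)
  moreover have "(\<lambda>\<phi>. (abs_L2 \<phi>, abs_L2 (gradient \<phi>))) ` test_functions D \<subseteq> {w :: 'a H1. snd w \<bullet> abs_L2 h = 0}"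
  proof clarsimp
    fix \<phi> :: "'a \<Rightarrow> real" assume \<phi>: "\<phi> \<in> test_functions D"
    then obtain K where C: "\<forall>k. Ck k \<phi>" and K: "compact K" "K \<subseteq> D" "\<And>x. x \<notin> K \<Longrightarrow> \<phi> x = 0"
      unfolding test_functions_def by blast
    have "gradient \<phi> x = 0" if "x \<notin> K" for x
    proof -
      have "(\<phi> has_derivative (\<lambda>_. 0)) (at x)"
      proof (rule has_derivative_transform_within_open[where f = "\<lambda>_. 0" and s = "- K"])
        show "open (- K)" using K(1) compact_imp_closed by blast
      qed (use that K in auto)
      then have "frechet_derivative \<phi> (at x) = (\<lambda>_. 0)" by (metis frechet_derivative_at)
      then show ?thesis by (simp add: gradient_def)
    qed
    then have "gradient \<phi> x \<bullet> h x = 0" for x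
      using K(2) by (cases "x \<in> K") (auto simp: h_def indicator_def)
    then show "abs_L2 (gradient \<phi>) \<bullet> abs_L2 h = 0"
      by (simp add: inner_abs_L2 test_function_square_integrable[OF \<phi>] h)
  qed
  ultimately have "snd v \<bullet> abs_L2 h = 0" using v closure_minimal unfolding H10_def by blast
  moreover have "snd v = abs_L2 g" by (simp add: g_def weak_grad_def abs_rep_L2)
  moreover have "g x \<bullet> h x = (norm (h x))\<^sup>2" for x by (simp add: h_def power2_norm_eq_inner indicator_def)
  ultimately have "(LINT x|lebesgue. (norm (h x))\<^sup>2) = 0" by (simp add: inner_abs_L2 g h)
  then have "AE x in lebesgue. (norm (h x))\<^sup>2 = 0"
    using h by (subst (asm) integral_nonneg_eq_0_iff_AE) (auto simp: square_integrable_def)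
  then show ?thesis by eventually_elim (auto simp: h_def g_def indicator_def)
qed

section \<open>The affine problem\<close>

definition mult_L2 :: "('a::euclidean_space \<Rightarrow> real) \<Rightarrow> ('a, 'b::euclidean_space) L2 \<Rightarrow> ('a, 'b) L2" where
  "mult_L2 m g = abs_L2 (\<lambda>x. m x *\<^sub>R rep_L2 g x)"

text \<open>The bound is an explicit argument so that it can be shared by all members of a sequence
  of coefficients.\<close>

definition ess_bdd :: "('a::euclidean_space \<Rightarrow> real) \<Rightarrow> real \<Rightarrow> bool" where
  "ess_bdd m B \<longleftrightarrow> 0 \<le> B \<and> m \<in> borel_measurable lebesgue \<and> (AE x in lebesgue. \<bar>m x\<bar> \<le> B)"

lemma abs_L2_eqI:
  assumes "square_integrable f" "square_integrable g" "AE x in lebesgue. f x = g x"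
  shows "abs_L2 f = abs_L2 g"
  using Quotient3_rel_abs[OF Quotient3_L2] assms by blast

lemma rep_L2_add: "AE x in lebesgue. rep_L2 (g + h) x = rep_L2 g x + rep_L2 h x"
proof -
  have "g + h = abs_L2 (\<lambda>x. rep_L2 g x + rep_L2 h x)"
    using add_abs_L2[of "rep_L2 g" "rep_L2 h"] by (simp add: abs_rep_L2 square_integrable_rep_L2)
  then show ?thesis
    using rep_abs_L2[of "\<lambda>x. rep_L2 g x + rep_L2 h x"] by (simp add: square_integrable_add square_integrable_rep_L2)
qed

lemma rep_L2_scaleR: "AE x in lebesgue. rep_L2 (c *\<^sub>R g) x = c *\<^sub>R rep_L2 g x"
proof -
  have "c *\<^sub>R g = abs_L2 (\<lambda>x. c *\<^sub>R rep_L2 g x)"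
    using scaleR_abs_L2[of "rep_L2 g" c] by (simp add: abs_rep_L2 square_integrable_rep_L2)
  then show ?thesis
    using rep_abs_L2[of "\<lambda>x. c *\<^sub>R rep_L2 g x"] by (simp add: square_integrable_scaleR square_integrable_rep_L2)
qed

lemma ess_bdd_mult_bound:
  fixes f :: "'a::euclidean_space \<Rightarrow> 'b::euclidean_space"
  assumes "ess_bdd m B"
  shows "AE x in lebesgue. (norm (m x *\<^sub>R f x))\<^sup>2 \<le> B\<^sup>2 * (norm (f x))\<^sup>2"
proof -
  have "AE x in lebesgue. \<bar>m x\<bar> \<le> B" using assms by (simp add: ess_bdd_def)
  then show ?thesis
  proof eventually_elim
    case (elim x)
    then have "\<bar>m x\<bar>\<^sup>2 \<le> B\<^sup>2" by (rule power_mono) simp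
    then show ?case by (simp add: power_mult_distrib mult_right_mono)
  qed
qed

lemma square_integrable_mult:
  assumes m: "ess_bdd m B" and f: "square_integrable f"
  shows "square_integrable (\<lambda>x. m x *\<^sub>R f x)"
proof (rule square_integrable_bound[OF _ _ ess_bdd_mult_bound[OF m]])
  show "(\<lambda>x. m x *\<^sub>R f x) \<in> borel_measurable lebesgue"
    using m f by (auto simp: ess_bdd_def square_integrable_def)
  show "integrable lebesgue (\<lambda>x. B\<^sup>2 * (norm (f x))\<^sup>2)" using f by (simp add: square_integrable_def)
qed

lemmas square_integrable_mult_rep = square_integrable_mult[OF _ square_integrable_rep_L2]

lemma mult_L2_inner:
  assumes m: "ess_bdd m B"
  shows "integrable lebesgue (\<lambda>x. m x * (rep_L2 g x \<bullet> rep_L2 h x))"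
    and "mult_L2 m g \<bullet> h = (LINT x|lebesgue. m x * (rep_L2 g x \<bullet> rep_L2 h x))"
proof -
  note sq = square_integrable_mult_rep[OF m, of g] square_integrable_rep_L2[of h]
  show "integrable lebesgue (\<lambda>x. m x * (rep_L2 g x \<bullet> rep_L2 h x))"
    using integrable_inner_square_integrable[OF sq] by simp
  have "mult_L2 m g \<bullet> h = abs_L2 (\<lambda>x. m x *\<^sub>R rep_L2 g x) \<bullet> abs_L2 (rep_L2 h)"
    by (simp only: mult_L2_def abs_rep_L2)
  also have "\<dots> = (LINT x|lebesgue. m x * (rep_L2 g x \<bullet> rep_L2 h x))"
    by (simp add: inner_abs_L2[OF sq])
  finally show "mult_L2 m g \<bullet> h = (LINT x|lebesgue. m x * (rep_L2 g x \<bullet> rep_L2 h x))" .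
qed

lemma mult_L2_norm_le:
  assumes m: "ess_bdd m B"
  shows "norm (mult_L2 m g) \<le> B * norm g"
proof (rule power2_le_imp_le)
  have "(norm (mult_L2 m g))\<^sup>2 = (LINT x|lebesgue. (norm (m x *\<^sub>R rep_L2 g x))\<^sup>2)"
    unfolding mult_L2_def by (rule norm_abs_L2_power2[OF square_integrable_mult_rep[OF m]])
  also have "\<dots> \<le> (LINT x|lebesgue. B\<^sup>2 * (norm (rep_L2 g x))\<^sup>2)"
    using square_integrable_mult_rep[OF m, of g] square_integrable_rep_L2[of g]
    by (intro integral_mono_AE ess_bdd_mult_bound[OF m]) (auto simp: square_integrable_def)
  also have "\<dots> = B\<^sup>2 * (norm (abs_L2 (rep_L2 g)))\<^sup>2"
    by (simp add: norm_abs_L2_power2[OF square_integrable_rep_L2])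
  finally show "(norm (mult_L2 m g))\<^sup>2 \<le> (B * norm g)\<^sup>2" by (simp add: abs_rep_L2 power_mult_distrib)
  show "0 \<le> B * norm g" using m by (simp add: ess_bdd_def)
qed

lemma bounded_linear_mult_L2:
  assumes m: "ess_bdd m B"
  shows "bounded_linear (mult_L2 m)"
proof (rule bounded_linear_intro[where K = B])
  note sq = square_integrable_mult_rep[OF m]
  show "mult_L2 m (g + h) = mult_L2 m g + mult_L2 m h" for g h
    unfolding mult_L2_def add_abs_L2[OF sq sq]
  proof (rule abs_L2_eqI[OF sq square_integrable_add[OF sq sq]])
    show "AE x in lebesgue. m x *\<^sub>R rep_L2 (g + h) x = m x *\<^sub>R rep_L2 g x + m x *\<^sub>R rep_L2 h x"
      using rep_L2_add[of g h] by eventually_elim (simp add: scaleR_add_right)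
  qed
  show "mult_L2 m (c *\<^sub>R g) = c *\<^sub>R mult_L2 m g" for c g
    unfolding mult_L2_def scaleR_abs_L2[OF sq]
  proof (rule abs_L2_eqI[OF sq square_integrable_scaleR[OF sq]])
    show "AE x in lebesgue. m x *\<^sub>R rep_L2 (c *\<^sub>R g) x = c *\<^sub>R m x *\<^sub>R rep_L2 g x"
      using rep_L2_scaleR[of c g] by eventually_elim simp
  qed
  show "norm (mult_L2 m g) \<le> norm g * B" for g
    using mult_L2_norm_le[OF m, of g] by (simp add: mult.commute)
qed

lemma mult_L2_add:
  assumes "ess_bdd m B" "ess_bdd m' B'"
  shows "mult_L2 (\<lambda>x. m x + m' x) g = mult_L2 m g + mult_L2 m' g"
  unfolding mult_L2_def add_abs_L2[OF square_integrable_mult_rep[OF assms(1)] square_integrable_mult_rep[OF assms(2)]]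
  by (simp add: scaleR_add_left)

lemma mult_L2_scale:
  assumes "ess_bdd m B"
  shows "mult_L2 (\<lambda>x. c * m x) g = c *\<^sub>R mult_L2 m g"
  unfolding mult_L2_def scaleR_abs_L2[OF square_integrable_mult_rep[OF assms]] by simp

lemma ess_bdd_add:
  assumes "ess_bdd m B" "ess_bdd m' B'"
  shows "ess_bdd (\<lambda>x. m x + m' x) (B + B')"
proof -
  have "AE x in lebesgue. \<bar>m x\<bar> \<le> B" "AE x in lebesgue. \<bar>m' x\<bar> \<le> B'"
    using assms by (auto simp: ess_bdd_def)
  then have "AE x in lebesgue. \<bar>m x + m' x\<bar> \<le> B + B'" by eventually_elim linarith
  then show ?thesis using assms by (auto simp: ess_bdd_def)
qed

lemma ess_bdd_scale:
  assumes "ess_bdd m B"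
  shows "ess_bdd (\<lambda>x. c * m x) (\<bar>c\<bar> * B)"
proof -
  have "AE x in lebesgue. \<bar>m x\<bar> \<le> B" using assms by (auto simp: ess_bdd_def)
  then have "AE x in lebesgue. \<bar>c * m x\<bar> \<le> \<bar>c\<bar> * B" by eventually_elim (simp add: abs_mult mult_left_mono)
  then show ?thesis using assms by (auto simp: ess_bdd_def)
qed

lemma mult_L2_sum:
  assumes "finite I" "\<And>i. i \<in> I \<Longrightarrow> ess_bdd (m i) (B i)"
  shows "mult_L2 (\<lambda>x. \<Sum>i\<in>I. c i * m i x) g = (\<Sum>i\<in>I. c i *\<^sub>R mult_L2 (m i) g)
    \<and> ess_bdd (\<lambda>x. \<Sum>i\<in>I. c i * m i x) (\<Sum>i\<in>I. \<bar>c i\<bar> * B i)"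
  using assms
proof (induction rule: finite_induct)
  case empty
  then show ?case by (simp add: mult_L2_def ess_bdd_def zero_L2.abs_eq)
next
  case (insert i I)
  then have 1: "ess_bdd (\<lambda>x. c i * m i x) (\<bar>c i\<bar> * B i)" by (intro ess_bdd_scale) auto
  have 2: "ess_bdd (\<lambda>x. \<Sum>i\<in>I. c i * m i x) (\<Sum>i\<in>I. \<bar>c i\<bar> * B i)"
    and 3: "mult_L2 (\<lambda>x. \<Sum>i\<in>I. c i * m i x) g = (\<Sum>i\<in>I. c i *\<^sub>R mult_L2 (m i) g)"
    using insert by auto
  show ?case
    using mult_L2_add[OF 1 2, of g] ess_bdd_add[OF 1 2] mult_L2_scale[of "m i" "B i" "c i" g] insert 3
    by simp
qed

text \<open>Dominated convergence for a fixed \<open>g\<close>. Convergence in operator norm would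
  require uniform convergence of the coefficients, which the affine series does not provide.\<close>

lemma mult_L2_tendsto:
  assumes m: "\<And>n. ess_bdd (m n) B" and m': "ess_bdd m' B"
    and lim: "AE x in lebesgue. (\<lambda>n. m n x) \<longlonglongrightarrow> m' x"
  shows "(\<lambda>n. mult_L2 (m n) g) \<longlonglongrightarrow> mult_L2 m' g"
proof -
  let ?g = "rep_L2 g"
  note g = square_integrable_rep_L2[of g]
  have sq: "square_integrable (\<lambda>x. m n x *\<^sub>R ?g x - m' x *\<^sub>R ?g x)" for n
    by (intro square_integrable_diff square_integrable_mult_rep[OF m] square_integrable_mult_rep[OF m'])
  have e: "(dist (mult_L2 (m n) g) (mult_L2 m' g))\<^sup>2 = (LINT x|lebesgue. (norm (m n x *\<^sub>R ?g x - m' x *\<^sub>R ?g x))\<^sup>2)" for n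
    unfolding dist_norm mult_L2_def diff_abs_L2[OF square_integrable_mult_rep[OF m] square_integrable_mult_rep[OF m']]
    by (rule norm_abs_L2_power2[OF sq])
  have "(\<lambda>n. LINT x|lebesgue. (norm (m n x *\<^sub>R ?g x - m' x *\<^sub>R ?g x))\<^sup>2) \<longlonglongrightarrow> (LINT x::'a|lebesgue. 0 :: real)"
  proof (rule integral_dominated_convergence[where w = "\<lambda>x. (2 * B)\<^sup>2 * (norm (?g x))\<^sup>2"])
    show "integrable lebesgue (\<lambda>x. (2 * B)\<^sup>2 * (norm (?g x))\<^sup>2)" using g by (simp add: square_integrable_def)
    show "(\<lambda>x. (norm (m n x *\<^sub>R ?g x - m' x *\<^sub>R ?g x))\<^sup>2) \<in> borel_measurable lebesgue" for n
      using sq[of n] by (auto simp: square_integrable_def)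
    show "AE x in lebesgue. (\<lambda>n. (norm (m n x *\<^sub>R ?g x - m' x *\<^sub>R ?g x))\<^sup>2) \<longlonglongrightarrow> 0"
      using lim
    proof eventually_elim
      case (elim x)
      then have "(\<lambda>n. (norm (m n x *\<^sub>R ?g x - m' x *\<^sub>R ?g x))\<^sup>2) \<longlonglongrightarrow> (norm (m' x *\<^sub>R ?g x - m' x *\<^sub>R ?g x))\<^sup>2"
        by (intro tendsto_intros)
      then show ?case by simp
    qed
    show "AE x in lebesgue. norm ((norm (m n x *\<^sub>R ?g x - m' x *\<^sub>R ?g x))\<^sup>2) \<le> (2 * B)\<^sup>2 * (norm (?g x))\<^sup>2" for n
    proof -
      have "AE x in lebesgue. \<bar>m n x\<bar> \<le> B" "AE x in lebesgue. \<bar>m' x\<bar> \<le> B"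
        using m[of n] m' by (auto simp: ess_bdd_def)
      then show ?thesis
      proof eventually_elim
        case (elim x)
        then have "\<bar>m n x - m' x\<bar> \<le> 2 * B" by linarith
        then have "\<bar>m n x - m' x\<bar>\<^sup>2 \<le> (2 * B)\<^sup>2" by (rule power_mono) simp
        then show ?case
          unfolding scaleR_diff_left[symmetric] norm_scaleR power_mult_distrib[of "\<bar>_\<bar>"]
          by (auto intro!: mult_right_mono)
      qed
    qed
  qed simp
  then have "(\<lambda>n. (dist (mult_L2 (m n) g) (mult_L2 m' g))\<^sup>2) \<longlonglongrightarrow> 0" unfolding e by simp
  then have "(\<lambda>n. sqrt ((dist (mult_L2 (m n) g) (mult_L2 m' g))\<^sup>2)) \<longlonglongrightarrow> sqrt 0"
    by (rule tendsto_real_sqrt)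
  then show ?thesis unfolding tendsto_dist_iff[of "\<lambda>n. mult_L2 (m n) g"] by simp
qed

lemma has_vector_derivative_quotient:
  fixes f :: "real \<Rightarrow> 'v::real_normed_vector"
  shows "(f has_vector_derivative d) (at x) \<longleftrightarrow> ((\<lambda>h. (f (x + h) - f x) /\<^sub>R h) \<longlongrightarrow> d) (at 0)"
proof -
  have "norm ((f (x + h) - f x) /\<^sub>R h - d) = norm (f (x + h) - f x - h *\<^sub>R d) / norm h" if "h \<noteq> 0" for h
  proof -
    have "(f (x + h) - f x) /\<^sub>R h - d = inverse h *\<^sub>R (f (x + h) - f x - h *\<^sub>R d)"
      using that by (simp add: scaleR_diff_right)
    then show ?thesis by (simp add: divide_inverse mult.commute)
  qed
  then have "((\<lambda>h. norm (f (x + h) - f x - h *\<^sub>R d) / norm h) \<longlongrightarrow> 0) (at 0)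
      \<longleftrightarrow> ((\<lambda>h. norm ((f (x + h) - f x) /\<^sub>R h - d)) \<longlongrightarrow> 0) (at 0)"
    by (intro tendsto_cong) (auto simp: eventually_at_filter)
  also have "\<dots> \<longleftrightarrow> ((\<lambda>h. (f (x + h) - f x) /\<^sub>R h) \<longlongrightarrow> d) (at 0)"
    unfolding tendsto_norm_zero_iff by (rule Lim_null[symmetric])
  finally show ?thesis
    unfolding has_vector_derivative_def has_derivative_at by (simp add: bounded_linear_scaleR_left)
qed

section \<open>The affine problem: operators, coercivity, continuity\<close>

text \<open>The problem is posed on the whole space with coefficients that are cut off outside
  \<open>D\<close> in the application; hence the factor \<open>indicator D\<close> in the
  ellipticity margin.\<close>

locale affine_problem =
  fixes D :: "'a::euclidean_space set" and ab :: "'a \<Rightarrow> real" and ps :: "nat \<Rightarrow> 'a \<Rightarrow> real"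
    and f :: "'a H1 \<Rightarrow> real" and u :: "(nat \<Rightarrow> real) \<Rightarrow> 'a H1" and r0 B0 :: real
  assumes D_open: "open D" and D_bdd: "bounded D" and f_dual: "f \<in> H10_dual D"
    and r0: "0 < r0" and ab: "ess_bdd ab B0" and ps_meas: "\<And>j. ps j \<in> borel_measurable lebesgue"
    and uea: "AE x in lebesgue. summable (\<lambda>j. \<bar>ps j x\<bar>) \<and> (\<Sum>j. \<bar>ps j x\<bar>) \<le> ab x - r0 * indicator D x"
    and sol: "\<And>y. y \<in> unit_cube \<Longrightarrow> u y \<in> H10 D"
      "\<And>y v. y \<in> unit_cube \<Longrightarrow> v \<in> H10 D \<Longrightarrow>
         (LINT x|lebesgue. (ab x + (\<Sum>j. y j * ps j x)) * (weak_grad (u y) x \<bullet> weak_grad v x)) = f v"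
begin

abbreviation A0 :: "('a, 'a) L2 \<Rightarrow> ('a, 'a) L2" where "A0 \<equiv> mult_L2 ab"
abbreviation P :: "nat \<Rightarrow> ('a, 'a) L2 \<Rightarrow> ('a, 'a) L2" where "P j \<equiv> mult_L2 (ps j)"

definition am :: "(nat \<Rightarrow> real) \<Rightarrow> 'a \<Rightarrow> real" where "am y x = ab x + (\<Sum>j. y j * ps j x)"
abbreviation A :: "(nat \<Rightarrow> real) \<Rightarrow> ('a, 'a) L2 \<Rightarrow> ('a, 'a) L2" where "A y \<equiv> mult_L2 (am y)"

lemma B0: "0 \<le> B0" using ab by (simp add: ess_bdd_def)

lemma ps_summable_AE: "AE x in lebesgue. summable (\<lambda>j. \<bar>ps j x\<bar>) \<and> (\<Sum>j. \<bar>ps j x\<bar>) \<le> B0"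
proof -
  have "AE x in lebesgue. \<bar>ab x\<bar> \<le> B0" using ab by (simp add: ess_bdd_def)
  with uea show ?thesis
  proof eventually_elim
    case (elim x)
    have "0 \<le> r0 * indicator D x" using r0 by simp
    then show ?case using elim by linarith
  qed
qed

lemma ps_bdd: "ess_bdd (ps j) B0"
proof -
  have "AE x in lebesgue. \<bar>ps j x\<bar> \<le> B0"
    using ps_summable_AE
  proof eventually_elim
    case (elim x)
    then have "(\<Sum>i\<in>{j}. \<bar>ps i x\<bar>) \<le> (\<Sum>i. \<bar>ps i x\<bar>)" by (intro sum_le_suminf) auto
    then show ?case using elim by simp
  qed
  then show ?thesis using B0 ps_meas by (simp add: ess_bdd_def)
qed

lemma partial_sum_bdd:
  assumes y: "\<And>j. \<bar>y j\<bar> \<le> 1"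
  shows "ess_bdd (\<lambda>x. \<Sum>j<n. y j * ps j x) B0"
proof -
  have "AE x in lebesgue. \<bar>\<Sum>j<n. y j * ps j x\<bar> \<le> B0"
    using ps_summable_AE
  proof eventually_elim
    case (elim x)
    have "\<bar>\<Sum>j<n. y j * ps j x\<bar> \<le> (\<Sum>j<n. \<bar>y j * ps j x\<bar>)" by (rule sum_abs)
    also have "\<dots> \<le> (\<Sum>j<n. \<bar>ps j x\<bar>)"
      using y by (intro sum_mono) (simp add: abs_mult mult_left_le_one_le)
    also have "\<dots> \<le> (\<Sum>j. \<bar>ps j x\<bar>)" using elim by (intro sum_le_suminf) auto
    finally show ?case using elim by linarith
  qed
  then show ?thesis using B0 ps_meas by (auto simp: ess_bdd_def)
qed

lemma cube_abs: "y \<in> unit_cube \<longleftrightarrow> (\<forall>j. \<bar>y j\<bar> \<le> 1)"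
  by (auto simp: unit_cube_def abs_le_iff minus_le_iff[of _ 1])

lemma summable_cube:
  assumes "y \<in> unit_cube" "summable (\<lambda>j. \<bar>ps j x\<bar>)"
  shows "summable (\<lambda>j. y j * ps j x)" "\<bar>\<Sum>j. y j * ps j x\<bar> \<le> (\<Sum>j. \<bar>ps j x\<bar>)"
proof -
  have le: "\<bar>y j * ps j x\<bar> \<le> \<bar>ps j x\<bar>" for j
    using assms(1) by (simp add: cube_abs abs_mult mult_left_le_one_le)
  have s: "summable (\<lambda>j. \<bar>y j * ps j x\<bar>)"
    by (rule summable_comparison_test'[OF assms(2)]) (use le in auto)
  then show "summable (\<lambda>j. y j * ps j x)" by (rule summable_rabs_cancel)
  have "\<bar>\<Sum>j. y j * ps j x\<bar> \<le> (\<Sum>j. \<bar>y j * ps j x\<bar>)" by (rule summable_rabs[OF s])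
  also have "\<dots> \<le> (\<Sum>j. \<bar>ps j x\<bar>)" by (rule suminf_le[OF le s assms(2)])
  finally show "\<bar>\<Sum>j. y j * ps j x\<bar> \<le> (\<Sum>j. \<bar>ps j x\<bar>)" .
qed

lemma series_bdd: "y \<in> unit_cube \<Longrightarrow> ess_bdd (\<lambda>x. \<Sum>j. y j * ps j x) B0"
proof -
  assume y: "y \<in> unit_cube"
  have "AE x in lebesgue. \<bar>\<Sum>j. y j * ps j x\<bar> \<le> B0"
    using ps_summable_AE by eventually_elim (use summable_cube[OF y] in force)
  moreover have "(\<lambda>x. \<Sum>j. y j * ps j x) \<in> borel_measurable lebesgue"
    using ps_meas by measurable
  ultimately show ?thesis using B0 by (simp add: ess_bdd_def)
qed

lemma am_bdd: "y \<in> unit_cube \<Longrightarrow> ess_bdd (am y) (B0 + B0)"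
  unfolding am_def[abs_def] by (rule ess_bdd_add[OF ab series_bdd])

lemma solA: "y \<in> unit_cube \<Longrightarrow> v \<in> H10 D \<Longrightarrow> A y (snd (u y)) \<bullet> snd v = f v"
  using sol(2)[of y v] mult_L2_inner(2)[OF am_bdd, of y "snd (u y)" "snd v"]
  by (simp only: am_def weak_grad_def)

text \<open>Partial sums of the coefficient series converge almost everywhere under the common bound
  \<open>B0\<close>, so the operator series converges on each fixed \<open>g\<close>.\<close>

lemma A_sums:
  assumes y: "y \<in> unit_cube"
  shows "(\<lambda>j. y j *\<^sub>R P j g) sums (A y g - A0 g)"
proof -
  have "(\<lambda>n. mult_L2 (\<lambda>x. \<Sum>j<n. y j * ps j x) g) \<longlonglongrightarrow> mult_L2 (\<lambda>x. \<Sum>j. y j * ps j x) g"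
  proof (rule mult_L2_tendsto[OF partial_sum_bdd series_bdd[OF y]])
    show "\<bar>y j\<bar> \<le> 1" for j using y by (simp add: cube_abs)
    show "AE x in lebesgue. (\<lambda>n. \<Sum>j<n. y j * ps j x) \<longlonglongrightarrow> (\<Sum>j. y j * ps j x)"
      using ps_summable_AE by eventually_elim (use summable_cube(1)[OF y] in \<open>blast intro: summable_LIMSEQ\<close>)
  qed
  moreover have "mult_L2 (\<lambda>x. \<Sum>j<n. y j * ps j x) g = (\<Sum>j<n. y j *\<^sub>R P j g)" for n
    using mult_L2_sum[of "{..<n}" ps "\<lambda>_. B0" y g] ps_bdd by simp
  moreover have "A y g = A0 g + mult_L2 (\<lambda>x. \<Sum>j. y j * ps j x) g"
    unfolding am_def[abs_def] by (rule mult_L2_add[OF ab series_bdd[OF y]])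
  ultimately show ?thesis by (simp add: sums_def)
qed

text \<open>The series for the two parameters differ in the single term with index \<open>k\<close>:
  the operator is affine in each coordinate.\<close>

lemma A_update:
  assumes y: "y \<in> unit_cube" "y(k := s) \<in> unit_cube"
  shows "A (y(k := s)) g = A y g + (s - y k) *\<^sub>R P k g"
proof -
  have "(\<lambda>j. (y(k := s)) j *\<^sub>R P j g - y j *\<^sub>R P j g) sums ((A (y(k := s)) g - A0 g) - (A y g - A0 g))"
    by (intro sums_diff A_sums y)
  also have "(\<lambda>j. (y(k := s)) j *\<^sub>R P j g - y j *\<^sub>R P j g) = (\<lambda>j. if j = k then (s - y k) *\<^sub>R P k g else 0)"
    by (auto simp: fun_eq_iff scaleR_diff_left)
  finally have "(\<lambda>j. if j = k then (s - y k) *\<^sub>R P k g else 0) sums (A (y(k := s)) g - A y g)"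
    by (simp only: diff_diff_eq2 diff_add_cancel)
  moreover have "(\<lambda>j. if j = k then (s - y k) *\<^sub>R P k g else 0) sums ((s - y k) *\<^sub>R P k g)"
    by (rule sums_single)
  ultimately have "A (y(k := s)) g - A y g = (s - y k) *\<^sub>R P k g" by (rule sums_unique2)
  then show ?thesis by (simp add: algebra_simps)
qed

text \<open>Choosing the parameters as the signs of \<open>P j g \<bullet> h\<close> turns a partial
  sum of absolute values into one inner product with a multiplication operator bounded by
  \<open>B0\<close>. This replaces summability of the operator norms of the
  \<open>P j\<close>.\<close>

lemma P_inner_summable:
  shows "summable (\<lambda>j. \<bar>P j g \<bullet> h\<bar>)" "(\<Sum>j. \<bar>P j g \<bullet> h\<bar>) \<le> B0 * norm g * norm h"
proof -
  define \<epsilon> :: "nat \<Rightarrow> real" where "\<epsilon> j = sgn (P j g \<bullet> h)" for j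
  have \<epsilon>: "\<bar>\<epsilon> j\<bar> \<le> 1" for j by (simp add: \<epsilon>_def abs_sgn_eq)
  have le: "(\<Sum>j<n. \<bar>P j g \<bullet> h\<bar>) \<le> B0 * norm g * norm h" for n
  proof -
    have "(\<Sum>j<n. \<bar>P j g \<bullet> h\<bar>) = (\<Sum>j<n. \<epsilon> j *\<^sub>R P j g) \<bullet> h"
      by (simp add: \<epsilon>_def inner_sum_left abs_sgn mult.commute)
    also have "(\<Sum>j<n. \<epsilon> j *\<^sub>R P j g) = mult_L2 (\<lambda>x. \<Sum>j<n. \<epsilon> j * ps j x) g"
      using mult_L2_sum[of "{..<n}" ps "\<lambda>_. B0" \<epsilon> g] ps_bdd by simp
    also have "\<dots> \<bullet> h \<le> norm (mult_L2 (\<lambda>x. \<Sum>j<n. \<epsilon> j * ps j x) g) * norm h"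
      by (rule norm_cauchy_schwarz)
    also have "\<dots> \<le> B0 * norm g * norm h"
      by (intro mult_right_mono mult_L2_norm_le partial_sum_bdd \<epsilon>) simp
    finally show ?thesis .
  qed
  show s: "summable (\<lambda>j. \<bar>P j g \<bullet> h\<bar>)"
    by (rule bounded_imp_summable[where B = "B0 * norm g * norm h"])
      (use le[of "Suc _"] in \<open>auto simp: lessThan_Suc_atMost\<close>)
  show "(\<Sum>j. \<bar>P j g \<bullet> h\<bar>) \<le> B0 * norm g * norm h"
    by (rule suminf_le_const[OF s le])
qed

text \<open>On \<open>D\<close> the coefficient is at least \<open>r0\<close> by uniform
  ellipticity; elsewhere the gradient is zero.\<close>

lemma coercive:
  assumes y: "y \<in> unit_cube" and w: "w \<in> H10 D"
  shows "r0 * (normV w)\<^sup>2 \<le> A y (snd w) \<bullet> snd w"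
proof -
  let ?g = "rep_L2 (snd w)"
  note g = square_integrable_rep_L2[of "snd w"]
  have "(normV w)\<^sup>2 = (LINT x|lebesgue. (norm (?g x))\<^sup>2)"
    using norm_abs_L2_power2[OF g] by (simp add: normV_def abs_rep_L2)
  then have "r0 * (normV w)\<^sup>2 = (LINT x|lebesgue. r0 * (norm (?g x))\<^sup>2)" by simp
  also have "\<dots> \<le> (LINT x|lebesgue. am y x * (?g x \<bullet> ?g x))"
  proof (rule integral_mono_AE)
    show "integrable lebesgue (\<lambda>x. r0 * (norm (?g x))\<^sup>2)" using g by (simp add: square_integrable_def)
    show "integrable lebesgue (\<lambda>x. am y x * (?g x \<bullet> ?g x))" by (rule mult_L2_inner(1)[OF am_bdd[OF y]])
    show "AE x in lebesgue. r0 * (norm (?g x))\<^sup>2 \<le> am y x * (?g x \<bullet> ?g x)"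
      using uea weak_grad_outside[OF D_open w]
    proof eventually_elim
      case (elim x)
      show ?case
      proof (cases "x \<in> D")
        case True
        have "r0 \<le> am y x"
          unfolding am_def using summable_cube(2)[OF y, of x] elim(1) True by auto
        then show ?thesis by (simp add: power2_norm_eq_inner mult_right_mono)
      next
        case False
        then show ?thesis using elim(2) by (simp add: weak_grad_def)
      qed
    qed
  qed
  also have "\<dots> = A y (snd w) \<bullet> snd w" by (rule mult_L2_inner(2)[OF am_bdd[OF y], symmetric])
  finally show ?thesis .
qed

lemma normV_nonneg[simp]: "0 \<le> normV w" by (simp add: normV_def)

text \<open>The second alternative covers the case in which \<open>normV w\<close> cannot be
  cancelled, where a negative \<open>c\<close> would violate the first.\<close>

lemma stability:
  assumes y: "y \<in> unit_cube" and w: "w \<in> H10 D"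
    and R: "A y (snd w) \<bullet> snd w \<le> c * normV w"
  shows "r0 * normV w \<le> c \<or> normV w = 0"
proof -
  have "(r0 * normV w) * normV w \<le> c * normV w"
    using coercive[OF y w] R by (simp add: power2_eq_square mult.assoc)
  then show ?thesis by (auto simp: mult_le_cancel_right) (use normV_nonneg[of w] in linarith)
qed

lemma stability_R:
  assumes y: "y \<in> unit_cube" and w: "w \<in> H10 D"
    and R: "A y (snd w) \<bullet> snd w = R \<bullet> snd w"
  shows "r0 * normV w \<le> norm R"
  using stability[OF y w, of "norm R"] norm_cauchy_schwarz[of R "snd w"] R by (auto simp: normV_def)

lemma normV_zero:
  assumes "w \<in> H10 D" "normV w = 0"
  shows "w = 0"
  using poincare_H10[OF D_bdd] assms by fastforce

text \<open>The difference of two solutions has zero residual, so its gradient vanishes by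
  coercivity and the Poincare inequality makes it 0.\<close>

lemma unique:
  assumes y: "y \<in> unit_cube" and w: "w \<in> H10 D" "\<And>v. v \<in> H10 D \<Longrightarrow> A y (snd w) \<bullet> snd v = f v"
  shows "w = u y"
proof -
  interpret bounded_linear "A y" by (rule bounded_linear_mult_L2[OF am_bdd[OF y]])
  have z: "w - u y \<in> H10 D" using w(1) sol(1)[OF y] by (rule subspace_diff[OF subspace_H10])
  have "A y (snd (w - u y)) \<bullet> snd (w - u y) = 0 \<bullet> snd (w - u y)"
    using w(2)[OF z] solA[OF y z] by (simp add: diff inner_diff_left)
  from stability_R[OF y z this] have "normV (w - u y) \<le> 0" using r0 by (simp add: mult_le_0_iff)
  then have "w - u y = 0" using normV_zero[OF z] normV_nonneg[of "w - u y"] by simp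
  then show ?thesis by simp
qed

lemma u_bounded: "\<exists>B. \<forall>y\<in>unit_cube. normV (u y) \<le> B"
proof -
  obtain C where C: "\<And>v. v \<in> H10 D \<Longrightarrow> \<bar>f v\<bar> \<le> C * normV v"
    using f_dual unfolding H10_dual_def by blast
  have "normV (u y) \<le> max 0 (C / r0)" if y: "y \<in> unit_cube" for y
  proof -
    have "A y (snd (u y)) \<bullet> snd (u y) \<le> C * normV (u y)"
      using solA[OF y sol(1)[OF y]] C[OF sol(1)[OF y]] by simp
    from stability[OF y sol(1)[OF y] this] have "normV (u y) \<le> C / r0 \<or> normV (u y) = 0"
      using r0 by (simp add: pos_le_divide_eq mult.commute)
    then show ?thesis by (auto simp: le_max_iff_disj)
  qed
  then show ?thesis by blast
qed

text \<open>The difference of two solutions has as its residual the change of the operator applied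
  to the fixed \<open>u y\<close>, so convergence on fixed elements suffices. Coordinatewise
  convergence of parameters makes the coefficients converge almost everywhere, dominated by
  \<open>\<bar>ps j x\<bar>\<close>. Measurability in the parameter follows from this
  continuity.\<close>

lemma u_continuous: "continuous_on unit_cube u"
proof -
  obtain C where C: "0 < C" "\<And>v. v \<in> H10 D \<Longrightarrow> norm v \<le> C * normV v"
    using poincare_H10[OF D_bdd] by blast
  show ?thesis
    unfolding continuous_on_sequentially
  proof (intro allI ballI impI, elim conjE)
    fix yn :: "nat \<Rightarrow> nat \<Rightarrow> real" and y
    assume y: "y \<in> unit_cube" and yn: "\<forall>n. yn n \<in> unit_cube" and lim: "yn \<longlonglongrightarrow> y"
    have limj: "(\<lambda>n. yn n j) \<longlonglongrightarrow> y j" for j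
      by (rule continuous_on_tendsto_compose[OF continuous_on_product_coordinates lim]) auto
    have "(\<lambda>n. A (yn n) (snd (u y))) \<longlonglongrightarrow> A y (snd (u y))"
    proof (rule mult_L2_tendsto[OF am_bdd am_bdd[OF y]])
      show "yn n \<in> unit_cube" for n using yn by blast
      show "AE x in lebesgue. (\<lambda>n. am (yn n) x) \<longlonglongrightarrow> am y x"
        using ps_summable_AE
      proof eventually_elim
        case (elim x)
        have "(\<lambda>n. \<Sum>j. yn n j * ps j x) \<longlonglongrightarrow> (\<Sum>j. y j * ps j x)"
        proof (rule tannerys_theorem[THEN conjunct2, THEN conjunct2])
          show "((\<lambda>n. yn n j * ps j x) \<longlongrightarrow> y j * ps j x) sequentially" for j by (intro tendsto_intros limj)
          show "summable (\<lambda>j. \<bar>ps j x\<bar>)" using elim by simp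
          have "norm (yn n j * ps j x) \<le> \<bar>ps j x\<bar>" for n j
            using yn by (simp add: cube_abs abs_mult mult_left_le_one_le)
          then show "\<forall>\<^sub>F (j, n) in at_top \<times>\<^sub>F sequentially. norm (yn n j * ps j x) \<le> \<bar>ps j x\<bar>"
            by (intro always_eventually) auto
        qed simp
        then show ?case unfolding am_def by (intro tendsto_intros)
      qed
    qed
    then have l0: "(\<lambda>n. norm (A y (snd (u y)) - A (yn n) (snd (u y)))) \<longlonglongrightarrow> 0"
      by (intro tendsto_norm_zero) (auto intro: tendsto_eq_intros)
    have "dist (u (yn n)) (u y) \<le> C / r0 * norm (A y (snd (u y)) - A (yn n) (snd (u y)))" for n
    proof -
      interpret bounded_linear "A (yn n)" by (rule bounded_linear_mult_L2[OF am_bdd]) (use yn in blast)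
      have yn': "yn n \<in> unit_cube" using yn by blast
      have z: "u (yn n) - u y \<in> H10 D" by (intro subspace_diff[OF subspace_H10] sol(1) y yn')
      have "A (yn n) (snd (u (yn n) - u y)) \<bullet> snd (u (yn n) - u y)
          = (A y (snd (u y)) - A (yn n) (snd (u y))) \<bullet> snd (u (yn n) - u y)"
        using solA[OF yn' z] solA[OF y z] by (simp add: diff inner_diff_left)
      from stability_R[OF yn' z this]
      have "normV (u (yn n) - u y) \<le> norm (A y (snd (u y)) - A (yn n) (snd (u y))) / r0"
        using r0 by (simp add: pos_le_divide_eq mult.commute)
      then have "C * normV (u (yn n) - u y) \<le> C * (norm (A y (snd (u y)) - A (yn n) (snd (u y))) / r0)"
        using C(1) by (intro mult_left_mono) auto
      then show ?thesis using C(2)[OF z] by (simp add: dist_norm)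
    qed
    then have "(\<lambda>n. dist (u (yn n)) (u y)) \<longlonglongrightarrow> 0"
      by (intro tendsto_sandwich[OF _ _ tendsto_const tendsto_mult_right_zero[OF l0, of "C / r0"]]) auto
    then show "(u \<circ> yn) \<longlonglongrightarrow> u y" unfolding o_def by (simp add: tendsto_dist_iff[symmetric])
  qed
qed

end

section \<open>Derivatives of the solution in the coordinates\<close>

context affine_problem
begin

text \<open>Every single coordinate can move a little in both directions, as partial derivatives
  require. The set is not open in the product topology.\<close>

definition open_cube :: "(nat \<Rightarrow> real) set" where "open_cube = {y. \<forall>j. \<bar>y j\<bar> < 1}"

lemma open_cube_cube: "y \<in> open_cube \<Longrightarrow> y \<in> unit_cube"
  by (auto simp: open_cube_def cube_abs intro: less_imp_le)

lemma open_cube_update: "y \<in> open_cube \<Longrightarrow> \<bar>s\<bar> < 1 \<Longrightarrow> y(k := s) \<in> open_cube"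
  by (simp add: open_cube_def)

lemma normV_add: "normV (v + w) \<le> normV v + normV w"
  by (simp add: normV_def norm_triangle_ineq)

lemma tendsto_snd_quotient:
  assumes "(g has_vector_derivative g') (at x)"
  shows "((\<lambda>h. snd (g (x + h) - g x)) \<longlongrightarrow> 0) (at 0)"
    and "((\<lambda>h. snd ((g (x + h) - g x) /\<^sub>R h)) \<longlongrightarrow> snd g') (at 0)"
proof -
  have "isCont g x" using assms has_vector_derivative_continuous by blast
  then have "((\<lambda>h. g (x + h)) \<longlongrightarrow> g x) (at 0)" by (simp add: isCont_iff)
  then show "((\<lambda>h. snd (g (x + h) - g x)) \<longlongrightarrow> 0) (at 0)"
    by (auto intro!: tendsto_eq_intros)
  show "((\<lambda>h. snd ((g (x + h) - g x) /\<^sub>R h)) \<longlongrightarrow> snd g') (at 0)"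
    using assms unfolding has_vector_derivative_quotient by (intro tendsto_intros)
qed

text \<open>
  The difference quotients of \<open>w\<close> solve the weak problem with data that converge, so by coercivity
  they form a Cauchy family: this gives the derivative without solving any new problem.
\<close>

lemma weak_solution_differentiable:
  fixes w :: "(nat \<Rightarrow> real) \<Rightarrow> 'a H1" and g :: "nat \<Rightarrow> (nat \<Rightarrow> real) \<Rightarrow> 'a H1"
  assumes w: "\<And>y. y \<in> open_cube \<Longrightarrow> w y \<in> H10 D"
    and eq: "\<And>y v. y \<in> open_cube \<Longrightarrow> v \<in> H10 D \<Longrightarrow>
      A y (snd (w y)) \<bullet> snd v = F v - (\<Sum>i<m. P (p i) (snd (g i y)) \<bullet> snd v)"
    and g: "\<And>i y. i < m \<Longrightarrow> y \<in> open_cube \<Longrightarrow> ((\<lambda>s. g i (y(k := s))) has_vector_derivative g' i y) (at (y k))"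
    and y: "y \<in> open_cube"
  shows "\<exists>w'. ((\<lambda>s. w (y(k := s))) has_vector_derivative w') (at (y k)) \<and> w' \<in> H10 D \<and>
    (\<forall>v\<in>H10 D. A y (snd w') \<bullet> snd v
       = - (P k (snd (w y)) \<bullet> snd v) - (\<Sum>i<m. P (p i) (snd (g' i y)) \<bullet> snd v))"
proof -
  interpret P: bounded_linear "P j" for j by (rule bounded_linear_mult_L2[OF ps_bdd])
  interpret A: bounded_linear "A y" by (rule bounded_linear_mult_L2[OF am_bdd[OF open_cube_cube[OF y]]])
  obtain C where C: "0 < C" "\<And>v. v \<in> H10 D \<Longrightarrow> norm v \<le> C * normV v"
    using poincare_H10[OF D_bdd] by blast
  define \<delta> where "\<delta> = 1 - \<bar>y k\<bar>"
  have \<delta>: "0 < \<delta>" using y by (simp add: \<delta>_def open_cube_def)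
  define z where "z h = y(k := y k + h)" for h
  have z: "z h \<in> open_cube" if "\<bar>h\<bar> < \<delta>" for h
    unfolding z_def using that by (intro open_cube_update y) (simp add: \<delta>_def)
  define d where "d h = w (z h) - w y" for h
  have dH: "d h \<in> H10 D" if "\<bar>h\<bar> < \<delta>" for h
    unfolding d_def by (intro subspace_diff[OF subspace_H10] w z that y)
  \<comment> \<open>The residual of the increment \<open>d h\<close> with respect to the operator at
    the base point \<open>y\<close>: the change of the operator acts on \<open>w (z h)\<close>, not
    on \<open>w y\<close>, so continuity of \<open>w\<close> must be established first.\<close>
  define R1 where "R1 h = - (h *\<^sub>R P k (snd (w (z h)))) - (\<Sum>i<m. P (p i) (snd (g i (z h) - g i y)))" for h
  have eqd: "A y (snd (d h)) \<bullet> snd v = R1 h \<bullet> snd v" if h: "\<bar>h\<bar> < \<delta>" and v: "v \<in> H10 D" for h v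
  proof -
    have "A (z h) g' = A y g' + h *\<^sub>R P k g'" for g'
      unfolding z_def using A_update[of y k "y k + h" g'] open_cube_cube[OF y] open_cube_cube[OF z[OF h]] by (simp add: z_def)
    then have 1: "A y (snd (w (z h))) \<bullet> snd v + h * (P k (snd (w (z h))) \<bullet> snd v)
        = F v - (\<Sum>i<m. P (p i) (snd (g i (z h))) \<bullet> snd v)"
      using eq[OF z[OF h] v] by (simp add: inner_add_left)
    have 2: "A y (snd (w y)) \<bullet> snd v = F v - (\<Sum>i<m. P (p i) (snd (g i y)) \<bullet> snd v)"
      by (rule eq[OF y v])
    show ?thesis
      using 1 2 by (simp add: d_def R1_def A.diff P.diff inner_diff_left inner_sum_left sum_subtractf inner_minus_left)
  qed
  have stab: "r0 * normV (d h) \<le> norm (R1 h)" if "\<bar>h\<bar> < \<delta>" for h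
    by (rule stability_R[OF open_cube_cube[OF y] dH[OF that] eqd[OF that dH[OF that]]])
  define S where "S h = (\<Sum>i<m. norm (P (p i) (snd (g i (z h) - g i y))))" for h
  have zg: "((\<lambda>h. snd (g i (z h) - g i y)) \<longlongrightarrow> 0) (at 0)"
      "((\<lambda>h. snd ((g i (z h) - g i y) /\<^sub>R h)) \<longlongrightarrow> snd (g' i y)) (at 0)" if "i < m" for i
    using tendsto_snd_quotient[OF g[OF that y]] by (simp_all add: z_def)
  have S0: "(S \<longlongrightarrow> 0) (at 0)"
  proof -
    have "((\<lambda>h. norm (P (p i) (snd (g i (z h) - g i y)))) \<longlongrightarrow> norm (P (p i) 0)) (at 0)" if "i < m" for i
      by (intro tendsto_norm P.tendsto zg that)
    then have "(S \<longlongrightarrow> (\<Sum>i<m. norm (P (p i) 0))) (at 0)"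
      unfolding S_def by (intro tendsto_sum) auto
    then show ?thesis by (simp add: P.zero)
  qed
  have near: "\<forall>\<^sub>F h in at 0. \<bar>h\<bar> < e" if "0 < e" for e :: real
    using that by (auto simp: eventually_at dist_real_def)
  have step1: "((\<lambda>h. snd (w (z h))) \<longlongrightarrow> snd (w y)) (at 0)"
  proof -
    \<comment> \<open>For such \<open>h\<close> one has
      \<open>\<bar>h\<bar> * B0 \<le> r0 / 2\<close>, which lets the term with
      \<open>normV (d h)\<close> be absorbed by half of the left-hand side. \<open>B0 + 1\<close>
      avoids a zero denominator.\<close>
    define e where "e = min \<delta> (r0 / (2 * (B0 + 1)))"
    have e: "0 < e" using \<delta> r0 B0 by (simp add: e_def)
    have le: "r0 / 2 * normV (d h) \<le> \<bar>h\<bar> * B0 * normV (w y) + S h" if h: "\<bar>h\<bar> < e" for h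
    proof -
      have h\<delta>: "\<bar>h\<bar> < \<delta>" and "\<bar>h\<bar> * (2 * (B0 + 1)) < r0"
        using h B0 by (auto simp: e_def pos_less_divide_eq)
      then have hr: "\<bar>h\<bar> * B0 \<le> r0 / 2" by (simp add: algebra_simps)
      have "norm (R1 h) \<le> norm (h *\<^sub>R P k (snd (w (z h)))) + norm (\<Sum>i<m. P (p i) (snd (g i (z h) - g i y)))"
        unfolding R1_def using norm_triangle_ineq4[of "- (h *\<^sub>R P k (snd (w (z h))))"] by (simp only: norm_minus_cancel)
      also have "norm (h *\<^sub>R P k (snd (w (z h)))) \<le> \<bar>h\<bar> * (B0 * normV (w (z h)))"
        using mult_L2_norm_le[OF ps_bdd, of k "snd (w (z h))"] by (simp add: normV_def mult_left_mono)
      also have "norm (\<Sum>i<m. P (p i) (snd (g i (z h) - g i y))) \<le> S h"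
        unfolding S_def by (rule norm_sum)
      also have "normV (w (z h)) \<le> normV (w y) + normV (d h)"
        using normV_add[of "w y" "d h"] by (simp add: d_def)
      finally have "norm (R1 h) \<le> \<bar>h\<bar> * (B0 * (normV (w y) + normV (d h))) + S h"
        using B0 by (simp add: mult_left_mono)
      also have "\<dots> = \<bar>h\<bar> * B0 * normV (w y) + \<bar>h\<bar> * B0 * normV (d h) + S h" by (simp add: algebra_simps)
      also have "\<bar>h\<bar> * B0 * normV (d h) \<le> r0 / 2 * normV (d h)" using hr by (rule mult_right_mono) simp
      finally show ?thesis using stab[OF h\<delta>] by simp
    qed
    have "((\<lambda>h. 2 / r0 * (\<bar>h\<bar> * B0 * normV (w y) + S h)) \<longlongrightarrow> 2 / r0 * (\<bar>0\<bar> * B0 * normV (w y) + 0)) (at 0)"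
      by (intro tendsto_intros S0)
    then have "((\<lambda>h. 2 / r0 * (\<bar>h\<bar> * B0 * normV (w y) + S h)) \<longlongrightarrow> 0) (at 0)" by simp
    moreover have "\<forall>\<^sub>F h in at 0. norm (snd (d h)) \<le> 2 / r0 * (\<bar>h\<bar> * B0 * normV (w y) + S h)"
      using near[OF e]
    proof eventually_elim
      case (elim h)
      then show ?case using le[OF elim] r0 by (simp add: normV_def field_simps)
    qed
    ultimately have "((\<lambda>h. snd (d h)) \<longlongrightarrow> 0) (at 0)"
      by (rule Lim_null_comparison[rotated])
    then show ?thesis unfolding d_def snd_diff by (rule LIM_zero_cancel)
  qed
  \<comment> \<open>The residual of the difference quotient. It converges, by the continuity just
    shown and the differentiability of the \<open>g i\<close>, and its limit is the right-hand side
    of the equation for the derivative.\<close>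
  define R where "R h = - P k (snd (w (z h))) - (\<Sum>i<m. P (p i) (snd ((g i (z h) - g i y) /\<^sub>R h)))" for h
  define R0 where "R0 = - P k (snd (w y)) - (\<Sum>i<m. P (p i) (snd (g' i y)))"
  have R: "(R \<longlongrightarrow> R0) (at 0)"
    unfolding R_def[abs_def] R0_def
    by (intro tendsto_diff tendsto_minus tendsto_sum P.tendsto step1 zg) auto
  define q where "q h = d h /\<^sub>R h" for h
  have qH: "q h \<in> H10 D" if "\<bar>h\<bar> < \<delta>" for h
    unfolding q_def by (intro subspace_scale[OF subspace_H10] dH that)
  have eqq: "A y (snd (q h)) \<bullet> snd v = R h \<bullet> snd v" if h: "\<bar>h\<bar> < \<delta>" "h \<noteq> 0" and v: "v \<in> H10 D" for h v
  proof -
    have "R h = R1 h /\<^sub>R h"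
    proof -
      have "P (p i) (snd ((g i (z h) - g i y) /\<^sub>R h)) = P (p i) (snd (g i (z h) - g i y)) /\<^sub>R h" for i
        by (simp only: snd_scaleR P.scaleR)
      then show ?thesis
        using h(2) unfolding R_def R1_def by (simp only:) (simp add: scaleR_diff_right scaleR_sum_right)
    qed
    then show ?thesis using eqd[OF h(1) v] by (simp add: q_def A.scaleR)
  qed
  have qdiff: "norm (q h - q h') \<le> C / r0 * norm (R h - R h')"
    if h: "\<bar>h\<bar> < \<delta>" "h \<noteq> 0" "\<bar>h'\<bar> < \<delta>" "h' \<noteq> 0" for h h'
  proof -
    have H: "q h - q h' \<in> H10 D" by (intro subspace_diff[OF subspace_H10] qH h)
    have "A y (snd (q h - q h')) \<bullet> snd (q h - q h') = (R h - R h') \<bullet> snd (q h - q h')"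
      using eqq[OF h(1,2) H] eqq[OF h(3,4) H] by (simp add: A.diff inner_diff_left)
    from stability_R[OF open_cube_cube[OF y] H this]
    have "normV (q h - q h') \<le> norm (R h - R h') / r0" using r0 by (simp add: pos_le_divide_eq mult.commute)
    then have "C * normV (q h - q h') \<le> C * (norm (R h - R h') / r0)" using C(1) by (intro mult_left_mono) auto
    then show ?thesis using C(2)[OF H] by simp
  qed
  \<comment> \<open>A null sequence of admissible increments; starting at
    \<open>\<delta> / 2\<close> keeps them strictly below \<open>\<delta>\<close>.\<close>
  define h where "h n = \<delta> * inverse (real (Suc (Suc n)))" for n
  have hn: "\<bar>h n\<bar> < \<delta>" "h n \<noteq> 0" for n
  proof -
    have "inverse (real (Suc (Suc n))) < 1" by (simp add: inverse_less_1_iff)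
    then show "\<bar>h n\<bar> < \<delta>" "h n \<noteq> 0" using \<delta> by (auto simp: h_def abs_mult)
  qed
  have "(\<lambda>n. inverse (real (Suc (Suc n)))) \<longlonglongrightarrow> 0"
    using LIMSEQ_inverse_real_of_nat by (rule LIMSEQ_Suc)
  then have "(\<lambda>n. \<delta> * inverse (real (Suc (Suc n)))) \<longlonglongrightarrow> 0" by (rule tendsto_mult_right_zero)
  then have h0: "filterlim h (at 0) sequentially"
    unfolding filterlim_at h_def[symmetric] using hn(2) by simp
  have Rn: "(\<lambda>n. R (h n)) \<longlonglongrightarrow> R0" using filterlim_compose[OF R h0] .
  have "Cauchy (\<lambda>n. q (h n))"
  proof (rule metric_CauchyI)
    fix e :: real assume "0 < e"
    then have "0 < e * r0 / C" using r0 C by simp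
    then obtain N where N: "\<And>i j. i \<ge> N \<Longrightarrow> j \<ge> N \<Longrightarrow> dist (R (h i)) (R (h j)) < e * r0 / C"
      using metric_CauchyD[OF LIMSEQ_imp_Cauchy[OF Rn]] by metis
    have "dist (q (h i)) (q (h j)) < e" if "i \<ge> N" "j \<ge> N" for i j
    proof -
      have "C / r0 * norm (R (h i) - R (h j)) < C / r0 * (e * r0 / C)"
        using N[OF that] C r0 by (intro mult_strict_left_mono) (auto simp: dist_norm)
      also have "\<dots> = e" using C r0 by simp
      finally show ?thesis using qdiff[OF hn hn, of i j] by (simp add: dist_norm)
    qed
    then show "\<exists>N. \<forall>i\<ge>N. \<forall>j\<ge>N. dist (q (h i)) (q (h j)) < e" by blast
  qed
  then obtain w' where w': "(\<lambda>n. q (h n)) \<longlonglongrightarrow> w'" using Cauchy_convergent convergent_def by blast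
  have w'H: "w' \<in> H10 D"
    by (rule closed_sequentially[OF closed_H10 qH[OF hn(1)] w'])
  \<comment> \<open>Passing to the limit in one argument of the estimate for quotients compares
    every small increment with \<open>w'\<close>, so convergence along the sequence becomes full
    convergence.\<close>
  have qw: "norm (q h' - w') \<le> C / r0 * norm (R h' - R0)" if "\<bar>h'\<bar> < \<delta>" "h' \<noteq> 0" for h'
  proof (rule LIMSEQ_le)
    show "(\<lambda>n. norm (q h' - q (h n))) \<longlonglongrightarrow> norm (q h' - w')" by (intro tendsto_intros w')
    show "(\<lambda>n. C / r0 * norm (R h' - R (h n))) \<longlonglongrightarrow> C / r0 * norm (R h' - R0)" by (intro tendsto_intros Rn)
    show "\<exists>N. \<forall>n\<ge>N. norm (q h' - q (h n)) \<le> C / r0 * norm (R h' - R (h n))"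
      using qdiff[OF that hn] by blast
  qed
  have "(q \<longlongrightarrow> w') (at 0)"
  proof -
    have "((\<lambda>h'. C / r0 * norm (R h' - R0)) \<longlongrightarrow> C / r0 * norm (R0 - R0)) (at 0)" by (intro tendsto_intros R)
    then have "((\<lambda>h'. C / r0 * norm (R h' - R0)) \<longlongrightarrow> 0) (at 0)" by simp
    moreover have "\<forall>\<^sub>F h' in at 0. norm (q h' - w') \<le> C / r0 * norm (R h' - R0)"
      using near[OF \<delta>] eventually_neq_at_within[of 0 0 UNIV] by eventually_elim (rule qw)
    ultimately have "((\<lambda>h'. q h' - w') \<longlongrightarrow> 0) (at 0)"
      by (rule Lim_null_comparison[rotated])
    then show ?thesis by (rule LIM_zero_cancel)
  qed
  then have 1: "((\<lambda>s. w (y(k := s))) has_vector_derivative w') (at (y k))"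
    unfolding has_vector_derivative_quotient q_def d_def z_def by simp
  have 2: "A y (snd w') \<bullet> snd v = R0 \<bullet> snd v" if v: "v \<in> H10 D" for v
  proof (rule LIMSEQ_unique)
    show "(\<lambda>n. A y (snd (q (h n))) \<bullet> snd v) \<longlonglongrightarrow> A y (snd w') \<bullet> snd v"
      by (intro tendsto_intros A.tendsto w')
    show "(\<lambda>n. A y (snd (q (h n))) \<bullet> snd v) \<longlonglongrightarrow> R0 \<bullet> snd v"
      unfolding eqq[OF hn v] by (intro tendsto_intros Rn)
  qed
  have "\<forall>v\<in>H10 D. A y (snd w') \<bullet> snd v
       = - (P k (snd (w y)) \<bullet> snd v) - (\<Sum>i<m. P (p i) (snd (g' i y)) \<bullet> snd v)"
    using 2 by (simp add: R0_def inner_diff_left inner_sum_left)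
  with 1 w'H show ?thesis by blast
qed

text \<open>
  Mixed derivatives are indexed by words in the variables, the head being differentiated last, so that
  no symmetry of higher derivatives is needed.
\<close>

primrec U :: "nat list \<Rightarrow> (nat \<Rightarrow> real) \<Rightarrow> 'a H1" where
  "U [] = u"
| "U (k # w) = partial_deriv k (U w)"

definition rem_nth :: "nat \<Rightarrow> nat list \<Rightarrow> nat list" where
  "rem_nth i w = take i w @ drop (Suc i) w"

lemma rem_nth_simps: "rem_nth 0 (k # w) = w" "rem_nth (Suc i) (k # w) = k # rem_nth i w"
  by (simp_all add: rem_nth_def)

lemma length_rem_nth: "i < length w \<Longrightarrow> Suc (length (rem_nth i w)) = length w"
  by (simp add: rem_nth_def)

text \<open>The weak formulation differentiated along \<open>w\<close> by the Leibniz rule. Since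
  the operator is affine in each coordinate, at most one derivative can fall on it, and each letter
  gives one such term.\<close>

definition weak_equation :: "nat list \<Rightarrow> bool" where
  "weak_equation w \<longleftrightarrow> (\<forall>y\<in>open_cube. U w y \<in> H10 D) \<and> (\<forall>y\<in>open_cube. \<forall>v\<in>H10 D. A y (snd (U w y)) \<bullet> snd v
     = (if w = [] then f v else 0) - (\<Sum>i<length w. P (w ! i) (snd (U (rem_nth i w) y)) \<bullet> snd v))"

definition differentiable_word :: "nat list \<Rightarrow> bool" where
  "differentiable_word w \<longleftrightarrow> (\<forall>k. \<forall>y\<in>open_cube. ((\<lambda>s. U w (y(k := s))) has_vector_derivative U (k # w) y) (at (y k)))"

lemma weak_equation_step:
  assumes g: "weak_equation w" and s: "\<And>i. i < length w \<Longrightarrow> differentiable_word (rem_nth i w)"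
  shows "differentiable_word w" "weak_equation (k # w)"
proof -
  have "((\<lambda>s. U w (y(k := s))) has_vector_derivative U (k # w) y) (at (y k)) \<and> U (k # w) y \<in> H10 D \<and>
    (\<forall>v\<in>H10 D. A y (snd (U (k # w) y)) \<bullet> snd v
       = - (P k (snd (U w y)) \<bullet> snd v) - (\<Sum>i<length w. P (w ! i) (snd (U (k # rem_nth i w) y)) \<bullet> snd v))"
    if y: "y \<in> open_cube" for y k
  proof -
    have "\<exists>w'. ((\<lambda>s. U w (y(k := s))) has_vector_derivative w') (at (y k)) \<and> w' \<in> H10 D \<and>
      (\<forall>v\<in>H10 D. A y (snd w') \<bullet> snd v
         = - (P k (snd (U w y)) \<bullet> snd v) - (\<Sum>i<length w. P (w ! i) (snd (U (k # rem_nth i w) y)) \<bullet> snd v))"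
      by (rule weak_solution_differentiable[where F = "\<lambda>v. if w = [] then f v else 0" and g = "\<lambda>i. U (rem_nth i w)"])
        (use g s y in \<open>auto simp: weak_equation_def differentiable_word_def\<close>)
    then obtain w' where w': "((\<lambda>s. U w (y(k := s))) has_vector_derivative w') (at (y k))" "w' \<in> H10 D"
      "\<forall>v\<in>H10 D. A y (snd w') \<bullet> snd v
         = - (P k (snd (U w y)) \<bullet> snd v) - (\<Sum>i<length w. P (w ! i) (snd (U (k # rem_nth i w) y)) \<bullet> snd v)"
      by blast
    have "U (k # w) y = w'"
      unfolding U.simps partial_deriv_def by (rule vector_derivative_at[OF w'(1)])
    then show ?thesis using w' by blast
  qed
  note * = this
  show "differentiable_word w" unfolding differentiable_word_def using * by blast
  have "A y (snd (U (k # w) y)) \<bullet> snd v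
      = (if k # w = [] then f v else 0) - (\<Sum>i<length (k # w). P ((k # w) ! i) (snd (U (rem_nth i (k # w)) y)) \<bullet> snd v)"
    if "y \<in> open_cube" "v \<in> H10 D" for y v
    using *[OF that(1), of k] that(2)
    by (simp only: list.size sum.lessThan_Suc_shift add_0_right add_Suc_right rem_nth_simps nth_Cons_0 nth_Cons_Suc)
      simp
  then show "weak_equation (k # w)" unfolding weak_equation_def using * by blast
qed

text \<open>Differentiating \<open>U w\<close> requires the differentiability of all words with one
  letter removed; these are shorter, so both properties are proved by induction on the
  length.\<close>

lemma weak_equation_differentiable: "weak_equation w \<and> differentiable_word w"
proof (induction "length w" arbitrary: w rule: less_induct)
  case less
  have s: "differentiable_word (rem_nth i w)" if "i < length w" for i
    using less(1)[of "rem_nth i w"] length_rem_nth[OF that] by simp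
  have "weak_equation w"
  proof (cases w)
    case Nil
    then show ?thesis unfolding weak_equation_def using sol(1) solA open_cube_cube by auto
  next
    case (Cons k w')
    have g: "weak_equation w'" using less(1)[of w'] Cons by simp
    have "differentiable_word (rem_nth i w')" if "i < length w'" for i
      using less(1)[of "rem_nth i w'"] length_rem_nth[OF that] Cons by simp
    then show ?thesis unfolding Cons by (rule weak_equation_step(2)[OF g])
  qed
  then show ?case using weak_equation_step(1)[OF _ s] by blast
qed

end

section \<open>The Taylor series\<close>

lemma sorted_list_of_set_snoc:
  assumes "finite S" "\<And>x. x \<in> S \<Longrightarrow> x < (k::nat)"
  shows "sorted_list_of_set (insert k S) = sorted_list_of_set S @ [k]"
proof -
  have "k \<notin> S" using assms(2) by blast
  then show ?thesis
    using assms by (subst sorted_list_of_set_unique[symmetric]) (auto simp: sorted_wrt_append)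
qed

text \<open>\<open>mixed_deriv\<close> runs through the variables in increasing order, so the
  largest one is differentiated last and a further derivative in it can simply be put outside,
  whether or not it occurred before.\<close>

lemma mixed_deriv_Suc_max:
  assumes fin: "finite {j. \<nu> j \<noteq> 0}" and max: "\<And>j. \<nu> j \<noteq> 0 \<Longrightarrow> j \<le> k"
  shows "mixed_deriv (\<nu>(k := Suc (\<nu> k))) u = partial_deriv k (mixed_deriv \<nu> u)"
proof -
  define S where "S = {j. \<nu> j \<noteq> 0} - {k}"
  have S: "finite S" "\<And>x. x \<in> S \<Longrightarrow> x < k" using fin max by (auto simp: S_def le_less)
  have *: "mixed_deriv (\<nu>(k := n)) u
      = (partial_deriv k ^^ n) (fold (\<lambda>j. partial_deriv j ^^ \<nu> j) (sorted_list_of_set S) u)" for n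
  proof -
    have c: "fold (\<lambda>j. partial_deriv j ^^ (\<nu>(k := n)) j) (sorted_list_of_set S) u
        = fold (\<lambda>j. partial_deriv j ^^ \<nu> j) (sorted_list_of_set S) u"
      by (rule fold_cong) (use S in auto)
    show ?thesis
    proof (cases "n = 0")
      case True
      then have "{j. (\<nu>(k := n)) j \<noteq> 0} = S" by (auto simp: S_def)
      then show ?thesis unfolding mixed_deriv_def using c True by simp
    next
      case False
      then have "{j. (\<nu>(k := n)) j \<noteq> 0} = insert k S" by (auto simp: S_def)
      then show ?thesis unfolding mixed_deriv_def using c sorted_list_of_set_snoc[OF S] by simp
    qed
  qed
  have "mixed_deriv \<nu> u = mixed_deriv (\<nu>(k := \<nu> k)) u" by simp
  then show ?thesis unfolding * by simp
qed

lemma finite_count_list: "finite {j. count_list w j \<noteq> 0}"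
  by (rule finite_subset[of _ "set w"]) (auto simp: count_list_0_iff)

text \<open>Heads of words are outermost, whereas \<open>mixed_deriv\<close> has the largest
  variable outermost; hence words with non-increasing letters represent it.\<close>

lemma ex_sorted_word:
  assumes "\<nu> \<in> multi_indices"
  shows "\<exists>w. sorted (rev w) \<and> count_list w = \<nu>"
proof -
  have "finite {j. 0 < \<nu> j}" using assms by (simp add: multi_indices_def)
  then have M: "count (Abs_multiset \<nu>) = \<nu>" by (rule count_Abs_multiset)
  obtain xs where xs: "mset xs = Abs_multiset \<nu>" using ex_mset by blast
  have "count_list (rev (sort xs)) j = \<nu> j" for j
    using M xs by (simp add: count_mset[symmetric])
  then show ?thesis by (intro exI[of _ "rev (sort xs)"]) auto
qed

lemma sum_nth_count_list:
  fixes g :: "'b \<Rightarrow> real"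
  assumes "finite X" "set w \<subseteq> X"
  shows "(\<Sum>i<length w. g (w ! i)) = (\<Sum>x\<in>X. real (count_list w x) * g x)"
  using assms(2)
proof (induction w)
  case (Cons a w)
  have "(\<Sum>i<length (a # w). g ((a # w) ! i)) = g a + (\<Sum>x\<in>X. real (count_list w x) * g x)"
    using Cons by (simp only: list.size add_0_right add_Suc_right sum.lessThan_Suc_shift nth_Cons_0 nth_Cons_Suc) simp
  also have "g a = (\<Sum>x\<in>X. if x = a then g x else 0)" using Cons.prems assms(1) by simp
  finally show ?case by (simp only: sum.distrib[symmetric]) (auto intro!: sum.cong simp: algebra_simps)
qed simp

lemma mfact_pos: "0 < mfact \<nu>"
  by (simp add: mfact_def prod_pos)

text \<open>The power of the variable that a repeated letter contributes, \<open>\<nu> j\<close>,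
  combines with the factorial of the reduced index; this is what normalizes the recursion.\<close>

lemma mfact_pred:
  assumes \<nu>: "\<nu> \<in> multi_indices" and j: "\<nu> j \<noteq> 0"
  shows "real (\<nu> j) * mfact (\<nu>(j := \<nu> j - 1)) = mfact \<nu>"
proof -
  have fin: "finite {i. \<nu> i \<noteq> 0}" using \<nu> by (simp add: multi_indices_def)
  have "mfact (\<nu>(j := \<nu> j - 1)) = (\<Prod>i | \<nu> i \<noteq> 0. fact ((\<nu>(j := \<nu> j - 1)) i))"
    unfolding mfact_def by (rule prod.mono_neutral_left[OF fin]) auto
  also have "\<dots> = fact (\<nu> j - 1) * (\<Prod>i\<in>{i. \<nu> i \<noteq> 0} - {j}. fact ((\<nu>(j := \<nu> j - 1)) i))"
    using fin j by (subst prod.remove[of _ j]) auto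
  also have "(\<Prod>i\<in>{i. \<nu> i \<noteq> 0} - {j}. fact ((\<nu>(j := \<nu> j - 1)) i)) = (\<Prod>i\<in>{i. \<nu> i \<noteq> 0} - {j}. fact (\<nu> i) :: real)"
    by (rule prod.cong) auto
  finally have "real (\<nu> j) * mfact (\<nu>(j := \<nu> j - 1))
      = (real (\<nu> j) * fact (\<nu> j - 1)) * (\<Prod>i\<in>{i. \<nu> i \<noteq> 0} - {j}. fact (\<nu> i))" by (simp only: mult.assoc)
  also have "real (\<nu> j) * fact (\<nu> j - 1) = fact (\<nu> j)" using j by (simp add: fact_reduce[of "\<nu> j"])
  also have "fact (\<nu> j) * (\<Prod>i\<in>{i. \<nu> i \<noteq> 0} - {j}. fact (\<nu> i)) = mfact \<nu>"
    unfolding mfact_def using fin j by (subst prod.remove[of _ j]) auto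
  finally show ?thesis .
qed

context affine_problem
begin

lemma U_sorted: "sorted (rev w) \<Longrightarrow> U w = mixed_deriv (count_list w) u"
proof (induction w)
  case Nil
  then show ?case by (simp add: mixed_deriv_def)
next
  case (Cons k w)
  have "sorted (rev w)" "\<And>j. j \<in> set w \<Longrightarrow> j \<le> k" using Cons.prems by (auto simp: sorted_append)
  then have "mixed_deriv ((count_list w)(k := Suc (count_list w k))) u = partial_deriv k (U w)"
    using Cons.IH by (subst mixed_deriv_Suc_max[OF finite_count_list]) (auto simp: count_list_0_iff)
  moreover have "count_list (k # w) = (count_list w)(k := Suc (count_list w k))" by auto
  ultimately show ?case by (simp only: U.simps)
qed

definition tc :: "(nat \<Rightarrow> nat) \<Rightarrow> 'a H1" where
  "tc \<nu> = (1 / mfact \<nu>) *\<^sub>R mixed_deriv \<nu> u (\<lambda>_. 0)"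

text \<open>The differentiated weak equation at parameter 0, where the operator is
  \<open>A0\<close>. The \<open>\<nu> j\<close> occurrences of a letter \<open>j\<close> give equal
  terms, and \<open>\<nu> j\<close> times the factorial of the reduced index is
  \<open>mfact \<nu>\<close>, which cancels.\<close>

lemma taylor_recursion:
  assumes \<nu>: "\<nu> \<in> multi_indices"
  shows "tc \<nu> \<in> H10 D"
    and "\<And>v. v \<in> H10 D \<Longrightarrow> A0 (snd (tc \<nu>)) \<bullet> snd v
      = (if \<nu> = (\<lambda>_. 0) then f v else 0) - (\<Sum>j | \<nu> j \<noteq> 0. P j (snd (tc (\<nu>(j := \<nu> j - 1)))) \<bullet> snd v)"
proof -
  obtain w where w: "sorted (rev w)" "count_list w = \<nu>" using ex_sorted_word[OF \<nu>] by blast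
  have fin: "finite {j. \<nu> j \<noteq> 0}" using \<nu> by (simp add: multi_indices_def)
  have set: "set w = {j. \<nu> j \<noteq> 0}" by (auto simp: w(2)[symmetric] count_list_0_iff)
  define zr :: "nat \<Rightarrow> real" where "zr = (\<lambda>_. 0)"
  have O: "zr \<in> open_cube" by (simp add: open_cube_def zr_def)
  have Uw: "U w zr = mfact \<nu> *\<^sub>R tc \<nu>"
    using U_sorted[OF w(1)] mfact_pos[of \<nu>] by (simp add: w(2) tc_def zr_def)
  have am0: "am zr = ab" by (simp add: am_def fun_eq_iff zr_def)
  have g: "weak_equation w" using weak_equation_differentiable by blast
  have "mfact \<nu> *\<^sub>R tc \<nu> \<in> H10 D" using g O unfolding weak_equation_def Uw[symmetric] by blast
  then have "(1 / mfact \<nu>) *\<^sub>R (mfact \<nu> *\<^sub>R tc \<nu>) \<in> H10 D" by (rule subspace_scale[OF subspace_H10])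
  then show "tc \<nu> \<in> H10 D" using mfact_pos[of \<nu>] by simp
  fix v assume v: "v \<in> H10 D"
  interpret A0: bounded_linear A0 by (rule bounded_linear_mult_L2[OF ab])
  interpret P: bounded_linear "P j" for j by (rule bounded_linear_mult_L2[OF ps_bdd])
  have rem: "U (rem_nth i w) zr = mfact (\<nu>(w ! i := \<nu> (w ! i) - 1)) *\<^sub>R tc (\<nu>(w ! i := \<nu> (w ! i) - 1))"
    if i: "i < length w" for i
  proof -
    have split: "w = take i w @ w ! i # drop (Suc i) w" using id_take_nth_drop[OF i] .
    have "sorted (rev (take i w @ w ! i # drop (Suc i) w))" using w(1) split by simp
    then have s: "sorted (rev (rem_nth i w))" by (auto simp: rem_nth_def sorted_append)
    have "count_list (take i w @ w ! i # drop (Suc i) w) = \<nu>" using w(2) split by simp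
    then have cx: "count_list (take i w @ w ! i # drop (Suc i) w) x = \<nu> x" for x by (rule fun_cong)
    have c: "count_list (rem_nth i w) = \<nu>(w ! i := \<nu> (w ! i) - 1)"
    proof
      fix x
      show "count_list (rem_nth i w) x = (\<nu>(w ! i := \<nu> (w ! i) - 1)) x"
        using cx[of x] by (cases "x = w ! i") (auto simp: rem_nth_def)
    qed
    show ?thesis
      using U_sorted[OF s] mfact_pos[of "\<nu>(w ! i := \<nu> (w ! i) - 1)"] by (simp add: c tc_def zr_def)
  qed
  have "mfact \<nu> * (A0 (snd (tc \<nu>)) \<bullet> snd v) = A zr (snd (U w zr)) \<bullet> snd v"
    by (simp add: Uw am0 A0.scaleR)
  also have "\<dots> = (if w = [] then f v else 0) - (\<Sum>i<length w. P (w ! i) (snd (U (rem_nth i w) zr)) \<bullet> snd v)"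
    using g O v unfolding weak_equation_def by blast
  also have "(\<Sum>i<length w. P (w ! i) (snd (U (rem_nth i w) zr)) \<bullet> snd v)
      = (\<Sum>i<length w. (\<lambda>j. mfact (\<nu>(j := \<nu> j - 1)) * (P j (snd (tc (\<nu>(j := \<nu> j - 1)))) \<bullet> snd v)) (w ! i))"
    by (intro sum.cong refl) (simp add: rem P.scaleR)
  also have "\<dots> = (\<Sum>j | \<nu> j \<noteq> 0. real (count_list w j) * (mfact (\<nu>(j := \<nu> j - 1)) * (P j (snd (tc (\<nu>(j := \<nu> j - 1)))) \<bullet> snd v)))"
    by (rule sum_nth_count_list[OF fin]) (simp add: set)
  also have "\<dots> = (\<Sum>j | \<nu> j \<noteq> 0. mfact \<nu> * (P j (snd (tc (\<nu>(j := \<nu> j - 1)))) \<bullet> snd v))"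
    unfolding w(2) by (intro sum.cong refl) (simp add: mfact_pred[OF \<nu>, symmetric])
  also have "\<dots> = mfact \<nu> * (\<Sum>j | \<nu> j \<noteq> 0. P j (snd (tc (\<nu>(j := \<nu> j - 1)))) \<bullet> snd v)"
    by (simp only: sum_distrib_left)
  also have "(if w = [] then f v else 0) = mfact \<nu> * (if \<nu> = (\<lambda>_. 0) then f v else 0)"
  proof -
    have "w = [] \<longleftrightarrow> \<nu> = (\<lambda>_. 0)" using set by (auto simp: fun_eq_iff)
    then show ?thesis by (auto simp: mfact_def)
  qed
  finally have "mfact \<nu> * (A0 (snd (tc \<nu>)) \<bullet> snd v)
      = mfact \<nu> * ((if \<nu> = (\<lambda>_. 0) then f v else 0) - (\<Sum>j | \<nu> j \<noteq> 0. P j (snd (tc (\<nu>(j := \<nu> j - 1)))) \<bullet> snd v))"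
    by (simp only: right_diff_distrib)
  then show "A0 (snd (tc \<nu>)) \<bullet> snd v
      = (if \<nu> = (\<lambda>_. 0) then f v else 0) - (\<Sum>j | \<nu> j \<noteq> 0. P j (snd (tc (\<nu>(j := \<nu> j - 1)))) \<bullet> snd v)"
    using mfact_pos[of \<nu>] by (simp only: mult_cancel_left) auto
qed

definition E :: "(nat \<Rightarrow> real) \<Rightarrow> (nat \<Rightarrow> nat) \<Rightarrow> real" where
  "E y \<nu> = (\<Prod>j | \<nu> j \<noteq> 0. y j ^ \<nu> j)"

lemma E_le: "y \<in> unit_cube \<Longrightarrow> \<bar>E y \<nu>\<bar> \<le> 1"
  unfolding E_def abs_prod by (rule prod_le_1) (auto simp: cube_abs power_abs power_le_one)

lemma E_Suc:
  assumes "\<nu> \<in> multi_indices"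
  shows "E y (\<nu>(j := Suc (\<nu> j))) = E y \<nu> * y j"
proof -
  define J where "J = insert j {i. \<nu> i \<noteq> 0}"
  have J: "finite J" "j \<in> J" using assms by (auto simp: J_def multi_indices_def)
  have "E y \<mu> = (\<Prod>i\<in>J. y i ^ \<mu> i)" if "{i. \<mu> i \<noteq> 0} \<subseteq> J" for \<mu>
    unfolding E_def by (rule prod.mono_neutral_left[OF J(1) that]) auto
  then have e: "E y \<mu> = y j ^ \<mu> j * (\<Prod>i\<in>J - {j}. y i ^ \<mu> i)" if "{i. \<mu> i \<noteq> 0} \<subseteq> J" for \<mu>
    using that J by (simp add: prod.remove)
  have "(\<Prod>i\<in>J - {j}. y i ^ (\<nu>(j := Suc (\<nu> j))) i) = (\<Prod>i\<in>J - {j}. y i ^ \<nu> i)" by (rule prod.cong) auto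
  then show ?thesis by (subst (1 2) e) (auto simp: J_def)
qed

text \<open>The sum \<open>w\<close> of the series is shown to solve the weak problem at
  \<open>y\<close>. The terms in which \<open>y j *\<^sub>R P j\<close> acts on the coefficient of
  index \<open>\<nu>\<close> cancel against those that the recursion produces for
  \<open>\<nu>\<close> increased by one at \<open>j\<close>; only the load \<open>f v\<close> is
  left.\<close>

theorem taylor_has_sum:
  assumes sm: "(\<lambda>\<nu>. normV (tc \<nu>)) summable_on multi_indices" and y: "y \<in> unit_cube"
  shows "((\<lambda>\<nu>. E y \<nu> *\<^sub>R tc \<nu>) has_sum u y) multi_indices"
proof -
  let ?I = "multi_indices"
  obtain C where C: "0 < C" "\<And>v. v \<in> H10 D \<Longrightarrow> norm v \<le> C * normV v"
    using poincare_H10[OF D_bdd] by blast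
  have "(\<lambda>\<nu>. norm (E y \<nu> *\<^sub>R tc \<nu>)) summable_on ?I"
  proof (rule summable_on_comparison_test[OF summable_on_cmult_right[OF sm, of C]])
    fix \<nu> assume \<nu>: "\<nu> \<in> ?I"
    have "norm (E y \<nu> *\<^sub>R tc \<nu>) \<le> 1 * norm (tc \<nu>)"
      unfolding norm_scaleR using E_le[OF y] by (intro mult_right_mono) auto
    then show "norm (E y \<nu> *\<^sub>R tc \<nu>) \<le> C * normV (tc \<nu>)" using C(2)[OF taylor_recursion(1)[OF \<nu>]] by simp
  qed simp
  then have sum: "(\<lambda>\<nu>. E y \<nu> *\<^sub>R tc \<nu>) summable_on ?I" by (rule abs_summable_summable)
  define w where "w = (\<Sum>\<^sub>\<infinity>\<nu>\<in>?I. E y \<nu> *\<^sub>R tc \<nu>)"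
  have hs: "((\<lambda>\<nu>. E y \<nu> *\<^sub>R tc \<nu>) has_sum w) ?I" unfolding w_def using sum by (rule has_sum_infsum)
  have wH: "w \<in> H10 D"
  proof (rule Lim_in_closed_set[OF closed_H10])
    show "(sum (\<lambda>\<nu>. E y \<nu> *\<^sub>R tc \<nu>) \<longlongrightarrow> w) (finite_subsets_at_top ?I)" using hs by (simp add: has_sum_def)
    show "\<forall>\<^sub>F F in finite_subsets_at_top ?I. (\<Sum>\<nu>\<in>F. E y \<nu> *\<^sub>R tc \<nu>) \<in> H10 D"
      by (rule eventually_finite_subsets_at_top_weakI)
        (intro subspace_sum[OF subspace_H10] subspace_scale[OF subspace_H10] taylor_recursion(1), auto)
  qed simp
  have "A y (snd w) \<bullet> snd v = f v" if v: "v \<in> H10 D" for v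
  proof -
    interpret A: bounded_linear "A y" by (rule bounded_linear_mult_L2[OF am_bdd[OF y]])
    define b where "b j \<nu> = P j (snd (tc \<nu>)) \<bullet> snd v" for j \<nu>
    \<comment> \<open>\<open>c\<close> collects the terms from the operator series at
      \<open>y\<close>, and \<open>c'\<close> those from the recursion. They are the same numbers,
      indexed differently.\<close>
    define c where "c = (\<lambda>(\<nu>, j). E y \<nu> * (y j * b j \<nu>))"
    define c' where "c' = (\<lambda>(\<nu>, j). E y \<nu> * b j (\<nu>(j := \<nu> j - 1)))"
    have bs: "summable (\<lambda>j. \<bar>b j \<nu>\<bar>)" "(\<Sum>j. \<bar>b j \<nu>\<bar>) \<le> B0 * normV (tc \<nu>) * normV v" for \<nu>
      unfolding b_def normV_def by (rule P_inner_summable)+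
    have c_le: "\<bar>c (\<nu>, j)\<bar> \<le> \<bar>b j \<nu>\<bar>" for \<nu> j
    proof -
      have "\<bar>E y \<nu>\<bar> * (\<bar>y j\<bar> * \<bar>b j \<nu>\<bar>) \<le> 1 * (1 * \<bar>b j \<nu>\<bar>)"
        using y E_le[OF y] by (intro mult_mono) (auto simp: cube_abs)
      then show ?thesis by (simp add: c_def abs_mult)
    qed
    have b_on: "(\<lambda>j. \<bar>b j \<nu>\<bar>) summable_on UNIV" for \<nu>
      using norm_summable_imp_summable_on[of "\<lambda>j. \<bar>b j \<nu>\<bar>"] bs(1)[of \<nu>] by simp
    have b_sum: "(\<Sum>\<^sub>\<infinity>j\<in>UNIV. \<bar>b j \<nu>\<bar>) \<le> B0 * normV (tc \<nu>) * normV v" for \<nu>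
    proof -
      have "(\<lambda>j. \<bar>b j \<nu>\<bar>) sums (\<Sum>\<^sub>\<infinity>j\<in>UNIV. \<bar>b j \<nu>\<bar>)" by (rule has_sum_imp_sums[OF has_sum_infsum[OF b_on]])
      then show ?thesis using bs(2)[of \<nu>] by (simp add: sums_iff)
    qed
    have c_inner: "(\<lambda>j. \<bar>c (\<nu>, j)\<bar>) summable_on UNIV" for \<nu>
      by (rule summable_on_comparison_test[OF b_on[of \<nu>]]) (use c_le in auto)
    \<comment> \<open>The inner sums are bounded by a multiple of \<open>normV (tc \<nu>)\<close>,
      so the assumed summability of the coefficients gives absolute summability of the double
      family, which licenses every rearrangement below.\<close>
    have "(\<lambda>x. norm (c x)) summable_on ?I \<times> UNIV"
      unfolding Infinite_Sum.abs_summable_on_Sigma_iff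
    proof (intro conjI ballI)
      show "(\<lambda>j. norm (c (\<nu>, j))) summable_on UNIV" for \<nu> using c_inner by simp
      show "(\<lambda>\<nu>. norm (\<Sum>\<^sub>\<infinity>j\<in>UNIV. norm (c (\<nu>, j)))) summable_on ?I"
      proof (rule summable_on_comparison_test[OF summable_on_cmult_left[OF summable_on_cmult_right[OF sm, of B0], of "normV v"]])
        fix \<nu>
        have "0 \<le> (\<Sum>\<^sub>\<infinity>j\<in>UNIV. norm (c (\<nu>, j)))" by (rule infsum_nonneg) simp
        moreover have "(\<Sum>\<^sub>\<infinity>j\<in>UNIV. norm (c (\<nu>, j))) \<le> (\<Sum>\<^sub>\<infinity>j\<in>UNIV. \<bar>b j \<nu>\<bar>)"
          using c_inner[of \<nu>] b_on[of \<nu>] c_le by (intro infsum_mono) auto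
        ultimately show "norm (\<Sum>\<^sub>\<infinity>j\<in>UNIV. norm (c (\<nu>, j))) \<le> B0 * normV (tc \<nu>) * normV v"
          using b_sum[of \<nu>] by simp
      qed simp
    qed
    then have c_sum: "c summable_on Sigma ?I (\<lambda>_. UNIV)" by (rule abs_summable_summable)
    have upd: "\<nu>(j := m) \<in> ?I" if "\<nu> \<in> ?I" for \<nu> :: "nat \<Rightarrow> nat" and j m
      using that unfolding multi_indices_def
      by (auto intro: finite_subset[of _ "insert j {i. \<nu> i \<noteq> 0}"])
    have cc': "c' (\<nu>(j := Suc (\<nu> j)), j) = c (\<nu>, j)" if "\<nu> \<in> ?I" for \<nu> j
      using E_Suc[OF that, of y j] by (simp add: c_def c'_def)
    let ?T = "Sigma ?I (\<lambda>\<nu>. {j. \<nu> j \<noteq> 0})"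
    \<comment> \<open>Raising \<open>\<nu>\<close> at \<open>j\<close> maps all pairs onto the pairs
      with \<open>\<nu> j \<noteq> 0\<close>; the truncated predecessor is its inverse
      there.\<close>
    have bij: "bij_betw (\<lambda>(\<nu>, j). (\<nu>(j := Suc (\<nu> j)), j)) (Sigma ?I (\<lambda>_. UNIV)) ?T"
      by (rule bij_betw_byWitness[where f' = "\<lambda>(\<nu>, j). (\<nu>(j := \<nu> j - 1), j)"]) (auto intro: upd)
    have c'_sum: "c' summable_on ?T"
      using c_sum unfolding summable_on_reindex_bij_betw[OF bij, symmetric]
      by (rule summable_on_cong[THEN iffD1, rotated]) (auto simp: cc')
    have c'_eq: "infsum c' ?T = infsum c (Sigma ?I (\<lambda>_. UNIV))"
      unfolding infsum_reindex_bij_betw[OF bij, symmetric] by (rule infsum_cong) (auto simp: cc')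
    define \<Gamma> where "\<Gamma> \<nu> = (\<Sum>j | \<nu> j \<noteq> 0. c' (\<nu>, j))" for \<nu>
    have \<Gamma>: "\<Gamma> \<nu> = (\<Sum>\<^sub>\<infinity>j\<in>{j. \<nu> j \<noteq> 0}. c' (\<nu>, j))" if "\<nu> \<in> ?I" for \<nu>
      using that by (simp add: \<Gamma>_def multi_indices_def)
    have \<Gamma>_sum: "\<Gamma> summable_on ?I" "infsum \<Gamma> ?I = infsum c' ?T"
    proof -
      have "(\<lambda>\<nu>. \<Sum>\<^sub>\<infinity>j\<in>{j. \<nu> j \<noteq> 0}. c' (\<nu>, j)) summable_on ?I"
        using summable_on_Sigma_banach[of "\<lambda>\<nu> j. c' (\<nu>, j)" ?I "\<lambda>\<nu>. {j. \<nu> j \<noteq> 0}"] c'_sum by simp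
      then show "\<Gamma> summable_on ?I" by (rule summable_on_cong[THEN iffD2, rotated]) (rule \<Gamma>)
      have "infsum \<Gamma> ?I = (\<Sum>\<^sub>\<infinity>\<nu>\<in>?I. \<Sum>\<^sub>\<infinity>j\<in>{j. \<nu> j \<noteq> 0}. c' (\<nu>, j))" by (rule infsum_cong) (rule \<Gamma>)
      also have "\<dots> = infsum c' ?T"
        using infsum_Sigma'_banach[of "\<lambda>\<nu> j. c' (\<nu>, j)" ?I "\<lambda>\<nu>. {j. \<nu> j \<noteq> 0}"] c'_sum by simp
      finally show "infsum \<Gamma> ?I = infsum c' ?T" .
    qed
    define \<Delta> where "\<Delta> \<nu> = (\<Sum>\<^sub>\<infinity>j\<in>UNIV. c (\<nu>, j))" for \<nu>
    have \<Delta>_sum: "\<Delta> summable_on ?I" "infsum \<Delta> ?I = infsum c (Sigma ?I (\<lambda>_. UNIV))"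
      unfolding \<Delta>_def[abs_def]
      using summable_on_Sigma_banach[of "\<lambda>\<nu> j. c (\<nu>, j)" ?I "\<lambda>_. UNIV"]
        infsum_Sigma'_banach[of "\<lambda>\<nu> j. c (\<nu>, j)" ?I "\<lambda>_. UNIV"] c_sum by simp_all
    have trm: "E y \<nu> * (A y (snd (tc \<nu>)) \<bullet> snd v) = (if \<nu> = (\<lambda>_. 0) then f v else 0) - \<Gamma> \<nu> + \<Delta> \<nu>"
      if \<nu>: "\<nu> \<in> ?I" for \<nu>
    proof -
      have "(\<lambda>j. (y j *\<^sub>R P j (snd (tc \<nu>))) \<bullet> snd v) sums ((A y (snd (tc \<nu>)) - A0 (snd (tc \<nu>))) \<bullet> snd v)"
        by (rule bounded_linear.sums[OF bounded_linear_inner_left A_sums[OF y]])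
      then have "(\<lambda>j. y j * b j \<nu>) sums ((A y (snd (tc \<nu>)) - A0 (snd (tc \<nu>))) \<bullet> snd v)"
        by (simp add: b_def)
      then have "(\<lambda>j. E y \<nu> * (y j * b j \<nu>)) sums (E y \<nu> * ((A y (snd (tc \<nu>)) - A0 (snd (tc \<nu>))) \<bullet> snd v))"
        by (rule sums_mult)
      moreover have "(\<lambda>j. c (\<nu>, j)) sums \<Delta> \<nu>"
      proof -
        have "(\<lambda>j. c (\<nu>, j)) summable_on UNIV" by (rule abs_summable_summable) (use c_inner[of \<nu>] in simp)
        then show ?thesis unfolding \<Delta>_def by (rule has_sum_imp_sums[OF has_sum_infsum])
      qed
      ultimately have "\<Delta> \<nu> = E y \<nu> * ((A y (snd (tc \<nu>)) - A0 (snd (tc \<nu>))) \<bullet> snd v)"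
        by (simp add: c_def sums_unique2)
      moreover have "E y \<nu> * (A0 (snd (tc \<nu>)) \<bullet> snd v) = (if \<nu> = (\<lambda>_. 0) then f v else 0) - \<Gamma> \<nu>"
      proof -
        have "E y \<nu> = 1" if "\<nu> = (\<lambda>_. 0)" using that by (simp add: E_def)
        then show ?thesis
          unfolding taylor_recursion(2)[OF \<nu> v] \<Gamma>_def c'_def b_def
          by (auto simp: right_diff_distrib sum_distrib_left)
      qed
      ultimately show ?thesis by (simp add: inner_diff_left algebra_simps)
    qed
    have fv: "((\<lambda>\<nu>. if \<nu> = (\<lambda>_. 0) then f v else 0) has_sum f v) ?I"
    proof -
      have "((\<lambda>\<nu>. if \<nu> = (\<lambda>_. 0) then f v else 0) has_sum f v) {\<lambda>_ :: nat. 0 :: nat}"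
        by (intro has_sum_finiteI) auto
      then show ?thesis
        by (rule has_sum_cong_neutral[THEN iffD1, rotated -1]) (auto simp: multi_indices_def)
    qed
    \<comment> \<open>The sums of \<open>\<Gamma>\<close> and \<open>\<Delta>\<close> agree by the
      reindexing, so the total is \<open>f v\<close>.\<close>
    have "((\<lambda>\<nu>. (if \<nu> = (\<lambda>_. 0) then f v else 0) + (-1) * \<Gamma> \<nu> + \<Delta> \<nu>) has_sum (f v + (-1) * infsum \<Gamma> ?I + infsum \<Delta> ?I)) ?I"
      by (intro has_sum_add has_sum_cmult_right fv has_sum_infsum \<Gamma>_sum(1) \<Delta>_sum(1))
    then have 1: "((\<lambda>\<nu>. E y \<nu> * (A y (snd (tc \<nu>)) \<bullet> snd v)) has_sum f v) ?I"
      unfolding \<Gamma>_sum(2) \<Delta>_sum(2) c'_eq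
      by (subst has_sum_cong[OF trm]) simp_all
    have "bounded_linear (\<lambda>z. A y (snd z) \<bullet> snd v)"
      by (intro bounded_linear_compose[OF bounded_linear_inner_left] bounded_linear_compose[OF A.bounded_linear_axioms] bounded_linear_snd)
    from has_sum_bounded_linear[OF this hs]
    have 2: "((\<lambda>\<nu>. E y \<nu> * (A y (snd (tc \<nu>)) \<bullet> snd v)) has_sum A y (snd w) \<bullet> snd v) ?I"
      by (simp add: A.scaleR)
    show ?thesis using has_sum_unique[OF 2 1] .
  qed
  then have "w = u y" by (rule unique[OF y wH])
  then show ?thesis using hs by simp
qed

text \<open>Monomials are bounded by 1 on the cube, so the coefficient errors and the tail add up
  with no further factor, uniformly in \<open>y\<close>.\<close>

theorem taylor_error:
  assumes sm: "(\<lambda>\<nu>. normV (tc \<nu>)) summable_on multi_indices" and y: "y \<in> unit_cube"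
    and L: "finite \<Lambda>" "\<Lambda> \<subseteq> multi_indices"
  shows "normV (u y - (\<Sum>\<nu>\<in>\<Lambda>. E y \<nu> *\<^sub>R d \<nu>))
    \<le> (\<Sum>\<nu>\<in>\<Lambda>. normV (tc \<nu> - d \<nu>)) + (\<Sum>\<^sub>\<infinity>\<nu>\<in>multi_indices - \<Lambda>. normV (tc \<nu>))"
proof -
  let ?J = "multi_indices - \<Lambda>"
  have hs: "((\<lambda>\<nu>. E y \<nu> *\<^sub>R snd (tc \<nu>)) has_sum snd (u y)) multi_indices"
    using has_sum_bounded_linear[OF bounded_linear_snd taylor_has_sum[OF sm y]] by simp
  have "((\<lambda>\<nu>. E y \<nu> *\<^sub>R snd (tc \<nu>)) has_sum (snd (u y) - (\<Sum>\<nu>\<in>\<Lambda>. E y \<nu> *\<^sub>R snd (tc \<nu>)))) ?J"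
    by (rule has_sum_Diff[OF hs has_sum_finite[OF L(1)] L(2)])
  then have eq: "(\<Sum>\<^sub>\<infinity>\<nu>\<in>?J. E y \<nu> *\<^sub>R snd (tc \<nu>)) = snd (u y) - (\<Sum>\<nu>\<in>\<Lambda>. E y \<nu> *\<^sub>R snd (tc \<nu>))"
    by (rule infsumI)
  have le: "norm (E y \<nu> *\<^sub>R g) \<le> norm g" for \<nu> and g :: "('a, 'a) L2"
    using mult_right_mono[OF E_le[OF y], of "norm g" \<nu>] by simp
  have smJ: "(\<lambda>\<nu>. normV (tc \<nu>)) summable_on ?J" using sm by (rule summable_on_subset_banach) simp
  have ab: "(\<lambda>\<nu>. norm (E y \<nu> *\<^sub>R snd (tc \<nu>))) summable_on ?J"
    by (rule summable_on_comparison_test[OF smJ]) (use le in \<open>auto simp: normV_def\<close>)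
  have "norm (\<Sum>\<^sub>\<infinity>\<nu>\<in>?J. E y \<nu> *\<^sub>R snd (tc \<nu>)) \<le> (\<Sum>\<^sub>\<infinity>\<nu>\<in>?J. norm (E y \<nu> *\<^sub>R snd (tc \<nu>)))"
    by (rule norm_infsum_bound[OF ab])
  also have "\<dots> \<le> (\<Sum>\<^sub>\<infinity>\<nu>\<in>?J. normV (tc \<nu>))"
    using le by (intro infsum_mono ab smJ) (auto simp: normV_def)
  finally have 1: "norm (\<Sum>\<^sub>\<infinity>\<nu>\<in>?J. E y \<nu> *\<^sub>R snd (tc \<nu>)) \<le> (\<Sum>\<^sub>\<infinity>\<nu>\<in>?J. normV (tc \<nu>))" .
  have "norm (\<Sum>\<nu>\<in>\<Lambda>. E y \<nu> *\<^sub>R snd (tc \<nu> - d \<nu>)) \<le> (\<Sum>\<nu>\<in>\<Lambda>. norm (E y \<nu> *\<^sub>R snd (tc \<nu> - d \<nu>)))" by (rule norm_sum)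
  also have "\<dots> \<le> (\<Sum>\<nu>\<in>\<Lambda>. normV (tc \<nu> - d \<nu>))" unfolding normV_def by (intro sum_mono le)
  finally have 2: "norm (\<Sum>\<nu>\<in>\<Lambda>. E y \<nu> *\<^sub>R snd (tc \<nu> - d \<nu>)) \<le> (\<Sum>\<nu>\<in>\<Lambda>. normV (tc \<nu> - d \<nu>))" .
  have "snd (u y - (\<Sum>\<nu>\<in>\<Lambda>. E y \<nu> *\<^sub>R d \<nu>))
      = (\<Sum>\<nu>\<in>\<Lambda>. E y \<nu> *\<^sub>R snd (tc \<nu> - d \<nu>)) + (\<Sum>\<^sub>\<infinity>\<nu>\<in>?J. E y \<nu> *\<^sub>R snd (tc \<nu>))"
    unfolding eq by (simp add: linear_sum[OF bounded_linear.linear[OF bounded_linear_snd]] scaleR_diff_right sum_subtractf)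
  then have "normV (u y - (\<Sum>\<nu>\<in>\<Lambda>. E y \<nu> *\<^sub>R d \<nu>))
      \<le> norm (\<Sum>\<nu>\<in>\<Lambda>. E y \<nu> *\<^sub>R snd (tc \<nu> - d \<nu>)) + norm (\<Sum>\<^sub>\<infinity>\<nu>\<in>?J. E y \<nu> *\<^sub>R snd (tc \<nu>))"
    by (simp only: normV_def norm_triangle_ineq)
  with 1 2 show ?thesis by linarith
qed

end

section \<open>Dimension of the approximation spaces\<close>

interpretation fun_vs: vector_space "\<lambda>(c::real) (w :: 'b \<Rightarrow> 'v::real_vector) y. c *\<^sub>R w y"
  by unfold_locales (auto simp: fun_eq_iff scaleR_add_right scaleR_add_left)

lemma sum_fun_apply: "(\<Sum>i\<in>I. f i) y = (\<Sum>i\<in>I. (f i y :: 'v::ab_group_add))"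
  by (induction I rule: infinite_finite_induct) auto

text \<open>The products of the \<open>b \<nu>\<close> with basis vectors of \<open>W \<nu>\<close>
  form a basis. Independence of the \<open>b \<nu>\<close> is assumed with vector coefficients
  because the inner combination in each \<open>W \<nu>\<close> has to vanish before its scalars can
  be compared.\<close>

lemma fun_dim_tensor:
  fixes b :: "'i \<Rightarrow> 'b \<Rightarrow> real" and W :: "'i \<Rightarrow> 'v::real_vector set"
  assumes fin: "finite \<Lambda>"
    and ind: "\<And>d :: 'i \<Rightarrow> 'v. \<And>\<nu>. (\<And>y. y \<in> Z \<Longrightarrow> (\<Sum>\<nu>\<in>\<Lambda>. b \<nu> y *\<^sub>R d \<nu>) = 0) \<Longrightarrow> \<nu> \<in> \<Lambda> \<Longrightarrow> d \<nu> = 0"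
    and W: "\<And>\<nu>. \<nu> \<in> \<Lambda> \<Longrightarrow> subspace (W \<nu>)" "\<And>\<nu>. \<nu> \<in> \<Lambda> \<Longrightarrow> dim (W \<nu>) = n \<nu>" "\<And>\<nu>. \<nu> \<in> \<Lambda> \<Longrightarrow> 0 < n \<nu>"
  shows "fun_dim {(\<lambda>y. if y \<in> Z then \<Sum>\<nu>\<in>\<Lambda>. b \<nu> y *\<^sub>R v \<nu> else 0) | v. \<forall>\<nu>\<in>\<Lambda>. v \<nu> \<in> W \<nu>} = (\<Sum>\<nu>\<in>\<Lambda>. n \<nu>)"
    (is "fun_dim ?S = _")
proof -
  have "\<exists>B. B \<subseteq> W \<nu> \<and> independent B \<and> W \<nu> \<subseteq> span B \<and> card B = n \<nu>" if "\<nu> \<in> \<Lambda>" for \<nu>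
    using basis_exists[of "W \<nu>"] W(2)[OF that] by metis
  then obtain B where B: "\<And>\<nu>. \<nu> \<in> \<Lambda> \<Longrightarrow> B \<nu> \<subseteq> W \<nu>" "\<And>\<nu>. \<nu> \<in> \<Lambda> \<Longrightarrow> independent (B \<nu>)"
    "\<And>\<nu>. \<nu> \<in> \<Lambda> \<Longrightarrow> W \<nu> \<subseteq> span (B \<nu>)" "\<And>\<nu>. \<nu> \<in> \<Lambda> \<Longrightarrow> card (B \<nu>) = n \<nu>" by metis
  have finB: "finite (B \<nu>)" if "\<nu> \<in> \<Lambda>" for \<nu> using B(4)[OF that] W(3)[OF that] by (metis card_gt_0_iff)
  define T where "T = (\<lambda>(\<nu>, x) y. if y \<in> Z then b \<nu> y *\<^sub>R (x :: 'v) else 0)"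
  let ?I = "Sigma \<Lambda> B"
  have finI: "finite ?I" using fin finB by auto
  have nz: "x \<noteq> 0" if "\<nu> \<in> \<Lambda>" "x \<in> B \<nu>" for \<nu> x using B(2) that dependent_zero by metis
  have inj: "inj_on T ?I"
  proof (rule inj_onI, clarify)
    fix \<nu> \<nu>' x x' assume *: "\<nu> \<in> \<Lambda>" "x \<in> B \<nu>" "\<nu>' \<in> \<Lambda>" "x' \<in> B \<nu>'" "T (\<nu>, x) = T (\<nu>', x')"
    \<comment> \<open>Equality of two basis products is a relation between the
      \<open>b \<nu>\<close> with at most two non-zero coefficients; its coefficient at
      \<open>\<nu>\<close> vanishes only if both the indices and the vectors agree.\<close>
    define d where "d \<kappa> = (if \<kappa> = \<nu> then x else 0) - (if \<kappa> = \<nu>' then x' else 0)" for \<kappa>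
    have "d \<kappa> = 0" if k: "\<kappa> \<in> \<Lambda>" for \<kappa>
    proof (rule ind[OF _ k])
      fix y assume "y \<in> Z"
      then have "b \<nu> y *\<^sub>R x = b \<nu>' y *\<^sub>R x'" using fun_cong[OF *(5), of y] by (simp add: T_def)
      moreover have "b \<kappa> y *\<^sub>R d \<kappa> = (if \<kappa> = \<nu> then b \<nu> y *\<^sub>R x else 0) - (if \<kappa> = \<nu>' then b \<nu>' y *\<^sub>R x' else 0)" for \<kappa>
        by (simp add: d_def scaleR_diff_right)
      ultimately show "(\<Sum>\<kappa>\<in>\<Lambda>. b \<kappa> y *\<^sub>R d \<kappa>) = 0" using *(1,3) fin by (simp add: sum_subtractf)
    qed
    then have "d \<nu> = 0" using * by blast
    then have "\<nu> = \<nu>'" "x = x'" using nz[OF *(1,2)] by (auto simp: d_def split: if_splits)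
    then show "\<nu> = \<nu>' \<and> x = x'" by blast
  qed
  have "fun_vs.dim ?S = (\<Sum>\<nu>\<in>\<Lambda>. n \<nu>)"
  proof (rule fun_vs.dim_unique)
    show "T ` ?I \<subseteq> ?S"
    proof clarify
      fix \<nu> x assume *: "\<nu> \<in> \<Lambda>" "x \<in> B \<nu>"
      show "\<exists>v. T (\<nu>, x) = (\<lambda>y. if y \<in> Z then \<Sum>\<nu>\<in>\<Lambda>. b \<nu> y *\<^sub>R v \<nu> else 0) \<and> (\<forall>\<nu>\<in>\<Lambda>. v \<nu> \<in> W \<nu>)"
      proof (intro exI[of _ "\<lambda>\<kappa>. if \<kappa> = \<nu> then x else 0"] conjI ballI)
        show "T (\<nu>, x) = (\<lambda>y. if y \<in> Z then \<Sum>\<kappa>\<in>\<Lambda>. b \<kappa> y *\<^sub>R (if \<kappa> = \<nu> then x else 0) else 0)"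
          using * fin by (auto simp: T_def fun_eq_iff if_distrib[of "\<lambda>z. _ *\<^sub>R z"] cong: if_cong)
        show "(if \<kappa> = \<nu> then x else 0) \<in> W \<kappa>" if "\<kappa> \<in> \<Lambda>" for \<kappa>
          using * that B(1) subspace_0[OF W(1)] by auto
      qed
    qed
    show "?S \<subseteq> fun_vs.span (T ` ?I)"
    proof clarify
      fix v assume v: "\<forall>\<nu>\<in>\<Lambda>. v \<nu> \<in> W \<nu>"
      have "\<exists>r. v \<nu> = (\<Sum>x\<in>B \<nu>. r x *\<^sub>R x)" if "\<nu> \<in> \<Lambda>" for \<nu>
        using v B(3)[OF that] that span_finite[OF finB[OF that]] by blast
      then obtain r where r: "\<And>\<nu>. \<nu> \<in> \<Lambda> \<Longrightarrow> v \<nu> = (\<Sum>x\<in>B \<nu>. r \<nu> x *\<^sub>R x)" by metis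
      have "(\<lambda>y. if y \<in> Z then \<Sum>\<nu>\<in>\<Lambda>. b \<nu> y *\<^sub>R v \<nu> else 0) = (\<Sum>\<nu>\<in>\<Lambda>. \<Sum>x\<in>B \<nu>. (\<lambda>y. r \<nu> x *\<^sub>R T (\<nu>, x) y))"
      proof
        fix y
        show "(if y \<in> Z then \<Sum>\<nu>\<in>\<Lambda>. b \<nu> y *\<^sub>R v \<nu> else 0) = (\<Sum>\<nu>\<in>\<Lambda>. \<Sum>x\<in>B \<nu>. (\<lambda>y. r \<nu> x *\<^sub>R T (\<nu>, x) y)) y"
          by (auto simp: sum_fun_apply T_def r scaleR_sum_right mult.commute intro!: sum.cong)
      qed
      also have "\<dots> \<in> fun_vs.span (T ` ?I)"
        by (intro fun_vs.span_sum fun_vs.span_scale fun_vs.span_base) auto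
      finally show "(\<lambda>y. if y \<in> Z then \<Sum>\<nu>\<in>\<Lambda>. b \<nu> y *\<^sub>R v \<nu> else 0) \<in> fun_vs.span (T ` ?I)" .
    qed
    show "fun_vs.independent (T ` ?I)"
    proof (rule fun_vs.independent_if_scalars_zero)
      fix f and g assume z: "(\<Sum>g\<in>T ` ?I. (\<lambda>y. f g *\<^sub>R g y)) = 0" and g: "g \<in> T ` ?I"
      define r where "r \<nu> x = f (T (\<nu>, x))" for \<nu> x
      have r0: "(\<Sum>\<nu>\<in>\<Lambda>. b \<nu> y *\<^sub>R (\<Sum>x\<in>B \<nu>. r \<nu> x *\<^sub>R x)) = 0" if "y \<in> Z" for y
      proof -
        have "0 = (\<Sum>g\<in>T ` ?I. f g *\<^sub>R g y)" using fun_cong[OF z, of y] by (simp add: sum_fun_apply)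
        also have "\<dots> = (\<Sum>i\<in>?I. f (T i) *\<^sub>R T i y)" by (simp add: sum.reindex[OF inj])
        also have "\<dots> = (\<Sum>\<nu>\<in>\<Lambda>. \<Sum>x\<in>B \<nu>. f (T (\<nu>, x)) *\<^sub>R T (\<nu>, x) y)"
          using fin finB by (subst sum.Sigma) (auto intro!: sum.cong)
        also have "\<dots> = (\<Sum>\<nu>\<in>\<Lambda>. b \<nu> y *\<^sub>R (\<Sum>x\<in>B \<nu>. r \<nu> x *\<^sub>R x))"
          using that by (simp add: r_def T_def scaleR_sum_right mult.commute)
        finally show ?thesis ..
      qed
      have "(\<Sum>x\<in>B \<nu>. r \<nu> x *\<^sub>R x) = 0" if "\<nu> \<in> \<Lambda>" for \<nu>
        by (rule ind[where d = "\<lambda>\<nu>. \<Sum>x\<in>B \<nu>. r \<nu> x *\<^sub>R x", OF r0 that])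
      then have "r \<nu> x = 0" if "\<nu> \<in> \<Lambda>" "x \<in> B \<nu>" for \<nu> x
        using independentD[OF B(2)[OF that(1)] finB[OF that(1)] subset_refl] that by blast
      then show "f g = 0" using g by (auto simp: r_def)
    qed (use finI in simp)
    show "card (T ` ?I) = (\<Sum>\<nu>\<in>\<Lambda>. n \<nu>)"
      unfolding card_image[OF inj] using fin finB B(4) by (subst card_SigmaI) auto
  qed
  then show ?thesis unfolding fun_dim_def .
qed

text \<open>The lowest digit is the remainder modulo \<open>B\<close>; the others are the digits of
  the quotient.\<close>

lemma digits_unique:
  fixes a b :: "nat \<Rightarrow> nat"
  assumes "\<And>j. j < m \<Longrightarrow> a j < B" "\<And>j. j < m \<Longrightarrow> b j < B"
    and "(\<Sum>j<m. a j * B ^ j) = (\<Sum>j<m. b j * B ^ j)"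
  shows "j < m \<Longrightarrow> a j = b j"
  using assms
proof (induction m arbitrary: a b j)
  case (Suc m)
  have e: "(\<Sum>j<Suc m. c j * B ^ j) = c 0 + B * (\<Sum>j<m. c (Suc j) * B ^ j)" for c :: "nat \<Rightarrow> nat"
    by (simp only: sum.lessThan_Suc_shift) (simp add: sum_distrib_left mult_ac)
  have eq: "a 0 + B * (\<Sum>j<m. a (Suc j) * B ^ j) = b 0 + B * (\<Sum>j<m. b (Suc j) * B ^ j)"
    using Suc.prems(4) unfolding e .
  have lt: "a 0 < B" "b 0 < B" using Suc.prems(2,3)[of 0] by auto
  have "(a 0 + B * (\<Sum>j<m. a (Suc j) * B ^ j)) mod B = a 0" "(b 0 + B * (\<Sum>j<m. b (Suc j) * B ^ j)) mod B = b 0"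
    using lt by simp_all
  then have 0: "a 0 = b 0" using eq by metis
  then have "(\<Sum>j<m. a (Suc j) * B ^ j) = (\<Sum>j<m. b (Suc j) * B ^ j)" using eq lt by simp
  from Suc.IH[OF _ _ _ this] have "a (Suc i) = b (Suc i)" if "i < m" for i
    using Suc.prems(2,3) that by simp
  then show ?case using 0 Suc.prems(1) by (cases j) auto
qed simp

text \<open>Kronecker's substitution \<open>y j = z ^ (B ^ j)\<close> turns distinct monomials into distinct powers of \<open>z\<close>.\<close>

lemma monomials_independent:
  fixes d :: "(nat \<Rightarrow> nat) \<Rightarrow> 'v::real_inner"
  assumes F: "finite F" "F \<subseteq> multi_indices"
    and z: "\<And>y. y \<in> unit_cube \<Longrightarrow> (\<Sum>\<nu>\<in>F. (\<Prod>j | \<nu> j \<noteq> 0. y j ^ \<nu> j) *\<^sub>R d \<nu>) = 0"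
    and \<mu>: "\<mu> \<in> F"
  shows "d \<mu> = 0"
proof -
  define J where "J = (\<Union>\<nu>\<in>F. {j. \<nu> j \<noteq> 0})"
  have J: "finite J" using F by (auto simp: J_def multi_indices_def)
  obtain m where m: "\<And>j. j \<in> J \<Longrightarrow> j < m" using finite_nat_set_iff_bounded[of J] J by blast
  have "finite ((\<lambda>(\<nu>, j). \<nu> j) ` (F \<times> {..<m}))" using F by auto
  then have "\<exists>B. \<forall>i\<in>(\<lambda>(\<nu>, j). \<nu> j) ` (F \<times> {..<m}). i < B"
    by (simp only: finite_nat_set_iff_bounded)
  then obtain B where B: "\<And>i. i \<in> (\<lambda>(\<nu>, j). \<nu> j) ` (F \<times> {..<m}) \<Longrightarrow> i < B"
    by (elim exE) (rule that, blast)
  have dB: "\<nu> j < B" if "\<nu> \<in> F" "j < m" for \<nu> j using B[of "\<nu> j"] that by force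
  define k where "k \<nu> = (\<Sum>j<m. \<nu> j * B ^ j)" for \<nu>
  have z0: "\<nu> j = 0" if "\<nu> \<in> F" "\<not> j < m" for \<nu> j
    using m[of j] that unfolding J_def by blast
  have inj: "\<nu> = \<kappa>" if "\<nu> \<in> F" "\<kappa> \<in> F" "k \<nu> = k \<kappa>" for \<nu> \<kappa>
  proof
    fix j
    show "\<nu> j = \<kappa> j"
      using digits_unique[of m \<nu> B \<kappa> j] dB[OF that(1)] dB[OF that(2)] that(3) z0[OF that(1)] z0[OF that(2)]
      unfolding k_def by (cases "j < m") auto
  qed
  \<comment> \<open>The vector identity is tested against \<open>d \<mu>\<close>, which gives a real
    polynomial in one variable with infinitely many zeros.\<close>
  define p where "p = (\<Sum>\<nu>\<in>F. monom (d \<nu> \<bullet> d \<mu>) (k \<nu>))"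
  have p0: "poly p x = 0" if x: "x \<in> {0..1}" for x
  proof -
    define y where "y j = x ^ (B ^ j)" for j :: nat
    have "y j \<in> {-1..1}" for j
    proof -
      have "0 \<le> y j" "y j \<le> 1" using x by (auto simp: y_def power_le_one)
      then show ?thesis by simp
    qed
    then have "y \<in> unit_cube" by (simp add: unit_cube_def)
    have mono: "(\<Prod>j | \<nu> j \<noteq> 0. y j ^ \<nu> j) = x ^ k \<nu>" if "\<nu> \<in> F" for \<nu>
    proof -
      have "(\<Prod>j | \<nu> j \<noteq> 0. y j ^ \<nu> j) = (\<Prod>j<m. y j ^ \<nu> j)"
        by (intro prod.mono_neutral_left) (use z0[OF that] in \<open>auto intro: ccontr\<close>)
      also have "\<dots> = x ^ k \<nu>" by (simp add: y_def k_def power_sum power_mult[symmetric] mult.commute)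
      finally show ?thesis .
    qed
    have "poly p x = (\<Sum>\<nu>\<in>F. x ^ k \<nu> *\<^sub>R d \<nu>) \<bullet> d \<mu>"
      by (simp add: p_def poly_sum poly_monom inner_sum_left mult.commute)
    also have "(\<Sum>\<nu>\<in>F. x ^ k \<nu> *\<^sub>R d \<nu>) = 0"
      using z[OF \<open>y \<in> unit_cube\<close>] mono by (simp cong: sum.cong)
    finally show ?thesis by simp
  qed
  have "p = 0"
  proof (rule ccontr)
    assume "p \<noteq> 0"
    then have "finite {x. poly p x = 0}" by (rule poly_roots_finite)
    moreover have "{0..1::real} \<subseteq> {x. poly p x = 0}" using p0 by auto
    ultimately have "finite {0..1::real}" by (rule rev_finite_subset)
    then show False using infinite_Icc[of "0::real" 1] by simp
  qed
  \<comment> \<open>As distinct multi-indices have distinct exponents, the coefficient at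
    \<open>k \<mu>\<close> is the squared norm of \<open>d \<mu>\<close>.\<close>
  then have "0 = coeff p (k \<mu>)" by simp
  also have "\<dots> = (\<Sum>\<nu>\<in>F. if \<nu> = \<mu> then d \<nu> \<bullet> d \<mu> else 0)"
    unfolding p_def coeff_sum using inj \<mu> by (intro sum.cong) auto
  also have "\<dots> = d \<mu> \<bullet> d \<mu>" using F(1) \<mu> by simp
  finally show ?thesis by simp
qed

context orthonormal_system
begin

text \<open>
  Only the gradient of \<open>u\<close> is assumed square integrable; the Poincare inequality makes the
  coefficients well-defined Bochner integrals in H^1.
\<close>

lemma expansion_error_H1:
  fixes u :: "(nat \<Rightarrow> real) \<Rightarrow> 'a::euclidean_space H1"
  assumes D: "bounded D" and Z: "Z \<in> sets M" "AE y in M. y \<in> Z"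
    and um: "u \<in> borel_measurable (restrict_space M Z)" and uH: "AE y in M. u y \<in> H10 D"
    and ui: "set_integrable M Z (\<lambda>y. (normV (u y))\<^sup>2)"
    and L: "finite \<Lambda>" "\<Lambda> \<subseteq> multi_indices"
    and cf: "\<And>\<nu>. cf \<nu> = (LINT y:Z|M. \<phi> \<nu> y *\<^sub>R u y)"
    and sm: "(\<lambda>\<nu>. (normV (cf \<nu>))\<^sup>2) summable_on multi_indices - \<Lambda>"
    and un: "\<And>y. y \<in> Z \<Longrightarrow> un y = (\<Sum>\<nu>\<in>\<Lambda>. \<phi> \<nu> y *\<^sub>R d \<nu>)"
  shows "(\<lambda>y. u y - un y) \<in> borel_measurable (restrict_space M Z)"
    and "set_integrable M Z (\<lambda>y. (normV (u y - un y))\<^sup>2)"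
    and "(LINT y:Z|M. (normV (u y - un y))\<^sup>2)
      \<le> (\<Sum>\<nu>\<in>\<Lambda>. (normV (cf \<nu> - d \<nu>))\<^sup>2) + (\<Sum>\<^sub>\<infinity>\<nu>\<in>multi_indices - \<Lambda>. (normV (cf \<nu>))\<^sup>2)"
proof -
  have Zs: "Z \<inter> space M \<in> sets M" using Z(1) by auto
  \<comment> \<open>Extension by 0 turns integrals over \<open>Z\<close> into integrals over the
    full measure space, and 0 lies in the subspace \<open>H10 D\<close>.\<close>
  define u' where "u' y = indicator Z y *\<^sub>R u y" for y
  have u'm[measurable]: "u' \<in> borel_measurable M"
    unfolding u'_def[abs_def] using um borel_measurable_restrict_space_iff[OF Zs] by blast
  have nV: "(normV (u' y))\<^sup>2 = indicator Z y *\<^sub>R (normV (u y))\<^sup>2" for y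
    by (simp add: u'_def normV_def indicator_def)
  have iV: "integrable M (\<lambda>y. (normV (u' y))\<^sup>2)" unfolding nV using ui by (simp add: set_integrable_def)
  obtain C where C: "0 < C" "\<And>v. v \<in> H10 D \<Longrightarrow> norm v \<le> C * normV v"
    using poincare_H10[OF D] by blast
  have i1: "integrable M (\<lambda>y. (norm (u' y))\<^sup>2)"
  proof (rule Bochner_Integration.integrable_bound)
    show "integrable M (\<lambda>y. C\<^sup>2 * (normV (u' y))\<^sup>2)" using iV by simp
    show "(\<lambda>y. (norm (u' y))\<^sup>2) \<in> borel_measurable M" by simp
    show "AE y in M. norm ((norm (u' y))\<^sup>2) \<le> norm (C\<^sup>2 * (normV (u' y))\<^sup>2)"
      using uH
    proof eventually_elim
      case (elim y)
      then have "u' y \<in> H10 D" unfolding u'_def by (rule subspace_scale[OF subspace_H10])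
      from power_mono[OF C(2)[OF this], of 2] show ?case by (simp add: power_mult_distrib)
    qed
  qed
  \<comment> \<open>\<open>normV\<close> sees only the gradient component, which commutes with the
    Bochner integral, so the Hilbert space theory is applied to \<open>g\<close>.\<close>
  define g where "g y = snd (u' y)" for y
  have gm: "g \<in> borel_measurable M"
    unfolding g_def[abs_def] by (rule borel_measurable_continuous_on[OF _ u'm]) (intro continuous_intros)
  have g: "L2_function M g" using gm iV by (simp add: L2_function_def g_def normV_def)
  have int: "integrable M (\<lambda>y. \<phi> \<nu> y *\<^sub>R u' y)" if "\<nu> \<in> multi_indices" for \<nu>
    by (rule integrable_scaleR_L2_function[OF \<phi>_L2[OF that] u'm i1])
  have cg: "snd (cf \<nu>) = (LINT y|M. \<phi> \<nu> y *\<^sub>R g y)" if "\<nu> \<in> multi_indices" for \<nu>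
  proof -
    have "cf \<nu> = (LINT y|M. \<phi> \<nu> y *\<^sub>R u' y)"
      by (simp add: cf set_lebesgue_integral_def u'_def mult.commute)
    then show ?thesis
      using integral_bounded_linear[OF bounded_linear_snd int[OF that]] by (simp add: g_def)
  qed
  have nVc: "(normV (cf \<nu>))\<^sup>2 = (norm (LINT y|M. \<phi> \<nu> y *\<^sub>R g y))\<^sup>2" if "\<nu> \<in> multi_indices" for \<nu>
    by (simp add: normV_def cg[OF that])
  have sm': "(\<lambda>\<nu>. (norm (LINT y|M. \<phi> \<nu> y *\<^sub>R g y))\<^sup>2) summable_on multi_indices - \<Lambda>"
    using sm by (rule summable_on_cong[THEN iffD1, rotated]) (simp add: nVc)
  let ?e = "\<lambda>y. g y - (\<Sum>\<nu>\<in>\<Lambda>. \<phi> \<nu> y *\<^sub>R snd (d \<nu>))"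
  have e: "L2_function M ?e" by (rule expansion_error_eq(1)[OF g L])
  have ind: "indicator Z y *\<^sub>R (u y - un y) = u' y - indicator Z y *\<^sub>R (\<Sum>\<nu>\<in>\<Lambda>. \<phi> \<nu> y *\<^sub>R d \<nu>)" for y
    using un[of y] by (cases "y \<in> Z") (auto simp: u'_def)
  have m: "(\<lambda>y. indicator Z y *\<^sub>R (u y - un y)) \<in> borel_measurable M"
    unfolding ind using Z(1) by measurable
  then show "(\<lambda>y. u y - un y) \<in> borel_measurable (restrict_space M Z)"
    using borel_measurable_restrict_space_iff[OF Zs] by blast
  have ez: "indicator Z y *\<^sub>R (normV (u y - un y))\<^sup>2 = indicator Z y *\<^sub>R (norm (?e y))\<^sup>2" for y
  proof (cases "y \<in> Z")
    case True
    then have "snd (u y - un y) = ?e y"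
      by (simp add: un g_def u'_def linear_sum[OF bounded_linear.linear[OF bounded_linear_snd]])
    then show ?thesis by (simp add: normV_def)
  qed simp
  have ie: "integrable M (\<lambda>y. indicator Z y *\<^sub>R (norm (?e y))\<^sup>2)"
    using e Z(1) by (intro integrable_mult_indicator) (auto simp: L2_function_def)
  then show "set_integrable M Z (\<lambda>y. (normV (u y - un y))\<^sup>2)"
    unfolding set_integrable_def ez .
  have "(LINT y:Z|M. (normV (u y - un y))\<^sup>2) \<le> (LINT y|M. (norm (?e y))\<^sup>2)"
    unfolding set_lebesgue_integral_def ez
    using e by (intro integral_mono ie) (auto simp: L2_function_def indicator_def)
  also have "\<dots> \<le> (\<Sum>\<nu>\<in>\<Lambda>. (norm ((LINT y|M. \<phi> \<nu> y *\<^sub>R g y) - snd (d \<nu>)))\<^sup>2)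
      + (\<Sum>\<^sub>\<infinity>\<nu>\<in>multi_indices - \<Lambda>. (norm (LINT y|M. \<phi> \<nu> y *\<^sub>R g y))\<^sup>2)"
    by (rule expansion_error_le[OF g L sm'])
  also have "(\<Sum>\<nu>\<in>\<Lambda>. (norm ((LINT y|M. \<phi> \<nu> y *\<^sub>R g y) - snd (d \<nu>)))\<^sup>2) = (\<Sum>\<nu>\<in>\<Lambda>. (normV (cf \<nu> - d \<nu>))\<^sup>2)"
    using L(2) by (intro sum.cong) (auto simp: normV_def cg[symmetric])
  also have "(\<Sum>\<^sub>\<infinity>\<nu>\<in>multi_indices - \<Lambda>. (norm (LINT y|M. \<phi> \<nu> y *\<^sub>R g y))\<^sup>2) = (\<Sum>\<^sub>\<infinity>\<nu>\<in>multi_indices - \<Lambda>. (normV (cf \<nu>))\<^sup>2)"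
    by (rule infsum_cong) (simp add: nVc)
  finally show "(LINT y:Z|M. (normV (u y - un y))\<^sup>2)
      \<le> (\<Sum>\<nu>\<in>\<Lambda>. (normV (cf \<nu> - d \<nu>))\<^sup>2) + (\<Sum>\<^sub>\<infinity>\<nu>\<in>multi_indices - \<Lambda>. (normV (cf \<nu>))\<^sup>2)" .
qed

end

section \<open>Error of the truncated expansions\<close>

text \<open>Extending the coefficients by 0 replaces the measure restricted to \<open>D\<close> by
  Lebesgue measure on the whole space; the integrand of the weak form then vanishes outside
  \<open>D\<close>.\<close>

lemma affine_solution_problem:
  fixes D :: "'a::euclidean_space set"
  assumes D: "bounded_lipschitz_domain D" and f: "f \<in> H10_dual D" and u: "affine_solution D abar \<psi> f u"
  shows "\<exists>r0 B0. affine_problem D (\<lambda>x. indicator D x * abar x) (\<lambda>j x. indicator D x * \<psi> j x) f u r0 B0"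
proof -
  have oD: "open D" "bounded D" using D by (auto simp: bounded_lipschitz_domain_def)
  then have Ds: "D \<inter> space lebesgue \<in> sets lebesgue" by (simp add: borel_open)
  have meas: "(\<lambda>x. indicator D x * h x) \<in> borel_measurable lebesgue" if "essentially_bounded_on D h" for h
    using that borel_measurable_restrict_space_iff[OF Ds, of h] by (simp add: essentially_bounded_on_def)
  note u = u[unfolded affine_solution_def]
  obtain B where B: "AE x in lebesgue_on D. \<bar>abar x\<bar> \<le> B" using u unfolding essentially_bounded_on_def by blast
  obtain r0 where r0: "0 < r0" "AE x in lebesgue_on D. summable (\<lambda>j. \<bar>\<psi> j x\<bar>) \<and> (\<Sum>j. \<bar>\<psi> j x\<bar>) \<le> abar x - r0"
    using u by blast
  \<comment> \<open>The essential bound is made non-negative, as \<open>ess_bdd\<close>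
    demands.\<close>
  have "affine_problem D (\<lambda>x. indicator D x * abar x) (\<lambda>j x. indicator D x * \<psi> j x) f u r0 (max 0 B)"
  proof
    show "open D" "bounded D" "f \<in> H10_dual D" "0 < r0" using oD f r0 by auto
    show "ess_bdd (\<lambda>x. indicator D x * abar x) (max 0 B)"
      unfolding ess_bdd_def
    proof (intro conjI)
      show "(\<lambda>x. indicator D x * abar x) \<in> borel_measurable lebesgue" using meas u by blast
      have "AE x in lebesgue. x \<in> D \<longrightarrow> \<bar>abar x\<bar> \<le> B" using B unfolding AE_restrict_space_iff[OF Ds] .
      then show "AE x in lebesgue. \<bar>indicator D x * abar x\<bar> \<le> max 0 B"
        by eventually_elim (auto simp: indicator_def)
    qed simp
    show "(\<lambda>x. indicator D x * \<psi> j x) \<in> borel_measurable lebesgue" for j using meas u by blast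
    have "AE x in lebesgue. x \<in> D \<longrightarrow> summable (\<lambda>j. \<bar>\<psi> j x\<bar>) \<and> (\<Sum>j. \<bar>\<psi> j x\<bar>) \<le> abar x - r0"
      using r0(2) unfolding AE_restrict_space_iff[OF Ds] .
    then show "AE x in lebesgue. summable (\<lambda>j. \<bar>indicator D x * \<psi> j x\<bar>) \<and>
        (\<Sum>j. \<bar>indicator D x * \<psi> j x\<bar>) \<le> indicator D x * abar x - r0 * indicator D x"
      by eventually_elim (auto simp: indicator_def)
  next
    fix y :: "nat \<Rightarrow> real" assume y: "y \<in> unit_cube"
    have ws: "weak_solution D (\<lambda>x. abar x + (\<Sum>j. y j * \<psi> j x)) f (u y)" using u y by blast
    then show "u y \<in> H10 D" by (simp add: weak_solution_def)
    fix v assume v: "v \<in> H10 D"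
    have "(\<lambda>x. (indicator D x * abar x + (\<Sum>j. y j * (indicator D x * \<psi> j x))) * (weak_grad (u y) x \<bullet> weak_grad v x))
        = (\<lambda>x. indicator D x *\<^sub>R ((abar x + (\<Sum>j. y j * \<psi> j x)) * (weak_grad (u y) x \<bullet> weak_grad v x)))"
      by (auto simp: fun_eq_iff indicator_def)
    then show "(LINT x|lebesgue. (indicator D x * abar x + (\<Sum>j. y j * (indicator D x * \<psi> j x))) *
        (weak_grad (u y) x \<bullet> weak_grad v x)) = f v"
      using ws v by (simp add: weak_solution_def set_lebesgue_integral_def)
  qed
  then show ?thesis by blast
qed

lemma unit_cube_measurable: "unit_cube \<in> sets (\<Pi>\<^sub>M j\<in>UNIV. borel)"
proof -
  have "unit_cube = {y \<in> space (\<Pi>\<^sub>M j\<in>UNIV. borel). \<forall>j::nat. y j \<in> {-1..1::real}}"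
    by (auto simp: unit_cube_def space_PiM)
  also have "\<dots> \<in> sets (\<Pi>\<^sub>M j\<in>UNIV. borel)" by measurable
  finally show ?thesis .
qed

text \<open>For countably many real coordinates the product sigma-algebra is the Borel sigma-algebra
  of the product topology, so continuity implies measurability.\<close>

lemma measurable_restrict_unit_cube:
  fixes u :: "(nat \<Rightarrow> real) \<Rightarrow> 'b::topological_space"
  assumes "continuous_on unit_cube u" and M: "sets M = sets (\<Pi>\<^sub>M j\<in>(UNIV :: nat set). (borel :: real measure))"
  shows "u \<in> borel_measurable (restrict_space M unit_cube)"
proof -
  have "sets (restrict_space M unit_cube) = sets (restrict_space (borel :: (nat \<Rightarrow> real) measure) unit_cube)"
    using M sets_PiM_equal_borel by (intro sets_restrict_space_cong) simp
  then show ?thesis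
    using borel_measurable_continuous_on_restrict[OF assms(1)] measurable_cong_sets[OF _ refl] by blast
qed

abbreviation param_poly ::
    "expansion \<Rightarrow> (nat \<Rightarrow> nat) set \<Rightarrow> ((nat \<Rightarrow> nat) \<Rightarrow> 'a::euclidean_space H1) \<Rightarrow> (nat \<Rightarrow> real) \<Rightarrow> 'a H1" where
  "param_poly ex \<Lambda> d \<equiv> (\<lambda>y. if y \<in> param_set ex then \<Sum>\<nu>\<in>\<Lambda>. basis_fun ex \<nu> y *\<^sub>R d \<nu> else 0)"

lemma taylor_expansion_error:
  fixes D :: "'a::euclidean_space set"
  assumes D: "bounded_lipschitz_domain D" and f: "f \<in> H10_dual D" and u: "affine_solution D abar \<psi> f u"
    and L: "finite \<Lambda>" "\<Lambda> \<subseteq> multi_indices"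
    and sm: "(\<lambda>\<nu>. normV (expansion_coeff Taylor u \<nu>)) summable_on multi_indices - \<Lambda>"
  shows "in_param_space Taylor (\<lambda>y. u y - param_poly Taylor \<Lambda> d y)"
    and "param_norm Taylor (\<lambda>y. u y - param_poly Taylor \<Lambda> d y)
      \<le> (\<Sum>\<nu>\<in>\<Lambda>. normV (expansion_coeff Taylor u \<nu> - d \<nu>))
        + (\<Sum>\<^sub>\<infinity>\<nu>\<in>multi_indices - \<Lambda>. normV (expansion_coeff Taylor u \<nu>))"
proof -
  let ?c = "expansion_coeff Taylor u"
  let ?e = "\<lambda>y. u y - param_poly Taylor \<Lambda> d y"
  obtain r0 B0 where "affine_problem D (\<lambda>x. indicator D x * abar x) (\<lambda>j x. indicator D x * \<psi> j x) f u r0 B0"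
    using affine_solution_problem[OF D f u] by blast
  then interpret A: affine_problem D "\<lambda>x. indicator D x * abar x" "\<lambda>j x. indicator D x * \<psi> j x" f u r0 B0 .
  have c: "?c = A.tc" by (simp add: fun_eq_iff expansion_coeff_def A.tc_def)
  have b: "basis_fun Taylor \<nu> y = A.E y \<nu>" for \<nu> y by (simp add: basis_fun_def A.E_def)
  \<comment> \<open>Finitely many retained terms are added back, since summing the Taylor series
    requires the whole family.\<close>
  have "(\<lambda>\<nu>. normV (A.tc \<nu>)) summable_on (multi_indices - \<Lambda>) \<union> \<Lambda>"
    using sm L by (intro summable_on_Un_disjoint) (auto simp: c)
  then have sm': "(\<lambda>\<nu>. normV (A.tc \<nu>)) summable_on multi_indices" using L(2) by (simp add: Un_absorb2)
  have le: "normV (?e y) \<le> (\<Sum>\<nu>\<in>\<Lambda>. normV (?c \<nu> - d \<nu>)) + (\<Sum>\<^sub>\<infinity>\<nu>\<in>multi_indices - \<Lambda>. normV (?c \<nu>))"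
    if "y \<in> unit_cube" for y
    using A.taylor_error[OF sm' that L, of d] that by (simp add: c b)
  have "continuous_on unit_cube (\<lambda>y. \<Sum>\<nu>\<in>\<Lambda>. A.E y \<nu> *\<^sub>R d \<nu>)"
    unfolding A.E_def
    by (intro continuous_intros continuous_on_subset[OF continuous_on_product_coordinates]) auto
  then have "continuous_on unit_cube (\<lambda>y. u y - (\<Sum>\<nu>\<in>\<Lambda>. A.E y \<nu> *\<^sub>R d \<nu>))"
    by (intro continuous_on_diff A.u_continuous)
  then have "continuous_on unit_cube ?e"
    by (rule continuous_on_eq) (simp add: b)
  then have "?e \<in> borel_measurable (restrict_space (param_measure Taylor) (param_set Taylor))"
    by (simp only: param_set.simps param_measure.simps) (rule measurable_restrict_unit_cube, auto)
  moreover have "bdd_above ((\<lambda>y. normV (?e y)) ` param_set Taylor)"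
    using le by (intro bdd_aboveI2) auto
  ultimately show "in_param_space Taylor ?e" by (simp add: in_param_space_def)
  have "(\<lambda>_. 0) \<in> unit_cube" by (simp add: unit_cube_def)
  then have "(SUP y\<in>param_set Taylor. normV (?e y))
      \<le> (\<Sum>\<nu>\<in>\<Lambda>. normV (?c \<nu> - d \<nu>)) + (\<Sum>\<^sub>\<infinity>\<nu>\<in>multi_indices - \<Lambda>. normV (?c \<nu>))"
    using le by (intro cSUP_least) auto
  then show "param_norm Taylor ?e
      \<le> (\<Sum>\<nu>\<in>\<Lambda>. normV (?c \<nu> - d \<nu>)) + (\<Sum>\<^sub>\<infinity>\<nu>\<in>multi_indices - \<Lambda>. normV (?c \<nu>))"
    by (simp add: param_norm_def)
qed

text \<open>The cube is a countable intersection of events that are almost sure in each coordinate,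
  so it has full measure and restricting integrals to it loses nothing.\<close>

lemma jacobi_system:
  assumes "jacobi_polynomials \<alpha> \<beta> J"
  obtains c where "orthonormal_system (jacobi_measure \<alpha> \<beta>) (\<lambda>n. poly (J n)) c"
    "orthonormal_system.\<phi> (\<lambda>n. poly (J n)) = basis_fun (Jacobi \<alpha> \<beta> J)"
    "unit_cube \<in> sets (param_measure (Jacobi \<alpha> \<beta> J))" "AE y in param_measure (Jacobi \<alpha> \<beta> J). y \<in> unit_cube"
    "sets (param_measure (Jacobi \<alpha> \<beta> J)) = sets (\<Pi>\<^sub>M j\<in>UNIV. borel)"
proof -
  obtain c where c: "orthonormal_system (jacobi_measure \<alpha> \<beta>) (\<lambda>n. poly (J n)) c"
    using jacobi_orthonormal_system(1)[OF assms] by blast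
  interpret S: orthonormal_system "jacobi_measure \<alpha> \<beta>" "\<lambda>n. poly (J n)" c by (rule c)
  have \<phi>: "S.\<phi> = basis_fun (Jacobi \<alpha> \<beta> J)"
    by (simp add: fun_eq_iff S.\<phi>_def basis_fun_def)
  have sets: "sets (param_measure (Jacobi \<alpha> \<beta> J)) = sets (\<Pi>\<^sub>M j\<in>UNIV. borel)"
    unfolding param_measure.simps by (rule sets_PiM_cong) (simp_all add: S.sets_mu)
  have "AE y in S.M. y j \<in> {-1..1}" for j
    by (rule S.P.AE_component[OF UNIV_I jacobi_orthonormal_system(2)[OF assms]])
  then have "AE y in S.M. \<forall>j. y j \<in> {-1..1}" unfolding AE_all_countable by blast
  then have "AE y in param_measure (Jacobi \<alpha> \<beta> J). y \<in> unit_cube"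
    unfolding param_measure.simps by (simp only: unit_cube_def mem_Collect_eq)
  with c \<phi> sets show thesis using unit_cube_measurable by (intro that) auto
qed

lemma hermite_system:
  obtains c where "orthonormal_system (density lborel std_normal_density) hermite c"
    "orthonormal_system.\<phi> hermite = basis_fun Hermite"
proof -
  have "(\<lambda>n. poly (smult (1 / sqrt (fact n)) (hermite_poly n))) = hermite"
    by (intro ext hermite_eq_poly[symmetric])
  then obtain c where c: "orthonormal_system (density lborel std_normal_density) hermite c"
    using hermite_orthonormal_system by auto
  interpret S: orthonormal_system "density lborel std_normal_density" hermite c by (rule c)
  have "S.\<phi> = basis_fun Hermite" by (simp add: fun_eq_iff S.\<phi>_def basis_fun_def)
  with c show thesis by (rule that)
qed

lemma L2_expansion_error:
  fixes D :: "'a::euclidean_space set"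
  assumes ex: "valid_expansion ex" "ex \<noteq> Taylor"
    and D: "bounded_lipschitz_domain D" and f: "f \<in> H10_dual D" and u: "solution_map ex D abar \<psi> f u"
    and L: "finite \<Lambda>" "\<Lambda> \<subseteq> multi_indices"
    and sm: "(\<lambda>\<nu>. (normV (expansion_coeff ex u \<nu>))\<^sup>2) summable_on multi_indices - \<Lambda>"
  shows "in_param_space ex (\<lambda>y. u y - param_poly ex \<Lambda> d y)"
    and "(param_norm ex (\<lambda>y. u y - param_poly ex \<Lambda> d y))\<^sup>2
      \<le> (\<Sum>\<nu>\<in>\<Lambda>. (normV (expansion_coeff ex u \<nu> - d \<nu>))\<^sup>2)
        + (\<Sum>\<^sub>\<infinity>\<nu>\<in>multi_indices - \<Lambda>. (normV (expansion_coeff ex u \<nu>))\<^sup>2)"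
proof -
  let ?M = "param_measure ex" and ?Z = "param_set ex"
  let ?c = "expansion_coeff ex u"
  let ?e = "\<lambda>y. u y - param_poly ex \<Lambda> d y"
  have bD: "bounded D" using D by (simp add: bounded_lipschitz_domain_def)
  have c: "?c \<nu> = (LINT y:?Z|?M. basis_fun ex \<nu> y *\<^sub>R u y)" for \<nu>
    using ex(2) by (simp add: expansion_coeff_def)
  have "?e \<in> borel_measurable (restrict_space ?M ?Z) \<and> set_integrable ?M ?Z (\<lambda>y. (normV (?e y))\<^sup>2) \<and>
    (LINT y:?Z|?M. (normV (?e y))\<^sup>2)
      \<le> (\<Sum>\<nu>\<in>\<Lambda>. (normV (?c \<nu> - d \<nu>))\<^sup>2) + (\<Sum>\<^sub>\<infinity>\<nu>\<in>multi_indices - \<Lambda>. (normV (?c \<nu>))\<^sup>2)"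
  proof (cases ex)
    case Taylor
    then show ?thesis using ex by simp
  next
    case (Jacobi \<alpha> \<beta> J)
    have J: "jacobi_polynomials \<alpha> \<beta> J" using ex Jacobi by simp
    obtain k where S: "orthonormal_system (jacobi_measure \<alpha> \<beta>) (\<lambda>n. poly (J n)) k"
      and \<phi>: "orthonormal_system.\<phi> (\<lambda>n. poly (J n)) = basis_fun (Jacobi \<alpha> \<beta> J)"
      and Z: "unit_cube \<in> sets (param_measure (Jacobi \<alpha> \<beta> J))" "AE y in param_measure (Jacobi \<alpha> \<beta> J). y \<in> unit_cube"
      and sets: "sets (param_measure (Jacobi \<alpha> \<beta> J)) = sets (\<Pi>\<^sub>M j\<in>UNIV. borel)"
      using jacobi_system[OF J] by blast
    interpret S: orthonormal_system "jacobi_measure \<alpha> \<beta>" "\<lambda>n. poly (J n)" k by (rule S)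
    have aff: "affine_solution D abar \<psi> f u" using u Jacobi by (simp add: solution_map_def)
    obtain r0 B0 where "affine_problem D (\<lambda>x. indicator D x * abar x) (\<lambda>j x. indicator D x * \<psi> j x) f u r0 B0"
      using affine_solution_problem[OF D f aff] by blast
    then interpret A: affine_problem D "\<lambda>x. indicator D x * abar x" "\<lambda>j x. indicator D x * \<psi> j x" f u r0 B0 .
    have Z': "unit_cube \<in> sets S.M" "AE y in S.M. y \<in> unit_cube" using Z unfolding param_measure.simps by blast+
    have um: "u \<in> borel_measurable (restrict_space S.M unit_cube)"
      using measurable_restrict_unit_cube[OF A.u_continuous] sets by simp
    have uH: "AE y in S.M. u y \<in> H10 D" using Z'(2) by eventually_elim (rule A.sol(1))
    \<comment> \<open>The solution is bounded on the cube, uniformly in the parameter, and the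
      measure is a probability.\<close>
    have ui: "set_integrable S.M unit_cube (\<lambda>y. (normV (u y))\<^sup>2)"
    proof -
      obtain B where B: "\<And>y. y \<in> unit_cube \<Longrightarrow> normV (u y) \<le> B" using A.u_bounded by blast
      have Zs: "unit_cube \<inter> space S.M \<in> sets S.M" using Z'(1) by auto
      have "(\<lambda>y. (normV (u y))\<^sup>2) \<in> borel_measurable (restrict_space S.M unit_cube)"
        unfolding normV_def by (rule borel_measurable_continuous_on[OF _ um]) (intro continuous_intros)
      then have m: "(\<lambda>y. indicator unit_cube y *\<^sub>R (normV (u y))\<^sup>2) \<in> borel_measurable S.M"
        using borel_measurable_restrict_space_iff[OF Zs, of "\<lambda>y. (normV (u y))\<^sup>2"] by blast
      have "norm (indicator unit_cube y *\<^sub>R (normV (u y))\<^sup>2) \<le> B\<^sup>2" for y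
        using power_mono[OF B, of y 2] by (cases "y \<in> unit_cube") (auto simp: normV_def)
      then show ?thesis
        unfolding set_integrable_def by (intro S.P.P.integrable_const_bound[OF _ m]) (rule AE_I2)
    qed
    have un: "param_poly ex \<Lambda> d y = (\<Sum>\<nu>\<in>\<Lambda>. S.\<phi> \<nu> y *\<^sub>R d \<nu>)" if "y \<in> unit_cube" for y
      using that by (simp add: Jacobi \<phi>)
    have cJ: "?c \<nu> = (LINT y:unit_cube|S.M. S.\<phi> \<nu> y *\<^sub>R u y)" for \<nu>
      unfolding c by (simp add: Jacobi \<phi>)
    note E = S.expansion_error_H1[OF bD Z' um uH ui L cJ sm un]
    show ?thesis using E by (simp add: Jacobi)
  next
    case Hermite
    obtain k where S: "orthonormal_system (density lborel std_normal_density) hermite k"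
      and \<phi>: "orthonormal_system.\<phi> hermite = basis_fun Hermite"
      using hermite_system by blast
    interpret S: orthonormal_system "density lborel std_normal_density" hermite k by (rule S)
    have ln: "lognormal_solution D \<psi> f u" using u Hermite by (simp add: solution_map_def)
    have Z: "UNIV \<in> sets S.M" "AE y in S.M. y \<in> UNIV" using sets.top[of S.M] by (auto simp: S.space_M)
    have um: "u \<in> borel_measurable (restrict_space S.M UNIV)"
      and ui: "set_integrable S.M UNIV (\<lambda>y. (normV (u y))\<^sup>2)"
      using ln by (auto simp: lognormal_solution_def in_param_space_def)
    have "AE y in S.M. (AE x in lebesgue_on D. summable (\<lambda>j. y j * \<psi> j x)) \<and>
        weak_solution D (\<lambda>x. exp (\<Sum>j. y j * \<psi> j x)) f (u y)"
      using ln unfolding lognormal_solution_def param_measure.simps by blast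
    then have uH: "AE y in S.M. u y \<in> H10 D"
      by eventually_elim (simp add: weak_solution_def)
    have un: "param_poly ex \<Lambda> d y = (\<Sum>\<nu>\<in>\<Lambda>. S.\<phi> \<nu> y *\<^sub>R d \<nu>)" for y
      by (simp add: Hermite \<phi>)
    have cH: "?c \<nu> = (LINT y:UNIV|S.M. S.\<phi> \<nu> y *\<^sub>R u y)" for \<nu>
      unfolding c by (simp add: Hermite \<phi>)
    note E = S.expansion_error_H1[OF bD Z um uH ui L cH sm un]
    show ?thesis using E by (simp add: Hermite)
  qed
  then show "in_param_space ex ?e" "(param_norm ex ?e)\<^sup>2
      \<le> (\<Sum>\<nu>\<in>\<Lambda>. (normV (?c \<nu> - d \<nu>))\<^sup>2) + (\<Sum>\<^sub>\<infinity>\<nu>\<in>multi_indices - \<Lambda>. (normV (?c \<nu>))\<^sup>2)"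
    using ex(2)
    by (auto simp: in_param_space_def param_norm_def set_lebesgue_integral_def)
qed

text \<open>With \<open>1 / b\<close> equal to 1 or 2, the supremum bound and the mean-square bound
  take a common form; the outer power is the identity or the square root of a non-negative
  sum.\<close>

lemma param_expansion_error:
  fixes D :: "'a::euclidean_space set"
  assumes ex: "valid_expansion ex"
    and D: "bounded_lipschitz_domain D" and f: "f \<in> H10_dual D" and u: "solution_map ex D abar \<psi> f u"
    and L: "finite \<Lambda>" "\<Lambda> \<subseteq> multi_indices" and b: "b = base_exponent ex"
    and sm: "(\<lambda>\<nu>. normV (expansion_coeff ex u \<nu>) powr (1 / b)) summable_on multi_indices - \<Lambda>"
  shows "in_param_space ex (\<lambda>y. u y - param_poly ex \<Lambda> d y)"
    and "param_norm ex (\<lambda>y. u y - param_poly ex \<Lambda> d y)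
      \<le> ((\<Sum>\<nu>\<in>\<Lambda>. normV (expansion_coeff ex u \<nu> - d \<nu>) powr (1 / b))
        + (\<Sum>\<^sub>\<infinity>\<nu>\<in>multi_indices - \<Lambda>. normV (expansion_coeff ex u \<nu>) powr (1 / b))) powr b"
proof -
  let ?c = "expansion_coeff ex u"
  let ?e = "\<lambda>y. u y - param_poly ex \<Lambda> d y"
  have n0: "0 \<le> normV w" for w :: "'a H1" by (simp add: normV_def)
  have "in_param_space ex ?e \<and> param_norm ex ?e
      \<le> ((\<Sum>\<nu>\<in>\<Lambda>. normV (?c \<nu> - d \<nu>) powr (1 / b))
        + (\<Sum>\<^sub>\<infinity>\<nu>\<in>multi_indices - \<Lambda>. normV (?c \<nu>) powr (1 / b))) powr b"
  proof (cases "ex = Taylor")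
    case True
    have b1: "b = 1" using b True by (simp add: base_exponent_def)
    have aff: "affine_solution D abar \<psi> f u" using u True by (simp add: solution_map_def)
    have "0 \<le> (\<Sum>\<nu>\<in>\<Lambda>. normV (?c \<nu> - d \<nu>)) + (\<Sum>\<^sub>\<infinity>\<nu>\<in>multi_indices - \<Lambda>. normV (?c \<nu>))"
      using n0 by (intro add_nonneg_nonneg sum_nonneg infsum_nonneg) auto
    then show ?thesis
      using taylor_expansion_error[OF D f aff L, of d] sm n0 unfolding True b1 by simp
  next
    case False
    have b': "b = 1 / 2" using b False by (simp add: base_exponent_def)
    have b2: "1 / b = 2" "b = 1 / 2" unfolding b' by simp_all
    have p2: "normV w powr 2 = (normV w)\<^sup>2" for w :: "'a H1" using n0[of w] by simp
    have "(\<lambda>\<nu>. (normV (?c \<nu>))\<^sup>2) summable_on multi_indices - \<Lambda>" using sm by (simp only: b2(1) p2)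
    note E = L2_expansion_error[OF ex False D f u L this, of d]
    let ?R = "(\<Sum>\<nu>\<in>\<Lambda>. (normV (?c \<nu> - d \<nu>))\<^sup>2) + (\<Sum>\<^sub>\<infinity>\<nu>\<in>multi_indices - \<Lambda>. (normV (?c \<nu>))\<^sup>2)"
    have R0: "0 \<le> ?R" by (intro add_nonneg_nonneg sum_nonneg infsum_nonneg) auto
    have "param_norm ex ?e \<le> sqrt ?R" using E(2) by (rule real_le_rsqrt)
    also have "sqrt ?R = ?R powr b" unfolding b2(2) using R0 by (simp add: powr_half_sqrt)
    finally show ?thesis using E(1) unfolding b2(1) p2 by blast
  qed
  then show "in_param_space ex ?e" "param_norm ex ?e
      \<le> ((\<Sum>\<nu>\<in>\<Lambda>. normV (?c \<nu> - d \<nu>) powr (1 / b))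
        + (\<Sum>\<^sub>\<infinity>\<nu>\<in>multi_indices - \<Lambda>. normV (?c \<nu>) powr (1 / b))) powr b" by blast+
qed

text \<open>For monomials a substitution reduces the claim to one variable. For the orthonormal
  bases vanishing almost everywhere suffices, and in the Jacobi case the cube has full
  measure.\<close>

lemma basis_fun_independent:
  fixes d :: "(nat \<Rightarrow> nat) \<Rightarrow> 'a::euclidean_space H1"
  assumes ex: "valid_expansion ex" and L: "finite \<Lambda>" "\<Lambda> \<subseteq> multi_indices"
    and z: "\<And>y. y \<in> param_set ex \<Longrightarrow> (\<Sum>\<nu>\<in>\<Lambda>. basis_fun ex \<nu> y *\<^sub>R d \<nu>) = 0" and \<nu>: "\<nu> \<in> \<Lambda>"
  shows "d \<nu> = 0"
proof (cases ex)
  case Taylor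
  show ?thesis
    by (rule monomials_independent[OF L _ \<nu>]) (use z in \<open>simp add: Taylor basis_fun_def\<close>)
next
  case (Jacobi \<alpha> \<beta> J)
  have J: "jacobi_polynomials \<alpha> \<beta> J" using ex Jacobi by simp
  obtain k where S: "orthonormal_system (jacobi_measure \<alpha> \<beta>) (\<lambda>n. poly (J n)) k"
    and \<phi>: "orthonormal_system.\<phi> (\<lambda>n. poly (J n)) = basis_fun (Jacobi \<alpha> \<beta> J)"
    and Z: "AE y in param_measure (Jacobi \<alpha> \<beta> J). y \<in> unit_cube"
    using jacobi_system[OF J] by blast
  interpret S: orthonormal_system "jacobi_measure \<alpha> \<beta>" "\<lambda>n. poly (J n)" k by (rule S)
  have "AE y in S.M. y \<in> unit_cube" using Z unfolding param_measure.simps .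
  then have "AE y in S.M. (\<Sum>\<nu>\<in>\<Lambda>. S.\<phi> \<nu> y *\<^sub>R d \<nu>) = 0"
    by eventually_elim (use z in \<open>simp add: Jacobi \<phi>\<close>)
  then show ?thesis by (rule S.basis_independent[OF L _ \<nu>])
next
  case Hermite
  obtain k where S: "orthonormal_system (density lborel std_normal_density) hermite k"
    and \<phi>: "orthonormal_system.\<phi> hermite = basis_fun Hermite"
    using hermite_system by blast
  interpret S: orthonormal_system "density lborel std_normal_density" hermite k by (rule S)
  have "AE y in S.M. (\<Sum>\<nu>\<in>\<Lambda>. S.\<phi> \<nu> y *\<^sub>R d \<nu>) = 0"
    using z by (intro AE_I2) (simp add: Hermite \<phi>)
  then show ?thesis by (rule S.basis_independent[OF L _ \<nu>])
qed

theorem theorem3p1: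
  fixes pV pX t AV AX CX :: real
  assumes "0 < pV" and "pV \<le> pX" and "pX < 2" and "0 < t" and "0 < CX"
  shows "\<exists>C>0. \<forall>(ex :: expansion) (D :: 'a::euclidean_space set) abar \<psi> f u X normX W \<Lambda>.
    valid_expansion ex \<and> (ex = Taylor \<longrightarrow> pV < 1) \<and>
    bounded_lipschitz_domain D \<and> f \<in> H10_dual D \<and> solution_map ex D abar \<psi> f u \<and>
    subspace X \<and> X \<subseteq> H10 D \<and> norm_on X normX \<and>
    (\<forall>n>0. subspace (W n) \<and> W n \<subseteq> H10 D \<and> dim (W n) = n) \<and>
    (\<forall>n>0. \<forall>v\<in>X. \<exists>vn\<in>W n. normV (v - vn) \<le> CX * real n powr (- t) * normX v) \<and>
    in_ell pV (\<lambda>\<nu>. normV (expansion_coeff ex u \<nu>)) \<and>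
    ell_norm pV (\<lambda>\<nu>. normV (expansion_coeff ex u \<nu>)) = AV \<and>
    (\<forall>\<nu>\<in>multi_indices. expansion_coeff ex u \<nu> \<in> X) \<and>
    in_ell pX (\<lambda>\<nu>. normX (expansion_coeff ex u \<nu>)) \<and>
    ell_norm pX (\<lambda>\<nu>. normX (expansion_coeff ex u \<nu>)) = AX \<and>
    (\<forall>n>0. n_largest n (\<lambda>\<nu>. normV (expansion_coeff ex u \<nu>)) (\<Lambda> n))
    \<longrightarrow>
    (\<forall>n>0. \<exists>nn. (\<forall>\<nu>\<in>\<Lambda> n. 0 < nn \<nu>) \<and>
       fun_dim (tensor_space ex W (\<Lambda> n) nn) = (\<Sum>\<nu>\<in>\<Lambda> n. nn \<nu>) \<and>
       (\<exists>un\<in>tensor_space ex W (\<Lambda> n) nn.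
          in_param_space ex (\<lambda>y. u y - un y) \<and>
          param_norm ex (\<lambda>y. u y - un y)
            \<le> C * real (\<Sum>\<nu>\<in>\<Lambda> n. nn \<nu>) powr (- min (rate_r ex pV pX t) t)))"
proof -
  \<comment> \<open>The balancing result with the sums of powers expressed by the sequence norms; as
    a predicate in \<open>b\<close> and \<open>C\<close> it allows a constant to be chosen for each
    \<open>b\<close>.\<close>
  define Q where "Q b C \<longleftrightarrow> (\<forall>(I :: (nat \<Rightarrow> nat) set) \<Lambda> v x n.
    (0::nat) < n \<and> finite \<Lambda> \<and> \<Lambda> \<subseteq> I \<and> card \<Lambda> = n \<and> (\<forall>i\<in>I. 0 \<le> v i) \<and> (\<forall>i\<in>I. 0 \<le> x i) \<and>
    (\<lambda>i. v i powr pV) summable_on I \<and> (\<Sum>\<^sub>\<infinity>i\<in>I. v i powr pV) = AV powr pV \<and>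
    (\<lambda>i. x i powr pX) summable_on I \<and> (\<Sum>\<^sub>\<infinity>i\<in>I. x i powr pX) = AX powr pX \<and>
    (\<forall>i\<in>\<Lambda>. \<forall>j\<in>I - \<Lambda>. v j \<le> v i) \<longrightarrow>
    (\<exists>nn. (\<forall>i\<in>\<Lambda>. (0::nat) < nn i) \<and>
       (\<forall>e. (\<forall>i\<in>\<Lambda>. 0 \<le> e i \<and> e i \<le> CX * real (nn i) powr (- t) * x i) \<longrightarrow>
          ((\<Sum>i\<in>\<Lambda>. e i powr (1 / b)) + (\<Sum>\<^sub>\<infinity>i\<in>I - \<Lambda>. v i powr (1 / b))) powr b
            \<le> C * real (\<Sum>i\<in>\<Lambda>. nn i) powr (- min ((1 / pV - b) * t / ((1 / pV - b) + t + b - 1 / pX)) t))))" for b C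
  \<comment> \<open>The conditions on \<open>b\<close> stand under the existential quantifier so
    that a constant exists for every \<open>b\<close>: for \<open>b = 1\<close> the bound on
    \<open>pV\<close> is known only once the expansion is, but the constant comes first.\<close>
  have "\<exists>C. 0 < C \<and> (0 < b \<longrightarrow> pV < 1 / b \<longrightarrow> Q b C)" for b
  proof (cases "0 < b \<and> pV < 1 / b")
    case True
    then have "\<exists>C>0. Q b C"
      unfolding Q_def using assms by (intro balanced_degrees refl) auto
    then show ?thesis by blast
  next
    case False
    then show ?thesis by (intro exI[of _ 1]) simp
  qed
  then obtain Cb where Cb0: "\<And>b. 0 < Cb b" and Cb: "\<And>b. 0 < b \<Longrightarrow> pV < 1 / b \<Longrightarrow> Q b (Cb b)"
    by metis
  \<comment> \<open>The constant precedes the choice of the expansion and must serve both values of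
    the exponent.\<close>
  define C where "C = max (Cb 1) (Cb (1/2))"
  have C0: "0 < C" using Cb0[of 1] by (simp add: C_def)
  have pX0: "0 < pX" using assms by simp
  show ?thesis
  proof (intro exI[of _ C] conjI allI impI C0)
    fix ex and D :: "'a set" and abar \<psi> f u X normX W \<Lambda> and n :: nat
    assume H: "valid_expansion ex \<and> (ex = Taylor \<longrightarrow> pV < 1) \<and>
      bounded_lipschitz_domain D \<and> f \<in> H10_dual D \<and> solution_map ex D abar \<psi> f u \<and>
      subspace X \<and> X \<subseteq> H10 D \<and> norm_on X normX \<and>
      (\<forall>n>0. subspace (W n) \<and> W n \<subseteq> H10 D \<and> dim (W n) = n) \<and>
      (\<forall>n>0. \<forall>v\<in>X. \<exists>vn\<in>W n. normV (v - vn) \<le> CX * real n powr (- t) * normX v) \<and>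
      in_ell pV (\<lambda>\<nu>. normV (expansion_coeff ex u \<nu>)) \<and>
      ell_norm pV (\<lambda>\<nu>. normV (expansion_coeff ex u \<nu>)) = AV \<and>
      (\<forall>\<nu>\<in>multi_indices. expansion_coeff ex u \<nu> \<in> X) \<and>
      in_ell pX (\<lambda>\<nu>. normX (expansion_coeff ex u \<nu>)) \<and>
      ell_norm pX (\<lambda>\<nu>. normX (expansion_coeff ex u \<nu>)) = AX \<and>
      (\<forall>n>0. n_largest n (\<lambda>\<nu>. normV (expansion_coeff ex u \<nu>)) (\<Lambda> n))" and n: "0 < n"
    let ?c = "expansion_coeff ex u"
    \<comment> \<open>The absolute values match the form of \<open>in_ell\<close> and give
      non-negativity at every index, since \<open>normX\<close> is known to be a norm only on
      \<open>X\<close>.\<close>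
    define v x where "v \<nu> = \<bar>normV (?c \<nu>)\<bar>" and "x \<nu> = \<bar>normX (?c \<nu>)\<bar>" for \<nu>
    define b where "b = base_exponent ex"
    have v: "v \<nu> = normV (?c \<nu>)" for \<nu> by (simp add: v_def normV_def)
    have b: "0 < b" "pV < 1 / b" "b = 1 \<or> b = 1/2"
      using H assms by (auto simp: b_def base_exponent_def)
    have valid: "valid_expansion ex" and D: "bounded_lipschitz_domain D" and f: "f \<in> H10_dual D"
      and u: "solution_map ex D abar \<psi> f u"
      and W: "\<And>n. 0 < n \<Longrightarrow> subspace (W n)" "\<And>n. 0 < n \<Longrightarrow> dim (W n) = n"
      and approx: "\<And>n v. 0 < n \<Longrightarrow> v \<in> X \<Longrightarrow> \<exists>vn\<in>W n. normV (v - vn) \<le> CX * real n powr (- t) * normX v"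
      and cX: "\<And>\<nu>. \<nu> \<in> multi_indices \<Longrightarrow> ?c \<nu> \<in> X"
      using H by blast+
    have "n_largest n (\<lambda>\<nu>. normV (?c \<nu>)) (\<Lambda> n)" using H n by blast
    then have L: "\<Lambda> n \<subseteq> multi_indices" "finite (\<Lambda> n)" "card (\<Lambda> n) = n"
      and ord: "\<And>i j. i \<in> \<Lambda> n \<Longrightarrow> j \<in> multi_indices - \<Lambda> n \<Longrightarrow> v j \<le> v i"
      by (auto simp: n_largest_def v)
    have p_norm: "(\<Sum>\<^sub>\<infinity>\<nu>\<in>multi_indices. \<bar>a \<nu>\<bar> powr p) = (ell_norm p a) powr p" if "0 < p" for p a
    proof -
      have "0 \<le> (\<Sum>\<^sub>\<infinity>\<nu>\<in>multi_indices. \<bar>a \<nu>\<bar> powr p)" by (rule infsum_nonneg) simp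
      then show ?thesis using that by (simp add: ell_norm_def powr_powr)
    qed
    have V: "(\<lambda>\<nu>. v \<nu> powr pV) summable_on multi_indices" "(\<Sum>\<^sub>\<infinity>\<nu>\<in>multi_indices. v \<nu> powr pV) = AV powr pV"
      using H p_norm[OF assms(1), of "\<lambda>\<nu>. normV (?c \<nu>)"] unfolding v_def in_ell_def by auto
    have Xs: "(\<lambda>\<nu>. x \<nu> powr pX) summable_on multi_indices" "(\<Sum>\<^sub>\<infinity>\<nu>\<in>multi_indices. x \<nu> powr pX) = AX powr pX"
      using H p_norm[OF pX0, of "\<lambda>\<nu>. normX (?c \<nu>)"] unfolding x_def in_ell_def by auto
    have "\<exists>nn. (\<forall>i\<in>\<Lambda> n. (0::nat) < nn i) \<and>
       (\<forall>e. (\<forall>i\<in>\<Lambda> n. 0 \<le> e i \<and> e i \<le> CX * real (nn i) powr (- t) * x i) \<longrightarrow>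
          ((\<Sum>i\<in>\<Lambda> n. e i powr (1 / b)) + (\<Sum>\<^sub>\<infinity>i\<in>multi_indices - \<Lambda> n. v i powr (1 / b))) powr b
            \<le> Cb b * real (\<Sum>i\<in>\<Lambda> n. nn i) powr (- min ((1 / pV - b) * t / ((1 / pV - b) + t + b - 1 / pX)) t))"
    proof (rule Cb[OF b(1,2), unfolded Q_def, THEN spec[of _ multi_indices], THEN spec[of _ "\<Lambda> n"],
          THEN spec[of _ v], THEN spec[of _ x], THEN spec[of _ n], THEN mp], intro conjI ballI)
      show "0 \<le> v i" "0 \<le> x i" for i by (simp_all add: v_def x_def)
      show "v j \<le> v i" if "i \<in> \<Lambda> n" "j \<in> multi_indices - \<Lambda> n" for i j using ord that by blast
    qed (fact n L V Xs)+
    then obtain nn where nn': "\<forall>i\<in>\<Lambda> n. (0::nat) < nn i" and err: "\<forall>e. (\<forall>i\<in>\<Lambda> n. 0 \<le> e i \<and> e i \<le> CX * real (nn i) powr (- t) * x i) \<longrightarrow>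
          ((\<Sum>i\<in>\<Lambda> n. e i powr (1 / b)) + (\<Sum>\<^sub>\<infinity>i\<in>multi_indices - \<Lambda> n. v i powr (1 / b))) powr b
            \<le> Cb b * real (\<Sum>i\<in>\<Lambda> n. nn i) powr (- min ((1 / pV - b) * t / ((1 / pV - b) + t + b - 1 / pX)) t)"
      by (elim exE conjE)
    have nn: "\<And>i. i \<in> \<Lambda> n \<Longrightarrow> 0 < nn i" using nn' by blast
    have "\<exists>w. w \<in> W (nn \<nu>) \<and> normV (?c \<nu> - w) \<le> CX * real (nn \<nu>) powr (- t) * x \<nu>" if \<nu>: "\<nu> \<in> \<Lambda> n" for \<nu>
    proof -
      obtain w where w: "w \<in> W (nn \<nu>)" "normV (?c \<nu> - w) \<le> CX * real (nn \<nu>) powr (- t) * normX (?c \<nu>)"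
        using approx[OF nn[OF \<nu>] cX] L(1) \<nu> by blast
      have "CX * real (nn \<nu>) powr (- t) * normX (?c \<nu>) \<le> CX * real (nn \<nu>) powr (- t) * x \<nu>"
        unfolding x_def using assms(5) by (intro mult_left_mono) auto
      then show ?thesis using w by (blast intro: order_trans)
    qed
    then obtain w where w: "\<And>\<nu>. \<nu> \<in> \<Lambda> n \<Longrightarrow> w \<nu> \<in> W (nn \<nu>)"
      "\<And>\<nu>. \<nu> \<in> \<Lambda> n \<Longrightarrow> normV (?c \<nu> - w \<nu>) \<le> CX * real (nn \<nu>) powr (- t) * x \<nu>" by metis
    let ?un = "param_poly ex (\<Lambda> n) w"
    have "pV \<le> 1 / b" using b by simp
    \<comment> \<open>Stechkin's estimate also yields that the tail is summable with the power
      \<open>1 / b\<close>, which the error bound presupposes.\<close>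
    have sm: "(\<lambda>\<nu>. normV (?c \<nu>) powr (1 / b)) summable_on multi_indices - \<Lambda> n"
      unfolding v[symmetric]
      by (rule stechkin_tail(1)[OF assms(1) \<open>pV \<le> 1 / b\<close> _ V(1) L(2,1,3) n ord V(2)]) (simp_all add: v_def)
    note E = param_expansion_error[OF valid D f u L(2,1) b_def sm, of w]
    have "\<forall>i\<in>\<Lambda> n. 0 \<le> normV (?c i - w i) \<and> normV (?c i - w i) \<le> CX * real (nn i) powr (- t) * x i"
      using w(2) by (simp add: normV_def)
    note err = err[THEN spec[of _ "\<lambda>\<nu>. normV (?c \<nu> - w \<nu>)"], THEN mp, OF this]
    have "param_norm ex (\<lambda>y. u y - ?un y)
        \<le> Cb b * real (\<Sum>i\<in>\<Lambda> n. nn i) powr (- min ((1 / pV - b) * t / ((1 / pV - b) + t + b - 1 / pX)) t)"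
      by (rule order_trans[OF E(2) err[unfolded v]])
    also have "(1 / pV - b) * t / ((1 / pV - b) + t + b - 1 / pX) = rate_r ex pV pX t"
      by (simp add: rate_r_def rate_s_def b_def)
    also have "Cb b * real (\<Sum>i\<in>\<Lambda> n. nn i) powr (- min (rate_r ex pV pX t) t)
        \<le> C * real (\<Sum>i\<in>\<Lambda> n. nn i) powr (- min (rate_r ex pV pX t) t)"
    proof (rule mult_right_mono)
      show "Cb b \<le> C" using b(3) unfolding C_def by (elim disjE) (simp_all only: max.cobounded1 max.cobounded2)
    qed simp
    finally have bound: "param_norm ex (\<lambda>y. u y - ?un y)
        \<le> C * real (\<Sum>i\<in>\<Lambda> n. nn i) powr (- min (rate_r ex pV pX t) t)" .
    have dim: "fun_dim (tensor_space ex W (\<Lambda> n) nn) = (\<Sum>\<nu>\<in>\<Lambda> n. nn \<nu>)"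
      unfolding tensor_space_def
    proof (rule fun_dim_tensor[OF L(2), where W = "\<lambda>\<nu>. W (nn \<nu>)"])
      show "d \<nu> = 0" if "\<And>y. y \<in> param_set ex \<Longrightarrow> (\<Sum>\<nu>\<in>\<Lambda> n. basis_fun ex \<nu> y *\<^sub>R d \<nu>) = 0" "\<nu> \<in> \<Lambda> n"
        for d :: "(nat \<Rightarrow> nat) \<Rightarrow> 'a H1" and \<nu>
        using basis_fun_independent[OF valid L(2,1) that] .
    qed (use W nn in auto)
    have mem: "?un \<in> tensor_space ex W (\<Lambda> n) nn"
      unfolding tensor_space_def using w(1) by blast
    show "\<exists>nn. (\<forall>\<nu>\<in>\<Lambda> n. 0 < nn \<nu>) \<and>
       fun_dim (tensor_space ex W (\<Lambda> n) nn) = (\<Sum>\<nu>\<in>\<Lambda> n. nn \<nu>) \<and>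
       (\<exists>un\<in>tensor_space ex W (\<Lambda> n) nn.
          in_param_space ex (\<lambda>y. u y - un y) \<and>
          param_norm ex (\<lambda>y. u y - un y)
            \<le> C * real (\<Sum>\<nu>\<in>\<Lambda> n. nn \<nu>) powr (- min (rate_r ex pV pX t) t))"
      by (intro exI[of _ nn] conjI[OF nn'] conjI[OF dim]) (rule bexI[OF _ mem], rule conjI[OF E(1) bound])
  qed
qed

end
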